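(* Let $q\ge 3$. The set of $q\times q$ real symmetric matrices $M$ such that $\mathrm{Pl\text{-}EVAL}(M)$ is not $\#$P-hard has Lebesgue measure $0$ (in the space $\mathbb{R}^{q(q+1)/2}$ of $q\times q$ real symmetric matrices).
   Context: For a symmetric matrix $M=(m_{ij})\in\mathbb{R}^{q\times q}$ and a finite undirected multigraph $G=(V,E)$, put $Z_M(G)=\sum_{\sigma:V\to[q]}\prod_{(u,v)\in E} m_{\sigma(u),\sigma(v)}$. The problem $\mathrm{Pl\text{-}EVAL}(M)$ is: $M$ is fixed; given a planar undirected multigraph $G$, output $Z_M(G)$. Model of computation: $M$ may have arbitrary real entries. Let $\mathbf{F}=\mathbb{Q}(\{m_{ij}\})$. One can write $\mathbf{F}=\mathbf{E}(\beta)$ with $\mathbf{E}=\mathbb{Q}(X_1,\dots,X_m)$ purely transcendental over $\mathbb{Q}$ ($m\ge 0$) and $\beta$ algebraic over $\mathbf{E}$; such a presentation (including the minimal polynomial of $\beta$ over $\mathbf{E}$) is treated as a fixed, known constant of the problem, and the output is the element $Z_M(G)\in\mathbf{F}$ written as a polynomial in $\beta$ with coefficients in $\mathbf{E}$. Complexity is bit complexity on Turing machines in the size of $G$. $\#$P-hardness is with respect to polynomial-time Turing reductions, and complexity statements assert the existence of algorithms or reductions. *)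

theory Defs
  imports "HOL-Analysis.Analysis" "Jordan_Normal_Form.Matrix"
begin

section \<open>Planar multigraphs and the partition function\<close>

text \<open>
  A multigraph has vertex set \<open>{..<n}\<close> and one edge for each position of a list of end point
  pairs.  Parallel edges and loops are allowed; the order within a pair is irrelevant, since
  edge weights will come from a symmetric matrix.
\<close>

type_synonym multigraph = "nat \<times> (nat \<times> nat) list"

definition multigraph :: "multigraph \<Rightarrow> bool" where
  "multigraph G \<longleftrightarrow> (case G of (n, es) \<Rightarrow> \<forall>(u, v)\<in>set es. u < n \<and> v < n)"

text \<open>
  Planarity is the existence of a drawing in the plane without crossings.  A simple path may
  return to its starting point, so non-loops are drawn as arcs and loops as closed simple curves.
\<close>

definition plane_drawing :: "multigraph \<Rightarrow> (nat \<Rightarrow> complex) \<Rightarrow> (nat \<Rightarrow> real \<Rightarrow> complex) \<Rightarrow> bool" where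
  "plane_drawing G pos curve \<longleftrightarrow> (case G of (n, es) \<Rightarrow>
     inj_on pos {..<n} \<and>
     (\<forall>k<length es. simple_path (curve k) \<and>
        pathstart (curve k) = pos (fst (es ! k)) \<and>
        pathfinish (curve k) = pos (snd (es ! k)) \<and>
        path_image (curve k) \<inter> pos ` {..<n} = {pos (fst (es ! k)), pos (snd (es ! k))}) \<and>
     (\<forall>k<length es. \<forall>l<length es. k \<noteq> l \<longrightarrow>
        path_image (curve k) \<inter> path_image (curve l) \<subseteq> pos ` {..<n}))"

definition planar :: "multigraph \<Rightarrow> bool" where
  "planar G \<longleftrightarrow> multigraph G \<and> (\<exists>pos curve. plane_drawing G pos curve)"

definition Z :: "real mat \<Rightarrow> multigraph \<Rightarrow> real" where
  "Z M G = (case G of (n, es) \<Rightarrow>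
     \<Sum>\<sigma>\<in>{..<n} \<rightarrow>\<^sub>E {..<dim_row M}. \<Prod>(u, v)\<leftarrow>es. M $$ (\<sigma> u, \<sigma> v))"


section \<open>Oracle Turing machines\<close>

type_synonym word = "bool list"

text \<open>
  Multitape machines over the states \<open>{..<nstates N}\<close> and the tape symbols \<open>{..<nsyms N}\<close>.
  Symbol 0 is the blank, 1 and 2 are the letters of input, output and oracle words.  Tape 0 holds
  the input, tape 1 the output and tape 2 is the oracle tape.  A tape is two-way infinite and is
  given with the position of its head.
\<close>

type_synonym tape = "(int \<Rightarrow> nat) \<times> int"
type_synonym config = "nat \<times> tape list"

record machine =
  ntapes :: nat
  nstates :: nat
  nsyms :: nat
  delta :: "nat \<Rightarrow> nat list \<Rightarrow> nat \<times> (nat \<times> int) list"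

abbreviation (input) start_state :: nat where "start_state \<equiv> 0"
abbreviation (input) halt_state :: nat where "halt_state \<equiv> 1"
abbreviation (input) query_state :: nat where "query_state \<equiv> 2"
abbreviation (input) answer_state :: nat where "answer_state \<equiv> 3"

definition wf_machine :: "machine \<Rightarrow> bool" where
  "wf_machine N \<longleftrightarrow> 3 \<le> ntapes N \<and> 4 \<le> nstates N \<and> 3 \<le> nsyms N \<and>
     (\<forall>s<nstates N. \<forall>reads. length reads = ntapes N \<and> set reads \<subseteq> {..<nsyms N} \<longrightarrow>
        (case delta N s reads of (s', acts) \<Rightarrow>
           s' < nstates N \<and> length acts = ntapes N \<and> set acts \<subseteq> {..<nsyms N} \<times> {-1, 0, 1}))"

definition word_tape :: "word \<Rightarrow> tape" where
  "word_tape w =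
     (\<lambda>i. if 0 \<le> i \<and> nat i < length w then (if w ! nat i then 2 else 1) else 0, 0)"

text \<open>The word on a tape starts at cell 0 and extends to the first cell not containing a letter.\<close>

definition tape_word :: "tape \<Rightarrow> word" where
  "tape_word t =
     map (\<lambda>i. fst t (int i) = 2) [0..<(LEAST i. fst t (int i) \<notin> {1, 2})]"

text \<open>
  A query takes one step; it replaces the contents of the oracle tape by the answer and rewinds
  the tape.  Halting configurations are fixed.
\<close>

definition step :: "(word \<Rightarrow> word) \<Rightarrow> machine \<Rightarrow> config \<Rightarrow> config" where
  "step f N c = (case c of (s, ts) \<Rightarrow>
     if s = halt_state then (s, ts)
     else if s = query_state then (answer_state, ts[2 := word_tape (f (tape_word (ts ! 2)))])
     else (case delta N s (map (\<lambda>(cells, h). cells h) ts) of (s', acts) \<Rightarrow>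
       (s', map2 (\<lambda>(cells, h) (a, d). (cells(h := a), h + d)) ts acts)))"

definition init_config :: "machine \<Rightarrow> word \<Rightarrow> config" where
  "init_config N x = (start_state, word_tape x # replicate (ntapes N - 1) (word_tape []))"

definition computes_within :: "(word \<Rightarrow> word) \<Rightarrow> machine \<Rightarrow> word \<Rightarrow> word \<Rightarrow> nat \<Rightarrow> bool" where
  "computes_within f N x y t \<longleftrightarrow>
     (case (step f N ^^ t) (init_config N x) of (s, ts) \<Rightarrow>
        s = halt_state \<and> tape_word (ts ! 1) = y)"

text \<open>An oracle that always answers with the empty word amounts to having no oracle.\<close>

definition poly_time :: "(word \<Rightarrow> word) \<Rightarrow> bool" where
  "poly_time g \<longleftrightarrow> (\<exists>N (p :: nat poly). wf_machine N \<and>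
     (\<forall>x. computes_within (\<lambda>_. []) N x (g x) (poly p (length x))))"


section \<open>Words for finite objects\<close>

text \<open>All encodings below except \<open>bin\<close> are prefix-free.\<close>

fun bin :: "nat \<Rightarrow> word" where
  "bin n = (if n = 0 then [] else odd n # bin (n div 2))"

declare bin.simps [simp del]

definition enc_list :: "('a \<Rightarrow> word) \<Rightarrow> 'a list \<Rightarrow> word" where
  "enc_list enc xs = concat (map (\<lambda>x. True # enc x) xs) @ [False]"

definition enc_unary :: "nat \<Rightarrow> word" where
  "enc_unary n = replicate n True @ [False]"

definition enc_nat :: "nat \<Rightarrow> word" where
  "enc_nat n = enc_list (\<lambda>b. [b]) (bin n)"

definition enc_int :: "int \<Rightarrow> word" where
  "enc_int z = (z < 0) # enc_nat (nat \<bar>z\<bar>)"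

definition enc_pair :: "word \<Rightarrow> word \<Rightarrow> word" where
  "enc_pair x y = enc_list (\<lambda>b. [b]) x @ y"

text \<open>
  The number of vertices is written in unary and every edge is listed, so that the length of the
  word is polynomially related to the size of the graph.
\<close>

definition enc_graph :: "multigraph \<Rightarrow> word" where
  "enc_graph G = (case G of (n, es) \<Rightarrow>
     enc_unary n @ enc_list (\<lambda>(u, v). enc_nat u @ enc_nat v) es)"


section \<open>Counting complexity\<close>

definition sharpP :: "(word \<Rightarrow> nat) set" where
  "sharpP = {g. \<exists>V (p :: nat poly). poly_time (\<lambda>w. [V w]) \<and>
     (\<forall>x. g x = card {y. length y = poly p (length x) \<and> V (enc_pair x y)})}"

text \<open>
  A computational problem in which an answer may have several correct representations is a
  relation between instances and correct answers; its instances form the domain of the relation.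
  As usual for such problems, only answers of length bounded by some polynomial \<open>p\<close> are
  considered, and a Turing reduction is a single machine that works with every oracle giving
  correct answers.  Nothing is assumed about the oracle outside the set of instances.
\<close>

type_synonym problem = "(word \<times> word) set"

definition solves :: "(word \<Rightarrow> word) \<Rightarrow> problem \<Rightarrow> nat poly \<Rightarrow> bool" where
  "solves f R p \<longleftrightarrow> (\<forall>x\<in>Domain R. (x, f x) \<in> R \<and> length (f x) \<le> poly p (length x))"

definition poly_time_Turing_reducible :: "(word \<Rightarrow> word) \<Rightarrow> problem \<Rightarrow> bool" where
  "poly_time_Turing_reducible g R \<longleftrightarrow> (\<forall>p. \<exists>N (r :: nat poly). wf_machine N \<and>
     (\<forall>f. solves f R p \<longrightarrow> (\<forall>x. computes_within f N x (g x) (poly r (length x)))))"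

definition sharpP_hard :: "problem \<Rightarrow> bool" where
  "sharpP_hard R \<longleftrightarrow> (\<forall>g\<in>sharpP. poly_time_Turing_reducible (bin \<circ> g) R)"


section \<open>Presentations of the field generated by the matrix entries\<close>

definition is_subfield :: "real set \<Rightarrow> bool" where
  "is_subfield K \<longleftrightarrow> 1 \<in> K \<and> (\<forall>x\<in>K. \<forall>y\<in>K. x - y \<in> K \<and> x * y \<in> K \<and> inverse x \<in> K)"

definition monomial :: "real list \<Rightarrow> nat list \<Rightarrow> real" where
  "monomial X e = (\<Prod>i<length X. (X ! i) ^ (e ! i))"

definition alg_independent :: "real list \<Rightarrow> bool" where
  "alg_independent X \<longleftrightarrow>
     (\<forall>S (c :: nat list \<Rightarrow> rat). finite S \<and> S \<subseteq> {e. length e = length X} \<and>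
        (\<Sum>e\<in>S. of_rat (c e) * monomial X e) = 0 \<longrightarrow> (\<forall>e\<in>S. c e = 0))"

definition algebraic_over :: "real set \<Rightarrow> real \<Rightarrow> bool" where
  "algebraic_over K b \<longleftrightarrow> (\<exists>p. p \<noteq> 0 \<and> (\<forall>i. coeff p i \<in> K) \<and> poly p b = 0)"

text \<open>
  \<open>is_subfield hull S\<close> is the subfield \<open>\<rat>(S)\<close> of the reals.  Since \<open>\<rat>(X)(\<beta>)\<close> is the real field
  generated by the entries, the indeterminates \<open>X\<close> are real numbers.
\<close>

definition presentation :: "real mat \<Rightarrow> real list \<Rightarrow> real \<Rightarrow> bool" where
  "presentation M X \<beta> \<longleftrightarrow> alg_independent X \<and> algebraic_over (is_subfield hull set X) \<beta> \<and>
     is_subfield hull (insert \<beta> (set X)) = is_subfield hull (elements_mat M)"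

text \<open>
  An element of \<open>\<rat>(X)(\<beta>)\<close> is written as the list of coefficients of a polynomial in \<open>\<beta>\<close>, each
  coefficient being a quotient of two integer polynomials in \<open>X\<close>, given as lists of terms.
  Exponents are written in unary, as the size of a polynomial accounts for its degree.
\<close>

type_synonym int_poly = "(int \<times> nat list) list"
type_synonym field_elem = "(int_poly \<times> int_poly) list"

definition int_poly_val :: "real list \<Rightarrow> int_poly \<Rightarrow> real" where
  "int_poly_val X P = (\<Sum>(c, e)\<leftarrow>P. of_int c * monomial X e)"

definition wf_field_elem :: "real list \<Rightarrow> field_elem \<Rightarrow> bool" where
  "wf_field_elem X a \<longleftrightarrow> (\<forall>(P, Q)\<in>set a.
     (\<forall>(c, e)\<in>set P \<union> set Q. length e = length X) \<and> int_poly_val X Q \<noteq> 0)"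

definition field_elem_val :: "real list \<Rightarrow> real \<Rightarrow> field_elem \<Rightarrow> real" where
  "field_elem_val X \<beta> a =
     (\<Sum>k<length a. int_poly_val X (fst (a ! k)) / int_poly_val X (snd (a ! k)) * \<beta> ^ k)"

definition enc_int_poly :: "int_poly \<Rightarrow> word" where
  "enc_int_poly = enc_list (\<lambda>(c, e). enc_int c @ enc_list enc_unary e)"

definition enc_field_elem :: "field_elem \<Rightarrow> word" where
  "enc_field_elem = enc_list (\<lambda>(P, Q). enc_int_poly P @ enc_int_poly Q)"


section \<open>The problem Pl-EVAL\<close>

definition Pl_EVAL :: "real mat \<Rightarrow> real list \<Rightarrow> real \<Rightarrow> problem" where
  "Pl_EVAL M X \<beta> = {(enc_graph G, enc_field_elem a) | G a.
     planar G \<and> wf_field_elem X a \<and> field_elem_val X \<beta> a = Z M G}"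

text \<open>
  Hardness is required for every presentation (there always is one, since the generated field is
  a finitely generated extension of \<open>\<rat>\<close> of characteristic 0).
\<close>

definition Pl_EVAL_hard :: "real mat \<Rightarrow> bool" where
  "Pl_EVAL_hard M \<longleftrightarrow> (\<forall>X \<beta>. presentation M X \<beta> \<longrightarrow> sharpP_hard (Pl_EVAL M X \<beta>))"


section \<open>Lebesgue measure on symmetric matrices\<close>

definition symmetric_mats :: "nat \<Rightarrow> real mat set" where
  "symmetric_mats q = {M \<in> carrier_mat q q. transpose_mat M = M}"

text \<open>A symmetric matrix is identified with its \<open>q(q+1)/2\<close> entries on and above the diagonal.\<close>

definition upper_indices :: "nat \<Rightarrow> (nat \<times> nat) set" where
  "upper_indices q = {(i, j). i \<le> j \<and> j < q}"

definition upper_entries :: "nat \<Rightarrow> real mat \<Rightarrow> nat \<times> nat \<Rightarrow> real" where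
  "upper_entries q M = restrict (\<lambda>ij. M $$ ij) (upper_indices q)"

definition symmetric_lebesgue :: "nat \<Rightarrow> (nat \<times> nat \<Rightarrow> real) measure" where
  "symmetric_lebesgue q = completion (PiM (upper_indices q) (\<lambda>_. lborel))"

end

theory Submission
  imports Defs "HOL-Library.Countable"
begin

text \<open>
 For almost every matrix the entries on and above the diagonal satisfy no nontrivial polynomial
 relation over the integers, since the exceptional set is a countable union of zero sets of
 polynomials.  For such a matrix, the equation between \<open>Z M G\<close> and an answer of the oracle is an
 identity of rational functions in the entries.  Hence the answer determines the partition
 function of \<open>G\<close> at every integer matrix at which its denominator does not vanish.

 It is evaluated at matrices that are 2-adically close to the matrix \<open>m0\<close> with the block
 \<open>(1,1,1), (1,-1,1), (1,1,0)\<close> and that, by a Kronecker substitution, are not zeros of the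
 denominator.  At \<open>m0\<close>, loops restrict the spins and parity checks let wires cross in the plane.
 This yields constraints that exactly one of a set of variables is true, then tilings, and
 finally the accepting computations of a verifier.  So the partition function at \<open>m0\<close> is a known
 nonzero constant times the number of witnesses, which is recovered by division modulo a power
 of 2.
\<close>

section \<open>Stack programs on Turing machines\<close>

text \<open>The oracle chooses the representation of its answer, so the denominator may vanish at
  \<open>m0\<close> itself; it is only known to be a nonzero polynomial of bounded size. Integer
  perturbations by high powers of 2 avoid its zeros and change the partition function only by a
  multiple of a high power of 2. As a count of witnesses has boundedly many bits, one query
  suffices, provided that every step between \<open>m0\<close> and the verifier keeps the count up
  to a known factor. Hence the constraints are exactly-one conditions, and their solutions, the
  tilings and the accepted words correspond bijectively.

  Spins 0 and 1 carry bits, but parity checks alone only cut out affine sets. The third spin breaks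
  this: loops remove it, whereas a vertex without loops keeps it and gives its two neighbours weight
  3 if they agree and 1 if not, instead of 2 and 0. Together with the sign of a single loop, a row
  of the grid has weight \<open>3 ^ a - 3 ^ b\<close>, which vanishes only for \<open>a = b\<close>
  and so excludes one value of a count.

  Polynomial time is handled by closure properties of \<open>FP\<close>; the basic loop is a fold
  over a word with polynomially bounded accumulators.\<close>

definition pb :: "(nat => nat) => bool" where
 "pb f \<longleftrightarrow> (\<exists>k. \<forall>n. f n <= (n + 2) ^ k)"

text \<open>The base \<open>n + 2\<close> is at least 2 even for \<open>n = 0\<close>, so that a
  constant is absorbed by the exponent.\<close>

lemma pb_const: "pb (%n. c)"
 unfolding pb_def
proof (intro exI allI)
 fix n
 have "c <= 2 ^ c" by (rule less_imp_le) (rule less_exp)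
 also have "\<dots> <= (n + 2) ^ c" by (rule power_mono) auto
 finally show "c <= (n + 2) ^ c" .
qed

lemma pb_id: "pb (%n. n)"
 unfolding pb_def by (intro exI[of _ 1]) auto

lemma pb_add: assumes "pb f" "pb g" shows "pb (%n. f n + g n)"
proof -
 obtain a b where ab: "\<And>n. f n <= (n + 2) ^ a" "\<And>n. g n <= (n + 2) ^ b"
  using assms unfolding pb_def by auto
 have "f n + g n <= (n + 2) ^ Suc (a + b)" for n
 proof -
  have "f n + g n <= (n + 2) ^ a + (n + 2) ^ b" using ab by (meson add_mono)
  also have "\<dots> <= (n + 2) ^ (a + b) + (n + 2) ^ (a + b)"
   by (intro add_mono power_increasing) auto
  also have "\<dots> <= (n + 2) ^ Suc (a + b)" by simp
  finally show ?thesis .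
 qed
 then show ?thesis unfolding pb_def by blast
qed

lemma pb_mult: assumes "pb f" "pb g" shows "pb (%n. f n * g n)"
proof -
 obtain a b where ab: "\<And>n. f n <= (n + 2) ^ a" "\<And>n. g n <= (n + 2) ^ b"
  using assms unfolding pb_def by auto
 have "f n * g n <= (n + 2) ^ (a + b)" for n
  unfolding power_add using ab by (meson mult_le_mono)
 then show ?thesis unfolding pb_def by blast
qed

lemma pb_mono: assumes "pb g" "\<And>n. f n <= g n" shows "pb f"
 using assms unfolding pb_def by (meson le_trans)

lemma pb_power: assumes "pb f" shows "pb (%n. f n ^ m)"
 by (induction m) (auto intro: pb_const pb_mult assms)

lemma pb_comp: assumes "pb f" "pb g" shows "pb (%n. f (g n))"
proof -
 obtain k where k: "\<And>n. f n <= (n + 2) ^ k" using assms unfolding pb_def by auto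
 show ?thesis
  by (rule pb_mono[of "%n. (g n + 2) ^ k"], intro pb_power pb_add pb_const assms, rule k)
qed

lemma pb_poly: "pb (%n. poly p n)"
proof (induction p)
 case 0 show ?case by (simp add: pb_const)
next
 case (pCons a p)
 show ?case by (simp, intro pb_add pb_mult pb_const pb_id pCons)
qed

lemmas pb_intros = pb_add pb_mult pb_const pb_id pb_power

section \<open>Stack programs and their running time\<close>

type_synonym env = "nat => nat list"

datatype com = Skip | Push nat nat | Pop nat | Out nat nat | Seq com com (infixr \<open>;;\<close> 60)
 | IfTop nat nat com com | While nat com

definition hdis :: "nat => nat list => bool" where
 "hdis a w \<longleftrightarrow> w ~= [] \<and> hd w = a"

text \<open>The times are those of the machine code: \<open>Push\<close> takes two steps, a move off
  the old top and then the write, and every test takes one.\<close>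

inductive exec :: "com => env => nat => env => bool" where
 Skip: "exec Skip e 1 e"
| Push: "exec (Push i a) e 2 (e(i := a # e i))"
| Pop: "exec (Pop i) e 1 (e(i := tl (e i)))"
| Out: "exec (Out i a) e 1 (e(i := e i @ [a]))"
| Seq: "exec c e t e' ==> exec d e' t' e'' ==> exec (c ;; d) e (t + t') e''"
| IfT: "hdis a (e i) ==> exec c e t e' ==> exec (IfTop i a c d) e (Suc t) e'"
| IfF: "\<not> hdis a (e i) ==> exec d e t e' ==> exec (IfTop i a c d) e (Suc t) e'"
| WhF: "e i = [] ==> exec (While i c) e 1 e"
| WhT: "e i ~= [] ==> exec c e t e' ==> exec (While i c) e' t' e'' ==>
  exec (While i c) e (Suc (t + t')) e''"

fun csize :: "com => nat" where
 "csize Skip = 1" | "csize (Push i a) = 2" | "csize (Pop i) = 1" | "csize (Out i a) = 1"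
| "csize (c ;; d) = csize c + csize d" | "csize (IfTop i a c d) = Suc (csize c + csize d)"
| "csize (While i c) = Suc (csize c)"

definition act :: "nat list => nat => nat => int => (nat \<times> int) list" where
 "act r i a d = (map (%x. (x, 0)) r)[i := (a, d)]"

definition idle :: "nat list => (nat \<times> int) list" where
 "idle r = map (%x. (x, 0)) r"

text \<open>The states from \<open>s\<close> to \<open>s + csize c - 1\<close> belong to
  \<open>c\<close>, and control leaves to \<open>nx\<close>. A symbol \<open>a\<close> is stored as
  \<open>Suc a\<close> because 0 is the blank. Popping an empty stack must not move the
  head.\<close>

fun code :: "com => nat => nat => nat => nat list => nat \<times> (nat \<times> int) list" where
 "code Skip s nx st r = (nx, idle r)"
| "code (Push i a) s nx st r =
   (if st = s then (Suc s, act r i (r ! i) (-1)) else (nx, act r i (Suc a) 0))"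
| "code (Pop i) s nx st r = (nx, if r ! i = 0 then idle r else act r i (r ! i) 1)"
| "code (Out i a) s nx st r = (nx, act r i (Suc a) 1)"
| "code (c ;; d) s nx st r =
   (if st < s + csize c then code c s (s + csize c) st r else code d (s + csize c) nx st r)"
| "code (IfTop i a c d) s nx st r =
   (if st = s then (if r ! i = Suc a then Suc s else Suc (s + csize c), idle r)
   else if st < Suc (s + csize c) then code c (Suc s) nx st r
   else code d (Suc (s + csize c)) nx st r)"
| "code (While i c) s nx st r =
   (if st = s then (if r ! i = 0 then nx else Suc s, idle r) else code c (Suc s) s st r)"

fun usable :: "nat set => nat => nat => com => bool" where
 "usable OT nt A Skip = True"
| "usable OT nt A (Push i a) = (i \<notin> OT \<and> i < nt \<and> a < A)"
| "usable OT nt A (Pop i) = (i \<notin> OT \<and> i < nt)"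
| "usable OT nt A (Out i a) = (i \<in> OT \<and> i < nt \<and> a < A)"
| "usable OT nt A (c ;; d) = (usable OT nt A c \<and> usable OT nt A d)"
| "usable OT nt A (IfTop i a c d) = (i \<notin> OT \<and> i < nt \<and> usable OT nt A c \<and> usable OT nt A d)"
| "usable OT nt A (While i c) = (i \<notin> OT \<and> i < nt \<and> usable OT nt A c)"

lemma csize_pos: "0 < csize c"
 by (induction c) auto

lemma code_wf:
 assumes "usable OT nt A c" "length r = nt" "set r \<subseteq> {..<Suc A}" "s <= st" "st < s + csize c"
  "s + csize c <= n" "nx < n"
 shows "fst (code c s nx st r) < n \<and> length (snd (code c s nx st r)) = nt \<and>
  set (snd (code c s nx st r)) \<subseteq> {..<Suc A} \<times> {-1, 0, 1}"
proof -
 have idle: "length (idle r) = nt" "set (idle r) \<subseteq> {..<Suc A} \<times> {-1, 0, 1}"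
  using assms(2,3) by (auto simp: idle_def)
 have act: "length (act r i a d) = nt"
  "a < Suc A ==> d \<in> {-1,0,1} ==> set (act r i a d) \<subseteq> {..<Suc A} \<times> {-1, 0, 1}" for i a d
  using assms(2,3) set_update_subset_insert[of "map (%x. (x, 0)) r" i "(a,d)"]
  by (auto simp: act_def)
 have nth: "i < nt ==> r ! i < Suc A" for i
  using assms(2,3) nth_mem[of i r] by (auto simp del: nth_mem)
 show ?thesis using assms(1,4-)
 proof (induction c arbitrary: s nx)
  case Skip then show ?case using idle by auto
 next
  case (Push i a)
  then have "r ! i < Suc A" "Suc a < Suc A" using nth by auto
  with Push show ?case using act(1) act(2)[of "r ! i" "-1" i] act(2)[of "Suc a" 0 i] by simp
 next
  case (Pop i)
  then have "r ! i < Suc A" using nth by auto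
  with Pop show ?case using act(1) act(2)[of "r ! i" 1 i] idle by simp
 next
  case (Out i a)
  then show ?case using act(1) act(2)[of "Suc a" 1 i] by simp
 next
  case (Seq c d)
  show ?case
  proof (cases "st < s + csize c")
   case True
   then show ?thesis using Seq.IH(1)[of s "s + csize c"] Seq.prems csize_pos[of d] by simp
  next
   case False
   then show ?thesis using Seq.IH(2)[of "s + csize c" nx] Seq.prems by simp
  qed
 next
  case (IfTop i a c d)
  consider "st = s" | "st ~= s" "st < Suc (s + csize c)" | "st \<ge> Suc (s + csize c)" by linarith
  then show ?case
  proof cases
   case 1
   then show ?thesis using IfTop.prems idle csize_pos[of d] by auto
  next
   case 2
   then show ?thesis using IfTop.IH(1)[of "Suc s" nx] IfTop.prems by simp
  next
   case 3
   then show ?thesis using IfTop.IH(2)[of "Suc (s + csize c)" nx] IfTop.prems by simp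
  qed
 next
  case (While i c)
  show ?case
  proof (cases "st = s")
   case True
   then show ?thesis using While.prems idle csize_pos[of c] by auto
  next
   case False
   then show ?thesis using While.IH[of "Suc s" s] While.prems by simp
  qed
 qed
qed

section \<open>Tapes that hold stacks or outputs\<close>

definition srep :: "nat list => tape => bool" where
 "srep l t \<longleftrightarrow> (\<forall>j. fst t (snd t + int j) = (if j < length l then Suc (l ! j) else 0))"

text \<open>A stack has its top under the head and leaves the cells to the left of it unspecified.
  So a pop need not erase anything, and an input word or an oracle answer already is a stack. Output
  words have to begin at cell 0; they grow to the right and are only appended to.\<close>

definition orep :: "nat list => tape => bool" where
 "orep l t \<longleftrightarrow> snd t = int (length l) \<and>
   (\<forall>z. fst t z = (if 0 <= z \<and> nat z < length l then Suc (l ! nat z) else 0))"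

definition rep :: "nat set => nat => env => tape list => bool" where
 "rep OT nt e ts \<longleftrightarrow> length ts = nt \<and>
   (\<forall>i<nt. if i \<in> OT then orep (e i) (ts ! i) else srep (e i) (ts ! i))"

lemma srep_read: "srep l t ==> fst t (snd t) = (if l = [] then 0 else Suc (hd l))"
 unfolding srep_def by (drule spec[of _ 0]) (auto simp: hd_conv_nth)

lemma srep_pop: assumes "srep l (c, h)" shows "srep (tl l) (c, h + 1)"
 unfolding srep_def
proof
 fix j
 have "c (h + int (Suc j)) = (if Suc j < length l then Suc (l ! Suc j) else 0)"
  using assms unfolding srep_def fst_conv snd_conv by blast
 then show "fst (c, h + 1) (snd (c, h + 1) + int j) = (if j < length (tl l) then Suc (tl l ! j) else 0)"
  by (auto simp: nth_tl algebra_simps)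
qed

lemma srep_push: assumes "srep l (c, h)" shows "srep (a # l) (c(h - 1 := Suc a), h - 1)"
 unfolding srep_def
proof
 fix j
 show "fst (c(h - 1 := Suc a), h - 1) (snd (c(h - 1 := Suc a), h - 1) + int j) =
  (if j < length (a # l) then Suc ((a # l) ! j) else 0)"
 proof (cases j)
  case 0 then show ?thesis by simp
 next
  case (Suc k)
  have "c (h + int k) = (if k < length l then Suc (l ! k) else 0)"
   using assms unfolding srep_def fst_conv snd_conv by blast
  then show ?thesis using Suc by auto
 qed
qed

lemma orep_app: assumes "orep l (c, h)" shows "orep (l @ [a]) (c(h := Suc a), h + 1)"
 using assms unfolding orep_def by (auto simp: nth_append)

definition reads :: "tape list => nat list" where
 "reads ts = map (%(cells, h). cells h) ts"

definition perform :: "tape list => (nat \<times> int) list => tape list" where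
 "perform ts acts = map2 (%(cells, h) (a, d). (cells(h := a), h + d)) ts acts"

lemma step_delta: "s ~= 1 ==> s ~= 2 ==>
  step f N (s, ts) = (case delta N s (reads ts) of (s', acts) => (s', perform ts acts))"
 by (simp add: step_def reads_def perform_def)

lemma perform_idle: "perform ts (idle (reads ts)) = ts"
 unfolding perform_def idle_def reads_def
 by (rule nth_equalityI) (auto split: prod.splits)

lemma perform_act: "i < length ts ==> perform ts (act (reads ts) i a d) =
  ts[i := (case ts ! i of (cells, h) => (cells(h := a), h + d))]"
 unfolding perform_def act_def reads_def
 by (rule nth_equalityI) (auto split: prod.splits simp: nth_list_update)

lemma reads_nth: "i < length ts ==> reads ts ! i = fst (ts ! i) (snd (ts ! i))"
 unfolding reads_def by (auto split: prod.splits)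

lemma rep_read: "rep OT nt e ts ==> i < nt ==> i \<notin> OT ==>
  reads ts ! i = (if e i = [] then 0 else Suc (hd (e i)))"
 using reads_nth[of i ts] srep_read[of "e i" "ts ! i"] unfolding rep_def by auto

lemma rep_upd: "rep OT nt e ts ==> i < nt ==> (if i \<in> OT then orep l t else srep l t) ==>
  rep OT nt (e(i := l)) (ts[i := t])"
 unfolding rep_def by (auto simp: nth_list_update)

lemma funpow_add': "(f ^^ (m + n)) x = (f ^^ n) ((f ^^ m) x)"
 by (metis add.commute comp_apply funpow_add)

text \<open>Starting at state 4 or later keeps the code clear of the halting and the query state, in
  which \<open>step\<close> ignores \<open>delta\<close>. The oracle is therefore arbitrary.\<close>

lemma exec_sim:
 assumes "exec c e t e'" "usable OT nt A c" "rep OT nt e ts" "4 <= s"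
  "\<And>st r. s <= st ==> st < s + csize c ==> delta N st r = code c s nx st r"
 shows "\<exists>ts'. (step f N ^^ t) (s, ts) = (nx, ts') \<and> rep OT nt e' ts'"
 using assms
proof (induction arbitrary: ts s nx rule: exec.induct)
 case (Skip e)
 then show ?case by (simp add: step_delta perform_idle)
next
 case (Push i a e)
 then have i: "i < length ts" "i \<notin> OT" "i < nt" by (auto simp: rep_def)
 obtain cl h where t: "ts ! i = (cl, h)" by fastforce
 have sr: "srep (e i) (cl, h)" using Push(2) i t by (auto simp: rep_def)
 have 1: "step f N (s, ts) = (Suc s, ts[i := (cl, h - 1)])"
  using Push i t by (simp add: step_delta perform_act reads_nth)
 have 2: "step f N (Suc s, ts[i := (cl, h - 1)]) = (nx, ts[i := (cl(h - 1 := Suc a), h - 1)])"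
  using Push i t by (simp add: step_delta perform_act reads_nth)
 have "(step f N ^^ 2) (s, ts) = (nx, ts[i := (cl(h - 1 := Suc a), h - 1)])"
  by (simp add: numeral_2_eq_2 1 2)
 moreover have "rep OT nt (e(i := a # e i)) (ts[i := (cl(h - 1 := Suc a), h - 1)])"
  using rep_upd[OF Push(2)] srep_push[OF sr] i by simp
 ultimately show ?case by blast
next
 case (Pop i e)
 then have i: "i < length ts" "i \<notin> OT" "i < nt" by (auto simp: rep_def)
 obtain cl h where t: "ts ! i = (cl, h)" by fastforce
 have sr: "srep (e i) (cl, h)" using Pop(2) i t by (auto simp: rep_def)
 show ?case
 proof (cases "e i = []")
  case True
  then have "step f N (s, ts) = (nx, ts)"
   using Pop i rep_read[OF Pop(2)] by (simp add: step_delta perform_idle)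
  then show ?thesis using True Pop(2) by (simp add: fun_upd_idem)
 next
  case False
  then have "(step f N ^^ 1) (s, ts) = (nx, ts[i := (cl, h + 1)])"
   using Pop i t rep_read[OF Pop(2)] reads_nth[OF i(1)] by (simp add: step_delta perform_act)
  moreover have "rep OT nt (e(i := tl (e i))) (ts[i := (cl, h + 1)])"
   using rep_upd[OF Pop(2)] srep_pop[OF sr] i by simp
  ultimately show ?thesis by blast
 qed
next
 case (Out i a e)
 then have i: "i < length ts" "i \<in> OT" "i < nt" by (auto simp: rep_def)
 obtain cl h where t: "ts ! i = (cl, h)" by fastforce
 have sr: "orep (e i) (cl, h)" using Out(2) i t by (auto simp: rep_def)
 have "(step f N ^^ 1) (s, ts) = (nx, ts[i := (cl(h := Suc a), h + 1)])"
  using Out i t by (simp add: step_delta perform_act)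
 moreover have "rep OT nt (e(i := e i @ [a])) (ts[i := (cl(h := Suc a), h + 1)])"
  using rep_upd[OF Out(2)] orep_app[OF sr] i by simp
 ultimately show ?case by blast
next
 case (Seq c e t e' d t' e'')
 obtain ts1 where 1: "(step f N ^^ t) (s, ts) = (s + csize c, ts1)" "rep OT nt e' ts1"
  using Seq.IH(1)[of ts s "s + csize c"] Seq.prems by auto
 obtain ts2 where 2: "(step f N ^^ t') (s + csize c, ts1) = (nx, ts2)" "rep OT nt e'' ts2"
  using Seq.IH(2)[of ts1 "s + csize c" nx] Seq.prems 1 by auto
 show ?case by (simp add: funpow_add' 1 2)
next
 case (IfT a e i c t e' d)
 have "reads ts ! i = Suc a" using IfT rep_read[OF IfT(5)] by (auto simp: hdis_def)
 then have 1: "step f N (s, ts) = (Suc s, ts)"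
  using IfT by (simp add: step_delta perform_idle)
 obtain ts1 where "(step f N ^^ t) (Suc s, ts) = (nx, ts1)" "rep OT nt e' ts1"
  using IfT.IH[of ts "Suc s" nx] IfT.prems by auto
 then show ?case using 1 by (simp add: funpow_swap1)
next
 case (IfF a e i d t e' c)
 have "reads ts ! i ~= Suc a" using IfF rep_read[OF IfF(5)] by (auto simp: hdis_def)
 then have 1: "step f N (s, ts) = (Suc (s + csize c), ts)"
  using IfF by (simp add: step_delta perform_idle)
 obtain ts1 where "(step f N ^^ t) (Suc (s + csize c), ts) = (nx, ts1)" "rep OT nt e' ts1"
  using IfF.IH[of ts "Suc (s + csize c)" nx] IfF.prems by auto
 then show ?case using 1 by (simp add: funpow_swap1)
next
 case (WhF e i c)
 have "reads ts ! i = 0" using WhF rep_read[OF WhF(3)] by auto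
 then have 1: "step f N (s, ts) = (nx, ts)"
  using WhF by (simp add: step_delta perform_idle)
 then show ?case using WhF by simp
next
 case (WhT e i c t e' t' e'')
 have "reads ts ! i ~= 0" using WhT rep_read[OF WhT(7)] by (auto simp: WhT(1))
 then have 1: "step f N (s, ts) = (Suc s, ts)"
  using WhT by (simp add: step_delta perform_idle)
 obtain ts1 where 2: "(step f N ^^ t) (Suc s, ts) = (s, ts1)" "rep OT nt e' ts1"
  using WhT.IH(1)[of ts "Suc s" s] WhT.prems by auto
 obtain ts2 where 3: "(step f N ^^ t') (s, ts1) = (nx, ts2)" "rep OT nt e'' ts2"
  using WhT.IH(2)[of ts1 s nx] WhT.prems 2 by auto
 have "(step f N ^^ Suc (t + t')) (s, ts) = (step f N ^^ (t + t')) (step f N (s, ts))"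
  by (simp add: funpow_swap1)
 also have "\<dots> = (nx, ts2)" by (simp only: funpow_add' 1 2 3)
 finally show ?case using 3 by blast
qed

section \<open>Time bounds for loops and for copying stacks\<close>

fun pure_on :: "nat => nat set => com => bool" where
 "pure_on A R Skip = True"
| "pure_on A R (Push i a) = (i \<in> R \<and> a < A)"
| "pure_on A R (Pop i) = (i \<in> R)"
| "pure_on A R (Out i a) = False"
| "pure_on A R (c ;; d) = (pure_on A R c \<and> pure_on A R d)"
| "pure_on A R (IfTop i a c d) = (i \<in> R \<and> pure_on A R c \<and> pure_on A R d)"
| "pure_on A R (While i c) = (i \<in> R \<and> pure_on A R c)"

lemma pure_on_usable: "pure_on A R c ==> R \<inter> OT = {} ==> R \<subseteq> {..<nt} ==> usable OT nt A c"
 by (induction c) auto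

lemma pure_on_mono: "pure_on A R c ==> R \<subseteq> R' ==> pure_on A R' c"
 by (induction c) auto

definition exle :: "com => env => nat => env => bool" where
 "exle c e t e' \<longleftrightarrow> (\<exists>t'\<le>t. exec c e t' e')"

lemma exle_mono: "exle c e t e' ==> t <= t' ==> exle c e t' e'"
 unfolding exle_def by (meson le_trans)

lemma exle_Seq: "exle c e t e' ==> exle d e' t' e'' ==> exle (c ;; d) e (t + t') e''"
 unfolding exle_def by (meson add_mono exec.Seq)

lemma exle_Skip: "exle Skip e 1 e"
 unfolding exle_def using exec.Skip by blast

lemma exle_Push: "e' = e(i := a # e i) ==> exle (Push i a) e 2 e'"
 unfolding exle_def using exec.Push by blast

lemma exle_Pop: "e' = e(i := tl (e i)) ==> exle (Pop i) e 1 e'"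
 unfolding exle_def using exec.Pop by blast

lemma exle_Out: "e' = e(i := e i @ [a]) ==> exle (Out i a) e 1 e'"
 unfolding exle_def using exec.Out by blast

lemma exle_If: "exle (if hdis a (e i) then c else d) e t e' ==> exle (IfTop i a c d) e (Suc t) e'"
 unfolding exle_def by (auto intro: exec.IfT exec.IfF split: if_splits)

lemma exle_While:
 assumes "\<And>m. m < n ==> exle c (E m) t (E (Suc m))" "\<And>m. m < n ==> E m i ~= []" "E n i = []"
 shows "exle (While i c) (E 0) (n * Suc t + 1) (E n)"
 using assms
proof (induction n arbitrary: E)
 case 0
 then have "exec (While i c) (E 0) 1 (E 0)" by (intro exec.WhF) auto
 then show ?case unfolding exle_def by auto
next
 case (Suc n)
 have "exle (While i c) (E (Suc 0)) (n * Suc t + 1) (E (Suc n))"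
  using Suc.IH[of "%m. E (Suc m)"] Suc.prems by auto
 then obtain t2 where t2: "t2 <= n * Suc t + 1" "exec (While i c) (E (Suc 0)) t2 (E (Suc n))"
  unfolding exle_def by auto
 obtain t1 where t1: "t1 <= t" "exec c (E 0) t1 (E (Suc 0))"
  using Suc.prems(1)[of 0] unfolding exle_def by auto
 have "exec (While i c) (E 0) (Suc (t1 + t2)) (E (Suc n))"
  using Suc.prems(2)[of 0] t1 t2 by (auto intro: exec.WhT)
 then show ?case unfolding exle_def using t1 t2 by (intro exI[of _ "Suc (t1 + t2)"]) auto
qed

text \<open>One time unit adds at most one symbol, so a bound on the time is also a bound on all
  lengths.\<close>

lemma exle_len: "exle c e t e' ==> length (e' j) <= length (e j) + t"
proof -
 have "exec c e t e' ==> length (e' j) <= length (e j) + t" for t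
  by (induction rule: exec.induct) auto
 then show "exle c e t e' ==> length (e' j) <= length (e j) + t"
  unfolding exle_def by fastforce
qed

fun scase :: "nat => (nat => com) => nat => com" where
 "scase i c 0 = Skip"
| "scase i c (Suc n) = IfTop i n (c n) (scase i c n)"

lemma exle_scase: "x < n ==> hdis x (e i) ==> exle (c x) e t e' ==> exle (scase i c n) e (t + n) e'"
proof (induction n)
 case (Suc n)
 show ?case
 proof (cases "x = n")
  case True
  then have "exle (scase i c (Suc n)) e (Suc t) e'"
   using Suc.prems by (auto intro!: exle_If)
  then show ?thesis by (rule exle_mono) auto
 next
  case False
  then have "\<not> hdis n (e i)" "x < n" using Suc.prems by (auto simp: hdis_def)
  then have "exle (scase i c (Suc n)) e (Suc (t + n)) e'"
   using Suc.prems Suc.IH by (auto intro!: exle_If)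
  then show ?thesis by simp
 qed
qed simp

lemma pure_scase: "(\<And>x. x < n ==> pure_on A R (c x)) ==> i \<in> R ==> pure_on A R (scase i c n)"
 by (induction n) auto

fun seqn :: "nat => (nat => com) => com" where
 "seqn 0 c = Skip"
| "seqn (Suc n) c = seqn n c ;; c n"

lemma exle_seqn: "(\<And>i. i < n ==> exle (c i) (E i) t (E (Suc i))) ==> exle (seqn n c) (E 0) (n * t + 1) (E n)"
proof (induction n)
 case 0 show ?case by (simp add: exle_Skip[simplified])
next
 case (Suc n)
 have "exle (seqn n c ;; c n) (E 0) ((n * t + 1) + t) (E (Suc n))"
  by (rule exle_Seq) (use Suc in auto)
 then show ?case by (simp add: algebra_simps)
qed

lemma pure_seqn: "(\<And>x. x < n ==> pure_on A R (c x)) ==> pure_on A R (seqn n c)"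
 by (induction n) auto

lemma exle_symloop:
 assumes step: "\<And>m. m < length w ==> exle (c (w ! m)) (E m) t (E (Suc m))"
  and w: "set w \<subseteq> {..<A}" and E: "\<And>m. m <= length w ==> E m i = drop m w"
 shows "exle (While i (scase i c A)) (E 0) (length w * Suc (t + A) + 1) (E (length w))"
proof (rule exle_While)
 fix m assume m: "m < length w"
 then have "E m i = w ! m # drop (Suc m) w" using E by (simp add: Cons_nth_drop_Suc)
 then have "hdis (w ! m) (E m i)" by (simp add: hdis_def)
 moreover have "w ! m < A" using w m nth_mem by blast
 ultimately show "exle (scase i c A) (E m) (t + A) (E (Suc m))" using step m exle_scase by blast
qed (use E in auto)

definition mv :: "nat => nat => nat => com" where
 "mv A i j = While i (scase i (%a. Pop i ;; Push j a) A)"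

lemma exle_mv:
 assumes "i ~= j" "set (e i) \<subseteq> {..<A}" "e' = e(i := [], j := rev (e i) @ e j)"
 shows "exle (mv A i j) e (length (e i) * (A + 4) + 1) e'"
proof -
 define E where "E m = e(i := drop m (e i), j := rev (take m (e i)) @ e j)" for m
 have 1: "exle (While i (scase i (%a. Pop i ;; Push j a) A)) (E 0)
  (length (e i) * Suc (3 + A) + 1) (E (length (e i)))"
 proof (rule exle_symloop)
  fix m assume m: "m < length (e i)"
  have "exle (Pop i ;; Push j (e i ! m)) (E m) (1 + 2) (E (Suc m))"
   by (rule exle_Seq, rule exle_Pop, rule refl, rule exle_Push)
    (use m assms in \<open>auto simp: E_def fun_eq_iff take_Suc_conv_app_nth tl_drop drop_Suc\<close>)
  then show "exle (Pop i ;; Push j (e i ! m)) (E m) 3 (E (Suc m))" by (rule exle_mono) simp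
 qed (use assms in \<open>auto simp: E_def\<close>)
 have E: "E 0 = e" "E (length (e i)) = e'" using assms by (auto simp: E_def)
 show ?thesis unfolding mv_def by (rule exle_mono[OF 1[unfolded E]]) (simp add: algebra_simps)
qed

lemma pure_mv: "i \<in> R ==> j \<in> R ==> pure_on A R (mv A i j)"
 unfolding mv_def by (auto intro!: pure_scase)

text \<open>Reading a stack means popping it. The detour through \<open>k\<close> reverses the word
  twice and rebuilds the source together with the copy.\<close>

definition cpy :: "nat => nat => nat => nat => com" where
 "cpy A i j k = mv A i k ;; While k (scase k (%a. Pop k ;; Push i a ;; Push j a) A)"

lemma exle_cpy:
 assumes "i ~= j" "i ~= k" "j ~= k" "e k = []" "set (e i) \<subseteq> {..<A}" "e' = e(j := e i @ e j)"
 shows "exle (cpy A i j k) e (length (e i) * (2 * A + 10) + 2) e'"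
proof -
 define w where "w = rev (e i)"
 define E where "E m = e(k := drop m w, i := rev (take m w), j := rev (take m w) @ e j)" for m
 have 1: "exle (mv A i k) e (length (e i) * (A + 4) + 1) (e(i := [], k := w))"
  by (rule exle_mv) (use assms in \<open>auto simp: w_def\<close>)
 have 2: "exle (While k (scase k (%a. Pop k ;; Push i a ;; Push j a) A)) (E 0)
  (length w * Suc (5 + A) + 1) (E (length w))"
 proof (rule exle_symloop)
  fix m assume m: "m < length w"
  have "exle (Pop k ;; Push i (w ! m) ;; Push j (w ! m)) (E m) (1 + (2 + 2)) (E (Suc m))"
   by (rule exle_Seq, rule exle_Pop, rule refl, rule exle_Seq, rule exle_Push, rule refl,
     rule exle_Push)
    (use m assms in \<open>auto simp: E_def fun_eq_iff take_Suc_conv_app_nth tl_drop drop_Suc\<close>)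
  then show "exle (Pop k ;; Push i (w ! m) ;; Push j (w ! m)) (E m) 5 (E (Suc m))" by (rule exle_mono) simp
 qed (use assms in \<open>auto simp: E_def w_def\<close>)
 have E: "E 0 = e(i := [], k := w)" "E (length w) = e'"
  using assms by (auto simp: E_def w_def fun_eq_iff)
 have "exle (cpy A i j k) e ((length (e i) * (A + 4) + 1) + (length w * Suc (5 + A) + 1)) e'"
  unfolding cpy_def by (rule exle_Seq[OF 1 2[unfolded E]])
 then show ?thesis by (rule exle_mono) (simp add: w_def algebra_simps)
qed

lemma pure_cpy: "i \<in> R ==> j \<in> R ==> k \<in> R ==> pure_on A R (cpy A i j k)"
 unfolding cpy_def by (auto intro!: pure_scase pure_mv)

definition clr :: "nat => com" where
 "clr i = While i (Pop i)"

lemma exle_clr: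
 assumes "e' = e(i := [])"
 shows "exle (clr i) e (2 * length (e i) + 1) e'"
proof -
 define E where "E m = e(i := drop m (e i))" for m
 have 1: "exle (While i (Pop i)) (E 0) (length (e i) * Suc 1 + 1) (E (length (e i)))"
  by (rule exle_While, rule exle_Pop) (auto simp: E_def tl_drop drop_Suc)
 have E: "E 0 = e" "E (length (e i)) = e'" using assms by (auto simp: E_def)
 show ?thesis unfolding clr_def by (rule exle_mono[OF 1[unfolded E]]) simp
qed

lemma pure_clr: "i \<in> R ==> pure_on A R (clr i)"
 by (simp add: clr_def)

section \<open>Closure properties of polynomial-time functions\<close>

definition vld :: "nat => nat => env => bool" where
 "vld A K e \<longleftrightarrow> (\<forall>i<K. set (e i) \<subseteq> {..<A})"

definition sz :: "nat => env => nat" where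
 "sz K e = (\<Sum>i<K. length (e i))"

lemma sz_mono: "K <= K' ==> sz K e <= sz K' e"
 unfolding sz_def by (rule sum_mono2) auto

lemma vld_mono: "vld A K' e ==> K <= K' ==> vld A K e"
 unfolding vld_def by auto

lemma sz_ge: "i < K ==> length (e i) <= sz K e"
 unfolding sz_def by (rule member_le_sum) auto

lemma sz_cong: "(\<And>i. i < K ==> e i = e' i) ==> sz K e = sz K e'"
 unfolding sz_def by auto

text \<open>
 The program reads the arguments from the stacks \<open>rh i\<close>, writes to the empty stack \<open>ot\<close> and
 may use the stacks from \<open>s\<close> on as scratch space, which it leaves empty.
\<close>

definition FPt :: "nat => (env => nat list) => nat => nat => (nat => nat) => bool" where
 "FPt A f K B ta \<longleftrightarrow>
  (\<forall>e e'. vld A K e --> (\<forall>i<K. e i = e' i) --> f e = f e') \<and>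
  (\<forall>e. vld A K e --> set (f e) \<subseteq> {..<A}) \<and>
  (\<forall>rh ot s. (\<forall>i<K. rh i < s \<and> rh i ~= ot) --> ot < s -->
   (\<exists>c. pure_on A (rh ` {..<K} \<union> {ot} \<union> {s..<s + B}) c \<and>
    (\<forall>e. vld A K (%i. e (rh i)) --> e ot = [] --> (\<forall>j\<ge>s. e j = []) -->
     exle c e (ta (sz K (%i. e (rh i)))) (e(ot := f (%i. e (rh i)))))))"

definition FPw :: "nat => (env => nat list) => nat => nat => nat => bool" where
 "FPw A f K B k \<longleftrightarrow> FPt A f K B (%n. (n + 2) ^ k)"

definition FP :: "nat => (env => nat list) => bool" where
 "FP A f \<longleftrightarrow> (\<exists>K B k. FPw A f K B k)"

lemma FPt_dep: "FPt A f K B ta ==> vld A K e ==> (\<forall>i<K. e i = e' i) ==> f e = f e'"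
 unfolding FPt_def by (drule conjunct1) blast

lemma FPt_val: "FPt A f K B ta ==> vld A K e ==> set (f e) \<subseteq> {..<A}"
 unfolding FPt_def by (drule conjunct2, drule conjunct1) blast

lemma FPt_run:
 assumes "FPt A f K B ta" "\<forall>i<K. rh i < s \<and> rh i ~= ot" "ot < s"
 obtains c where "pure_on A (rh ` {..<K} \<union> {ot} \<union> {s..<s + B}) c"
  "\<And>e. vld A K (%i. e (rh i)) ==> e ot = [] ==> (\<forall>j\<ge>s. e j = []) ==>
     exle c e (ta (sz K (%i. e (rh i)))) (e(ot := f (%i. e (rh i))))"
proof -
 have "\<forall>rh ot s. (\<forall>i<K. rh i < s \<and> rh i ~= ot) --> ot < s -->
   (\<exists>c. pure_on A (rh ` {..<K} \<union> {ot} \<union> {s..<s + B}) c \<and>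
    (\<forall>e. vld A K (%i. e (rh i)) --> e ot = [] --> (\<forall>j\<ge>s. e j = []) -->
     exle c e (ta (sz K (%i. e (rh i)))) (e(ot := f (%i. e (rh i))))))"
  using assms(1) unfolding FPt_def by (elim conjE)
 from mp[OF mp[OF this[THEN spec[of _ rh], THEN spec[of _ ot], THEN spec[of _ s]] assms(2)] assms(3)]
 show ?thesis using that by blast
qed

lemma FPt_mono:
 assumes f: "FPt A f K B ta" and le: "K <= K'" "B <= B'" and ta: "\<And>n n'. n <= n' ==> ta n <= ta' n'"
 shows "FPt A f K' B' ta'"
proof -
 have run: "\<exists>c. pure_on A (rh ` {..<K'} \<union> {ot} \<union> {s..<s + B'}) c \<and>
    (\<forall>e. vld A K' (%i. e (rh i)) --> e ot = [] --> (\<forall>j\<ge>s. e j = []) -->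
     exle c e (ta' (sz K' (%i. e (rh i)))) (e(ot := f (%i. e (rh i)))))"
  if "\<forall>i<K'. rh i < s \<and> rh i ~= ot" "ot < s" for rh ot s
 proof -
  have "\<forall>i<K. rh i < s \<and> rh i ~= ot" using that(1) le(1) by auto
  from FPt_run[OF f this that(2)]
  obtain c where c: "pure_on A (rh ` {..<K} \<union> {ot} \<union> {s..<s + B}) c"
   "\<And>e. vld A K (%i. e (rh i)) ==> e ot = [] ==> (\<forall>j\<ge>s. e j = []) ==>
     exle c e (ta (sz K (%i. e (rh i)))) (e(ot := f (%i. e (rh i))))"
   by blast
  have "pure_on A (rh ` {..<K'} \<union> {ot} \<union> {s..<s + B'}) c"
   by (rule pure_on_mono[OF c(1)]) (use le in auto)
  moreover have "\<forall>e. vld A K' (%i. e (rh i)) --> e ot = [] --> (\<forall>j\<ge>s. e j = []) -->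
     exle c e (ta' (sz K' (%i. e (rh i)))) (e(ot := f (%i. e (rh i))))"
  proof (intro allI impI)
   fix e assume e: "vld A K' (%i. e (rh i))" "e ot = []" "\<forall>j\<ge>s. e j = []"
   show "exle c e (ta' (sz K' (%i. e (rh i)))) (e(ot := f (%i. e (rh i))))"
    by (rule exle_mono[OF c(2)[OF vld_mono[OF e(1) le(1)] e(2,3)] ta[OF sz_mono[OF le(1)]]])
  qed
  ultimately show ?thesis by blast
 qed
 have "\<forall>e e'. vld A K' e --> (\<forall>i<K'. e i = e' i) --> f e = f e'"
  using FPt_dep[OF f vld_mono[OF _ le(1)]] le(1) by (meson less_le_trans)
 moreover have "\<forall>e. vld A K' e --> set (f e) \<subseteq> {..<A}"
  using FPt_val[OF f] vld_mono[OF _ le(1)] by meson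
 ultimately show ?thesis unfolding FPt_def using run by blast
qed

lemma FPw_mono: "FPw A f K B k ==> K <= K' ==> B <= B' ==> k <= k' ==> FPw A f K' B' k'"
 unfolding FPw_def
 by (erule FPt_mono) (auto intro!: order_trans[OF power_mono power_increasing])

lemma FPt_FP: "FPt A f K B ta ==> pb ta ==> FP A f"
proof -
 assume f: "FPt A f K B ta" and "pb ta"
 then obtain k where k: "\<And>n. ta n <= (n + 2) ^ k" unfolding pb_def by auto
 have "FPt A f K B (%n. (n + 2) ^ k)"
  by (rule FPt_mono[OF f]) (auto intro!: order_trans[OF k] power_mono)
 then show ?thesis unfolding FP_def FPw_def by blast
qed

text \<open>A fold has one update function per letter and accumulator. There are finitely many of
  them, and monotonicity of \<open>FPw\<close> in all three bounds allows taking maxima.\<close>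

lemma FPw_family:
 assumes "finite X" "\<And>x. x \<in> X ==> FP A (h x)"
 shows "\<exists>K B k. \<forall>x\<in>X. FPw A (h x) K B k"
 using assms
proof (induction X rule: finite_induct)
 case (insert x X)
 then obtain K B k where 1: "\<forall>x\<in>X. FPw A (h x) K B k" by auto
 obtain K' B' k' where 2: "FPw A (h x) K' B' k'" using insert.prems[of x] unfolding FP_def by blast
 have "\<forall>y\<in>insert x X. FPw A (h y) (max K K') (max B B') (max k k')"
  using 1 2 by (auto elim!: FPw_mono)
 then show ?case by blast
qed auto

lemma FP_var: "FP A (%e. e i)"
proof -
 have "FPt A (%e. e i) (Suc i) 1 (%n. n * (2 * A + 10) + 2)"
  unfolding FPt_def
 proof (intro conjI allI impI)
  fix rh :: "nat => nat" and ot s assume r: "\<forall>j<Suc i. rh j < s \<and> rh j ~= ot" "ot < s"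
  show "\<exists>c. pure_on A (rh ` {..<Suc i} \<union> {ot} \<union> {s..<s + 1}) c \<and>
   (\<forall>e. vld A (Suc i) (%i. e (rh i)) --> e ot = [] --> (\<forall>j\<ge>s. e j = []) -->
    exle c e (sz (Suc i) (%i. e (rh i)) * (2 * A + 10) + 2) (e(ot := e (rh i))))"
  proof (intro exI conjI allI impI)
   show "pure_on A (rh ` {..<Suc i} \<union> {ot} \<union> {s..<s + 1}) (cpy A (rh i) ot s)"
    by (rule pure_cpy) auto
   fix e assume e: "vld A (Suc i) (%i. e (rh i))" "e ot = []" "\<forall>j\<ge>s. e j = []"
   have "rh i < s" "rh i ~= ot" using r(1) by auto
   then have "exle (cpy A (rh i) ot s) e (length (e (rh i)) * (2 * A + 10) + 2) (e(ot := e (rh i)))"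
    using r e by (intro exle_cpy) (auto simp: vld_def)
   then show "exle (cpy A (rh i) ot s) e (sz (Suc i) (%i. e (rh i)) * (2 * A + 10) + 2)
     (e(ot := e (rh i)))"
    by (rule exle_mono) (use sz_ge[of i "Suc i" "%i. e (rh i)"] in auto)
  qed
 qed (auto simp: vld_def)
 then show ?thesis by (rule FPt_FP) (intro pb_intros)
qed

lemma FP_nil: "FP A (%e. [])"
proof -
 have "FPt A (%e. []) 0 0 (%n. 1)"
  unfolding FPt_def
 proof (intro conjI allI impI)
  fix rh :: "nat => nat" and ot s :: nat
  show "\<exists>c. pure_on A (rh ` {..<0} \<union> {ot} \<union> {s..<s + 0}) c \<and>
   (\<forall>e. vld A 0 (%i. e (rh i)) --> e ot = [] --> (\<forall>j\<ge>s. e j = []) --> exle c e 1 (e(ot := [])))"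
   by (rule exI[of _ Skip]) (auto simp: fun_upd_idem exle_Skip[simplified])
 qed auto
 then show ?thesis by (rule FPt_FP) (intro pb_intros)
qed

text \<open>For operations on the top of the result, performed in place after the result has been
  computed.\<close>

lemma FP_append_com:
 assumes "FP A f" "\<And>e. h (f e) = f' e" "\<And>w. set w \<subseteq> {..<A} ==> set (h w) \<subseteq> {..<A}"
  "\<And>R ot. ot \<in> R ==> pure_on A R (d ot)" "\<And>e ot. exle (d ot) e 2 (e(ot := h (e ot)))"
 shows "FP A f'"
proof -
 obtain K B k where f: "FPt A f K B (%n. (n + 2) ^ k)" using assms unfolding FP_def FPw_def by auto
 have "FPt A f' K B (%n. (n + 2) ^ k + 2)"
  unfolding FPt_def
 proof (intro conjI allI impI)
  fix e e' :: env assume "vld A K e" "\<forall>i<K. e i = e' i"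
  then have "f e = f e'" by (rule FPt_dep[OF f])
  then show "f' e = f' e'" by (metis assms(2))
 next
  fix e assume "vld A K e"
  then show "set (f' e) \<subseteq> {..<A}" using FPt_val[OF f] assms(2,3) by metis
 next
  fix rh :: "nat => nat" and ot s assume r: "\<forall>j<K. rh j < s \<and> rh j ~= ot" "ot < s"
  from FPt_run[OF f this]
  obtain c where c: "pure_on A (rh ` {..<K} \<union> {ot} \<union> {s..<s + B}) c"
   "\<And>e. vld A K (%i. e (rh i)) ==> e ot = [] ==> (\<forall>j\<ge>s. e j = []) ==>
     exle c e ((sz K (%i. e (rh i)) + 2) ^ k) (e(ot := f (%i. e (rh i))))"
   by blast
  show "\<exists>c. pure_on A (rh ` {..<K} \<union> {ot} \<union> {s..<s + B}) c \<and>
   (\<forall>e. vld A K (%i. e (rh i)) --> e ot = [] --> (\<forall>j\<ge>s. e j = []) -->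
     exle c e ((sz K (%i. e (rh i)) + 2) ^ k + 2) (e(ot := f' (%i. e (rh i)))))"
  proof (rule exI[of _ "c ;; d ot"], intro conjI allI impI)
   show "pure_on A (rh ` {..<K} \<union> {ot} \<union> {s..<s + B}) (c ;; d ot)" using c(1) assms(4) by simp
   fix e assume e: "vld A K (%i. e (rh i))" "e ot = []" "\<forall>j\<ge>s. e j = []"
   show "exle (c ;; d ot) e ((sz K (%i. e (rh i)) + 2) ^ k + 2) (e(ot := f' (%i. e (rh i))))"
   proof (rule exle_Seq)
    show "exle c e ((sz K (%i. e (rh i)) + 2) ^ k) (e(ot := f (%i. e (rh i))))"
     using c(2) e by blast
    show "exle (d ot) (e(ot := f (%i. e (rh i)))) 2 (e(ot := f' (%i. e (rh i))))"
     using assms(5)[of ot "e(ot := f (%i. e (rh i)))"] by (simp add: assms(2))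
   qed
  qed
 qed
 then show ?thesis by (rule FPt_FP) (intro pb_intros)
qed

lemma set_tl_subset: "set (tl w) \<subseteq> set w"
 by (cases w) auto

lemma FP_Cons: "FP A f ==> a < A ==> FP A (%e. a # f e)"
 by (rule FP_append_com[where h = "%w. a # w" and d = "%i. Push i a"]) (auto intro: exle_Push)

lemma FP_tl: "FP A f ==> FP A (%e. tl (f e))"
 by (rule FP_append_com[where h = tl and d = "%i. Pop i"])
  (auto intro: exle_mono[OF exle_Pop] dest: set_mp[OF set_tl_subset])

lemma FP_rename:
 assumes "FP A f" shows "FP A (%e. f (%i. e (ph i)))"
proof -
 obtain K B k where f: "FPt A f K B (%n. (n + 2) ^ k)" using assms unfolding FP_def FPw_def by auto
 define K' where "K' = Suc (\<Sum>i<K. ph i)"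
 have ph: "ph i < K'" if "i < K" for i
  unfolding K'_def using member_le_sum[of i "{..<K}" ph] that by auto
 have size: "sz K (%i. e (ph i)) <= K * sz K' e" for e :: env
  unfolding sz_def[of K] using sum_bounded_above[of "{..<K}" "%i. length (e (ph i))" "sz K' e"] sz_ge ph by auto
 have "FPt A (%e. f (%i. e (ph i))) K' B (%n. (K * n + 2) ^ k)"
  unfolding FPt_def
 proof (intro conjI allI impI)
  fix e e' :: env assume e: "vld A K' e" "\<forall>i<K'. e i = e' i"
  have "vld A K (%i. e (ph i))" using ph e by (auto simp: vld_def)
  moreover have "\<forall>i<K. e (ph i) = e' (ph i)" using ph e by auto
  ultimately show "f (%i. e (ph i)) = f (%i. e' (ph i))" by (rule FPt_dep[OF f])
 next
  fix e assume "vld A K' e"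
  then have "vld A K (%i. e (ph i))" using ph by (auto simp: vld_def)
  then show "set (f (%i. e (ph i))) \<subseteq> {..<A}" by (rule FPt_val[OF f])
 next
  fix rh :: "nat => nat" and ot s assume r: "\<forall>j<K'. rh j < s \<and> rh j ~= ot" "ot < s"
  then have "\<forall>j<K. rh (ph j) < s \<and> rh (ph j) ~= ot" using ph by auto
  from FPt_run[OF f this r(2)]
  obtain c where c: "pure_on A ((%i. rh (ph i)) ` {..<K} \<union> {ot} \<union> {s..<s + B}) c"
   "\<And>e. vld A K (%i. e (rh (ph i))) ==> e ot = [] ==> (\<forall>j\<ge>s. e j = []) ==>
     exle c e ((sz K (%i. e (rh (ph i))) + 2) ^ k) (e(ot := f (%i. e (rh (ph i)))))"
   by blast
  show "\<exists>c. pure_on A (rh ` {..<K'} \<union> {ot} \<union> {s..<s + B}) c \<and>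
   (\<forall>e. vld A K' (%i. e (rh i)) --> e ot = [] --> (\<forall>j\<ge>s. e j = []) -->
     exle c e ((K * sz K' (%i. e (rh i)) + 2) ^ k) (e(ot := f (%i. e (rh (ph i))))))"
  proof (rule exI[of _ c], intro conjI allI impI)
   show "pure_on A (rh ` {..<K'} \<union> {ot} \<union> {s..<s + B}) c"
    by (rule pure_on_mono[OF c(1)]) (use ph in auto)
   fix e assume e: "vld A K' (%i. e (rh i))" "e ot = []" "\<forall>j\<ge>s. e j = []"
   then have "vld A K (%i. e (rh (ph i)))" using ph by (auto simp: vld_def)
   then have "exle c e ((sz K (%i. e (rh (ph i))) + 2) ^ k) (e(ot := f (%i. e (rh (ph i)))))"
    using c e by auto
   then show "exle c e ((K * sz K' (%i. e (rh i)) + 2) ^ k) (e(ot := f (%i. e (rh (ph i)))))"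
    by (rule exle_mono) (use size[of "%i. e (rh i)"] in \<open>auto intro!: power_mono\<close>)
  qed
 qed
 then show ?thesis by (rule FPt_FP) (intro pb_intros)
qed

text \<open>Variables are used in de Bruijn style: the value of \<open>g\<close> becomes variable 0
  and the other variables move up by one. Together with \<open>FP_rename\<close> this yields
  composition.\<close>

lemma FP_let:
 assumes "FP A g" "FP A f" shows "FP A (%e. f (case_nat (g e) e))"
proof -
 obtain K1 B1 k1 where g0: "FPw A g K1 B1 k1" using assms unfolding FP_def by auto
 obtain K2 B2 k2 where f0: "FPw A f K2 B2 k2" using assms unfolding FP_def by auto
 define K B k where "K = max K1 K2" and "B = max B1 B2" and "k = max k1 k2"
 have g: "FPt A g K B (%n. (n + 2) ^ k)" and f: "FPt A f K B (%n. (n + 2) ^ k)"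
  using FPw_mono[OF g0, of K B k] FPw_mono[OF f0, of K B k]
  by (auto simp: K_def B_def k_def FPw_def)
 note dep = FPt_dep[OF f] FPt_dep[OF g]
 note val = FPt_val[OF f] FPt_val[OF g]
 have vld_let: "vld A K (case_nat (g e) e)" if "vld A K e" for e
  unfolding vld_def
 proof (intro allI impI)
  fix i assume "i < K"
  then show "set (case_nat (g e) e i) \<subseteq> {..<A}"
   using that val(2)[OF that] unfolding vld_def by (cases i) auto
 qed
 have "FPt A (%e. f (case_nat (g e) e)) K (Suc B)
  (%n. (n + 2) ^ k + ((n + (n + 2) ^ k + 2) ^ k + (2 * (n + 2) ^ k + 1)))"
  unfolding FPt_def
 proof (intro conjI allI impI)
  fix e e' :: env assume v: "vld A K e" and e: "\<forall>i<K. e i = e' i"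
  show "f (case_nat (g e) e) = f (case_nat (g e') e')"
   by (rule dep(1)) (use e dep(2)[OF v e] vld_let[OF v] in \<open>auto split: nat.splits\<close>)
 next
  fix e assume "vld A K e"
  from vld_let[OF this]
  show "set (f (case_nat (g e) e)) \<subseteq> {..<A}" by (rule val(1))
 next
  fix rh :: "nat => nat" and ot s assume r: "\<forall>j<K. rh j < s \<and> rh j ~= ot" "ot < s"
  \<comment> \<open>The first scratch stack \<open>s\<close> plays variable 0. The programs for
    \<open>g\<close> and \<open>f\<close> run one after the other and share the scratch space from
    \<open>Suc s\<close> on.\<close>
  define rh' where "rh' = case_nat s rh"
  have r1: "\<forall>j<K. rh j < Suc s \<and> rh j ~= s" using r(1) by fastforce
  have r2: "\<forall>j<K. rh' j < Suc s \<and> rh' j ~= ot"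
  proof (intro allI impI)
   fix j assume "j < K" then show "rh' j < Suc s \<and> rh' j ~= ot"
    using r(1)[rule_format, of "j - 1"] r(2) unfolding rh'_def by (cases j) auto
  qed
  obtain c where c: "pure_on A (rh ` {..<K} \<union> {s} \<union> {Suc s..<Suc s + B}) c"
   "\<And>e. vld A K (%i. e (rh i)) ==> e s = [] ==> (\<forall>j\<ge>Suc s. e j = []) ==>
     exle c e ((sz K (%i. e (rh i)) + 2) ^ k) (e(s := g (%i. e (rh i))))"
   using FPt_run[OF g r1 lessI] by blast
  obtain d where d: "pure_on A (rh' ` {..<K} \<union> {ot} \<union> {Suc s..<Suc s + B}) d"
   "\<And>e. vld A K (%i. e (rh' i)) ==> e ot = [] ==> (\<forall>j\<ge>Suc s. e j = []) ==>
     exle d e ((sz K (%i. e (rh' i)) + 2) ^ k) (e(ot := f (%i. e (rh' i))))"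
   using FPt_run[OF f r2 less_SucI[OF r(2)]] by blast
  show "\<exists>c. pure_on A (rh ` {..<K} \<union> {ot} \<union> {s..<s + Suc B}) c \<and>
   (\<forall>e. vld A K (%i. e (rh i)) --> e ot = [] --> (\<forall>j\<ge>s. e j = []) -->
     exle c e ((sz K (%i. e (rh i)) + 2) ^ k + ((sz K (%i. e (rh i)) + (sz K (%i. e (rh i)) + 2) ^ k + 2) ^ k
       + (2 * (sz K (%i. e (rh i)) + 2) ^ k + 1)))
      (e(ot := f (case_nat (g (%i. e (rh i))) (%i. e (rh i))))))"
  proof (rule exI[of _ "c ;; d ;; clr s"], intro conjI allI impI)
   have "pure_on A (rh ` {..<K} \<union> {ot} \<union> {s..<s + Suc B}) c"
    by (rule pure_on_mono[OF c(1)]) auto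
   moreover have "pure_on A (rh ` {..<K} \<union> {ot} \<union> {s..<s + Suc B}) d"
    by (rule pure_on_mono[OF d(1)]) (auto simp: rh'_def split: nat.splits)
   ultimately show "pure_on A (rh ` {..<K} \<union> {ot} \<union> {s..<s + Suc B}) (c ;; d ;; clr s)"
    by (auto intro: pure_clr)
   fix e assume e: "vld A K (%i. e (rh i))" "e ot = []" "\<forall>j\<ge>s. e j = []"
   let ?S = "sz K (%i. e (rh i))" and ?w = "g (%i. e (rh i))"
   define e1 where "e1 = e(s := ?w)"
   have 1: "exle c e ((?S + 2) ^ k) e1" unfolding e1_def using c(2)[of e] e by auto
   have w: "length ?w <= (?S + 2) ^ k" using exle_len[OF 1, of s] e by (auto simp: e1_def)
   have e1rh: "\<forall>i<K. e1 (rh' i) = (case i of 0 => ?w | Suc j => e (rh j))"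
   proof (intro allI impI)
    fix i assume "i < K" then show "e1 (rh' i) = (case i of 0 => ?w | Suc j => e (rh j))"
     using r1[rule_format, of "i - 1"] by (cases i) (auto simp: e1_def rh'_def)
   qed
   have "sz K (%i. e1 (rh' i)) = sz K (case_nat ?w (%j. e (rh j)))"
    using e1rh by (intro sz_cong) auto
   also have "\<dots> <= sz (Suc K) (case_nat ?w (%j. e (rh j)))" by (rule sz_mono) simp
   also have "\<dots> = length ?w + ?S" unfolding sz_def by (subst sum.lessThan_Suc_shift) simp
   finally have size: "sz K (%i. e1 (rh' i)) <= ?S + (?S + 2) ^ k" using w by simp
   have ve1: "vld A K (%i. e1 (rh' i))"
    using vld_let[OF e(1)] e1rh by (auto simp: vld_def)
   then have "exle d e1 ((sz K (%i. e1 (rh' i)) + 2) ^ k) (e1(ot := f (%i. e1 (rh' i))))"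
    using d(2)[of e1] e r(2) by (auto simp: e1_def)
   moreover have "f (%i. e1 (rh' i)) = f (case_nat ?w (%j. e (rh j)))"
    by (rule dep(1)[OF ve1]) (use e1rh in auto)
   ultimately have 2: "exle d e1 ((?S + (?S + 2) ^ k + 2) ^ k) (e1(ot := f (case_nat ?w (%j. e (rh j)))))"
    using size by (auto elim!: exle_mono intro!: power_mono)
   have 3: "exle (clr s) (e1(ot := f (case_nat ?w (%j. e (rh j))))) (2 * (?S + 2) ^ k + 1)
     (e(ot := f (case_nat ?w (%j. e (rh j)))))"
    by (rule exle_mono[OF exle_clr]) (use r(2) w e in \<open>auto simp: e1_def fun_eq_iff\<close>)
   show "exle (c ;; d ;; clr s) e ((?S + 2) ^ k + ((?S + (?S + 2) ^ k + 2) ^ k + (2 * (?S + 2) ^ k + 1)))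
      (e(ot := f (case_nat (g (%i. e (rh i))) (%i. e (rh i)))))"
    by (rule exle_Seq[OF 1 exle_Seq[OF 2 3]])
  qed
 qed
 then show ?thesis by (rule FPt_FP) (intro pb_intros)
qed

lemma FP_if0:
 assumes "FP A f" "FP A g"
 shows "FP A (%e. if hdis a (e 0) then f e else g e)"
proof -
 obtain K1 B1 k1 where f0: "FPw A f K1 B1 k1" using assms unfolding FP_def by auto
 obtain K2 B2 k2 where g0: "FPw A g K2 B2 k2" using assms unfolding FP_def by auto
 define K B k where "K = Suc (max K1 K2)" and "B = max B1 B2" and "k = max k1 k2"
 have g: "FPt A g K B (%n. (n + 2) ^ k)" and f: "FPt A f K B (%n. (n + 2) ^ k)"
  using FPw_mono[OF g0, of K B k] FPw_mono[OF f0, of K B k]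
  by (auto simp: K_def B_def k_def FPw_def)
 have "FPt A (%e. if hdis a (e 0) then f e else g e) K B (%n. Suc ((n + 2) ^ k))"
  unfolding FPt_def
 proof (intro conjI allI impI)
  fix e e' :: env assume e: "vld A K e" "\<forall>i<K. e i = e' i"
  then have "e 0 = e' 0" by (auto simp: K_def)
  moreover have "f e = f e'" "g e = g e'" using e FPt_dep[OF f] FPt_dep[OF g] by auto
  ultimately show "(if hdis a (e 0) then f e else g e) = (if hdis a (e' 0) then f e' else g e')" by simp
 next
  fix e assume "vld A K e"
  then show "set (if hdis a (e 0) then f e else g e) \<subseteq> {..<A}"
   using FPt_val[OF f] FPt_val[OF g] by auto
 next
  fix rh :: "nat => nat" and ot s assume r: "\<forall>j<K. rh j < s \<and> rh j ~= ot" "ot < s"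
  obtain c where c: "pure_on A (rh ` {..<K} \<union> {ot} \<union> {s..<s + B}) c"
   "\<And>e. vld A K (%i. e (rh i)) ==> e ot = [] ==> (\<forall>j\<ge>s. e j = []) ==>
     exle c e ((sz K (%i. e (rh i)) + 2) ^ k) (e(ot := f (%i. e (rh i))))"
   using FPt_run[OF f r] by blast
  obtain d where d: "pure_on A (rh ` {..<K} \<union> {ot} \<union> {s..<s + B}) d"
   "\<And>e. vld A K (%i. e (rh i)) ==> e ot = [] ==> (\<forall>j\<ge>s. e j = []) ==>
     exle d e ((sz K (%i. e (rh i)) + 2) ^ k) (e(ot := g (%i. e (rh i))))"
   using FPt_run[OF g r] by blast
  show "\<exists>c. pure_on A (rh ` {..<K} \<union> {ot} \<union> {s..<s + B}) c \<and>
   (\<forall>e. vld A K (%i. e (rh i)) --> e ot = [] --> (\<forall>j\<ge>s. e j = []) -->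
     exle c e (Suc ((sz K (%i. e (rh i)) + 2) ^ k))
     (e(ot := if hdis a (e (rh 0)) then f (%i. e (rh i)) else g (%i. e (rh i)))))"
  proof (rule exI[of _ "IfTop (rh 0) a c d"], intro conjI allI impI)
   show "pure_on A (rh ` {..<K} \<union> {ot} \<union> {s..<s + B}) (IfTop (rh 0) a c d)"
    using c(1) d(1) by (auto simp: K_def)
  qed (use c(2) d(2) in \<open>auto intro!: exle_If\<close>)
 qed
 then show ?thesis by (rule FPt_FP) (simp only: Suc_eq_plus1, intro pb_intros)
qed

lemma FP_if:
 assumes "FP A t" "FP A f" "FP A g"
 shows "FP A (%e. if hdis a (t e) then f e else g e)"
 using FP_let[OF assms(1) FP_if0[OF FP_rename[OF assms(2), of Suc] FP_rename[OF assms(3), of Suc], of a]]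
 by (simp cong del: if_weak_cong)

definition mrg :: "nat => env => env => env" where
 "mrg n a e = (%i. if i < n then a i else e (i - n))"

text \<open>All accumulators are updated at once, so that a fold can carry a state besides its
  result; \<open>scan\<close> uses two accumulators.\<close>

definition facc :: "nat => (nat => nat => env => nat list) => env => nat list => env => env" where
 "facc n h e w a = fold (%x a i. h x i (mrg n a e)) w a"

lemma facc_take_Suc: "m < length w ==>
  facc n h e (take (Suc m) w) a = (%i. h (w ! m) i (mrg n (facc n h e (take m w) a) e))"
 by (simp add: facc_def take_Suc_conv_app_nth)

lemma vld_mrg: "(\<And>i. i < n ==> set (a i) \<subseteq> {..<A}) ==> vld A K e ==> vld A K (mrg n a e)"
 unfolding vld_def mrg_def by auto

lemma sz_mrg: "sz K (mrg n a e) <= (\<Sum>i<n. length (a i)) + sz K e"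
proof -
 have "sz (n + K) (mrg n a e) = (\<Sum>i<n. length (a i)) + sz K e"
  by (induction K) (auto simp: sz_def mrg_def)
 then show ?thesis using sz_mono[of K "n + K" "mrg n a e"] by simp
qed

text \<open>This is bounded recursion on notation in the sense of Cobham. A bound on the final value
  would not be enough: updates may double lengths, and the running time depends on the accumulators
  after every prefix.\<close>

lemma FP_fold:
 assumes g: "FP A g" and b: "\<And>i. i < n ==> FP A (b i)"
  and h: "\<And>x i. x < A ==> i < n ==> FP A (h x i)"
  and bound: "\<And>e m i. vld A K0 e ==> m <= length (g e) ==> i < n ==>
   length (facc n h e (take m (g e)) (%i. b i e) i) <= (sz K0 e + 2) ^ k0"
  and j: "j < n"
 shows "FP A (%e. facc n h e (g e) (%i. b i e) j)"
proof -
 obtain K1 B1 k1 where g0: "FPw A g K1 B1 k1" using g unfolding FP_def by blast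
 have "\<exists>K B k. \<forall>i\<in>{..<n}. FPw A (b i) K B k"
  by (rule FPw_family) (use b in auto)
 then obtain K2 B2 k2 where b0: "\<And>i. i < n ==> FPw A (b i) K2 B2 k2" by auto
 have "\<exists>K B k. \<forall>p\<in>{..<A}\<times>{..<n}. FPw A (h (fst p) (snd p)) K B k"
  by (rule FPw_family) (use h in auto)
 then obtain K3 B3 k3 where h0: "\<And>x i. x < A ==> i < n ==> FPw A (h x i) K3 B3 k3" by fastforce
 define K B k where "K = K0 + K1 + K2 + K3" and "B = B1 + B2 + B3" and "k = k1 + k2 + k3"
 have g: "FPt A g K B (%n. (n + 2) ^ k)"
  using FPw_mono[OF g0, of K B k] by (auto simp: K_def B_def k_def FPw_def)
 have b: "FPt A (b i) K B (%n. (n + 2) ^ k)" if "i < n" for i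
  using FPw_mono[OF b0[OF that], of K B k] by (auto simp: K_def B_def k_def FPw_def)
 have h: "FPt A (h x i) K B (%n. (n + 2) ^ k)" if "x < A" "i < n" for x i
  using FPw_mono[OF h0[OF that], of K B k] by (auto simp: K_def B_def k_def FPw_def)
 define F where "F e m = facc n h e (take m (g e)) (%i. b i e)" for e m
 have F_val: "set (F e m i) \<subseteq> {..<A}" if "vld A K e" "i < n" "m <= length (g e)" for e m i
  using that(2,3)
 proof (induction m arbitrary: i)
  case 0 then show ?case using FPt_val[OF b that(1)] by (simp add: F_def facc_def)
 next
  case (Suc m)
  have "g e ! m \<in> set (g e)" using Suc.prems by auto
  then have x: "g e ! m < A" using FPt_val[OF g that(1)] by auto
  have "vld A K (mrg n (F e m) e)" by (rule vld_mrg) (use that(1) Suc in auto)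
  then have "set (h (g e ! m) i (mrg n (F e m) e)) \<subseteq> {..<A}"
   by (rule FPt_val[OF h[OF x Suc.prems(1)]])
  then show ?case using Suc.prems by (simp add: F_def facc_take_Suc)
 qed
 have F_dep: "F e m i = F e' m i" if "\<forall>i<K. e i = e' i" "i < n" "m <= length (g e)" "vld A K e" for e e' m i
  using that(2,3)
 proof (induction m arbitrary: i)
  case 0 then show ?case using FPt_dep[OF b that(4,1)] by (simp add: F_def facc_def)
 next
  case (Suc m)
  have ge: "g e' = g e" using FPt_dep[OF g that(4,1)] by simp
  have "g e ! m \<in> set (g e)" using Suc.prems by auto
  then have x: "g e ! m < A" using FPt_val[OF g that(4)] by auto
  have "vld A K (mrg n (F e m) e)" by (rule vld_mrg) (use that F_val Suc.prems in auto)
  then have "h (g e ! m) i (mrg n (F e m) e) = h (g e ! m) i (mrg n (F e' m) e')"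
   by (rule FPt_dep[OF h[OF x Suc.prems(1)]]) (use that(1) Suc in \<open>auto simp: mrg_def\<close>)
  then show ?case using Suc.prems ge by (simp add: F_def facc_take_Suc)
 qed
 have F_len: "length (F e m i) <= (sz K e + 2) ^ k0" if "vld A K e" "i < n" "m <= length (g e)" for e m i
 proof -
  have "length (F e m i) <= (sz K0 e + 2) ^ k0"
   unfolding F_def by (rule bound) (use that vld_mono[OF that(1), of K0] in \<open>auto simp: K_def\<close>)
  also have "\<dots> <= (sz K e + 2) ^ k0"
   by (rule power_mono) (use sz_mono[of K0 K e] in \<open>auto simp: K_def\<close>)
  finally show ?thesis .
 qed
 \<comment> \<open>For arguments of total size \<open>S\<close>, \<open>T1\<close> bounds one
   update, \<open>T2\<close> the transfer of one new value and \<open>T3\<close> one round of the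
   loop.\<close>
 define T1 where "T1 S = (n * (S + 2) ^ k0 + S + 2) ^ k" for S :: nat
 define T2 where "T2 S = 2 * (S + 2) ^ k0 + 1 + (((S + 2) ^ k0 * (A + 4) + 1) + ((S + 2) ^ k0 * (A + 4) + 1))"
  for S :: nat
 define T3 where "T3 S = 1 + ((n * T1 S + 1) + (n * T2 S + 1))" for S :: nat
 define ta where "ta S = (S + 2) ^ k + ((n * (S + 2) ^ k + 1) + (((S + 2) ^ k * Suc (T3 S + A) + 1) +
   (((S + 2) ^ k0 * (A + 4) + 1) + (((S + 2) ^ k0 * (A + 4) + 1) + (n * (2 * (S + 2) ^ k0 + 1) + 1)))))"
  for S :: nat
 have "FPt A (%e. facc n h e (g e) (%i. b i e) j) K (2 + 2 * n + B) ta"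
  unfolding FPt_def
 proof (intro conjI allI impI)
  fix e e' :: env assume v: "vld A K e" and e: "\<forall>i<K. e i = e' i"
  show "facc n h e (g e) (%i. b i e) j = facc n h e' (g e') (%i. b i e') j"
   using F_dep[OF e j le_refl v] FPt_dep[OF g v e] by (simp add: F_def)
 next
  fix e assume "vld A K e"
  then show "set (facc n h e (g e) (%i. b i e) j) \<subseteq> {..<A}"
   using F_val[of e j "length (g e)"] j by (simp add: F_def)
 next
  fix rh :: "nat => nat" and ot s assume r: "\<forall>j<K. rh j < s \<and> rh j ~= ot" "ot < s"
  show "\<exists>c. pure_on A (rh ` {..<K} \<union> {ot} \<union> {s..<s + (2 + 2 * n + B)}) c \<and>
   (\<forall>e. vld A K (%i. e (rh i)) --> e ot = [] --> (\<forall>j\<ge>s. e j = []) -->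
     exle c e (ta (sz K (%i. e (rh i))))
     (e(ot := facc n h (%i. e (rh i)) (g (%i. e (rh i))) (%i. b i (%i. e (rh i))) j)))"
  proof -
   \<comment> \<open>All updates read the old accumulators, so the new values are first collected in
     the stacks \<open>nw i\<close>. They are moved to \<open>ac i\<close> through
     \<open>tmp\<close>, because each \<open>mv\<close> reverses its word.\<close>
   define ac nw tmp s' where "ac i = s + 1 + i" and "nw i = s + 1 + n + i" and "tmp = s + 1 + 2 * n"
    and "s' = s + 2 + 2 * n" for i
   define R where "R = rh ` {..<K} \<union> {ot} \<union> {s..<s + (2 + 2 * n + B)}"
   define rh' where "rh' i = (if i < n then ac i else rh (i - n))" for i
   have inR: "s \<in> R" "tmp \<in> R" "ot \<in> R" "i < n ==> ac i \<in> R" "i < n ==> nw i \<in> R" for i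
    by (auto simp: R_def ac_def nw_def tmp_def)
   have r': "\<forall>j<K. rh j < s' \<and> rh j ~= x" if "s <= x" for x
    using r(1) that unfolding s'_def by fastforce
   from FPt_run[OF g r'[OF order_refl]]
   obtain cg where cg: "pure_on A (rh ` {..<K} \<union> {s} \<union> {s'..<s' + B}) cg"
    "\<And>e. vld A K (%i. e (rh i)) ==> e s = [] ==> (\<forall>j\<ge>s'. e j = []) ==>
     exle cg e ((sz K (%i. e (rh i)) + 2) ^ k) (e(s := g (%i. e (rh i))))"
    by (auto simp: s'_def)
   have "\<forall>i. \<exists>c. i < n --> pure_on A (rh ` {..<K} \<union> {ac i} \<union> {s'..<s' + B}) c \<and>
    (\<forall>e. vld A K (%i. e (rh i)) --> e (ac i) = [] --> (\<forall>j\<ge>s'. e j = []) -->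
     exle c e ((sz K (%i. e (rh i)) + 2) ^ k) (e(ac i := b i (%i. e (rh i)))))"
   proof (intro allI)
    fix i
    show "\<exists>c. i < n --> pure_on A (rh ` {..<K} \<union> {ac i} \<union> {s'..<s' + B}) c \<and>
    (\<forall>e. vld A K (%i. e (rh i)) --> e (ac i) = [] --> (\<forall>j\<ge>s'. e j = []) -->
     exle c e ((sz K (%i. e (rh i)) + 2) ^ k) (e(ac i := b i (%i. e (rh i)))))"
    proof (cases "i < n")
     case True
     have 1: "s <= ac i" "ac i < s'" using True by (auto simp: ac_def s'_def)
     show ?thesis by (rule FPt_run[OF b[OF True] r'[OF 1(1)] 1(2)]) blast
    qed auto
   qed
   then obtain cb where cb: "\<And>i. i < n ==> pure_on A (rh ` {..<K} \<union> {ac i} \<union> {s'..<s' + B}) (cb i)"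
    "\<And>i e. i < n ==> vld A K (%i. e (rh i)) ==> e (ac i) = [] ==> (\<forall>j\<ge>s'. e j = []) ==>
     exle (cb i) e ((sz K (%i. e (rh i)) + 2) ^ k) (e(ac i := b i (%i. e (rh i))))"
    by metis
   have r'': "\<forall>j<K. rh' j < s' \<and> rh' j ~= nw i" if "i < n" for i
   proof (intro allI impI)
    fix j assume "j < K"
    then have "j - n < K" by simp
    then show "rh' j < s' \<and> rh' j ~= nw i"
     using r(1)[rule_format, of "j - n"] that unfolding rh'_def ac_def nw_def s'_def by auto
   qed
   have "\<forall>x i. \<exists>c. x < A \<and> i < n --> pure_on A (rh' ` {..<K} \<union> {nw i} \<union> {s'..<s' + B}) c \<and>
    (\<forall>e. vld A K (%i. e (rh' i)) --> e (nw i) = [] --> (\<forall>j\<ge>s'. e j = []) -->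
     exle c e ((sz K (%i. e (rh' i)) + 2) ^ k) (e(nw i := h x i (%i. e (rh' i)))))"
   proof (intro allI)
    fix x i
    show "\<exists>c. x < A \<and> i < n --> pure_on A (rh' ` {..<K} \<union> {nw i} \<union> {s'..<s' + B}) c \<and>
    (\<forall>e. vld A K (%i. e (rh' i)) --> e (nw i) = [] --> (\<forall>j\<ge>s'. e j = []) -->
     exle c e ((sz K (%i. e (rh' i)) + 2) ^ k) (e(nw i := h x i (%i. e (rh' i)))))"
    proof (cases "x < A \<and> i < n")
     case True
     then have 1: "nw i < s'" by (auto simp: nw_def s'_def)
     from True have 2: "x < A" "i < n" by auto
     show ?thesis by (rule FPt_run[OF h[OF 2] r''[OF 2(2)] 1]) blast
    qed auto
   qed
   then obtain ch where ch: "\<And>x i. x < A ==> i < n ==> pure_on A (rh' ` {..<K} \<union> {nw i} \<union> {s'..<s' + B}) (ch x i)"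
    "\<And>x i e. x < A ==> i < n ==> vld A K (%i. e (rh' i)) ==> e (nw i) = [] ==> (\<forall>j\<ge>s'. e j = []) ==>
     exle (ch x i) e ((sz K (%i. e (rh' i)) + 2) ^ k) (e(nw i := h x i (%i. e (rh' i))))"
    by metis
   define cc where "cc i = clr (ac i) ;; mv A (nw i) tmp ;; mv A tmp (ac i)" for i
   define body where "body x = Pop s ;; seqn n (ch x) ;; seqn n cc" for x
   define main where "main = cg ;; seqn n cb ;; While s (scase s body A) ;; mv A (ac j) tmp ;;
    mv A tmp ot ;; seqn n (%i. clr (ac i))"
   have sub: "rh ` {..<K} \<union> {ac i} \<union> {s'..<s' + B} \<subseteq> R" "rh' ` {..<K} \<union> {nw i} \<union> {s'..<s' + B} \<subseteq> R"
    "rh ` {..<K} \<union> {s} \<union> {s'..<s' + B} \<subseteq> R" if "i < n" for i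
    using that by (auto simp: R_def s'_def ac_def nw_def rh'_def)
   have pure: "pure_on A R main"
    unfolding main_def body_def cc_def
    using pure_on_mono[OF cg(1) sub(3)[OF j]] pure_on_mono[OF cb(1) sub(1)] pure_on_mono[OF ch(1) sub(2)] j inR
    by (auto intro!: pure_seqn pure_scase pure_mv pure_clr)
   have run: "exle main e (ta (sz K (%i. e (rh i))))
     (e(ot := facc n h (%i. e (rh i)) (g (%i. e (rh i))) (%i. b i (%i. e (rh i))) j))"
    if v: "vld A K (%i. e (rh i))" and eot: "e ot = []" and emp: "\<forall>j\<ge>s. e j = []" for e
   proof -
    define e0 where "e0 = (%i. e (rh i))"
    define S where "S = sz K e0"
    define w where "w = g e0"
    have ve0: "vld A K e0" using v by (simp add: e0_def)
    \<comment> \<open>The environment between the phases of the run: \<open>l\<close> is the unread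
      part of the word, \<open>a\<close> and \<open>c\<close> are the old and the new accumulators,
      and all else is as in \<open>e\<close>.\<close>
    define st where "st l a c = (%r. if r = s then l else if s + 1 <= r \<and> r < s + 1 + n then a (r - s - 1)
     else if s + 1 + n <= r \<and> r < s + 1 + 2 * n then c (r - s - 1 - n) else e r)"
     for l and a c :: env
    have st_simps: "st l a c s = l" "i < n ==> st l a c (ac i) = a i" "i < n ==> st l a c (nw i) = c i"
     "st l a c tmp = []" "st l a c ot = []" "s' <= r ==> st l a c r = []"
     "i < K ==> st l a c (rh i) = e0 i" for l a c i r'
     and r :: nat
     using emp r eot unfolding st_def ac_def nw_def tmp_def s'_def e0_def by auto
    have st_eqI: "st l a c = e'" if "e' s = l" "\<And>i. i < n ==> e' (ac i) = a i" "\<And>i. i < n ==> e' (nw i) = c i"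
     "\<And>r. r < s \<or> tmp <= r ==> e' r = e r" for l a c e'
    proof
     fix r
     consider "r = s" | i where "i < n" "r = ac i" | i where "i < n" "r = nw i" | "r < s \<or> tmp <= r"
     proof (cases "s < r \<and> r < tmp")
      case True
      show ?thesis
      proof (cases "r < s + 1 + n")
       case T: True
       then show ?thesis using True that(2)[of "r - s - 1"] unfolding ac_def by auto
      next
       case F: False
       then show ?thesis using True that(3)[of "r - s - 1 - n"] unfolding nw_def tmp_def by auto
      qed
     qed (use that in linarith)
     then show "st l a c r = e' r"
      by cases (use that in \<open>auto simp: st_def ac_def nw_def tmp_def\<close>)
    qed
    define nil :: env where "nil = (%i. [])"
    have e_st: "st [] nil nil = e"
     by (rule st_eqI) (use emp in \<open>auto simp: nil_def ac_def nw_def\<close>)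
    have len: "length (F e0 m i) <= (S + 2) ^ k0" if "i < n" "m <= length w" for m i
     using F_len[OF ve0] that by (simp add: w_def S_def)
    have val: "set (F e0 m i) \<subseteq> {..<A}" if "i < n" "m <= length w" for m i
     using F_val[OF ve0] that by (simp add: w_def)
    have 1: "exle cg e ((S + 2) ^ k) (st w nil nil)"
    proof -
     have "st w nil nil = e(s := g e0)"
      by (rule st_eqI) (use emp in \<open>auto simp: nil_def ac_def nw_def w_def tmp_def\<close>)
     then show ?thesis using cg(2)[OF v] emp by (auto simp: S_def e0_def s'_def)
    qed
    have w_len: "length w <= (S + 2) ^ k"
     using exle_len[OF 1, of s] emp by (simp add: st_simps)
    have wA: "set w \<subseteq> {..<A}" using FPt_val[OF g ve0] by (simp add: w_def)
    have 2: "exle (seqn n cb) (st w nil nil) (n * (S + 2) ^ k + 1) (st w (F e0 0) nil)"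
    proof -
     define E where "E m = st w (%i. if i < m then F e0 0 i else []) nil" for m
     have "exle (cb i) (E i) ((S + 2) ^ k) (E (Suc i))" if i: "i < n" for i
     proof -
      have a: "vld A K (%j. E i (rh j))" using ve0 by (auto simp: E_def st_simps vld_def)
      have sz: "sz K (%j. E i (rh j)) = S" unfolding S_def by (rule sz_cong) (simp add: E_def st_simps)
      have be: "b i (%j. E i (rh j)) = b i e0"
       by (rule FPt_dep[OF b[OF i] a]) (simp add: E_def st_simps)
      have b0: "b i e0 = F e0 0 i" by (simp add: F_def facc_def)
      have eq: "E (Suc i) = (E i)(ac i := b i e0)"
       unfolding E_def b0 by (rule st_eqI) (use i in \<open>auto simp: st_simps ac_def nw_def tmp_def less_Suc_eq\<close>, auto simp: st_def tmp_def)
      show ?thesis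
       using cb(2)[OF i a] by (simp add: sz be eq) (simp add: E_def st_simps i)
     qed
     then have "exle (seqn n cb) (E 0) (n * (S + 2) ^ k + 1) (E n)" by (rule exle_seqn)
     moreover have "E 0 = st w nil nil" by (simp add: E_def nil_def)
     moreover have "E n = st w (F e0 0) nil"
      unfolding E_def by (rule st_eqI) (auto simp: st_simps, auto simp: st_def tmp_def)
     ultimately show ?thesis by simp
    qed
    define E where "E m = st (drop m w) (F e0 m) nil" for m
    have body: "exle (body (w ! m)) (E m) (T3 S) (E (Suc m))" if m: "m < length w" for m
    proof -
     have x: "w ! m < A" using wA m nth_mem by blast
     let ?l = "drop (Suc m) w"
     have b1: "exle (Pop s) (E m) 1 (st ?l (F e0 m) nil)"
      by (rule exle_Pop, unfold E_def, rule st_eqI)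
       (auto simp: st_simps nil_def tl_drop drop_Suc, auto simp: st_def tmp_def ac_def nw_def)
     have b2: "exle (seqn n (ch (w ! m))) (st ?l (F e0 m) nil) (n * T1 S + 1) (st ?l (F e0 m) (F e0 (Suc m)))"
     proof -
      define E' where "E' q = st ?l (F e0 m) (%i. if i < q then F e0 (Suc m) i else [])" for q
      have "exle (ch (w ! m) i) (E' i) (T1 S) (E' (Suc i))" if i: "i < n" for i
      proof -
       have cg': "E' i (rh' q) = mrg n (F e0 m) e0 q" if "q < K" for q
        using that by (auto simp: E'_def rh'_def mrg_def st_simps)
       have vm: "vld A K (mrg n (F e0 m) e0)" by (rule vld_mrg) (use val m ve0 in auto)
       then have a: "vld A K (%q. E' i (rh' q))" using cg' by (auto simp: vld_def)
       have "sz K (%q. E' i (rh' q)) = sz K (mrg n (F e0 m) e0)" by (rule sz_cong) (rule cg')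
       also have "\<dots> <= (\<Sum>i<n. length (F e0 m i)) + sz K e0" by (rule sz_mrg)
       also have "\<dots> <= n * (S + 2) ^ k0 + S"
        using sum_bounded_above[of "{..<n}" "%i. length (F e0 m i)" "(S + 2) ^ k0"] len m
        by (auto simp: S_def)
       finally have sz: "(sz K (%q. E' i (rh' q)) + 2) ^ k <= T1 S"
        unfolding T1_def by (intro power_mono) auto
       have he: "h (w ! m) i (%q. E' i (rh' q)) = h (w ! m) i (mrg n (F e0 m) e0)"
        by (rule FPt_dep[OF h[OF x i] a]) (use cg' in auto)
       also have "\<dots> = F e0 (Suc m) i"
        using m by (simp add: F_def facc_take_Suc w_def)
       finally have he: "h (w ! m) i (%q. E' i (rh' q)) = F e0 (Suc m) i" .
       have eq: "E' (Suc i) = (E' i)(nw i := F e0 (Suc m) i)"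
        unfolding E'_def by (rule st_eqI) (use i in \<open>auto simp: st_simps ac_def nw_def tmp_def less_Suc_eq\<close>, auto simp: st_def tmp_def ac_def nw_def)
       have "exle (ch (w ! m) i) (E' i) ((sz K (%q. E' i (rh' q)) + 2) ^ k) (E' (Suc i))"
        using ch(2)[OF x i a] by (simp add: he eq) (simp add: E'_def st_simps i)
       then show ?thesis using sz by (rule exle_mono)
      qed
      then have "exle (seqn n (ch (w ! m))) (E' 0) (n * T1 S + 1) (E' n)" by (rule exle_seqn)
      moreover have "E' 0 = st ?l (F e0 m) nil" by (simp add: E'_def nil_def)
      moreover have "E' n = st ?l (F e0 m) (F e0 (Suc m))"
       unfolding E'_def by (rule st_eqI) (auto simp: st_simps, auto simp: st_def tmp_def)
      ultimately show ?thesis by simp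
     qed
     have b3: "exle (seqn n cc) (st ?l (F e0 m) (F e0 (Suc m))) (n * T2 S + 1) (st ?l (F e0 (Suc m)) nil)"
     proof -
      define E' where "E' q = st ?l (%i. if i < q then F e0 (Suc m) i else F e0 m i)
       (%i. if i < q then [] else F e0 (Suc m) i)" for q
      have "exle (cc i) (E' i) (T2 S) (E' (Suc i))" if i: "i < n" for i
      proof -
       have ne: "ac i ~= nw i" "ac i ~= tmp" "nw i ~= tmp" using i by (auto simp: ac_def nw_def tmp_def)
       let ?E1 = "(E' i)(ac i := [])" and ?v = "F e0 (Suc m) i"
       let ?E2 = "?E1(nw i := [], tmp := rev ?v)"
       have vals: "E' i (ac i) = F e0 m i" "E' i (nw i) = ?v" "E' i tmp = []"
        using i by (auto simp: E'_def st_simps)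
       have c1: "exle (clr (ac i)) (E' i) (2 * (S + 2) ^ k0 + 1) ?E1"
        by (rule exle_mono[OF exle_clr[OF refl]]) (use vals len[of i m] i m in auto)
       have c2: "exle (mv A (nw i) tmp) ?E1 ((S + 2) ^ k0 * (A + 4) + 1) ?E2"
        by (rule exle_mono[OF exle_mv]) (use vals ne len[of i "Suc m"] val[of i "Suc m"] i m in auto)
       have eq: "E' (Suc i) = ?E2(tmp := [], ac i := rev (rev ?v) @ [])"
        unfolding E'_def
        by (rule st_eqI) (use i ne in \<open>auto simp: st_simps ac_def nw_def tmp_def less_Suc_eq\<close>, auto simp: st_def tmp_def ac_def nw_def emp)
       have c3: "exle (mv A tmp (ac i)) ?E2 ((S + 2) ^ k0 * (A + 4) + 1) (E' (Suc i))"
        unfolding eq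
        by (rule exle_mono[OF exle_mv]) (use vals ne len[of i "Suc m"] val[of i "Suc m"] i m in auto)
       show ?thesis unfolding cc_def T2_def by (rule exle_Seq[OF c1 exle_Seq[OF c2 c3]])
      qed
      then have "exle (seqn n cc) (E' 0) (n * T2 S + 1) (E' n)" by (rule exle_seqn)
      moreover have "E' 0 = st ?l (F e0 m) (F e0 (Suc m))" by (simp add: E'_def)
      moreover have "E' n = st ?l (F e0 (Suc m)) nil"
       unfolding E'_def by (rule st_eqI) (auto simp: st_simps nil_def, auto simp: st_def tmp_def)
      ultimately show ?thesis by simp
     qed
     show ?thesis unfolding body_def T3_def E_def
      by (rule exle_Seq[OF b1[unfolded E_def] exle_Seq[OF b2 b3]])
    qed
    have 3: "exle (While s (scase s body A)) (st w (F e0 0) nil) ((S + 2) ^ k * Suc (T3 S + A) + 1)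
      (st [] (F e0 (length w)) nil)"
    proof -
     have "exle (While s (scase s body A)) (E 0) (length w * Suc (T3 S + A) + 1) (E (length w))"
      by (rule exle_symloop) (use body wA in \<open>auto simp: E_def st_simps\<close>)
     then have "exle (While s (scase s body A)) (E 0) ((S + 2) ^ k * Suc (T3 S + A) + 1) (E (length w))"
      by (rule exle_mono) (rule add_mono[OF mult_le_mono1[OF w_len] order_refl])
     then show ?thesis by (simp add: E_def)
    qed
    let ?v = "F e0 (length w) j"
    let ?a1 = "(F e0 (length w))(j := [])"
    have 4: "exle (mv A (ac j) tmp) (st [] (F e0 (length w)) nil) ((S + 2) ^ k0 * (A + 4) + 1)
     ((st [] ?a1 nil)(tmp := rev ?v))"
    proof (rule exle_mono[OF exle_mv])
     show "(st [] ?a1 nil)(tmp := rev ?v) = (st [] (F e0 (length w)) nil)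
      (ac j := [], tmp := rev (st [] (F e0 (length w)) nil (ac j)) @ st [] (F e0 (length w)) nil tmp)"
      using j by (auto simp: fun_eq_iff st_simps, auto simp: st_def ac_def tmp_def)
    qed (use j len[of j "length w"] val[of j "length w"] in \<open>auto simp: st_simps ac_def tmp_def\<close>,
       auto simp: st_simps(2)[unfolded ac_def, simplified])
    have ottmp: "ot ~= tmp" "ot ~= s" "\<And>i. ot ~= ac i" using r(2) by (auto simp: tmp_def ac_def)
    have 5: "exle (mv A tmp ot) ((st [] ?a1 nil)(tmp := rev ?v)) ((S + 2) ^ k0 * (A + 4) + 1)
     ((st [] ?a1 nil)(ot := ?v))"
     by (rule exle_mono[OF exle_mv])
      (use ottmp j len[of j "length w"] val[of j "length w"] in \<open>auto simp: fun_eq_iff st_simps\<close>)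
    have 6: "exle (seqn n (%i. clr (ac i))) ((st [] ?a1 nil)(ot := ?v)) (n * (2 * (S + 2) ^ k0 + 1) + 1)
     (e(ot := ?v))"
    proof -
     define E' where "E' q = (st [] (%i. if i < q then [] else ?a1 i) nil)(ot := ?v)" for q
     have "exle (clr (ac i)) (E' i) (2 * (S + 2) ^ k0 + 1) (E' (Suc i))" if i: "i < n" for i
     proof (rule exle_mono[OF exle_clr])
      have "st [] (%ia. if ia < Suc i then [] else ?a1 ia) nil =
       (st [] (%ia. if ia < i then [] else ?a1 ia) nil)(ac i := [])"
       by (rule st_eqI) (use i in \<open>auto simp: st_simps ac_def nw_def tmp_def less_Suc_eq\<close>, auto simp: st_def tmp_def ac_def nw_def)
      then show "E' (Suc i) = (E' i)(ac i := [])"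
       using ottmp by (simp add: E'_def fun_upd_twist)
      show "2 * length (E' i (ac i)) + 1 <= 2 * (S + 2) ^ k0 + 1"
       using len[of i "length w"] i ottmp by (auto simp: E'_def st_simps)
     qed
     then have "exle (seqn n (%i. clr (ac i))) (E' 0) (n * (2 * (S + 2) ^ k0 + 1) + 1) (E' n)"
      by (rule exle_seqn)
     moreover have "E' 0 = (st [] ?a1 nil)(ot := ?v)" by (simp add: E'_def fun_upd_def)
     moreover have "st [] (%i. if i < n then [] else ?a1 i) nil = e"
      by (rule st_eqI) (use emp in \<open>auto simp: nil_def ac_def nw_def\<close>)
     ultimately show ?thesis by (simp only: E'_def)
    qed
    have "exle main e (ta S) (e(ot := ?v))"
     unfolding main_def ta_def
     by (rule exle_Seq[OF 1 exle_Seq[OF 2 exle_Seq[OF 3 exle_Seq[OF 4 exle_Seq[OF 5 6]]]]])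
    then show ?thesis by (simp add: F_def w_def S_def e0_def)
   qed
   show ?thesis using pure run unfolding R_def by blast
  qed
 qed
 moreover have "pb ta" unfolding ta_def T1_def T2_def T3_def Suc_eq_plus1 by (intro pb_intros)
 ultimately show ?thesis by (rule FPt_FP)
qed

section \<open>Machines that ask a single query\<close>

definition enc :: "word => nat list" where
 "enc w = map (%b. if b then 1 else 0) w"

lemma length_enc [simp]: "length (enc w) = length w"
 by (simp add: enc_def)

text \<open>State 0 enters \<open>c\<close>, whose exit is the query state 2. The answer state 3
  enters \<open>d\<close>, whose exit is the halting state 1.\<close>

definition prog_machine :: "nat => nat => com => com => machine" where
 "prog_machine nt A c d = \<lparr>ntapes = nt, nstates = 4 + csize c + csize d, nsyms = Suc A,
   delta = (%st r. if st = 0 then (4, idle r) else if st = 3 then (4 + csize c, idle r)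
    else if st < 4 then (st, idle r)
    else if st < 4 + csize c then code c 4 2 st r else code d (4 + csize c) 1 st r)\<rparr>"

lemma wf_prog_machine:
 assumes "usable OT nt A c" "usable OT' nt A d" "3 <= nt" "2 <= A"
 shows "wf_machine (prog_machine nt A c d)"
proof -
 have "case delta (prog_machine nt A c d) st r of (s', acts) =>
   s' < 4 + csize c + csize d \<and> length acts = nt \<and> set acts \<subseteq> {..<Suc A} \<times> {-1, 0, 1}"
  if "st < 4 + csize c + csize d" "length r = nt" "set r \<subseteq> {..<Suc A}" for st r
 proof -
  have "length (idle r) = nt \<and> set (idle r) \<subseteq> {..<Suc A} \<times> {-1, 0, 1}"
   using that by (auto simp: idle_def)
  moreover have "fst (code c 4 2 st r) < 4 + csize c + csize d \<and> length (snd (code c 4 2 st r)) = nt \<and>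
    set (snd (code c 4 2 st r)) \<subseteq> {..<Suc A} \<times> {-1, 0, 1}" if "4 <= st" "st < 4 + csize c"
   by (rule code_wf[OF assms(1)]) (use that \<open>length r = nt\<close> \<open>set r \<subseteq> _\<close> in auto)
  moreover have "fst (code d (4 + csize c) 1 st r) < 4 + csize c + csize d \<and>
    length (snd (code d (4 + csize c) 1 st r)) = nt \<and>
    set (snd (code d (4 + csize c) 1 st r)) \<subseteq> {..<Suc A} \<times> {-1, 0, 1}"
   if "4 + csize c <= st" "st < 4 + csize c + csize d"
   by (rule code_wf[OF assms(2)]) (use that \<open>length r = nt\<close> \<open>set r \<subseteq> _\<close> in auto)
  ultimately show ?thesis
   using that csize_pos[of d] by (auto simp: prog_machine_def case_prod_beta)
 qed
 then show ?thesis using assms(3,4) unfolding wf_machine_def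
  by (simp add: prog_machine_def)
qed

lemma tape_word_orep: assumes "orep (enc w) t" shows "tape_word t = w"
proof -
 have c: "fst t (int i) = (if i < length w then Suc (enc w ! i) else 0)" for i
  using assms unfolding orep_def by (auto simp: enc_def)
 have "(LEAST i. fst t (int i) \<notin> {1, 2}) = length w"
  by (rule Least_equality) (auto simp: c enc_def not_less[symmetric] split: if_splits)
 then show ?thesis unfolding tape_word_def
  by (intro nth_equalityI) (auto simp: c enc_def)
qed

lemma srep_word_tape: "srep (enc w) (word_tape w)"
 unfolding srep_def word_tape_def by (auto simp: enc_def)

lemma orep_word_tape: "orep [] (word_tape [])"
 unfolding orep_def word_tape_def by auto

definition outw :: "nat => nat => nat => com" where
 "outw A i j = While i (scase i (%a. Pop i ;; Out j a) A)"

lemma exle_outw: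
 assumes "i ~= j" "set (e i) \<subseteq> {..<A}" "e' = e(i := [], j := e j @ e i)"
 shows "exle (outw A i j) e (length (e i) * (A + 3) + 1) e'"
proof -
 define E where "E m = e(i := drop m (e i), j := e j @ take m (e i))" for m
 have 1: "exle (While i (scase i (%a. Pop i ;; Out j a) A)) (E 0)
  (length (e i) * Suc (2 + A) + 1) (E (length (e i)))"
 proof (rule exle_symloop)
  fix m assume m: "m < length (e i)"
  have "exle (Pop i ;; Out j (e i ! m)) (E m) (1 + 1) (E (Suc m))"
   by (rule exle_Seq, rule exle_Pop, rule refl, rule exle_Out)
    (use m assms in \<open>auto simp: E_def fun_eq_iff take_Suc_conv_app_nth tl_drop drop_Suc\<close>)
  then show "exle (Pop i ;; Out j (e i ! m)) (E m) 2 (E (Suc m))" by (rule exle_mono) simp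
 qed (use assms in \<open>auto simp: E_def\<close>)
 have E: "E 0 = e" "E (length (e i)) = e'" using assms by (auto simp: E_def)
 show ?thesis unfolding outw_def by (rule exle_mono[OF 1[unfolded E]]) (simp add: algebra_simps)
qed

lemma usable_scase: "(\<And>x. x < n ==> usable OT nt A (c x)) ==> i \<notin> OT ==> i < nt ==> usable OT nt A (scase i c n)"
 by (induction n) auto

lemma usable_outw: "i \<notin> OT ==> j \<in> OT ==> i < nt ==> j < nt ==> usable OT nt A (outw A i j)"
 unfolding outw_def by (auto intro!: usable_scase)

text \<open>Argument \<open>i\<close> is read from tape \<open>r i\<close> for \<open>i < m\<close>;
  the remaining arguments are attached to stacks that are empty. The result appears on stack 3
  first, since a program for a function in \<open>FP\<close> works on stacks, and is then copied to
  the output tape.\<close>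

lemma FP_out:
 assumes "FP A f" "2 <= A" and r: "\<And>i. r i < 3" "\<And>i. r i \<notin> OT" "ot \<in> OT" "OT \<subseteq> {1, 2}" "\<And>i. r i ~= 3"
 shows "\<exists>c ta n0. pb ta \<and> mono ta \<and> (\<forall>nt\<ge>n0. usable OT nt A c) \<and>
  (\<forall>e. (\<forall>i\<ge>3. e i = []) --> e ot = [] --> (\<forall>i<3. set (e i) \<subseteq> {..<A}) -->
   exle c e (ta (length (e 0) + length (e 1) + length (e 2)))
    (e(ot := f (%i. if i < m then e (r i) else []))))"
proof -
 obtain K B k where f: "FPt A f K B (%n. (n + 2) ^ k)" using assms unfolding FP_def FPw_def by auto
 define rh where "rh i = (if i < m then r i else 4 + i)" for i
 have "\<forall>i<K. rh i < 4 + K \<and> rh i ~= 3"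
 proof (intro allI impI)
  fix i assume "i < K" then show "rh i < 4 + K \<and> rh i ~= 3" using r(1)[of i] by (auto simp: rh_def)
 qed
 from FPt_run[OF f this]
 obtain c where c: "pure_on A (rh ` {..<K} \<union> {3} \<union> {4 + K..<4 + K + B}) c"
  "\<And>e. vld A K (%i. e (rh i)) ==> e 3 = [] ==> (\<forall>j\<ge>4 + K. e j = []) ==>
     exle c e ((sz K (%i. e (rh i)) + 2) ^ k) (e(3 := f (%i. e (rh i))))"
  by auto
 define ta where "ta n = (K * n + 2) ^ k + ((K * n + 2) ^ k * (A + 3) + 1)" for n
 show ?thesis
 proof (intro exI conjI allI impI)
  show "pb ta" unfolding ta_def by (intro pb_intros)
  show "mono ta" unfolding ta_def by (intro monoI add_mono mult_le_mono power_mono) auto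
  fix nt assume nt: "4 + K + B <= nt"
  have "usable OT nt A c"
   by (rule pure_on_usable[OF c(1)])
    (use r nt in \<open>auto simp: rh_def intro: less_le_trans[OF r(1)] split: if_splits\<close>)
  moreover have "ot < nt" "3 \<notin> OT" using r nt by auto
  ultimately show "usable OT nt A (c ;; outw A 3 ot)" using r nt by (auto intro: usable_outw)
 next
  fix e :: env assume e: "\<forall>i\<ge>3. e i = []" "e ot = []" "\<forall>i<3. set (e i) \<subseteq> {..<A}"
  let ?S = "length (e 0) + length (e 1) + length (e 2)"
  let ?e = "%i. if i < m then e (r i) else []"
  have er: "(%i. e (rh i)) = ?e" using e(1) by (auto simp: rh_def)
  have v: "vld A K ?e" using e(3) r(1) by (auto simp: vld_def)
  have "length (?e i) <= ?S" for i
  proof -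
   have "r i = 0 \<or> r i = 1 \<or> r i = 2" using r(1)[of i] by linarith
   then show ?thesis by auto
  qed
  then have "sz K ?e <= K * ?S"
   unfolding sz_def using sum_bounded_above[of "{..<K}" "%i. length (?e i)" ?S] by auto
  then have le: "(sz K ?e + 2) ^ k <= (K * ?S + 2) ^ k" by (intro power_mono) auto
  have 1: "exle c e ((K * ?S + 2) ^ k) (e(3 := f ?e))"
   using exle_mono[OF c(2)[of e, unfolded er, OF v] le] e by auto
  have l: "length (f ?e) <= (K * ?S + 2) ^ k" using exle_len[OF 1, of 3] e by auto
  have ot: "ot ~= 3" using r by auto
  have 2: "exle (outw A 3 ot) (e(3 := f ?e)) ((K * ?S + 2) ^ k * (A + 3) + 1) (e(ot := f ?e))"
   by (rule exle_mono[OF exle_outw])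
    (use ot e l FPt_val[OF f v] in \<open>auto simp: fun_eq_iff\<close>)
  show "exle (c ;; outw A 3 ot) e (ta ?S) (e(ot := f ?e))"
   unfolding ta_def by (rule exle_Seq[OF 1 2])
 qed
qed

text \<open>Before the query the oracle tape is written from cell 0 on, afterwards it is a stack
  that holds the answer. Hence tape 2 counts as an output tape for the first program and as a stack
  for the second one. The bound \<open>l\<close> on the answers limits the time of the second
  program, and neither program depends on the oracle.\<close>

theorem reduction_machine:
 assumes "FP A f1" "FP A f2" "2 <= A"
  and f1: "\<And>x. f1 (%i. if i = 0 then enc x else []) = enc (q x)"
  and f2: "\<And>x a. a \<in> Ans x ==> f2 (%i. if i = 0 then enc x else if i = 1 then enc a else []) = enc (g x)"
  and l: "pb l" "\<And>x a. a \<in> Ans x ==> length a <= l (length x)"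
 shows "\<exists>N (r :: nat poly). wf_machine N \<and> (\<forall>f. (\<forall>x. f (q x) \<in> Ans x) -->
  (\<forall>x. computes_within f N x (g x) (poly r (length x))))"
proof -
 have "\<exists>c ta n0. pb ta \<and> mono ta \<and> (\<forall>nt\<ge>n0. usable {1,2} nt A c) \<and>
  (\<forall>e. (\<forall>i\<ge>3. e i = []) --> e 2 = [] --> (\<forall>i<3. set (e i) \<subseteq> {..<A}) -->
   exle c e (ta (length (e 0) + length (e 1) + length (e 2)))
    (e(2 := f1 (%i. if i < 1 then e 0 else []))))"
  by (rule FP_out[OF assms(1,3), where r = "%i. 0"]) auto
 then obtain c1 ta1 n1 where c1: "pb ta1" "mono ta1" "\<And>nt. n1 <= nt ==> usable {1,2} nt A c1"
  "\<And>e. (\<forall>i\<ge>3. e i = []) ==> e 2 = [] ==> (\<forall>i<3. set (e i) \<subseteq> {..<A}) ==>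
   exle c1 e (ta1 (length (e 0) + length (e 1) + length (e 2)))
    (e(2 := f1 (%i. if i < 1 then e 0 else [])))" by auto
 have "\<exists>c ta n0. pb ta \<and> mono ta \<and> (\<forall>nt\<ge>n0. usable {1} nt A c) \<and>
  (\<forall>e. (\<forall>i\<ge>3. e i = []) --> e 1 = [] --> (\<forall>i<3. set (e i) \<subseteq> {..<A}) -->
   exle c e (ta (length (e 0) + length (e 1) + length (e 2)))
    (e(1 := f2 (%i. if i < 2 then e (if i = 0 then 0 else 2) else []))))"
  by (rule FP_out[OF assms(2,3), where r = "%i. if i = 0 then 0 else 2"]) auto
 then obtain c2 ta2 n2 where c2: "pb ta2" "mono ta2" "\<And>nt. n2 <= nt ==> usable {1} nt A c2"
  "\<And>e. (\<forall>i\<ge>3. e i = []) ==> e 1 = [] ==> (\<forall>i<3. set (e i) \<subseteq> {..<A}) ==>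
   exle c2 e (ta2 (length (e 0) + length (e 1) + length (e 2)))
    (e(1 := f2 (%i. if i < 2 then e (if i = 0 then 0 else 2) else [])))" by auto
 define nt where "nt = 3 + n1 + n2"
 define N where "N = prog_machine nt A c1 c2"
 have u: "usable {1,2} nt A c1" "usable {1} nt A c2" using c1(3) c2(3) by (auto simp: nt_def)
 have wf: "wf_machine N" unfolding N_def by (rule wf_prog_machine[OF u]) (auto simp: nt_def assms)
 have d1: "delta N st r = code c1 4 2 st r" if "4 <= st" "st < 4 + csize c1" for st r
  using that by (simp add: N_def prog_machine_def)
 have d2: "delta N st r = code c2 (4 + csize c1) 1 st r" if "4 + csize c1 <= st" for st r
  using that by (simp add: N_def prog_machine_def)
 have "pb (%n. ta1 n + (ta2 (n + l n) + 3))"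
  by (intro pb_intros c1(1) pb_comp[OF c2(1), of "%n. n + l n"] l(1))
 then obtain k where "\<And>n. ta1 n + (ta2 (n + l n) + 3) <= (n + 2) ^ k" unfolding pb_def by auto
 \<comment> \<open>The polynomial \<open>(n + 2) ^ k\<close>.\<close>
 moreover define r :: "nat poly" where "r = [:2, 1:] ^ k"
 ultimately have r: "ta1 n + (ta2 (n + l n) + 3) <= poly r n" for n
  by (simp add: add.commute)
 have "computes_within f N x (g x) (poly r (length x))" if f: "\<forall>x. f (q x) \<in> Ans x" for f x
 proof -
  define e0 where "e0 = (%i::nat. if i = 0 then enc x else [])"
  have encA: "set (enc w) \<subseteq> {..<A}" for w using assms(3) by (auto simp: enc_def)
  have "init_config N x = (0, word_tape x # replicate (nt - 1) (word_tape []))"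
   by (simp add: init_config_def N_def prog_machine_def)
  moreover define ts0 where "ts0 = word_tape x # replicate (nt - 1) (word_tape [])"
  ultimately have init: "init_config N x = (0, ts0)" by simp
  have rep0: "rep {1, 2} nt e0 ts0"
   unfolding rep_def ts0_def e0_def
   using orep_word_tape srep_word_tape srep_word_tape[of "[]"] by (auto simp: nt_def nth_Cons' enc_def)
  have s0: "step f N (0, ts0) = (4, ts0)"
   by (simp add: step_delta perform_idle) (simp add: N_def prog_machine_def perform_idle)
  have e0f: "(%i. if i < 1 then e0 0 else []) = (%i::nat. if i = 0 then enc x else [])"
   by (auto simp: e0_def)
  have "exle c1 e0 (ta1 (length x)) (e0(2 := enc (q x)))"
   using c1(4)[of e0] encA unfolding e0f f1 by (auto simp: e0_def)
  then obtain t1 where t1: "t1 <= ta1 (length x)" "exec c1 e0 t1 (e0(2 := enc (q x)))"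
   unfolding exle_def by auto
  obtain ts1 where ts1: "(step f N ^^ t1) (4, ts0) = (2, ts1)" "rep {1, 2} nt (e0(2 := enc (q x))) ts1"
   using exec_sim[where f = f and nx = 2, OF t1(2) u(1) rep0 order_refl d1] by blast
  define ts2 where "ts2 = ts1[2 := word_tape (f (q x))]"
  have len1: "length ts1 = nt" "2 < nt" using ts1(2) by (auto simp: rep_def nt_def)
  have "tape_word (ts1 ! 2) = q x"
   by (rule tape_word_orep) (use ts1(2) len1 in \<open>auto simp: rep_def\<close>)
  then have s1: "step f N (2, ts1) = (3, ts2)" by (simp add: step_def ts2_def)
  define e2 where "e2 = e0(2 := enc (f (q x)))"
  have rep2: "rep {1} nt e2 ts2"
   unfolding rep_def
  proof (intro conjI allI impI)
   fix i assume i: "i < nt"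
   show "if i \<in> {1} then orep (e2 i) (ts2 ! i) else srep (e2 i) (ts2 ! i)"
   proof (cases "i = 2")
    case True
    then show ?thesis using len1 srep_word_tape by (simp add: ts2_def e2_def)
   next
    case False
    then show ?thesis using ts1(2) i by (auto simp: ts2_def e2_def rep_def)
   qed
  qed (simp add: ts2_def len1)
  have s2: "step f N (3, ts2) = (4 + csize c1, ts2)"
   by (simp add: step_delta perform_idle) (simp add: N_def prog_machine_def perform_idle)
  have A: "f (q x) \<in> Ans x" using f by simp
  have e2f: "(%i. if i < 2 then e2 (if i = 0 then 0 else 2) else []) =
   (%i::nat. if i = 0 then enc x else if i = 1 then enc (f (q x)) else [])"
   by (auto simp: e2_def e0_def fun_eq_iff)
  have v2: "\<forall>i<3. set (e2 i) \<subseteq> {..<A}" using encA by (auto simp: e2_def e0_def)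
  have "exle c2 e2 (ta2 (length x + length (f (q x)))) (e2(1 := enc (g x)))"
  proof -
   have "exle c2 e2 (ta2 (length (e2 0) + length (e2 1) + length (e2 2))) (e2(1 := enc (g x)))"
    by (rule c2(4)[OF _ _ v2, unfolded e2f f2[OF A]]) (auto simp: e2_def e0_def)
   moreover have "length (e2 0) + length (e2 1) + length (e2 2) = length x + length (f (q x))"
    by (simp add: e2_def e0_def)
   ultimately show ?thesis by (simp only:)
  qed
  then obtain t2 where t2: "t2 <= ta2 (length x + length (f (q x)))" "exec c2 e2 t2 (e2(1 := enc (g x)))"
   unfolding exle_def by auto
  obtain ts3 where ts3: "(step f N ^^ t2) (4 + csize c1, ts2) = (1, ts3)" "rep {1} nt (e2(1 := enc (g x))) ts3"
   using exec_sim[where f = f and nx = 1, OF t2(2) u(2) rep2 _ d2] by auto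
  have out: "tape_word (ts3 ! 1) = g x"
   by (rule tape_word_orep) (use ts3(2)[unfolded rep_def, THEN conjunct2, THEN spec[of _ 1]] len1 in auto)
  have one: "(step f N ^^ 1) c = step f N c" for c by simp
  have run: "(step f N ^^ (1 + (t1 + (1 + (1 + t2))))) (0, ts0) = (1, ts3)"
   by (simp only: funpow_add' one s0 ts1 s1 s2 ts3)
  have stay: "(step f N ^^ d) (1, ts3) = (1, ts3)" for d
   by (induction d) (auto simp: step_def)
  have "ta2 (length x + length (f (q x))) <= ta2 (length x + l (length x))"
   by (rule monoD[OF c2(2)]) (use l(2)[OF A] in auto)
  then have "1 + (t1 + (1 + (1 + t2))) <= poly r (length x)"
   using t1(1) t2(1) r[of "length x"] by linarith
  then obtain d where d: "poly r (length x) = (1 + (t1 + (1 + (1 + t2)))) + d"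
   using le_Suc_ex by blast
  have "(step f N ^^ poly r (length x)) (0, ts0) = (1, ts3)"
   unfolding d by (subst funpow_add') (simp only: run stay)
  then show ?thesis unfolding computes_within_def init by (simp add: out[unfolded One_nat_def])
 qed
 then show ?thesis using wf by blast
qed

section \<open>Planarity of lattice graphs\<close>

text \<open>A loop at \<open>z\<close>, for sizes up to 1 inside the unit square to the upper right.
  Its direction turns with \<open>t\<close>, so that loops of different size meet only at
  \<open>z\<close>.\<close>

definition petal :: "complex => real => real => complex" where
 "petal z r t = z + of_real (r * t * (1 - t)) * Complex (1 / 2 + t) (3 / 2 - t)"

lemma petal_Re: "Re (petal z r t) = Re z + r * t * (1 - t) * (1 / 2 + t)"
 and petal_Im: "Im (petal z r t) = Im z + r * t * (1 - t) * (3 / 2 - t)"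
 by (simp_all add: petal_def)

lemma petal_ends: "petal z r 0 = z" "petal z r 1 = z"
 by (simp_all add: petal_def)

text \<open>
 The sum of the two coordinates relative to the base point determines \<open>r * t * (1 - t)\<close>, their
 difference then determines \<open>t\<close>.
\<close>

lemma petal_inj:
 assumes "petal z r t = petal z r' s" "0 < r" "0 < t" "t < 1"
 shows "t = s \<and> r = r'"
proof -
 define a b where "a = r * t * (1 - t)" and "b = r' * s * (1 - s)"
 have a: "0 < a" using assms by (simp add: a_def)
 have 1: "a * (1 / 2 + t) = b * (1 / 2 + s)" "a * (3 / 2 - t) = b * (3 / 2 - s)"
  using assms(1) petal_Re[of z r t] petal_Re[of z r' s] petal_Im[of z r t] petal_Im[of z r' s]
  by (simp_all add: a_def b_def)
 then have "a * (1 / 2 + t) + a * (3 / 2 - t) = b * (1 / 2 + s) + b * (3 / 2 - s)" by simp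
 then have "a = b" by (simp add: algebra_simps)
 with 1 a have "t = s" by simp
 with \<open>a = b\<close> show ?thesis using assms by (simp add: a_def b_def)
qed

lemma simple_path_petal: assumes "0 < r" shows "simple_path (petal z r)"
proof -
 have "path (petal z r)"
  unfolding path_def petal_def Complex_eq by (intro continuous_intros)
 moreover have "loop_free (petal z r)"
  unfolding loop_free_def
 proof (intro ballI impI)
  fix t s :: real assume ts: "t \<in> {0..1}" "s \<in> {0..1}" and eq: "petal z r t = petal z r s"
  consider "0 < t \<and> t < 1" | "0 < s \<and> s < 1" | "t \<in> {0, 1} \<and> s \<in> {0, 1}" using ts by fastforce
  then show "t = s \<or> t = 0 \<and> s = 1 \<or> t = 1 \<and> s = 0"
   by cases (use petal_inj[OF eq assms] petal_inj[OF eq[symmetric] assms] in auto)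
 qed
 ultimately show ?thesis by (simp add: simple_path_def)
qed

section \<open>Points on lattice edges and on loops\<close>

definition lpos :: "int \<times> int => complex" where
 "lpos P = Complex (of_int (fst P)) (of_int (snd P))"

text \<open>The floors of the coordinates of an inner point recover the edge that it lies on.
  Disjointness of two curves then needs no case distinction on their relative position.\<close>

definition on_edge :: "int \<times> int => int \<times> int => complex => bool" where
 "on_edge P Q z \<longleftrightarrow>
  Im z = of_int \<lfloor>Im z\<rfloor> \<and> Re z ~= of_int \<lfloor>Re z\<rfloor> \<and>
   {P, Q} = {(\<lfloor>Re z\<rfloor>, \<lfloor>Im z\<rfloor>), (\<lfloor>Re z\<rfloor> + 1, \<lfloor>Im z\<rfloor>)} \<or>
  Re z = of_int \<lfloor>Re z\<rfloor> \<and> Im z ~= of_int \<lfloor>Im z\<rfloor> \<and>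
   {P, Q} = {(\<lfloor>Re z\<rfloor>, \<lfloor>Im z\<rfloor>), (\<lfloor>Re z\<rfloor>, \<lfloor>Im z\<rfloor> + 1)}"

definition on_petal :: "int \<times> int => complex => bool" where
 "on_petal P z \<longleftrightarrow> Im z ~= of_int \<lfloor>Im z\<rfloor> \<and> Re z ~= of_int \<lfloor>Re z\<rfloor> \<and> P = (\<lfloor>Re z\<rfloor>, \<lfloor>Im z\<rfloor>)"

lemma on_edge_linepath:
 assumes "\<bar>fst P - fst Q\<bar> + \<bar>snd P - snd Q\<bar> = 1" "z \<in> path_image (linepath (lpos P) (lpos Q))"
 shows "z = lpos P \<or> z = lpos Q \<or> on_edge P Q z"
proof -
 obtain a b c d where PQ: "P = (a, b)" "Q = (c, d)" by fastforce
 obtain t where t: "0 <= t" "t <= 1" and z: "z = linepath (lpos P) (lpos Q) t"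
  using assms(2) unfolding path_image_def by auto
 have Re: "Re z = of_int a + t * of_int (c - a)" and Im: "Im z = of_int b + t * of_int (d - b)"
  unfolding z linepath_def by (simp_all add: lpos_def PQ algebra_simps)
 show ?thesis
 proof (cases "t = 0 \<or> t = 1")
  case True
  then show ?thesis unfolding z by (auto simp: linepath_def)
 next
  case False
  then have t: "0 < t" "t < 1" using t by auto
  have fl: "\<lfloor>y\<rfloor> = x \<and> y ~= of_int \<lfloor>y\<rfloor>" if "of_int x < y" "y < of_int x + 1" for x :: int and y :: real
  proof -
   have "\<lfloor>y\<rfloor> = x" by (rule floor_unique) (use that in auto)
   then show ?thesis using that by simp
  qed
  consider "c = a + 1 \<and> d = b" | "c = a - 1 \<and> d = b" | "c = a \<and> d = b + 1" | "c = a \<and> d = b - 1"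
   using assms(1) unfolding PQ by fastforce
  then have "on_edge P Q z"
  proof cases
   case 1
   have "\<lfloor>Re z\<rfloor> = a \<and> Re z ~= of_int \<lfloor>Re z\<rfloor>" by (rule fl) (use 1 t Re in auto)
   then show ?thesis using Im 1 unfolding on_edge_def PQ by simp
  next
   case 2
   have "\<lfloor>Re z\<rfloor> = c \<and> Re z ~= of_int \<lfloor>Re z\<rfloor>" by (rule fl) (use 2 t Re in auto)
   then show ?thesis using Im 2 unfolding on_edge_def PQ by (simp add: insert_commute)
  next
   case 3
   have "\<lfloor>Im z\<rfloor> = b \<and> Im z ~= of_int \<lfloor>Im z\<rfloor>" by (rule fl) (use 3 t Im in auto)
   then show ?thesis using Re 3 unfolding on_edge_def PQ by simp
  next
   case 4
   have "\<lfloor>Im z\<rfloor> = d \<and> Im z ~= of_int \<lfloor>Im z\<rfloor>" by (rule fl) (use 4 t Im in auto)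
   then show ?thesis using Re 4 unfolding on_edge_def PQ by (simp add: insert_commute)
  qed
  then show ?thesis by simp
 qed
qed

lemma on_petal_petal:
 assumes "0 < r" "r <= 1" "z \<in> path_image (petal (lpos P) r)"
 shows "z = lpos P \<or> on_petal P z \<and> (\<exists>t. 0 < t \<and> t < 1 \<and> z = petal (lpos P) r t)"
proof -
 obtain t where t: "0 <= t" "t <= 1" and z: "z = petal (lpos P) r t"
  using assms(3) unfolding path_image_def by auto
 show ?thesis
 proof (cases "t = 0 \<or> t = 1")
  case True
  then show ?thesis unfolding z by (auto simp: petal_ends)
 next
  case False
  then have t: "0 < t" "t < 1" using t by auto
  define A where "A = r * t * (1 - t)"
  have A: "0 < A" using t assms by (simp add: A_def)
  \<comment> \<open>With \<open>r \<le> 1\<close> the scale \<open>A\<close> is at most 1/4 and both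
    direction coordinates are below 4, so the point stays inside the unit square.\<close>
  have "t * (1 - t) <= 1 / 4" using zero_le_power2[of "t - 1 / 2"] by (simp add: power2_eq_square algebra_simps)
  moreover have "A <= 1 * (t * (1 - t))" unfolding A_def mult.assoc
   by (rule mult_right_mono) (use t assms in auto)
  ultimately have A4: "A <= 1 / 4" by linarith
  have "A * (1 / 2 + t) < 1 / 4 * 4" "A * (3 / 2 - t) < 1 / 4 * 4"
   by (rule mult_le_less_imp_less; use A A4 t in auto)+
  moreover have "0 < A * (1 / 2 + t)" "0 < A * (3 / 2 - t)" using A t by auto
  ultimately have b: "0 < A * (1 / 2 + t) \<and> A * (1 / 2 + t) < 1 \<and> 0 < A * (3 / 2 - t) \<and> A * (3 / 2 - t) < 1"
   by simp
  have RI: "Re z = of_int (fst P) + A * (1 / 2 + t)" "Im z = of_int (snd P) + A * (3 / 2 - t)"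
   unfolding z petal_Re petal_Im by (simp_all add: lpos_def A_def)
  have fl: "\<lfloor>Re z\<rfloor> = fst P" "\<lfloor>Im z\<rfloor> = snd P"
   by (rule floor_unique; use RI b in linarith)+
  have "on_petal P z" unfolding on_petal_def fl unfolding RI using b A t by auto
  then show ?thesis using t z by blast
 qed
qed

text \<open>Loops at one vertex may be repeated, since the edge with number \<open>k\<close> gets
  size \<open>1 / Suc k\<close>. Repeated segments would coincide, so other edges must have
  different pairs of ends.\<close>

theorem planar_lattice:
 fixes p :: "nat => int \<times> int"
 assumes es: "\<And>u v. (u, v) \<in> set es ==> u < n \<and> v < n" and inj: "inj_on p {..<n}"
  and unit: "\<And>u v. (u, v) \<in> set es ==> u ~= v ==>
   \<bar>fst (p u) - fst (p v)\<bar> + \<bar>snd (p u) - snd (p v)\<bar> = 1"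
  and dist: "\<And>k l. k < length es ==> l < length es ==> k ~= l ==> fst (es ! k) ~= snd (es ! k) ==>
   {fst (es ! k), snd (es ! k)} ~= {fst (es ! l), snd (es ! l)}"
 shows "planar (n, es)"
proof -
 define pos where "pos u = lpos (p u)" for u
 define curve where "curve k = (if fst (es ! k) = snd (es ! k) then petal (pos (fst (es ! k))) (1 / real (Suc k))
  else linepath (pos (fst (es ! k))) (pos (snd (es ! k))))" for k
 have lpos_inj: "lpos P = lpos Q \<longleftrightarrow> P = Q" for P Q by (auto simp: lpos_def prod_eq_iff)
 have ends: "fst (es ! k) < n" "snd (es ! k) < n" if "k < length es" for k
  using es[of "fst (es ! k)" "snd (es ! k)"] that by auto
 have pinj: "p u = p v \<longleftrightarrow> u = v" if "u < n" "v < n" for u v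
  using inj that by (auto simp: inj_on_def)
 have int: "\<not> on_edge P Q (lpos R)" "\<not> on_petal P (lpos R)" for P Q R
  by (auto simp: on_edge_def on_petal_def lpos_def)
 have img: "z = pos (fst (es ! k)) \<or> z = pos (snd (es ! k)) \<or>
   fst (es ! k) ~= snd (es ! k) \<and> on_edge (p (fst (es ! k))) (p (snd (es ! k))) z \<or>
   fst (es ! k) = snd (es ! k) \<and> on_petal (p (fst (es ! k))) z \<and>
    (\<exists>t. 0 < t \<and> t < 1 \<and> z = petal (pos (fst (es ! k))) (1 / real (Suc k)) t)"
  if "k < length es" "z \<in> path_image (curve k)" for k z
 proof (cases "fst (es ! k) = snd (es ! k)")
  case True
  then show ?thesis
   using that(2) on_petal_petal[of "1 / real (Suc k)" z "p (fst (es ! k))"] by (auto simp: curve_def pos_def)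
 next
  case False
  then show ?thesis
   using that on_edge_linepath[OF unit[of "fst (es ! k)" "snd (es ! k)"], of z] by (auto simp: curve_def pos_def)
 qed
 have ends': "pos (fst (es ! k)) \<in> path_image (curve k)" "pos (snd (es ! k)) \<in> path_image (curve k)"
  "pathstart (curve k) = pos (fst (es ! k))" "pathfinish (curve k) = pos (snd (es ! k))" for k
  using pathstart_in_path_image[of "curve k"] pathfinish_in_path_image[of "curve k"]
  by (auto simp: curve_def petal_ends pathstart_def[of "petal _ _"] pathfinish_def[of "petal _ _"])
 have "plane_drawing (n, es) pos curve"
  unfolding plane_drawing_def prod.case
 proof (intro conjI allI impI)
  show "inj_on pos {..<n}" using inj by (auto simp: pos_def inj_on_def lpos_inj)
 next
  fix k assume k: "k < length es"
  show "simple_path (curve k)"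
   using pinj[OF ends[OF k]] by (auto simp: curve_def pos_def lpos_inj simple_path_petal)
  show "pathstart (curve k) = pos (fst (es ! k))" "pathfinish (curve k) = pos (snd (es ! k))"
   using ends' by auto
  show "path_image (curve k) \<inter> pos ` {..<n} = {pos (fst (es ! k)), pos (snd (es ! k))}"
  proof (intro equalityI subsetI)
   fix z assume z: "z \<in> path_image (curve k) \<inter> pos ` {..<n}"
   then obtain w where "z = lpos (p w)" by (auto simp: pos_def)
   then show "z \<in> {pos (fst (es ! k)), pos (snd (es ! k))}" using img[OF k, of z] z int by auto
  qed (use ends' ends[OF k] in auto)
 next
  fix k l assume kl: "k < length es" "l < length es" "k ~= l"
  show "path_image (curve k) \<inter> path_image (curve l) \<subseteq> pos ` {..<n}"
  proof
   fix z assume z: "z \<in> path_image (curve k) \<inter> path_image (curve l)"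
   show "z \<in> pos ` {..<n}"
   proof (rule ccontr)
    assume nz: "z \<notin> pos ` {..<n}"
    then have nz: "z ~= pos (fst (es ! k))" "z ~= pos (snd (es ! k))" "z ~= pos (fst (es ! l))" "z ~= pos (snd (es ! l))"
     using ends kl by auto
    note i = img[OF kl(1), of z] img[OF kl(2), of z]
    show False
    proof (cases "fst (es ! k) = snd (es ! k) \<or> fst (es ! l) = snd (es ! l)")
     case False
     then have "on_edge (p (fst (es ! k))) (p (snd (es ! k))) z" "on_edge (p (fst (es ! l))) (p (snd (es ! l))) z"
      using i z nz by auto
     then have "p ` {fst (es ! k), snd (es ! k)} = p ` {fst (es ! l), snd (es ! l)}"
      by (auto simp: on_edge_def)
     then have "{fst (es ! k), snd (es ! k)} = {fst (es ! l), snd (es ! l)}"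
      using inj_on_image_eq_iff[OF inj, of "{fst (es ! k), snd (es ! k)}" "{fst (es ! l), snd (es ! l)}"]
       ends[OF kl(1)] ends[OF kl(2)] by simp
     then show False using dist[OF kl] False by auto
    next
     case True
     then have both: "fst (es ! k) = snd (es ! k)" "fst (es ! l) = snd (es ! l)"
      using i z nz by (auto simp: on_edge_def on_petal_def)
     then obtain t s where ts: "0 < t" "t < 1" "z = petal (pos (fst (es ! k))) (1 / real (Suc k)) t"
      "z = petal (pos (fst (es ! l))) (1 / real (Suc l)) s" "on_petal (p (fst (es ! k))) z"
      "on_petal (p (fst (es ! l))) z"
      using i z nz by auto
     then have "pos (fst (es ! k)) = pos (fst (es ! l))" by (simp add: pos_def on_petal_def)
     then have "1 / real (Suc k) = 1 / real (Suc l)"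
      using petal_inj[of "pos (fst (es ! k))" "1 / real (Suc k)" t "1 / real (Suc l)" s] ts by auto
     then show False using kl by simp
    qed
   qed
  qed
 qed
 then show ?thesis unfolding planar_def multigraph_def using es by auto
qed

section \<open>The crossing gadget\<close>

text \<open>Over an arbitrary ring, as the partition function is compared at the real matrix and at
  integer matrices.\<close>

definition ZZ :: "nat => (nat => nat => 'a::comm_ring_1) => multigraph => 'a" where
 "ZZ q m G = (case G of (n, es) =>
   \<Sum>si\<in>{..<n} \<rightarrow>\<^sub>E {..<q}. \<Prod>(u, v)\<leftarrow>es. m (si u) (si v))"

section \<open>Factoring sums over spin configurations\<close>

lemma sum_PiE_insert:
 fixes S :: "'b set" and f :: "('a => 'b) => 'c::comm_monoid_add"
 assumes "x \<notin> A"
 shows "(\<Sum>si\<in>insert x A \<rightarrow>\<^sub>E S. f si) = (\<Sum>y\<in>S. \<Sum>si\<in>A \<rightarrow>\<^sub>E S. f (si(x := y)))"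
proof -
 define j where "j si = (si x, si(x := undefined))" for si :: "'a => 'b"
 define i where "i = (%(y, si). si(x := y) :: 'a => 'b)"
 have "(\<Sum>si\<in>insert x A \<rightarrow>\<^sub>E S. f si) = (\<Sum>p\<in>S \<times> (A \<rightarrow>\<^sub>E S). f (i p))"
 proof (rule sum.reindex_bij_witness[where i = i and j = j])
  fix p assume p: "p \<in> S \<times> (A \<rightarrow>\<^sub>E S)"
  then show "i p \<in> insert x A \<rightarrow>\<^sub>E S" by (auto simp: i_def PiE_iff extensional_def)
  have "(snd p) x = undefined" using p assms by (auto simp: PiE_iff extensional_def)
  then show "j (i p) = p" by (auto simp: i_def j_def fun_eq_iff split: prod.splits)
 next
  fix si assume si: "si \<in> insert x A \<rightarrow>\<^sub>E S"
  then show "j si \<in> S \<times> (A \<rightarrow>\<^sub>E S)" using assms by (auto simp: j_def PiE_iff extensional_def)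
  show "i (j si) = si" "f (i (j si)) = f si" by (simp_all add: i_def j_def)
 qed
 then show ?thesis by (simp add: sum.cartesian_product i_def case_prod_beta)
qed

lemma sum_PiE_union:
 fixes S :: "'b set" and f :: "('a => 'b) => 'c::comm_monoid_add"
 assumes "A \<inter> B = {}"
 shows "(\<Sum>si\<in>(A \<union> B) \<rightarrow>\<^sub>E S. f si) = (\<Sum>ah\<in>A \<rightarrow>\<^sub>E S. \<Sum>bh\<in>B \<rightarrow>\<^sub>E S. f (%x. if x \<in> A then ah x else bh x))"
proof -
 define j where "j si = (restrict si A, restrict si B)" for si :: "'a => 'b"
 define i where "i = (%(ah, bh) x. if x \<in> A then ah x else bh x :: 'b)"
 have ij: "i (j si) = si" if "si \<in> (A \<union> B) \<rightarrow>\<^sub>E S" for si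
  using that by (auto simp: i_def j_def fun_eq_iff PiE_iff extensional_def)
 have ji: "j (i p) = p" if "p \<in> (A \<rightarrow>\<^sub>E S) \<times> (B \<rightarrow>\<^sub>E S)" for p
 proof -
  obtain ah bh where p: "p = (ah, bh)" by fastforce
  have "restrict (i p) A = ah" using that unfolding p i_def by (auto simp: fun_eq_iff PiE_iff extensional_def)
  moreover have "restrict (i p) B = bh"
  proof
   fix x show "restrict (i p) B x = bh x"
    using that assms unfolding p i_def by (cases "x \<in> B") (auto simp: PiE_iff extensional_def)
  qed
  ultimately show ?thesis by (simp add: j_def p)
 qed
 have "(\<Sum>si\<in>(A \<union> B) \<rightarrow>\<^sub>E S. f si) = (\<Sum>p\<in>(A \<rightarrow>\<^sub>E S) \<times> (B \<rightarrow>\<^sub>E S). f (i p))"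
 proof (rule sum.reindex_bij_witness[where i = i and j = j])
  fix p assume "p \<in> (A \<rightarrow>\<^sub>E S) \<times> (B \<rightarrow>\<^sub>E S)"
  then show "i p \<in> (A \<union> B) \<rightarrow>\<^sub>E S" by (auto simp: i_def PiE_iff extensional_def)
 qed (use ij ji in \<open>auto simp: j_def\<close>)
 then show ?thesis by (simp add: sum.cartesian_product i_def case_prod_beta)
qed

text \<open>Distributivity for factors that depend on disjoint blocks of vertices.\<close>

lemma prod_sum_blocks:
 fixes g :: "'i => ('v => 's) => 'a::comm_semiring_1"
 assumes "finite I" "\<And>k l. k \<in> I ==> l \<in> I ==> k ~= l ==> R k \<inter> R l = {}"
  "\<And>k si si'. k \<in> I ==> (\<And>x. x \<in> R k ==> si x = si' x) ==> g k si = g k si'"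
 shows "(\<Sum>si\<in>(\<Union>k\<in>I. R k) \<rightarrow>\<^sub>E S. \<Prod>k\<in>I. g k si) = (\<Prod>k\<in>I. \<Sum>rh\<in>R k \<rightarrow>\<^sub>E S. g k rh)"
 using assms
proof (induction I rule: finite_induct)
 case (insert k I)
 let ?U = "\<Union>k\<in>I. R k"
 have disj: "R k \<inter> ?U = {}" using insert.prems(1) insert.hyps by fastforce
 have "(\<Sum>si\<in>(\<Union>k\<in>insert k I. R k) \<rightarrow>\<^sub>E S. \<Prod>l\<in>insert k I. g l si) =
   (\<Sum>ah\<in>R k \<rightarrow>\<^sub>E S. \<Sum>bh\<in>?U \<rightarrow>\<^sub>E S. \<Prod>l\<in>insert k I. g l (%x. if x \<in> R k then ah x else bh x))"
  using sum_PiE_union[OF disj] by simp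
 also have "\<dots> = (\<Sum>ah\<in>R k \<rightarrow>\<^sub>E S. \<Sum>bh\<in>?U \<rightarrow>\<^sub>E S. g k ah * (\<Prod>l\<in>I. g l bh))"
 proof (intro sum.cong refl)
  fix ah bh
  have "g k (%x. if x \<in> R k then ah x else bh x) = g k ah" by (rule insert.prems) auto
  moreover have "g l (%x. if x \<in> R k then ah x else bh x) = g l bh" if "l \<in> I" for l
   by (rule insert.prems) (use that disj in auto)
  ultimately show "(\<Prod>l\<in>insert k I. g l (%x. if x \<in> R k then ah x else bh x)) = g k ah * (\<Prod>l\<in>I. g l bh)"
   using insert.hyps by simp
 qed
 also have "\<dots> = (\<Sum>ah\<in>R k \<rightarrow>\<^sub>E S. g k ah) * (\<Sum>bh\<in>?U \<rightarrow>\<^sub>E S. \<Prod>l\<in>I. g l bh)"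
  by (simp add: sum_product)
 also have "(\<Sum>bh\<in>?U \<rightarrow>\<^sub>E S. \<Prod>l\<in>I. g l bh) = (\<Prod>k\<in>I. \<Sum>rh\<in>R k \<rightarrow>\<^sub>E S. g k rh)"
 proof (rule insert.IH)
  fix k l assume "k \<in> I" "l \<in> I" "k ~= l"
  then show "R k \<inter> R l = {}" by (intro insert.prems) auto
 next
  fix k and si si' :: "'v => 's" assume "k \<in> I" "\<And>x. x \<in> R k ==> si x = si' x"
  then show "g k si = g k si'" by (intro insert.prems) auto
 qed
 finally show ?case using insert.hyps by simp
qed simp

text \<open>The sum over the spins of the listed vertices, as nested sums that the simplifier can
  evaluate cell by cell.\<close>

fun nsum :: "nat => nat list => ((nat => nat) => int) => (nat => nat) => int" where
 "nsum q [] F x = F x"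
| "nsum q (k # ks) F x = (\<Sum>y<q. nsum q ks F (x(k := y)))"

lemma nsum_PiE:
 assumes "distinct ks"
 shows "(\<Sum>rh\<in>(%k. b + k) ` set ks \<rightarrow>\<^sub>E {..<q}. F (%k. if k \<in> set ks then rh (b + k) else x k)) = nsum q ks F x"
 using assms
proof (induction ks arbitrary: x)
 case Nil then show ?case by simp
next
 case (Cons k ks)
 have "(\<Sum>rh\<in>(%k. b + k) ` set (k # ks) \<rightarrow>\<^sub>E {..<q}. F (%j. if j \<in> set (k # ks) then rh (b + j) else x j)) =
   (\<Sum>y<q. \<Sum>rh\<in>(%k. b + k) ` set ks \<rightarrow>\<^sub>E {..<q}. F (%j. if j \<in> set (k # ks) then (rh(b + k := y)) (b + j) else x j))"
  using Cons.prems by (subst sum_PiE_insert[symmetric]) auto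
 also have "\<dots> = (\<Sum>y<q. \<Sum>rh\<in>(%k. b + k) ` set ks \<rightarrow>\<^sub>E {..<q}. F (%j. if j \<in> set ks then rh (b + j) else (x(k := y)) j))"
  using Cons.prems by (intro sum.cong refl arg_cong[of _ _ F]) (auto simp: fun_eq_iff)
 also have "\<dots> = (\<Sum>y<q. nsum q ks F (x(k := y)))"
  by (intro sum.cong refl Cons.IH) (use Cons.prems in simp)
 finally show ?case by (simp only: nsum.simps)
qed

section \<open>Local sums of a single cell\<close>

definition m0 :: "nat => nat => int" where
 "m0 i j = (if i < 3 \<and> j < 3 then (if i = 2 \<and> j = 2 then 0 else if i = 1 \<and> j = 1 then -1 else 1) else 0)"

text \<open>
 The vertices of a cell are numbered as follows: 0 and 1 carry the row and the column value at
 the left and lower side, 2 carries their sum modulo 2, 3, 4, 5 are the parity checks making a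
 crossing, and 6 couples row and column.  An edge is given by a vertex of the cell, the position
 of the other cell (0: same, 1: right, 2: above) and the other vertex.
\<close>

definition cedges :: "nat => (nat \<times> nat \<times> nat) list" where
 "cedges t =
  (if t = 0 then []
   else if t = 1 then [(4,2,1), (4,0,4), (4,0,4)]
   else if t = 2 then [(4,2,1), (4,0,4)]
   else if t = 3 then [(0,0,0), (0,0,0)]
   else if t = 4 then [(1,0,1), (1,0,1)]
   else [(3,0,0), (3,0,1), (3,0,2), (4,0,0), (4,0,2), (4,2,1), (5,0,1), (5,0,2), (5,1,0),
    (1,0,1), (1,0,1), (2,0,2), (2,0,2), (3,0,3), (3,0,3), (4,0,4), (4,0,4), (5,0,5), (5,0,5), (0,0,0)] @
    (if 7 <= t then [] else [(0,0,0)]) @ (if t = 6 \<or> t = 8 then [(6,1,0), (6,2,1)] else []))"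

definition cshift :: "nat => nat => nat" where
 "cshift Wd d = (if d = 0 then 0 else if d = 1 then 1 else Wd)"

definition gg :: "nat list => nat => multigraph" where
 "gg w Wd = (7 * length w, concat (map (%ka. map (%(k1, d, k2).
   (7 * ka + k1, 7 * (ka + cshift Wd d) + k2)) (cedges (w ! ka))) [0..<length w]))"

text \<open>Other cells enter only through the row vertex of the cell on the right, with spin
  \<open>a'\<close>, and the column vertex of the cell above, with spin \<open>b'\<close>.\<close>

definition cw :: "nat => nat => nat => (nat => nat) => int" where
 "cw t a' b' x = (\<Prod>(k1, d, k2)\<leftarrow>cedges t. m0 (x k1) (if d = 0 then x k2 else if d = 1 then a' else b'))"

text \<open>The diagonal of \<open>m0\<close> is 1, -1, 0 and then 0, so two loops restrict a vertex
  to the spins 0 and 1.\<close>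

lemma sum_lp2: assumes "3 <= q" shows "(\<Sum>p<q. m0 p p * (m0 p p * g p)) = g 0 + g 1"
proof -
 have "(\<Sum>p<q. m0 p p * (m0 p p * g p)) = (\<Sum>p\<in>{0,1}. m0 p p * (m0 p p * g p))"
  by (rule sum.mono_neutral_right) (use assms in \<open>auto simp: m0_def\<close>)
 then show ?thesis by (simp add: m0_def)
qed

text \<open>A single loop restricts the spin as well, but keeps the sign of spin 1.\<close>

lemma sum_lp: assumes "3 <= q" shows "(\<Sum>p<q. m0 p p * g p) = g 0 - g 1"
proof -
 have "(\<Sum>p<q. m0 p p * g p) = (\<Sum>p\<in>{0,1}. m0 p p * g p)"
  by (rule sum.mono_neutral_right) (use assms in \<open>auto simp: m0_def\<close>)
 then show ?thesis by (simp add: m0_def)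
qed

text \<open>A vertex without loops also takes spin 2, which adds 1 to the values 2 and 0 obtained
  from the spins 0 and 1.\<close>

lemma sum_X: assumes "3 <= q" "a < 2" "b < 2" shows "(\<Sum>x<q. m0 x a * m0 x b) = (if a = b then 3 else 1)"
proof -
 have "(\<Sum>x<q. m0 x a * m0 x b) = (\<Sum>x\<in>{0,1,2}. m0 x a * m0 x b)"
  by (rule sum.mono_neutral_right) (use assms in \<open>auto simp: m0_def\<close>)
 then show ?thesis using assms by (auto simp: m0_def less_2_cases_iff)
qed

text \<open>Types 1 and 2 pin a column to 0 and to 1, types 3 and 4 end a row and a column. From
  type 5 on the cell is a crossing: 7 and 8 have only one loop at the row vertex, 6 and 8 couple row
  and column. The constants collect a factor \<open>q\<close> for each free vertex and a factor 2
  for each parity check.\<close>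

definition kc :: "nat => nat => int" where
 "kc q t = (if t = 0 then int q ^ 7 else if t <= 2 then 2 * int q ^ 6 else if t <= 4 then int q ^ 6
   else if t = 6 \<or> t = 8 then 8 else 8 * int q)"

definition sg :: "nat => int" where "sg a = (if a = 0 then 1 else -1)"

text \<open>A doubly looped vertex joined to three bits sums to 2 if their parity is even and to 0
  otherwise. The three checks say that \<open>c = a + b\<close>, \<open>b' = a + c\<close> and
  \<open>a' = b + c\<close> modulo 2. Hence exactly one \<open>c\<close> contributes and both bits
  pass unchanged, with a factor 2 for each check.\<close>

lemma nsum_full:
 assumes q: "3 <= q" and x: "x 0 = a" "x 1 = b" "a < 2" "b < 2" "a' < 2" "b' < 2" and t: "5 <= t" "t < 9"
 shows "nsum q [2,3,4,5,6] (cw t a' b') x = (if a' = a \<and> b' = b then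
  kc q t * (if 7 <= t then sg a else 1) * (if t = 6 \<or> t = 8 then (if a = b then 3 else 1) else 1) else 0)"
proof -
 define L :: int where "L = (if 7 <= t then m0 a a else m0 a a * m0 a a) * (m0 b b * m0 b b)"
 define X :: int where "X = (if t = 6 \<or> t = 8 then (if a' = b' then 3 else 1) else int q)"
 have xs: "x (Suc 0) = b" using x by simp
 have "nsum q [2,3,4,5,6] (cw t a' b') x = (\<Sum>c<q. m0 c c * (m0 c c * (L *
   (\<Sum>p<q. m0 p p * (m0 p p * (m0 p a * m0 p b * m0 p c *
    (\<Sum>p<q. m0 p p * (m0 p p * (m0 p a * m0 p c * m0 p b' *
    (\<Sum>p<q. m0 p p * (m0 p p * (m0 p b * m0 p c * m0 p a' *
     (\<Sum>y<q. if t = 6 \<or> t = 8 then m0 y a' * m0 y b' else 1)))))))))))))"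
  unfolding sum_distrib_left sum_distrib_right nsum.simps
  by (intro sum.cong refl) (use t in \<open>auto simp: cw_def cedges_def x xs L_def mult_ac\<close>)
 also have "(\<Sum>y<q. if t = 6 \<or> t = 8 then m0 y a' * m0 y b' else 1) = X"
  using sum_X[OF q x(5,6)] by (auto simp: X_def)
 finally have 1: "nsum q [2,3,4,5,6] (cw t a' b') x = (\<Sum>c<q. m0 c c * (m0 c c * (L *
   (\<Sum>p<q. m0 p p * (m0 p p * (m0 p a * m0 p b * m0 p c *
    (\<Sum>p<q. m0 p p * (m0 p p * (m0 p a * m0 p c * m0 p b' *
    (\<Sum>p<q. m0 p p * (m0 p p * (m0 p b * m0 p c * m0 p a' * X))))))))))))" .
 have v: "m0 0 0 = 1" "m0 0 (Suc 0) = 1" "m0 (Suc 0) 0 = 1" "m0 (Suc 0) (Suc 0) = -1"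
  by (simp_all add: m0_def)
 have L: "L = (if 7 <= t then sg a else 1)"
  using x(3,4) by (auto simp: L_def m0_def sg_def less_2_cases_iff)
 have "(if a' = a \<and> b' = b then kc q t * (if 7 <= t then sg a else 1) *
   (if t = 6 \<or> t = 8 then (if a = b then 3 else 1) else 1) else 0) =
   (if a' = a \<and> b' = b then 8 * (L * X) else 0)"
  using t by (auto simp: kc_def X_def L)
 moreover have "a = 0 \<or> a = Suc 0" "b = 0 \<or> b = Suc 0" "a' = 0 \<or> a' = Suc 0" "b' = 0 \<or> b' = Suc 0"
  using x by auto
 then have "nsum q [2,3,4,5,6] (cw t a' b') x = (if a' = a \<and> b' = b then 8 * (L * X) else 0)"
  unfolding 1 sum_lp2[OF q] by (elim disjE; simp add: v)
 ultimately show ?thesis by simp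
qed

lemma nsum_zero: assumes "\<And>x'. (\<And>k. k \<notin> set ks ==> x' k = x k) ==> F x' = 0" shows "nsum q ks F x = 0"
 using assms
proof (induction ks arbitrary: x)
 case (Cons k ks)
 have "nsum q ks F (x(k := y)) = 0" for y
  by (rule Cons.IH) (rule Cons.prems, auto)
 then show ?case by simp
qed simp

lemma nsum_full_zero:
 assumes "5 <= t" "t < 9" "2 <= x 0 \<or> 2 <= x 1"
 shows "nsum q [2,3,4,5,6] (cw t a' b') x = 0"
proof (rule nsum_zero)
 fix x' assume "\<And>k. k \<notin> set [2, 3, 4, 5, 6] ==> x' k = x k"
 then have "x' 0 = x 0" "x' 1 = x 1" by auto
 then have "m0 (x' 0) (x' 0) = 0 \<or> m0 (x' 1) (x' 1) = 0" using assms(3) by (auto simp: m0_def)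
 then show "cw t a' b' x' = 0" using assms(1,2) by (auto simp: cw_def cedges_def)
qed

text \<open>At a pin the looped vertex is joined to the column above only: two loops give
  \<open>1 + (-1) ^ b'\<close> and one loop gives \<open>1 - (-1) ^ b'\<close>.\<close>

lemma nsum_bdry:
 assumes q: "3 <= q" and b': "b' < 2"
 shows "nsum q [0,1,2,3,4,5,6] (cw 0 a' b'') x = kc q 0"
  "nsum q [0,1,2,3,4,5,6] (cw 1 a' b') x = kc q 1 * (if b' = 0 then 1 else 0)"
  "nsum q [0,1,2,3,4,5,6] (cw 2 a' b') x = kc q 2 * (if b' = 1 then 1 else 0)"
  "nsum q [1,2,3,4,5,6] (cw 3 a' b'') x = kc q 3 * (if x 0 < 2 then 1 else 0)"
  "nsum q [0,2,3,4,5,6] (cw 4 a' b'') x = kc q 4 * (if x 1 < 2 then 1 else 0)"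
proof -
 show "nsum q [0,1,2,3,4,5,6] (cw 0 a' b'') x = kc q 0"
  by (simp add: cw_def cedges_def kc_def power_numeral_reduce)
 have "nsum q [0,1,2,3,4,5,6] (cw 1 a' b') x = int q * (int q * (int q * (int q *
   (\<Sum>p<q. m0 p p * (m0 p p * (int q * (int q * m0 p b')))))))"
  by (simp add: cw_def cedges_def mult_ac)
 then show "nsum q [0,1,2,3,4,5,6] (cw 1 a' b') x = kc q 1 * (if b' = 0 then 1 else 0)"
  unfolding sum_lp2[OF q] using b' by (auto simp: less_2_cases_iff m0_def kc_def power_numeral_reduce)
 have "nsum q [0,1,2,3,4,5,6] (cw 2 a' b') x = int q * (int q * (int q * (int q *
   (\<Sum>p<q. m0 p p * (int q * (int q * m0 p b'))))))"
  by (simp add: cw_def cedges_def mult_ac)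
 then show "nsum q [0,1,2,3,4,5,6] (cw 2 a' b') x = kc q 2 * (if b' = 1 then 1 else 0)"
  unfolding sum_lp[OF q] using b' by (auto simp: less_2_cases_iff m0_def kc_def power_numeral_reduce)
 show "nsum q [1,2,3,4,5,6] (cw 3 a' b'') x = kc q 3 * (if x 0 < 2 then 1 else 0)"
  by (simp add: cw_def cedges_def kc_def power_numeral_reduce) (auto simp: m0_def)
 show "nsum q [0,2,3,4,5,6] (cw 4 a' b'') x = kc q 4 * (if x 1 < 2 then 1 else 0)"
  by (simp add: cw_def cedges_def kc_def power_numeral_reduce) (auto simp: m0_def)
qed

section \<open>The partition function of a grid of cells\<close>

definition ct :: "(nat => nat) => (nat => nat => bool) => nat => nat => nat => nat => nat" where
 "ct p U nr nc i j =
  (if i = 0 then (if j < nc then p j else 0)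
   else if i <= nr then (if j < nc then (if j = 0 then 7 else 5) + (if U (i - 1) j then 1 else 0) else 3)
   else (if j < nc then 4 else 0))"

lemma prod_list_concat_map:
 "prod_list (map h (concat (map g xs))) = (prod_list (map (%x. prod_list (map h (g x))) xs) :: 'a::comm_monoid_mult)"
 by (induction xs) auto

lemma prod_lessThan_mult:
 fixes f :: "nat => 'a::comm_monoid_mult"
 shows "(\<Prod>ka<n * k. f ka) = (\<Prod>i<n. \<Prod>j<k. f (i * k + j))"
proof (induction n)
 case (Suc n)
 have "(\<Prod>ka<n * k + m. f ka) = (\<Prod>ka<n * k. f ka) * (\<Prod>j<m. f (n * k + j))" for m
  by (induction m) (auto simp: mult.assoc)
 from this[of k] show ?case using Suc by (simp add: add.commute)
qed simp

lemma cw_cong: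
 assumes "\<And>k. k < 7 ==> x k = x' k" "5 <= t ==> a = a'" "5 <= t \<or> t = 1 \<or> t = 2 ==> b = b'"
 shows "cw t a b x = cw t a' b' x'"
 using assms by (auto simp: cw_def cedges_def)

lemma cedges_wf: "(k1, d, k2) \<in> set (cedges t) ==>
  k1 < 7 \<and> k2 < 7 \<and> (d = 0 \<or> d = 1 \<and> k2 = 0 \<and> 5 <= t \<or> d = 2 \<and> k2 = 1 \<and> (5 <= t \<or> t = 1 \<or> t = 2))"
 by (auto simp: cedges_def split: if_splits)

lemma ZZ_gg:
 "ZZ q m0 (gg w Wd) = (\<Sum>si\<in>{..<7 * length w} \<rightarrow>\<^sub>E {..<q}. \<Prod>ka<length w.
   cw (w ! ka) (si (7 * (ka + 1))) (si (7 * (ka + Wd) + 1)) (%k. si (7 * ka + k)))"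
proof -
 have "(\<Prod>(u, v)\<leftarrow>snd (gg w Wd). m0 (si u) (si v)) = (\<Prod>ka<length w.
   cw (w ! ka) (si (7 * (ka + 1))) (si (7 * (ka + Wd) + 1)) (%k. si (7 * ka + k)))" for si :: "nat => nat"
 proof -
  have "(\<Prod>(u, v)\<leftarrow>snd (gg w Wd). m0 (si u) (si v)) = (\<Prod>ka\<leftarrow>[0..<length w].
   cw (w ! ka) (si (7 * (ka + 1))) (si (7 * (ka + Wd) + 1)) (%k. si (7 * ka + k)))"
   unfolding gg_def snd_conv prod_list_concat_map cw_def
   by (intro arg_cong[of _ _ prod_list] map_cong refl, simp only: map_map,
     intro arg_cong[of _ _ prod_list] map_cong refl) (auto dest!: cedges_wf simp: cshift_def add.commute)
  also have "\<dots> = (\<Prod>ka\<in>set [0..<length w].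
   cw (w ! ka) (si (7 * (ka + 1))) (si (7 * (ka + Wd) + 1)) (%k. si (7 * ka + k)))"
   by (rule prod.distinct_set_conv_list[symmetric]) simp
  finally show ?thesis by (simp add: atLeast0LessThan)
 qed
 then show ?thesis by (simp add: ZZ_def gg_def)
qed

lemma prod_if_card: "(\<Prod>j<n::nat. if P j then (3::int) else 1) = 3 ^ card {j. j < n \<and> P j}"
proof -
 have "(\<Prod>j<n. if P j then (3::int) else 1) = (\<Prod>j\<in>{j\<in>{..<n}. P j}. 3)"
  by (rule prod.inter_filter[symmetric]) simp
 then show ?thesis by simp
qed

text \<open>Crossings force each row and each column to carry one bit; the bottom cells pin columns,
  and the last row and column of cells only end the wires. Summing over the bit of a row, whose sign
  comes from the single loop in column 0, leaves the difference of two products of coupling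
  weights.\<close>

theorem Z_grid:
 assumes q: "3 <= q" and nc: "0 < nc" and len: "length w = (nr + 2) * (nc + 1)"
  and w: "\<And>i j. i < nr + 2 ==> j < nc + 1 ==> w ! (i * (nc + 1) + j) = ct p U nr nc i j"
  and p: "\<And>j. j < nc ==> p j <= 2"
 shows "ZZ q m0 (gg w (nc + 1)) = (\<Prod>t\<leftarrow>w. kc q t) *
  (\<Sum>v\<in>{v \<in> {..<nc} \<rightarrow>\<^sub>E {..<2::nat}. \<forall>j<nc. (p j = 1 --> v j = 0) \<and> (p j = 2 --> v j = 1)}.
    \<Prod>i<nr. 3 ^ card {j. j < nc \<and> U i j \<and> v j = 0} - 3 ^ card {j. j < nc \<and> U i j \<and> v j = 1})"
proof -
 define Wd N where "Wd = nc + 1" and "N = (nr + 2) * Wd"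
 have Wd: "0 < Wd" by (simp add: Wd_def)
 \<comment> \<open>\<open>T\<close> collects the wire vertices, that is, the row vertices in the
   rows of crossings and the column vertices above the pins. The vertices in \<open>ks\<close> are
   private to their cell and are summed out first.\<close>
 define isA isB where "isA ka \<longleftrightarrow> 1 <= ka div Wd \<and> ka div Wd <= nr"
  and "isB ka \<longleftrightarrow> 1 <= ka div Wd \<and> ka mod Wd < nc" for ka
 define T where "T = {x. x < 7 * N \<and> (x mod 7 = 0 \<and> isA (x div 7) \<or> x mod 7 = 1 \<and> isB (x div 7))}"
 define ks where "ks ka = (if isA ka then [] else [0]) @ (if isB ka then [] else [1]) @ [2,3,4,5,6::nat]" for ka
 define R where "R ka = (%k. 7 * ka + k) ` set (ks ka)" for ka
 have ks: "k \<in> set (ks ka) \<longleftrightarrow> k < 7 \<and> 7 * ka + k \<notin> T" if "ka < N" for ka k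
 proof (cases "k < 7")
  case True
  then have "k \<in> {0,1,2,3,4,5,6}" by auto
  moreover have "(7 * ka + k) div 7 = ka" "(7 * ka + k) mod 7 = k" "7 * ka + k < 7 * N" using True that by auto
  ultimately show ?thesis by (auto simp: T_def ks_def)
 qed (auto simp: ks_def)
 have dks: "distinct (ks ka)" for ka by (auto simp: ks_def)
 have cell: "(i * Wd + j) div Wd = i" "(i * Wd + j) mod Wd = j" if "j < Wd" for i j
  using that by auto
 have cellN: "i * Wd + j < N" if "i < nr + 2" "j < Wd" for i j
 proof -
  have "i * Wd + j < Suc i * Wd" using that by simp
  also have "\<dots> <= N" unfolding N_def using that by (intro mult_le_mono1) auto
  finally show ?thesis .
 qed
 have cellE: "\<exists>i j. i < nr + 2 \<and> j < Wd \<and> ka = i * Wd + j" if "ka < N" for ka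
  using that Wd by (intro exI[of _ "ka div Wd"] exI[of _ "ka mod Wd"]) (auto simp: N_def less_mult_imp_div_less)
 have TA: "7 * (i * Wd + j) \<in> T" if "1 <= i" "i <= nr" "j <= nc" for i j
  using that cellN[of i j] cell[of j i] by (auto simp: T_def isA_def Wd_def)
 have TB: "7 * (i * Wd + j) + 1 \<in> T" if "1 <= i" "i <= nr + 1" "j < nc" for i j
 proof -
  have "(7 * (i * Wd + j) + 1) div 7 = i * Wd + j" "(7 * (i * Wd + j) + 1) mod 7 = 1" by auto
  then show ?thesis using that cellN[of i j] cell[of j i] unfolding T_def isB_def by (auto simp: Wd_def)
 qed
 have TE: "(\<exists>i j. 1 <= i \<and> i <= nr \<and> j <= nc \<and> x = 7 * (i * Wd + j)) \<or>
   (\<exists>i j. 1 <= i \<and> i <= nr + 1 \<and> j < nc \<and> x = 7 * (i * Wd + j) + 1)" if "x \<in> T" for x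
 proof -
  have "x div 7 < N" using that by (auto simp: T_def)
  then obtain i j where ij: "i < nr + 2" "j < Wd" "x div 7 = i * Wd + j" using cellE by blast
  have x: "x = 7 * (x div 7) + x mod 7" by simp
  show ?thesis
  proof (cases "x mod 7 = 0")
   case True
   then have "isA (x div 7)" using that by (auto simp: T_def)
   then have "1 <= i \<and> i <= nr \<and> j <= nc" using ij cell[of j i] by (auto simp: isA_def Wd_def)
   then show ?thesis using x True ij by auto
  next
   case False
   then have *: "x mod 7 = 1" "isB (x div 7)" using that by (auto simp: T_def)
   then have "1 <= i \<and> i <= nr + 1 \<and> j < nc" using ij cell[of j i] by (auto simp: isB_def)
   then show ?thesis using x * ij by auto
  qed
 qed
 define h where "h ka ta = nsum q (ks ka) (cw (w ! ka) (ta (7 * (ka + 1))) (ta (7 * (ka + Wd) + 1))) (%k. ta (7 * ka + k))"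
  for ka and ta :: "nat => nat"
 have wct: "w ! (i * Wd + j) = ct p U nr nc i j" if "i < nr + 2" "j < Wd" for i j
  using w that by (simp add: Wd_def)
 have Z1: "ZZ q m0 (gg w (nc + 1)) = (\<Sum>ta\<in>T \<rightarrow>\<^sub>E {..<q}. \<Prod>ka<N. h ka ta)"
 proof -
  define g where "g ta ka bh = cw (w ! ka) (ta (7 * (ka + 1))) (ta (7 * (ka + Wd) + 1))
    (%k. if k \<in> set (ks ka) then bh (7 * ka + k) else ta (7 * ka + k))"
   for ta bh :: "nat => nat" and ka
  have un: "{..<7 * N} = T \<union> (\<Union>ka<N. R ka)"
  proof (intro equalityI subsetI)
   fix x assume "x \<in> {..<7 * N}"
   then have "x div 7 < N" by auto
   moreover have "x = 7 * (x div 7) + x mod 7" by simp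
   ultimately have "x \<in> R (x div 7)" if "x \<notin> T"
    using ks[of "x div 7" "x mod 7"] that unfolding R_def by (intro image_eqI[of _ _ "x mod 7"]) auto
   then show "x \<in> T \<union> (\<Union>ka<N. R ka)" using \<open>x div 7 < N\<close> by blast
  qed (auto simp: R_def ks T_def)
  have disj: "T \<inter> (\<Union>ka<N. R ka) = {}" using ks by (fastforce simp: R_def)
  have Rdisj: "R k \<inter> R l = {}" if "k ~= l" for k l
   using that by (auto simp: R_def ks_def split: if_splits)
  have merge: "cw (w ! ka) (si (7 * (ka + 1))) (si (7 * (ka + Wd) + 1)) (%k. si (7 * ka + k)) = g ta ka bh"
   if ka: "ka < N" and si: "si = (%x. if x \<in> T then ta x else bh x)" for ka si ta bh
  proof -
   obtain i j where ij: "i < nr + 2" "j < Wd" "ka = i * Wd + j" using cellE[OF ka] by blast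
   have wka: "w ! ka = ct p U nr nc i j" using wct ij by simp
   show ?thesis unfolding g_def
   proof (rule cw_cong)
    fix k :: nat assume "k < 7"
    then show "si (7 * ka + k) = (if k \<in> set (ks ka) then bh (7 * ka + k) else ta (7 * ka + k))"
     using ks[OF ka] by (auto simp: si)
   next
    assume "5 <= w ! ka"
    then have "1 <= i \<and> i <= nr \<and> j < nc"
     using p[of j] unfolding wka ct_def by (auto split: if_splits)
    then have "7 * (i * Wd + (j + 1)) \<in> T" by (intro TA) auto
    then show "si (7 * (ka + 1)) = ta (7 * (ka + 1))" by (simp add: si ij add.assoc)
   next
    assume "5 <= w ! ka \<or> w ! ka = 1 \<or> w ! ka = 2"
    then have "i <= nr \<and> j < nc" unfolding wka ct_def using p[of j] by (auto split: if_splits)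
    then have "7 * ((i + 1) * Wd + j) + 1 \<in> T" by (intro TB) auto
    moreover have "(i + 1) * Wd + j = ka + Wd" by (simp add: ij)
    ultimately have "7 * (ka + Wd) + 1 \<in> T" by (simp only:)
    then show "si (7 * (ka + Wd) + 1) = ta (7 * (ka + Wd) + 1)" unfolding si by (simp only: if_True)
   qed
  qed
  have "ZZ q m0 (gg w (nc + 1)) = (\<Sum>si\<in>(T \<union> (\<Union>ka<N. R ka)) \<rightarrow>\<^sub>E {..<q}. \<Prod>ka<N.
    cw (w ! ka) (si (7 * (ka + 1))) (si (7 * (ka + Wd) + 1)) (%k. si (7 * ka + k)))"
   unfolding ZZ_gg un[symmetric] by (simp add: len N_def Wd_def)
  also have "\<dots> = (\<Sum>ta\<in>T \<rightarrow>\<^sub>E {..<q}. \<Sum>bh\<in>(\<Union>ka<N. R ka) \<rightarrow>\<^sub>E {..<q}. \<Prod>ka<N. g ta ka bh)"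
   unfolding sum_PiE_union[OF disj] by (intro sum.cong prod.cong refl merge) auto
  also have "\<dots> = (\<Sum>ta\<in>T \<rightarrow>\<^sub>E {..<q}. \<Prod>ka<N. \<Sum>rh\<in>R ka \<rightarrow>\<^sub>E {..<q}. g ta ka rh)"
  proof (rule sum.cong[OF refl], rule prod_sum_blocks)
   fix ta ka and si si' :: "nat => nat" assume "\<And>x. x \<in> R ka ==> si x = si' x"
   then have "(%k. if k \<in> set (ks ka) then si (7 * ka + k) else ta (7 * ka + k)) =
     (%k. if k \<in> set (ks ka) then si' (7 * ka + k) else ta (7 * ka + k))"
    by (auto simp: R_def)
   then show "g ta ka si = g ta ka si'" unfolding g_def by (simp only:)
  qed (use Rdisj in auto)
  also have "\<dots> = (\<Sum>ta\<in>T \<rightarrow>\<^sub>E {..<q}. \<Prod>ka<N. h ka ta)"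
   unfolding R_def g_def h_def by (intro sum.cong prod.cong refl nsum_PiE dks)
  finally show ?thesis .
 qed
 \<comment> \<open>One bit per row and one per column determine the spins on \<open>T\<close> that
   contribute.\<close>
 define D where "D = ({..<nr} \<rightarrow>\<^sub>E {..<2::nat}) \<times> ({..<nc} \<rightarrow>\<^sub>E {..<2::nat})"
 define mk where "mk = (%(s, v) x. if x \<in> T then (if x mod 7 = 0 then s ((x div 7) div Wd - 1) else v ((x div 7) mod Wd))
   else undefined :: nat)"
 have mkA: "mk (s, v) (7 * (i * Wd + j)) = s (i - 1)" if "1 <= i" "i <= nr" "j <= nc" for s v i j
  using TA[OF that] cell[of j i] that by (simp add: mk_def Wd_def)
 have mkB: "mk (s, v) (7 * (i * Wd + j) + 1) = v j" if "1 <= i" "i <= nr + 1" "j < nc" for s v i j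
 proof -
  have "(7 * (i * Wd + j) + 1) div 7 = i * Wd + j" "(7 * (i * Wd + j) + 1) mod 7 = 1" by auto
  then show ?thesis using TB[OF that] cell[of j i] that unfolding mk_def prod.case by (simp add: Wd_def)
 qed
 have ksf: "ks (i * Wd + j) = (if 1 <= i \<and> i <= nr then [] else [0]) @ (if 1 <= i \<and> j < nc then [] else [1]) @ [2,3,4,5,6]"
  if "j < Wd" for i j
  using cell[OF that] by (simp add: ks_def isA_def isB_def)
 have h_eq: "h (i * Wd + j) ta = nsum q (ks (i * Wd + j)) (cw (ct p U nr nc i j) (ta (7 * (i * Wd + (j + 1))))
   (ta (7 * ((i + 1) * Wd + j) + 1))) (%k. ta (7 * (i * Wd + j) + k))" if "i < nr + 2" "j < Wd" for i j ta
  using wct[OF that] by (simp add: h_def algebra_simps)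
 have full_t: "5 <= ct p U nr nc i j" "ct p U nr nc i j < 9" "7 <= ct p U nr nc i j \<longleftrightarrow> j = 0"
   "ct p U nr nc i j = 6 \<or> ct p U nr nc i j = 8 \<longleftrightarrow> U (i - 1) j"
  if "1 <= i" "i <= nr" "j < nc" for i j
  using that by (auto simp: ct_def)
 have hfull: "h (i * Wd + j) ta = (if ta (7 * (i * Wd + (j + 1))) = ta (7 * (i * Wd + j)) \<and>
    ta (7 * ((i + 1) * Wd + j) + 1) = ta (7 * (i * Wd + j) + 1)
   then kc q (ct p U nr nc i j) * (if j = 0 then sg (ta (7 * (i * Wd + j))) else 1) *
    (if U (i - 1) j then (if ta (7 * (i * Wd + j)) = ta (7 * (i * Wd + j) + 1) then 3 else 1) else 1) else 0)"
  if ij: "1 <= i" "i <= nr" "j < nc" and lt: "ta (7 * (i * Wd + j)) < 2" "ta (7 * (i * Wd + j) + 1) < 2"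
   "ta (7 * (i * Wd + (j + 1))) < 2" "ta (7 * ((i + 1) * Wd + j) + 1) < 2" for i j ta
 proof -
  have r: "i < nr + 2" "j < Wd" using ij by (auto simp: Wd_def)
  have k: "ks (i * Wd + j) = [2,3,4,5,6]" using ksf[OF r(2), of i] ij by simp
  show ?thesis unfolding h_eq[OF r] k
   by (subst nsum_full[OF q _ _ lt(1,2,3,4) full_t(1,2)[OF ij]]) (simp_all only: full_t(3,4)[OF ij] add_0_right)
 qed
 define inA inB where "inA i j \<longleftrightarrow> 1 <= i \<and> i <= nr \<and> j <= nc" and "inB i j \<longleftrightarrow> 1 <= i \<and> i <= nr + 1 \<and> j < nc" for i j
 \<comment> \<open>Where spins are not constant along a wire, or not below 2, the local sum of some
   cell vanishes.\<close>
 have zero: "ta \<in> mk ` D" if ta: "ta \<in> T \<rightarrow>\<^sub>E {..<q}" and nz: "(\<Prod>ka<N. h ka ta) ~= 0" for ta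
 proof -
  have nz: "h (i * Wd + j) ta ~= 0" if "i < nr + 2" "j < Wd" for i j
   using nz cellN[OF that] by auto
  have full: "ta (7 * (i * Wd + j)) < 2 \<and> ta (7 * (i * Wd + j) + 1) < 2" if ij: "1 <= i" "i <= nr" "j < nc" for i j
  proof (rule ccontr)
   assume c: "\<not> ?thesis"
   have r: "i < nr + 2" "j < Wd" using ij by (auto simp: Wd_def)
   have k: "ks (i * Wd + j) = [2,3,4,5,6]" using ksf[OF r(2), of i] ij by simp
   have "h (i * Wd + j) ta = 0" unfolding h_eq[OF r] k
    by (rule nsum_full_zero[OF full_t(1,2)[OF ij]]) (use c in auto)
   then show False using nz[OF r] by simp
  qed
  have A: "ta (7 * (i * Wd + j)) < 2" if ij: "1 <= i" "i <= nr" "j <= nc" for i j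
  proof (cases "j < nc")
   case False
   then have j: "j = nc" "i < nr + 2" "j < Wd" using ij by (auto simp: Wd_def)
   have k: "ks (i * Wd + j) = [1,2,3,4,5,6]" "ct p U nr nc i j = 3" using ksf[OF j(3), of i] ij j by (auto simp: ct_def)
   show ?thesis using nz[OF j(2,3)] nsum_bdry(4)[OF q, of 0] unfolding h_eq[OF j(2,3)] k by (auto split: if_splits)
  qed (use full ij in auto)
  have B: "ta (7 * (i * Wd + j) + 1) < 2" if ij: "1 <= i" "i <= nr + 1" "j < nc" for i j
  proof (cases "i <= nr")
   case False
   then have j: "i = nr + 1" "i < nr + 2" "j < Wd" using ij by (auto simp: Wd_def)
   have k: "ks (i * Wd + j) = [0,2,3,4,5,6]" "ct p U nr nc i j = 4" using ksf[OF j(3), of i] ij j by (auto simp: ct_def)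
   show ?thesis using nz[OF j(2,3)] nsum_bdry(5)[OF q, of 0] unfolding h_eq[OF j(2,3)] k by (auto split: if_splits)
  qed (use full ij in auto)
  have eq: "ta (7 * (i * Wd + (j + 1))) = ta (7 * (i * Wd + j)) \<and>
    ta (7 * ((i + 1) * Wd + j) + 1) = ta (7 * (i * Wd + j) + 1)" if ij: "1 <= i" "i <= nr" "j < nc" for i j
  proof -
   have "h (i * Wd + j) ta ~= 0" using ij by (intro nz) (auto simp: Wd_def)
   then show ?thesis
    using hfull[OF ij, of ta] A[of i j] A[of i "j + 1"] B[of i j] B[of "i + 1" j] ij by (auto split: if_splits)
  qed
  have rowA: "ta (7 * (i * Wd + j)) = ta (7 * (i * Wd))" if "1 <= i" "i <= nr" "j <= nc" for i j
   using that(3)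
  proof (induction j)
   case (Suc j) then show ?case using eq[of i j] that by auto
  qed simp
  have colB: "ta (7 * (i * Wd + j) + 1) = ta (7 * (1 * Wd + j) + 1)" if "1 <= i" "i <= nr + 1" "j < nc" for i j
   using that(1,2)
  proof (induction i rule: dec_induct)
   case (step i) then show ?case using eq[of i j] that(3) by auto
  qed simp
  define s v where "s = restrict (%i. ta (7 * ((i + 1) * Wd))) {..<nr}" and "v = restrict (%j. ta (7 * (1 * Wd + j) + 1)) {..<nc}"
  have "(s, v) \<in> D" unfolding D_def s_def v_def using A[of "_ + 1" 0] B[of 1] by auto
  moreover have "ta = mk (s, v)"
  proof
   fix x show "ta x = mk (s, v) x"
   proof (cases "x \<in> T")
    case True
    from TE[OF True] show ?thesis
    proof (elim disjE exE conjE)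
     fix i j assume ij: "1 <= i" "i <= nr" "j <= nc" and x: "x = 7 * (i * Wd + j)"
     then show ?thesis unfolding x mkA[OF ij] rowA[OF ij] by (cases i) (auto simp: s_def)
    next
     fix i j assume ij: "1 <= i" "i <= nr + 1" "j < nc" and x: "x = 7 * (i * Wd + j) + 1"
     then show ?thesis unfolding x mkB[OF ij] colB[OF ij] by (simp add: v_def)
    qed
   qed (use ta in \<open>auto simp: mk_def\<close>)
  qed
  ultimately show ?thesis by blast
 qed
 have mkT: "mk x \<in> T \<rightarrow>\<^sub>E {..<q}" if "x \<in> D" for x
 proof (rule PiE_I)
  obtain s v where x: "x = (s, v)" by fastforce
  have sv: "s i < 2" if "i < nr" for i using that \<open>x \<in> D\<close> unfolding x D_def by auto
  have sv': "v i < 2" if "i < nc" for i using that \<open>x \<in> D\<close> unfolding x D_def by auto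
  fix y assume "y \<in> T"
  from TE[OF this] show "mk x y \<in> {..<q}"
  proof (elim disjE exE conjE)
   fix i j assume ij: "1 <= i" "i <= nr" "j <= nc" and y: "y = 7 * (i * Wd + j)"
   have "s (i - 1) < 2" by (rule sv) (use ij in linarith)
   then show ?thesis unfolding y x mkA[OF ij] using q by auto
  next
   fix i j assume ij: "1 <= i" "i <= nr + 1" "j < nc" and y: "y = 7 * (i * Wd + j) + 1"
   show ?thesis unfolding y x mkB[OF ij] using sv'[of j] ij q by auto
  qed
 qed (auto simp: mk_def split: prod.splits)
 have inj: "inj_on mk D"
 proof (rule inj_onI)
  fix x y assume xy: "x \<in> D" "y \<in> D" "mk x = mk y"
  obtain s v s' v' where x: "x = (s, v)" "y = (s', v')" by fastforce
  have "s i = s' i" if "i < nr" for i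
   using fun_cong[OF xy(3), of "7 * ((i + 1) * Wd + 0)"] mkA[of "i + 1" 0] that unfolding x by simp
  moreover have "v j = v' j" if "j < nc" for j
   using fun_cong[OF xy(3), of "7 * (1 * Wd + j) + 1"] mkB[of 1 j] that unfolding x by simp
  moreover have "s i = s' i" if "\<not> i < nr" for i
   using xy(1,2) that unfolding x D_def by (auto simp: PiE_iff extensional_def)
  moreover have "v i = v' i" if "\<not> i < nc" for i
   using xy(1,2) that unfolding x D_def by (auto simp: PiE_iff extensional_def)
  ultimately have "s i = s' i" "v i = v' i" for i by blast+
  then show "x = y" unfolding x by (simp add: fun_eq_iff)
 qed
 have Z2: "ZZ q m0 (gg w (nc + 1)) = (\<Sum>x\<in>D. \<Prod>ka<N. h ka (mk x))"
 proof -
  have "(\<Sum>ta\<in>T \<rightarrow>\<^sub>E {..<q}. \<Prod>ka<N. h ka ta) = (\<Sum>ta\<in>mk ` D. \<Prod>ka<N. h ka ta)"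
  proof (rule sum.mono_neutral_right)
   have "finite T" by (rule finite_subset[of _ "{..<7 * N}"]) (auto simp: T_def)
   then show "finite (T \<rightarrow>\<^sub>E {..<q})" by (intro finite_PiE) auto
  qed (use zero mkT in blast)+
  then show ?thesis unfolding Z1 using inj by (simp add: sum.reindex)
 qed
 define F where "F i v a = (\<Prod>j<nc. if U i j then (if a = v j then 3 else (1::int)) else 1)" for i a and v :: "nat => nat"
 define pin where "pin v = (\<Prod>j<nc. if (p j = 1 --> v j = 0) \<and> (p j = 2 --> v j = 1) then 1 else (0::int))" for v :: "nat => nat"
 have hmk: "(\<Prod>ka<N. h ka (mk (s, v))) = (\<Prod>t\<leftarrow>w. kc q t) * (pin v * (\<Prod>i<nr. sg (s i) * F i v (s i)))"
  if sv: "(s, v) \<in> D" for s v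
 proof -
  have s: "s i < 2" if "i < nr" for i using that sv unfolding D_def by auto
  have v: "v i < 2" if "i < nc" for i using that sv unfolding D_def by auto
  \<comment> \<open>The factor of a cell beyond its constant \<open>kc\<close>; the sign of a row is
    charged to column 0.\<close>
  define ex where "ex i j = (if j < nc then (if i = 0 then (if (p j = 1 --> v j = 0) \<and> (p j = 2 --> v j = 1) then 1 else 0)
   else if i <= nr then (if j = 0 then sg (s (i - 1)) else 1) * (if U (i - 1) j then (if s (i - 1) = v j then 3 else 1) else 1)
   else 1) else (1::int))" for i j
  have cellv: "h (i * Wd + j) (mk (s, v)) = kc q (ct p U nr nc i j) * ex i j" if r: "i < nr + 2" "j < Wd" for i j
  proof -
   consider "i = 0" "j < nc" | "1 <= i" "i <= nr" "j < nc" | "i = nr + 1" "j < nc" | "i = 0" "j = nc" | "1 <= i" "i <= nr" "j = nc"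
    | "i = nr + 1" "j = nc" using r unfolding Wd_def by linarith
   then show ?thesis
   proof cases
    case 1
    have k: "ks (i * Wd + j) = [0,1,2,3,4,5,6]" using ksf[OF r(2), of i] 1 by simp
    have c: "ct p U nr nc i j = p j" "p j = 0 \<or> p j = 1 \<or> p j = 2" using p[OF 1(2)] 1 by (auto simp: ct_def)
    have b: "mk (s, v) (7 * ((i + 1) * Wd + j) + 1) = v j" using mkB[of 1 j s v] 1 by simp
    show ?thesis using c(2) unfolding h_eq[OF r] k c(1) b
     by (elim disjE) (simp_all only: nsum_bdry[OF q v[OF 1(2)]], auto simp: ex_def 1)
   next
    case 2
    have vals: "mk (s, v) (7 * (i * Wd + (j + 1))) = s (i - 1)" "mk (s, v) (7 * (i * Wd + j)) = s (i - 1)"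
     "mk (s, v) (7 * ((i + 1) * Wd + j) + 1) = v j" "mk (s, v) (7 * (i * Wd + j) + 1) = v j"
     using mkA[of i j] mkA[of i "j + 1"] mkB[of i j] mkB[of "i + 1" j] 2 by auto
    have s2: "s (i - 1) < 2" by (rule s) (use 2 in linarith)
    show ?thesis using hfull[OF 2, of "mk (s, v)", unfolded vals, OF s2 v[OF 2(3)] s2 v[OF 2(3)]] 2
     by (simp add: ex_def)
   next
    case 3
    have k: "ks (i * Wd + j) = [0,2,3,4,5,6]" "ct p U nr nc i j = 4" using ksf[OF r(2), of i] 3 by (auto simp: ct_def)
    have b: "mk (s, v) (7 * (i * Wd + j) + 1) = v j" using mkB[of i j] 3 by auto
    show ?thesis unfolding h_eq[OF r] k nsum_bdry(5)[OF q zero_less_numeral] b using v[OF 3(2)] 3 by (simp add: ex_def)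
   next
    case 4
    have k: "ks (i * Wd + j) = [0,1,2,3,4,5,6]" "ct p U nr nc i j = 0" using ksf[OF r(2), of i] 4 by (auto simp: ct_def)
    show ?thesis unfolding h_eq[OF r] k nsum_bdry(1)[OF q zero_less_numeral] using 4 by (simp add: ex_def)
   next
    case 5
    have k: "ks (i * Wd + j) = [1,2,3,4,5,6]" "ct p U nr nc i j = 3" using ksf[OF r(2), of i] 5 by (auto simp: ct_def)
    have b: "mk (s, v) (7 * (i * Wd + j) + 0) = s (i - 1)" using mkA[of i j] 5 by auto
    have "s (i - 1) < 2" by (rule s) (use 5 in linarith)
    then show ?thesis unfolding h_eq[OF r] k nsum_bdry(4)[OF q zero_less_numeral] b using 5 by (simp add: ex_def)
   next
    case 6
    have k: "ks (i * Wd + j) = [0,1,2,3,4,5,6]" "ct p U nr nc i j = 0" using ksf[OF r(2), of i] 6 by (auto simp: ct_def)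
    show ?thesis unfolding h_eq[OF r] k nsum_bdry(1)[OF q zero_less_numeral] using 6 by (simp add: ex_def)
   qed
  qed
  have "(\<Prod>ka<N. h ka (mk (s, v))) = (\<Prod>i<nr + 2. \<Prod>j<Wd. kc q (w ! (i * Wd + j)) * ex i j)"
   unfolding N_def prod_lessThan_mult by (intro prod.cong refl) (use cellv wct in auto)
  also have "\<dots> = (\<Prod>ka<N. kc q (w ! ka)) * (\<Prod>i<nr + 2. \<Prod>j<Wd. ex i j)"
   unfolding N_def prod_lessThan_mult by (simp only: prod.distrib)
  also have "(\<Prod>ka<N. kc q (w ! ka)) = (\<Prod>t\<leftarrow>w. kc q t)"
   using prod.list_conv_set_nth[of "map (kc q) w"] by (simp add: len N_def Wd_def atLeast0LessThan)
  also have "(\<Prod>i<nr + 2. \<Prod>j<Wd. ex i j) = (\<Prod>i<nr + 2. \<Prod>j<nc. ex i j)"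
  proof (rule prod.cong[OF refl])
   fix i show "(\<Prod>j<Wd. ex i j) = (\<Prod>j<nc. ex i j)"
    unfolding Wd_def by (simp add: prod.lessThan_Suc) (simp add: ex_def)
  qed
  also have "\<dots> = (\<Prod>j<nc. ex 0 j) * (\<Prod>i<nr. \<Prod>j<nc. ex (Suc i) j)"
  proof -
   have "(\<Prod>i<nr + 2. \<Prod>j<nc. ex i j) = (\<Prod>i<Suc nr. \<Prod>j<nc. ex i j) * (\<Prod>j<nc. ex (Suc nr) j)" by simp
   also have "(\<Prod>j<nc. ex (Suc nr) j) = 1" by (rule prod.neutral) (simp add: ex_def)
   also have "(\<Prod>i<Suc nr. \<Prod>j<nc. ex i j) = (\<Prod>j<nc. ex 0 j) * (\<Prod>i<nr. \<Prod>j<nc. ex (Suc i) j)"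
    by (rule prod.lessThan_Suc_shift)
   finally show ?thesis by simp
  qed
  also have "(\<Prod>j<nc. ex 0 j) = pin v" unfolding pin_def by (intro prod.cong refl) (simp add: ex_def)
  also have "(\<Prod>i<nr. \<Prod>j<nc. ex (Suc i) j) = (\<Prod>i<nr. sg (s i) * F i v (s i))"
  proof (intro prod.cong refl)
   fix i assume i: "i \<in> {..<nr}"
   have "(\<Prod>j<nc. ex (Suc i) j) = (\<Prod>j<nc. (if j = 0 then sg (s i) else 1) * (if U i j then (if s i = v j then 3 else 1) else 1))"
    by (intro prod.cong refl) (use i in \<open>auto simp: ex_def\<close>)
   also have "\<dots> = sg (s i) * F i v (s i)"
    unfolding prod.distrib F_def using nc by (simp add: prod.delta)
   finally show "(\<Prod>j<nc. ex (Suc i) j) = sg (s i) * F i v (s i)" .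
  qed
  finally show ?thesis .
 qed
 have "ZZ q m0 (gg w (nc + 1)) = (\<Sum>(s, v)\<in>D. (\<Prod>t\<leftarrow>w. kc q t) * (pin v * (\<Prod>i<nr. sg (s i) * F i v (s i))))"
  unfolding Z2 by (intro sum.cong refl) (use hmk in auto)
 also have "\<dots> = (\<Sum>v\<in>{..<nc} \<rightarrow>\<^sub>E {..<2}. \<Sum>s\<in>{..<nr} \<rightarrow>\<^sub>E {..<2}. (\<Prod>t\<leftarrow>w. kc q t) * (pin v * (\<Prod>i<nr. sg (s i) * F i v (s i))))"
  unfolding D_def sum.cartesian_product[symmetric] by (rule sum.swap)
 also have "\<dots> = (\<Prod>t\<leftarrow>w. kc q t) * (\<Sum>v\<in>{..<nc} \<rightarrow>\<^sub>E {..<2}. pin v * (\<Prod>i<nr. \<Sum>a<2. sg a * F i v a))"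
  by (simp add: sum_distrib_left prod_sum_PiE)
 also have "(\<Sum>v\<in>{..<nc} \<rightarrow>\<^sub>E {..<2}. pin v * (\<Prod>i<nr. \<Sum>a<2. sg a * F i v a)) =
  (\<Sum>v\<in>{v \<in> {..<nc} \<rightarrow>\<^sub>E {..<2::nat}. \<forall>j<nc. (p j = 1 --> v j = 0) \<and> (p j = 2 --> v j = 1)}. \<Prod>i<nr. \<Sum>a<2. sg a * F i v a)"
 proof -
  have pin: "pin v = (if \<forall>j<nc. (p j = 1 --> v j = 0) \<and> (p j = 2 --> v j = 1) then 1 else 0)" for v
   unfolding pin_def by auto
  have "pin v * x = (if \<forall>j<nc. (p j = 1 --> v j = 0) \<and> (p j = 2 --> v j = 1) then x else 0)" for v x
   unfolding pin if_distrib[of "%y. y * x"] by (simp only: mult_1_left mult_zero_left)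
  then show ?thesis by (simp only:) (rule sum.inter_filter[symmetric], simp add: finite_PiE)
 qed
 also have "\<dots> = (\<Sum>v\<in>{v \<in> {..<nc} \<rightarrow>\<^sub>E {..<2::nat}. \<forall>j<nc. (p j = 1 --> v j = 0) \<and> (p j = 2 --> v j = 1)}.
    \<Prod>i<nr. 3 ^ card {j. j < nc \<and> U i j \<and> v j = 0} - 3 ^ card {j. j < nc \<and> U i j \<and> v j = 1})"
 proof (intro sum.cong prod.cong refl)
  fix v i
  have F: "F i v a = 3 ^ card {j. j < nc \<and> U i j \<and> v j = a}" for a
  proof -
   have "F i v a = (\<Prod>j<nc. if U i j \<and> v j = a then 3 else 1)" unfolding F_def by (intro prod.cong refl) auto
   then show ?thesis by (simp only: prod_if_card)
  qed
  have "(\<Sum>a<2. sg a * F i v a) = F i v 0 - F i v 1" by (simp add: numeral_2_eq_2 sg_def)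
  then show "(\<Sum>a<2. sg a * F i v a) = 3 ^ card {j. j < nc \<and> U i j \<and> v j = 0} - 3 ^ card {j. j < nc \<and> U i j \<and> v j = 1}"
   by (simp only: F)
 qed
 finally show ?thesis .
qed

section \<open>Drawing the grid on the lattice\<close>

lemma distinct_filter_nth:
 "distinct (filter P xs) ==> k < length xs ==> l < length xs ==> P (xs ! k) ==> xs ! k = xs ! l ==> k = l"
proof (induction xs arbitrary: k l)
 case (Cons x xs)
 show ?case
 proof (cases k)
  case 0
  then show ?thesis using Cons.prems by (cases l) (auto split: if_splits)
 next
  case (Suc k')
  show ?thesis
  proof (cases l)
   case 0
   then have "xs ! k' = x" "xs ! k' \<in> set xs" using Cons.prems Suc by auto
   then show ?thesis using Cons.prems Suc by (auto split: if_splits)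
  next
   case l: (Suc l')
   then show ?thesis using Cons.IH[of k' l'] Cons.prems Suc by (auto split: if_splits)
  qed
 qed
qed simp

lemma distinct_concat_map_upt:
 assumes "\<And>k. k < N ==> distinct (g k)" "\<And>k l x. k < N ==> l < N ==> x \<in> set (g k) ==> x \<in> set (g l) ==> k = l"
 shows "distinct (concat (map g [0..<N]))"
 using assms
proof (induction N)
 case (Suc N)
 have "distinct (concat (map g [0..<N]))"
 proof (rule Suc.IH)
  fix k l x assume "k < N" "l < N" "x \<in> set (g k)" "x \<in> set (g l)"
  then show "k = l" by (intro Suc.prems(2)) auto
 qed (use Suc.prems(1) in auto)
 moreover have "set (concat (map g [0..<N])) \<inter> set (g N) = {}"
 proof (intro equals0I)
  fix x assume "x \<in> set (concat (map g [0..<N])) \<inter> set (g N)"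
  then obtain k where "k < N" "x \<in> set (g k)" "x \<in> set (g N)" by auto
  then show False using Suc.prems(2)[of k N x] by simp
 qed
 ultimately show ?case using Suc.prems(1)[of N] by simp
qed simp

text \<open>In the coordinates \<open>offa + offb\<close> and \<open>offa - offb\<close> a cell is a
  4 by 4 square. Vertices 0, 1, 2 have even coordinates and 3 to 6 odd ones, all at different
  places. Unit edges change both parities, so they join the two kinds.\<close>

definition offa :: "nat => int" where
 "offa k = (if k = 0 then 1 else if k = 1 then 1 else if k = 2 then 2 else if k = 3 then 1 else if k = 4 then 2
  else if k = 5 then 2 else 3)"

definition offb :: "nat => int" where
 "offb k = (if k = 0 then -1 else if k = 1 then 1 else if k = 2 then 0 else if k = 3 then 0 else if k = 4 then -1
  else if k = 5 then 1 else 0)"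

text \<open>
 Rows run along the diagonal direction \<open>(2, -2)\<close> and columns along \<open>(2, 2)\<close>, so that all edges
 of a cell become unit edges.
\<close>

definition gpos :: "nat => nat => int \<times> int" where
 "gpos Wd x = (let ka = x div 7; i = int (ka div Wd); j = int (ka mod Wd) in
   (2 * j + 2 * i + offa (x mod 7), 2 * j - 2 * i + offb (x mod 7)))"

lemma gpos_inj:
 assumes "gpos Wd x = gpos Wd y"
 shows "x = y"
proof -
 define i j i' j' where "i = int (x div 7 div Wd)" and "j = int (x div 7 mod Wd)"
  and "i' = int (y div 7 div Wd)" and "j' = int (y div 7 mod Wd)"
 define k k' where "k = x mod 7" and "k' = y mod 7"
 have k: "k \<in> {0,1,2,3,4,5,6}" "k' \<in> {0,1,2,3,4,5,6}" by (auto simp: k_def k'_def)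
 have e: "2 * j + 2 * i + offa k = 2 * j' + 2 * i' + offa k'" "2 * j - 2 * i + offb k = 2 * j' - 2 * i' + offb k'"
  using assms by (auto simp: gpos_def Let_def i_def j_def i'_def j'_def k_def k'_def)
 define ox oy where "ox k = offa k + offb k" and "oy k = offa k - offb k" for k
 have e': "4 * j + ox k = 4 * j' + ox k'" "4 * i + oy k = 4 * i' + oy k'"
  using e unfolding ox_def oy_def by linarith+
 have o: "0 <= ox k" "ox k < 4" "0 <= oy k" "oy k < 4" "0 <= ox k'" "ox k' < 4" "0 <= oy k'" "oy k' < 4"
  using k by (auto simp: ox_def oy_def offa_def offb_def)
 have ij: "j = j'" "i = i'" using e' o by linarith+
 then have "ox k = ox k'" "oy k = oy k'" using e' by auto
 then have "offa k = offa k'" "offb k = offb k'" unfolding ox_def oy_def by linarith+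
 then have "k = k'" using k by (elim insertE emptyE) (simp_all add: offa_def offb_def)
 moreover have "x div 7 = y div 7"
 proof -
  have "x div 7 div Wd = y div 7 div Wd" "x div 7 mod Wd = y div 7 mod Wd"
   using ij by (auto simp: i_def j_def i'_def j'_def)
  then show ?thesis by (metis div_mult_mod_eq)
 qed
 ultimately show ?thesis unfolding k_def k'_def by (metis div_mult_mod_eq)
qed

lemma gpos_cell:
 assumes "k < 7" "j < Wd"
 shows "gpos Wd (7 * (i * Wd + j) + k) = (2 * int j + 2 * int i + offa k, 2 * int j - 2 * int i + offb k)"
proof -
 have 7: "(7 * x + k) div 7 = x" "(7 * x + k) mod 7 = k" for x using assms by auto
 have "(i * Wd + j) div Wd = i" "(i * Wd + j) mod Wd = j" using assms by auto
 then show ?thesis unfolding gpos_def Let_def 7 by simp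
qed

lemma off_simps:
 "offa 0 = 1" "offa (Suc 0) = 1" "offa 2 = 2" "offa 3 = 1" "offa 4 = 2" "offa 5 = 2" "offa 6 = 3"
 "offb 0 = -1" "offb (Suc 0) = 1" "offb 2 = 0" "offb 3 = 0" "offb 4 = -1" "offb 5 = 1" "offb 6 = 0"
 by (simp_all add: offa_def offb_def)

lemma cedges_unit:
 assumes "(k1, d, k2) \<in> set (cedges t)" "\<not> (d = 0 \<and> k1 = k2)"
 shows "\<bar>offa k1 - offa k2 - (if d = 0 then 0 else 2)\<bar> +
   \<bar>offb k1 - offb k2 - (if d = 0 then 0 else if d = 1 then 2 else - 2)\<bar> = 1"
  "3 <= k1" "k2 < 3"
proof -
 have "list_all (%(k1, d, k2). d = 0 \<and> k1 = k2 \<or> \<bar>offa k1 - offa k2 - (if d = 0 then 0 else 2)\<bar> +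
   \<bar>offb k1 - offb k2 - (if d = 0 then 0 else if d = 1 then 2 else - 2)\<bar> = 1 \<and> 3 <= k1 \<and> k2 < 3) (cedges t)"
  unfolding cedges_def by (simp add: off_simps)
 from bspec[OF this[unfolded list_all_iff] assms(1), unfolded prod.case]
 have *: "\<bar>offa k1 - offa k2 - (if d = 0 then 0 else 2)\<bar> +
   \<bar>offb k1 - offb k2 - (if d = 0 then 0 else if d = 1 then 2 else - 2)\<bar> = 1 \<and> 3 <= k1 \<and> k2 < 3"
  by (rule disjE) (use assms(2) in blast, assumption)
 show "\<bar>offa k1 - offa k2 - (if d = 0 then 0 else 2)\<bar> +
   \<bar>offb k1 - offb k2 - (if d = 0 then 0 else if d = 1 then 2 else - 2)\<bar> = 1"
  "3 <= k1" "k2 < 3"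
  by (rule conjunct1[OF *], rule conjunct1[OF conjunct2[OF *]], rule conjunct2[OF conjunct2[OF *]])
qed

theorem planar_gg:
 assumes len: "length w = (nr + 2) * (nc + 1)"
  and w: "\<And>i j. i < nr + 2 ==> j < nc + 1 ==> w ! (i * (nc + 1) + j) = ct p U nr nc i j"
  and p: "\<And>j. j < nc ==> p j <= 2"
 shows "planar (gg w (nc + 1))"
proof -
 define Wd N where "Wd = nc + 1" and "N = length w"
 have Wd: "0 < Wd" by (simp add: Wd_def)
 define g where "g ka = map (%(k1, d, k2). (7 * ka + k1, 7 * (ka + cshift Wd d) + k2)) (cedges (w ! ka))" for ka
 define es where "es = concat (map g [0..<N])"
 have edge: "\<exists>ka k1 d k2 i j. ka < N \<and> (k1, d, k2) \<in> set (cedges (w ! ka)) \<and> u = 7 * ka + k1 \<and>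
   v = 7 * (ka + cshift Wd d) + k2 \<and> ka = i * Wd + j \<and> i < nr + 2 \<and> j < Wd \<and>
   (d = 1 --> j + 1 < Wd) \<and> (d = 2 --> i + 1 < nr + 2)" if uv: "(u, v) \<in> set es" for u v
 proof -
  obtain ka k1 d k2 where 1: "ka < N" "(k1, d, k2) \<in> set (cedges (w ! ka))" "u = 7 * ka + k1"
   "v = 7 * (ka + cshift Wd d) + k2"
   using uv unfolding es_def g_def by auto
  define i j where "i = ka div Wd" and "j = ka mod Wd"
  have "ka < (nr + 2) * Wd" using 1(1) len by (simp only: N_def Wd_def)
  then have ij: "ka = i * Wd + j" "i < nr + 2" "j < Wd"
   using Wd by (auto simp only: i_def j_def less_mult_imp_div_less div_mult_mod_eq mod_less_divisor)
  have wk: "w ! ka = ct p U nr nc i j" using w[of i j] ij by (simp add: Wd_def)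
  have "(d = 1 --> j + 1 < Wd) \<and> (d = 2 --> i + 1 < nr + 2)"
   using cedges_wf[OF 1(2)] p[of j] unfolding wk ct_def Wd_def by (auto split: if_splits)
  then show ?thesis using 1 ij by blast
 qed
 have "planar (7 * N, es)"
 proof (rule planar_lattice[where p = "gpos Wd"])
  show "inj_on (gpos Wd) {..<7 * N}" by (auto intro!: inj_onI dest: gpos_inj)
 next
  fix u v assume uv: "(u, v) \<in> set es"
  obtain ka k1 d k2 i j where 1: "ka < N" "(k1, d, k2) \<in> set (cedges (w ! ka))" "u = 7 * ka + k1"
   "v = 7 * (ka + cshift Wd d) + k2" "ka = i * Wd + j" "i < nr + 2" "j < Wd"
   "d = 1 --> j + 1 < Wd" "d = 2 --> i + 1 < nr + 2" using edge[OF uv] by blast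
  define i' j' where "i' = (if d = 2 then i + 1 else i)" and "j' = (if d = 1 then j + 1 else j)"
  note wf = cedges_wf[OF 1(2)]
  have t: "ka + cshift Wd d = i' * Wd + j'" using wf 1(5) by (auto simp: cshift_def i'_def j'_def)
  have r: "i' < nr + 2" "j' < Wd" using 1 by (auto simp: i'_def j'_def)
  have "i' * Wd + j' < Suc i' * Wd" using r by simp
  also have "\<dots> <= (nr + 2) * Wd" using r by (intro mult_le_mono1) auto
  finally have "i' * Wd + j' < N" unfolding N_def len Wd_def .
  then show "u < 7 * N \<and> v < 7 * N" using 1 wf t by auto
  assume ne: "u ~= v"
  have k: "k1 < 7" "k2 < 7" using wf by auto
  have "\<not> (d = 0 \<and> k1 = k2)" using ne 1 by (auto simp: cshift_def)
  from cedges_unit(1)[OF 1(2) this]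
  show "\<bar>fst (gpos Wd u) - fst (gpos Wd v)\<bar> + \<bar>snd (gpos Wd u) - snd (gpos Wd v)\<bar> = 1"
   unfolding 1(3,4) t unfolding 1(5) gpos_cell[OF k(1) 1(7)] gpos_cell[OF k(2) r(2)]
   using wf by (auto simp: i'_def j'_def algebra_simps split: if_splits)
 next
  fix k l assume kl: "k < length es" "l < length es" "k ~= l" "fst (es ! k) ~= snd (es ! k)"
  \<comment> \<open>An edge that is not a loop lists a vertex of kind 3 to 6 first and one of kind 0
    to 2 second, so its unordered pair of ends determines the ordered one.\<close>
  have cls: "3 <= u mod 7 \<and> v mod 7 < 3" if uv: "(u, v) \<in> set es" "u ~= v" for u v
  proof -
   obtain ka k1 d k2 where 1: "(k1, d, k2) \<in> set (cedges (w ! ka))" "u = 7 * ka + k1"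
    "v = 7 * (ka + cshift Wd d) + k2" using edge[OF uv(1)] by blast
   have "\<not> (d = 0 \<and> k1 = k2)" using uv(2) 1 by (auto simp: cshift_def)
   then have c: "3 <= k1" "k2 < 3" using cedges_unit(2,3)[OF 1(1)] by auto
   have k: "k1 < 7" "k2 < 7" using cedges_wf[OF 1(1)] by auto
   have m: "(7 * x + k) mod 7 = k" if "k < 7" for x k :: nat using that by auto
   show ?thesis unfolding 1(2,3) m[OF k(1)] m[OF k(2)] using c by simp
  qed
  have "distinct (filter (%(u, v). u ~= v) es)"
   unfolding es_def filter_concat map_map
  proof (rule distinct_concat_map_upt)
   fix ka
   have "distinct (filter (%(k1, d, k2). \<not> (d = 0 \<and> k1 = k2)) (cedges t))" for t
    by (simp add: cedges_def)
   moreover have "filter (%(u, v). u ~= v) (g ka) = map (%(k1, d, k2). (7 * ka + k1, 7 * (ka + cshift Wd d) + k2))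
     (filter (%(k1, d, k2). \<not> (d = 0 \<and> k1 = k2)) (cedges (w ! ka)))"
   proof -
    have "7 * ka + k1 ~= 7 * (ka + cshift Wd d) + k2 \<longleftrightarrow> \<not> (d = 0 \<and> k1 = k2)"
     if "(k1, d, k2) \<in> set (cedges (w ! ka))" for k1 d k2
     using cedges_wf[OF that] Wd by (auto simp: cshift_def)
    then have "((%(u, v). u ~= v) \<circ> (%(k1, d, k2). (7 * ka + k1, 7 * (ka + cshift Wd d) + k2))) x =
      (%(k1, d, k2). \<not> (d = 0 \<and> k1 = k2)) x" if "x \<in> set (cedges (w ! ka))" for x
     using that by (cases x) (simp only: comp_def prod.case)
    then show ?thesis unfolding g_def filter_map by (intro arg_cong[of _ _ "map _"] filter_cong refl)
   qed
   moreover have "inj_on (%(k1, d, k2). (7 * ka + k1, 7 * (ka + cshift Wd d) + k2)) (set (cedges (w ! ka)))"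
   proof (rule inj_onI)
    fix x y assume xy: "x \<in> set (cedges (w ! ka))" "y \<in> set (cedges (w ! ka))"
     and eq: "(case x of (k1, d, k2) => (7 * ka + k1, 7 * (ka + cshift Wd d) + k2)) =
      (case y of (k1, d, k2) => (7 * ka + k1, 7 * (ka + cshift Wd d) + k2))"
    obtain k1 d k2 k1' d' k2' where x: "x = (k1, d, k2)" "y = (k1', d', k2')" by (metis prod_cases3)
    have e: "7 * ka + k1 = 7 * ka + k1'" "7 * (ka + cshift Wd d) + k2 = 7 * (ka + cshift Wd d') + k2'"
     using eq unfolding x prod.case by blast+
    from xy have wf: "k2 < 7" "k2' < 7" "d = 0 \<or> d = 1 \<and> k2 = 0 \<or> d = 2 \<and> k2 = 1" "d' = 0 \<or> d' = 1 \<and> k2' = 0 \<or> d' = 2 \<and> k2' = 1"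
     using cedges_wf unfolding x by blast+
    have "(7 * (ka + cshift Wd d) + k2) mod 7 = (7 * (ka + cshift Wd d') + k2') mod 7" by (simp only: e(2))
    moreover have m: "(7 * x + k) mod 7 = k" if "k < 7" for x k :: nat using that by auto
    ultimately have "k2 = k2'" using wf(1,2) by (simp only: m)
    moreover from this e have "cshift Wd d = cshift Wd d'" by simp
    then have "d = d'" using wf \<open>k2 = k2'\<close> Wd by (auto simp: cshift_def split: if_splits)
    ultimately show "x = y" using e x by simp
   qed
   ultimately show "distinct ((filter (%(u, v). u ~= v) \<circ> g) ka)"
    by (auto simp: distinct_map intro: inj_on_subset)
  next
   fix ka ka' x assume "x \<in> set ((filter (%(u, v). u ~= v) \<circ> g) ka)" "x \<in> set ((filter (%(u, v). u ~= v) \<circ> g) ka')"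
   then obtain k1 k1' where "fst x = 7 * ka + k1" "k1 < 7" "fst x = 7 * ka' + k1'" "k1' < 7"
    unfolding g_def by (auto dest!: cedges_wf)
   then show "ka = ka'" by linarith
  qed
  note dist = distinct_filter_nth[OF this kl(1,2)]
  show "{fst (es ! k), snd (es ! k)} ~= {fst (es ! l), snd (es ! l)}"
  proof
   assume e: "{fst (es ! k), snd (es ! k)} = {fst (es ! l), snd (es ! l)}"
   obtain u v u' v' where uv: "es ! k = (u, v)" "es ! l = (u', v')" by fastforce
   have in_es: "(u, v) \<in> set es" "(u', v') \<in> set es" using kl uv nth_mem by metis+
   have ne: "u ~= v" "u' ~= v'" using kl(4) e uv by (auto simp: doubleton_eq_iff)
   have "u = u' \<and> v = v'" using e cls[OF in_es(1) ne(1)] cls[OF in_es(2) ne(2)] unfolding uv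
    by (auto simp: doubleton_eq_iff)
   then show False using dist ne uv kl(3) by auto
  qed
 qed
 then show ?thesis by (simp add: gg_def es_def g_def[abs_def] N_def Wd_def)
qed

section \<open>Generic points and Kronecker substitution\<close>

text \<open>Polynomials stay unexpanded: a machine has to evaluate them, there are only countably
  many, and bounds on degree and coefficients are all that is asked of their size.\<close>

datatype pexp = PC int | PV nat | PA pexp pexp | PM pexp pexp

instance pexp :: countable by countable_datatype

fun ev :: "(nat => 'a::comm_ring_1) => pexp => 'a" where
 "ev x (PC c) = of_int c"
| "ev x (PV i) = x i"
| "ev x (PA a b) = ev x a + ev x b"
| "ev x (PM a b) = ev x a * ev x b"

fun pdeg :: "pexp => nat" where
 "pdeg (PC c) = 0" | "pdeg (PV i) = 1" | "pdeg (PA a b) = max (pdeg a) (pdeg b)" | "pdeg (PM a b) = pdeg a + pdeg b"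

text \<open>Bounds the sum of the absolute values of the coefficients when each variable counts \<open>s\<close>.\<close>

fun pnorm :: "nat => pexp => nat" where
 "pnorm s (PC c) = nat \<bar>c\<bar>" | "pnorm s (PV i) = s" | "pnorm s (PA a b) = pnorm s a + pnorm s b"
| "pnorm s (PM a b) = pnorm s a * pnorm s b"

fun pvars :: "pexp => nat set" where
 "pvars (PC c) = {}" | "pvars (PV i) = {i}" | "pvars (PA a b) = pvars a \<union> pvars b" | "pvars (PM a b) = pvars a \<union> pvars b"

definition psum :: "pexp list => pexp" where "psum es = foldr PA es (PC 0)"

text \<open>The coefficient of the \<open>j\<close>-th power of variable \<open>v\<close> is again
  an expression, in the other variables, which allows induction on the number of variables.\<close>

fun pcoef :: "nat => nat => pexp => pexp" where
 "pcoef v j (PC c) = PC (if j = 0 then c else 0)"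
| "pcoef v j (PV i) = (if i = v then PC (if j = 1 then 1 else 0) else if j = 0 then PV i else PC 0)"
| "pcoef v j (PA a b) = PA (pcoef v j a) (pcoef v j b)"
| "pcoef v j (PM a b) = psum (map (%i. PM (pcoef v i a) (pcoef v (j - i) b)) [0..<Suc j])"

lemma ev_psum: "ev x (psum es) = (\<Sum>e\<leftarrow>es. ev x e)"
 by (induction es) (auto simp: psum_def)

lemma pvars_psum: "pvars (psum es) = (\<Union>e\<in>set es. pvars e)"
 by (induction es) (auto simp: psum_def)

lemma pnorm_psum: "pnorm s (psum es) = (\<Sum>e\<leftarrow>es. pnorm s e)"
 by (induction es) (auto simp: psum_def)

lemma pdeg_psum: "(\<And>e. e \<in> set es ==> pdeg e <= d) ==> pdeg (psum es) <= d"
 by (induction es) (auto simp: psum_def)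

lemma pvars_pcoef: "pvars (pcoef v j e) \<subseteq> pvars e - {v}"
proof (induction e arbitrary: j)
 case (PM a b)
 have *: "pvars (PM (pcoef v i a) (pcoef v (j - i) b)) \<subseteq> pvars (PM a b) - {v}" for i
  using PM[of i] PM(2)[of "j - i"] by auto
 show ?case unfolding pcoef.simps pvars_psum
  by (intro UN_least) (use * in \<open>auto simp del: upt_Suc pvars.simps\<close>)
next
 case (PA a b)
 then show ?case using PA(1)[of j] PA(2)[of j] by auto
qed auto

lemma pdeg_pcoef: "pdeg (pcoef v j e) <= pdeg e"
proof (induction e arbitrary: j)
 case (PM a b)
 have *: "pdeg (PM (pcoef v i a) (pcoef v (j - i) b)) <= pdeg (PM a b)" for i
  using PM(1)[of i] PM(2)[of "j - i"] by simp
 show ?case unfolding pcoef.simps by (intro pdeg_psum) (use * in \<open>auto simp del: upt_Suc pdeg.simps\<close>)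
next
 case (PA a b)
 then show ?case using PA(1)[of j] PA(2)[of j] by (simp add: max.coboundedI1 max.coboundedI2)
qed auto

lemma sum_list_upt: "(\<Sum>i\<leftarrow>[0..<Suc j]. f i) = (\<Sum>i\<le>j. f i)" for f :: "nat => 'a::comm_monoid_add"
 by (simp only: sum.distinct_set_conv_list[symmetric, OF distinct_upt] set_upt atLeast0LessThan lessThan_Suc_atMost)

lemma ev_pcoef_PM: "ev x (pcoef v j (PM a b)) = (\<Sum>i\<le>j. ev x (pcoef v i a) * ev x (pcoef v (j - i) b))"
 by (simp only: pcoef.simps ev_psum map_map comp_def ev.simps sum_list_upt)

lemma ev_pcoef:
 fixes x :: "nat => 'a::idom"
 shows "(\<Sum>j\<le>pdeg e. ev x (pcoef v j e) * y ^ j) = ev (x(v := y)) e \<and> (\<forall>j>pdeg e. ev x (pcoef v j e) = 0)"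
proof (induction e)
 case (PC c) then show ?case by simp
next
 case (PV i) then show ?case by (simp add: atMost_Suc)
next
 case (PA a b)
 have *: "(\<Sum>j\<le>n. ev x (pcoef v j c) * y ^ j) = ev (x(v := y)) c" if "n \<ge> pdeg c" "c = a \<or> c = b" for n c
 proof -
  have "(\<Sum>j\<le>pdeg c. ev x (pcoef v j c) * y ^ j) = (\<Sum>j\<le>n. ev x (pcoef v j c) * y ^ j)"
  proof (rule sum.mono_neutral_left)
   show "\<forall>i\<in>{..n} - {..pdeg c}. ev x (pcoef v i c) * y ^ i = 0"
   proof
    fix i assume "i \<in> {..n} - {..pdeg c}"
    then have "pdeg c < i" by auto
    then have "ev x (pcoef v i c) = 0" using PA that(2) by blast
    then show "ev x (pcoef v i c) * y ^ i = 0" by simp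
   qed
  qed (use that in auto)
  moreover have "(\<Sum>j\<le>pdeg c. ev x (pcoef v j c) * y ^ j) = ev (x(v := y)) c"
   using PA that(2) by blast
  ultimately show ?thesis by (simp only:)
 qed
 have "(\<Sum>j\<le>pdeg (PA a b). ev x (pcoef v j (PA a b)) * y ^ j) = ev (x(v := y)) (PA a b)"
  by (simp only: pdeg.simps pcoef.simps ev.simps distrib_right sum.distrib *[OF max.cobounded1 disjI1[OF refl]]
    *[OF max.cobounded2 disjI2[OF refl]])
 moreover have "\<forall>j>pdeg (PA a b). ev x (pcoef v j (PA a b)) = 0" using PA by simp
 ultimately show ?case by blast
next
 case (PM a b)
 have "(\<Sum>j\<le>pdeg a + pdeg b. ev x (pcoef v j (PM a b)) * y ^ j) = ev (x(v := y)) (PM a b)"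
  (is ?A)
 proof -
  have va: "\<And>i. pdeg a < i ==> ev x (pcoef v i a) = 0" and vb: "\<And>i. pdeg b < i ==> ev x (pcoef v i b) = 0"
   using PM by blast+
  show ?thesis
   by (simp only: ev_pcoef_PM ev.simps conjunct1[OF PM(1), symmetric] conjunct1[OF PM(2), symmetric]
     polynomial_product[where a = "%i. ev x (pcoef v i a)" and b = "%i. ev x (pcoef v i b)", OF va vb])
 qed
 moreover have "\<forall>j>pdeg (PM a b). ev x (pcoef v j (PM a b)) = 0"
  unfolding ev_pcoef_PM
 proof (intro allI impI sum.neutral ballI)
  fix j i assume that: "j > pdeg (PM a b)" and "i \<in> {..j}"
  then have "i > pdeg a \<or> j - i > pdeg b" using that by auto
  then show "ev x (pcoef v i a) * ev x (pcoef v (j - i) b) = 0" using PM by auto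
 qed
 ultimately have "?A \<and> (\<forall>j>pdeg (PM a b). ev x (pcoef v j (PM a b)) = 0)" by (rule conjI)
 then show ?case unfolding pdeg.simps .
qed

lemma pnorm_pcoef: "(\<Sum>j\<le>N. pnorm 1 (pcoef v j e)) <= pnorm 1 e"
proof (induction e arbitrary: N)
 case (PC c)
 have "(\<Sum>j\<le>N. pnorm 1 (pcoef v j (PC c))) = (\<Sum>j\<in>{0}. pnorm 1 (pcoef v j (PC c)))"
  by (rule sum.mono_neutral_right) auto
 then show ?case by simp
next
 case (PV i)
 have "(\<Sum>j\<le>N. pnorm 1 (pcoef v j (PV i))) <= (\<Sum>j\<le>N. if j = (if i = v then 1 else 0) then 1 else 0)"
  by (rule sum_mono) auto
 also have "\<dots> <= 1" by (simp add: sum.delta)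
 finally show ?case by simp
next
 case (PA a b)
 then show ?case by (simp add: sum.distrib add_mono)
next
 case (PM a b)
 have "(\<Sum>j\<le>N. pnorm 1 (pcoef v j (PM a b))) = (\<Sum>j\<le>N. \<Sum>i\<le>j. pnorm 1 (pcoef v i a) * pnorm 1 (pcoef v (j - i) b))"
  by (simp only: pcoef.simps pnorm_psum map_map comp_def pnorm.simps sum_list_upt)
 also have "\<dots> = (\<Sum>(i, j)\<in>{(i, j). i + j <= N}. pnorm 1 (pcoef v i a) * pnorm 1 (pcoef v j b))"
  by (rule sum.triangle_reindex_eq[symmetric])
 also have "\<dots> <= (\<Sum>(i, j)\<in>{..N} \<times> {..N}. pnorm 1 (pcoef v i a) * pnorm 1 (pcoef v j b))"
  by (rule sum_mono2) auto
 also have "\<dots> = (\<Sum>i\<le>N. pnorm 1 (pcoef v i a)) * (\<Sum>j\<le>N. pnorm 1 (pcoef v j b))"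
  by (simp add: sum_product sum.cartesian_product)
 also have "\<dots> <= pnorm 1 a * pnorm 1 b" by (rule mult_le_mono) (use PM in auto)
 finally show ?case by simp
qed

lemma pnorm_pcoef1: "pnorm 1 (pcoef v j e) <= pnorm 1 e"
 using pnorm_pcoef[of v e j] member_le_sum[of j "{..j}" "%j. pnorm 1 (pcoef v j e)"] by simp

section \<open>Integer points at which a polynomial does not vanish\<close>

lemma ev_bound:
 fixes x :: "nat => int"
 assumes "\<And>i. i \<in> pvars e ==> \<bar>x i\<bar> <= B" "1 <= B"
 shows "\<bar>ev x e\<bar> <= int (pnorm 1 e) * B ^ pdeg e"
 using assms(1)
proof (induction e)
 case (PA a b)
 have "\<bar>ev x (PA a b)\<bar> <= int (pnorm 1 a) * B ^ pdeg a + int (pnorm 1 b) * B ^ pdeg b"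
  using PA.IH PA.prems by fastforce
 also have "\<dots> <= int (pnorm 1 a) * B ^ pdeg (PA a b) + int (pnorm 1 b) * B ^ pdeg (PA a b)"
  using assms(2) by (intro add_mono mult_left_mono power_increasing) auto
 finally show ?case by (simp add: distrib_right)
next
 case (PM a b)
 have "\<bar>ev x (PM a b)\<bar> = \<bar>ev x a\<bar> * \<bar>ev x b\<bar>" by (simp add: abs_mult)
 also have "\<dots> <= (int (pnorm 1 a) * B ^ pdeg a) * (int (pnorm 1 b) * B ^ pdeg b)"
  using PM assms(2) by (intro mult_mono) auto
 finally show ?case by (simp add: power_add mult_ac)
qed (use assms in auto)

lemma ev_cong: "(\<And>i. i \<in> pvars e ==> x i = y i) ==> ev x e = ev y e"
 by (induction e) auto

lemma ev_closed: "pvars e = {} ==> ev x e = of_int (ev y e)" for y :: "nat => int"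
 by (induction e) auto

text \<open>Otherwise the lowest nonzero coefficient would be divisible by \<open>t\<close>,
  although it is smaller in absolute value.\<close>

lemma poly_at_large:
 fixes a :: "nat => int"
 assumes "\<And>j. j <= d ==> \<bar>a j\<bar> < t" "i <= d" "a i ~= 0"
 shows "(\<Sum>j\<le>d. a j * t ^ j) ~= 0"
proof
 assume z: "(\<Sum>j\<le>d. a j * t ^ j) = 0"
 define k where "k = (LEAST i. i <= d \<and> a i ~= 0)"
 have k: "k <= d \<and> a k ~= 0" unfolding k_def by (rule LeastI[of _ i]) (use assms in auto)
 have least: "a j = 0" if "j < k" for j using not_less_Least[of j "%i. i <= d \<and> a i ~= 0"] that k unfolding k_def by auto
 have t: "0 < t" using assms(1)[OF assms(2)] by linarith
 have "(\<Sum>j\<le>d. a j * t ^ j) = (\<Sum>j\<in>{k..d}. a j * t ^ j)"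
  by (rule sum.mono_neutral_right) (use least in auto)
 also have "\<dots> = a k * t ^ k + (\<Sum>j\<in>{Suc k..d}. a j * t ^ j)" using k by (simp add: sum.atLeast_Suc_atMost)
 also have "(\<Sum>j\<in>{Suc k..d}. a j * t ^ j) = t ^ Suc k * (\<Sum>j\<in>{Suc k..d}. a j * t ^ (j - Suc k))"
 proof (unfold sum_distrib_left, rule sum.cong[OF refl])
  fix j assume "j \<in> {Suc k..d}"
  then have "t ^ j = t ^ Suc k * t ^ (j - Suc k)" by (simp only: power_add[symmetric]) simp
  then show "a j * t ^ j = t ^ Suc k * (a j * t ^ (j - Suc k))" by (simp only: mult_ac)
 qed
 finally have z': "a k * t ^ k + t ^ Suc k * (\<Sum>j\<in>{Suc k..d}. a j * t ^ (j - Suc k)) = 0"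
  using z by simp
 define S where "S = (\<Sum>j\<in>{Suc k..d}. a j * t ^ (j - Suc k))"
 have "t ^ k * (a k + t * S) = 0" using z' unfolding S_def[symmetric] by (simp add: algebra_simps)
 then have "a k + t * S = 0" using t by simp
 then have "a k = - (t * S)" by linarith
 then have "t dvd a k" by simp
 then have "t <= \<bar>a k\<bar>" using dvd_imp_le_int[of "a k" t] k t by simp
 then show False using assms(1)[of k] k by linarith
qed

text \<open>Variable \<open>V\<close> receives a value above all coefficients with respect to
  \<open>V\<close>, evaluated at the smaller variables. These are at most
  \<open>2 ^ (n + K * n)\<close> with \<open>K = (n + 2) ^ V\<close>, hence below
  \<open>2 ^ ((n + 2) ^ Suc V)\<close>.\<close>

lemma kronecker_aux:
 fixes m :: "nat => 'a::idom"
 assumes "pvars e \<subseteq> {..<V}" "pnorm 1 e <= 2 ^ n" "pdeg e <= n" "ev m e ~= 0"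
 shows "ev (%i. 2 ^ ((n + 2) ^ Suc i) :: int) e ~= 0"
 using assms
proof (induction V arbitrary: e)
 case 0
 then show ?case using ev_closed[of e m "%i. 2 ^ ((n + 2) ^ Suc i)"] by auto
next
 case (Suc V)
 define x :: "nat => int" where "x i = 2 ^ ((n + 2) ^ Suc i)" for i
 have "ev (m(V := m V)) e ~= 0" using Suc.prems by simp
 then obtain j where j: "j <= pdeg e" "ev m (pcoef V j e) ~= 0"
  using conjunct1[OF ev_pcoef[of m V e "m V"]] by (metis (no_types, lifting) atMost_iff mult_eq_0_iff sum.neutral)
 have vars: "pvars (pcoef V k e) \<subseteq> {..<V}" for k
 proof
  fix i assume "i \<in> pvars (pcoef V k e)"
  then have "i \<in> {..<Suc V}" "i ~= V" using pvars_pcoef[of V k e] Suc.prems(1) by blast+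
  then show "i \<in> {..<V}" by auto
 qed
 have norm: "pnorm 1 (pcoef V k e) <= 2 ^ n" for k using pnorm_pcoef1[of V k e] Suc.prems(2) by simp
 have deg: "pdeg (pcoef V k e) <= n" for k using pdeg_pcoef[of V k e] Suc.prems(3) by simp
 have nz: "ev x (pcoef V j e) ~= 0" using Suc.IH[OF vars norm deg j(2)] unfolding x_def[abs_def] .
 have bd: "\<bar>ev x (pcoef V k e)\<bar> < x V" for k
 proof -
  \<comment> \<open>For \<open>V = 0\<close> no variables remain, and their values are bounded by
    \<open>2 ^ 0\<close>.\<close>
  define K where "K = (if V = 0 then 0 else (n + 2) ^ V)"
  have x1: "(1::int) <= 2 ^ K" by simp
  have "\<bar>ev x (pcoef V k e)\<bar> <= int (pnorm 1 (pcoef V k e)) * (2 ^ K) ^ pdeg (pcoef V k e)"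
  proof (rule ev_bound[OF _ x1])
   fix i assume "i \<in> pvars (pcoef V k e)"
   then have "i < V" using vars by auto
   then have "(n + 2) ^ Suc i <= K" unfolding K_def by (auto intro!: power_increasing simp del: power_Suc)
   then show "\<bar>x i\<bar> <= 2 ^ K" unfolding x_def by (simp add: power_increasing del: power_Suc)
  qed
  also have "\<dots> <= 2 ^ n * (2 ^ K) ^ n"
  proof (rule mult_mono)
   have "int (pnorm 1 (pcoef V k e)) <= int (2 ^ n)" using norm by (simp only: of_nat_le_iff)
   then show "int (pnorm 1 (pcoef V k e)) <= 2 ^ n" by simp
   show "((2::int) ^ K) ^ pdeg (pcoef V k e) <= (2 ^ K) ^ n"
    using deg by (intro power_increasing) auto
  qed auto
  also have "\<dots> = 2 ^ (n + K * n)" by (simp add: power_add power_mult)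
  also have "\<dots> < 2 ^ ((n + 2) ^ Suc V)"
  proof (rule power_strict_increasing)
   show "n + K * n < (n + 2) ^ Suc V"
   proof (cases V)
    case (Suc W)
    have "(n + 2) ^ 1 <= (n + 2) ^ V" using Suc by (intro power_increasing) auto
    then show ?thesis using Suc by (simp add: K_def algebra_simps)
   qed (simp add: K_def)
  qed simp
  finally show ?thesis by (simp add: x_def)
 qed
 have "(\<Sum>k\<le>pdeg e. ev x (pcoef V k e) * x V ^ k) ~= 0"
  by (rule poly_at_large[where a = "%k. ev x (pcoef V k e)", OF bd j(1) nz])
 then have "ev (x(V := x V)) e ~= 0" unfolding conjunct1[OF ev_pcoef[of x V e "x V"]] .
 then have "ev x e ~= 0" by (simp only: fun_upd_triv not_False_eq_True)
 moreover have "x = (%i. 2 ^ ((n + 2) ^ Suc i))" by (rule ext) (rule x_def)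
 ultimately show ?case by blast
qed

fun psub :: "(nat => int) => pexp => pexp" where
 "psub c (PC k) = PC k" | "psub c (PV i) = PA (PV i) (PC (c i))" | "psub c (PA a b) = PA (psub c a) (psub c b)"
| "psub c (PM a b) = PM (psub c a) (psub c b)"

lemma ev_psub: "ev x (psub c e) = ev (%i. of_int (c i) + x i) e"
 by (induction e) (auto simp: add.commute)

lemma psub_simps: "pdeg (psub c e) = pdeg e" "pvars (psub c e) = pvars e"
 by (induction e) auto

lemma pnorm_psub: "(\<And>i. \<bar>c i\<bar> <= 1) ==> pnorm 1 (psub c e) <= pnorm 2 e"
proof (induction e)
 case (PV i)
 then have "\<bar>c i\<bar> <= 1" by simp
 then show ?case by simp
next
 case (PA a b) then show ?case by (simp add: add_mono)
next
 case (PM a b) then show ?case by (simp add: mult_le_mono)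
qed simp

text \<open>The point is shifted by the integers \<open>c\<close>, later the entries of
  \<open>m0\<close>. Replacing a variable by its sum with a constant of absolute value at most 1
  raises its weight to at most 2, hence the norm with weight 2.\<close>

lemma kronecker:
 fixes m :: "nat => 'a::idom" and c :: "nat => int"
 assumes "pvars e \<subseteq> {..<V}" "pnorm 2 e <= 2 ^ n" "pdeg e <= n" "\<And>i. \<bar>c i\<bar> <= 1" "ev m e ~= 0"
 shows "ev (%i. c i + 2 ^ ((n + 2) ^ Suc i)) e ~= 0"
proof -
 have "ev (%i. 2 ^ ((n + 2) ^ Suc i) :: int) (psub c e) ~= 0"
 proof (rule kronecker_aux)
  show "ev (%i. m i - of_int (c i)) (psub c e) ~= 0" using assms(5) by (simp add: ev_psub)
  show "pnorm 1 (psub c e) <= 2 ^ n" using pnorm_psub[of c e] assms by simp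
 qed (use assms in \<open>auto simp: psub_simps\<close>)
 then show ?thesis by (simp only: ev_psub of_int_eq_id id_apply simp_thms)
qed

text \<open>The size of the value bounds the power of 2 that divides it, and thereby the precision
  needed for the division.\<close>

lemma kronecker_bound:
 fixes c :: "nat => int"
 assumes "pvars e \<subseteq> {..<V}" "pnorm 2 e <= 2 ^ n" "pdeg e <= n" "\<And>i. \<bar>c i\<bar> <= 1"
 shows "\<bar>ev (%i. c i + 2 ^ ((n + 2) ^ Suc i)) e\<bar> < 2 ^ ((n + 2) ^ (V + 2))"
proof -
 define K where "K = (n + 2) ^ Suc V"
 have "\<bar>ev (%i. 2 ^ ((n + 2) ^ Suc i)) (psub c e)\<bar> <= int (pnorm 1 (psub c e)) * (2 ^ K) ^ pdeg (psub c e)"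
 proof (rule ev_bound)
  fix i assume "i \<in> pvars (psub c e)"
  then have "i < V" using assms by (auto simp: psub_simps)
  then have "(n + 2) ^ Suc i <= K" unfolding K_def by (intro power_increasing) auto
  then show "\<bar>2 ^ ((n + 2) ^ Suc i)\<bar> <= (2::int) ^ K" by (simp add: power_increasing del: power_Suc)
 qed simp
 also have "\<dots> <= 2 ^ n * (2 ^ K) ^ n"
 proof (rule mult_mono)
  have "pnorm 1 (psub c e) <= 2 ^ n" using pnorm_psub[of c e] assms by simp
  then have "int (pnorm 1 (psub c e)) <= int (2 ^ n)" by (simp only: of_nat_le_iff)
  then show "int (pnorm 1 (psub c e)) <= 2 ^ n" by simp
  show "((2::int) ^ K) ^ pdeg (psub c e) <= (2 ^ K) ^ n"
   using assms by (intro power_increasing) (auto simp: psub_simps)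
 qed auto
 also have "\<dots> = 2 ^ (n + K * n)" by (simp add: power_add power_mult)
 also have "\<dots> < 2 ^ ((n + 2) ^ (V + 2))"
 proof (rule power_strict_increasing)
  have "(n + 2) ^ 1 <= K" unfolding K_def by (intro power_increasing) auto
  then show "n + K * n < (n + 2) ^ (V + 2)" by (simp add: K_def algebra_simps)
 qed simp
 finally show ?thesis by (simp only: ev_psub of_int_eq_id id_apply simp_thms)
qed

text \<open>A nonzero value at some integer point means that the polynomial is nonzero, so this is
  algebraic independence over the rationals.\<close>

definition generic :: "nat set => (nat => real) => bool" where
 "generic VS m \<longleftrightarrow> (\<forall>e. pvars e \<subseteq> VS --> (\<exists>x :: nat => int. ev x e ~= 0) --> ev m e ~= 0)"

section \<open>Almost every point is generic\<close>

lemma measurable_ev: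
 "pvars e \<subseteq> VS ==> (%x. ev (%i. x (f i)) e) \<in> borel_measurable (PiM (f ` VS) (%_. lborel :: real measure))"
proof (induction e)
 case (PV i)
 then have "(%x. x (f i)) \<in> measurable (PiM (f ` VS) (%_. lborel :: real measure)) lborel"
  by (intro measurable_component_singleton) auto
 then show ?case by simp
qed auto

text \<open>Fubini and induction on the variables: outside a null set some coefficient with respect
  to \<open>v\<close> does not vanish, and then the section in direction \<open>v\<close> is the
  finite root set of a nonzero polynomial. The map \<open>f\<close> translates variable numbers to
  matrix positions.\<close>

lemma ev_null:
 assumes "finite VS" "inj_on f VS" "pvars e \<subseteq> VS" "\<exists>x :: nat => int. ev x e ~= 0"
 shows "{x \<in> space (PiM (f ` VS) (%_. lborel :: real measure)). ev (%i. x (f i)) e = 0}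
  \<in> null_sets (PiM (f ` VS) (%_. lborel))"
 using assms
proof (induction VS arbitrary: e rule: finite_induct)
 case empty
 then obtain x :: "nat => int" where "ev x e ~= 0" by auto
 then have "ev y e ~= (0::real)" for y using ev_closed[of e y x] empty by auto
 then show ?case by simp
next
 case (insert v VS)
 interpret product_sigma_finite "%_. lborel :: real measure" by standard
 define I where "I = f ` VS"
 have I: "finite I" "f v \<notin> I" using insert by (auto simp: I_def)
 define S where "S = {x \<in> space (PiM (insert (f v) I) (%_. lborel :: real measure)). ev (%i. x (f i)) e = 0}"
 have meas: "S \<in> sets (PiM (insert (f v) I) (%_. lborel :: real measure))"
  unfolding S_def using measurable_ev[OF insert.prems(2), of f] by (intro measurable_equality_set) (auto simp: I_def)
 obtain x0 :: "nat => int" where x0: "ev x0 e ~= 0" using insert.prems by auto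
 have "ev (x0(v := x0 v)) e ~= 0" using x0 by simp
 then obtain j where j: "j <= pdeg e" "ev x0 (pcoef v j e) ~= 0"
  using conjunct1[OF ev_pcoef[of x0 v e "x0 v"]] by (metis (no_types, lifting) atMost_iff mult_eq_0_iff sum.neutral)
 have vars: "pvars (pcoef v k e) \<subseteq> VS" for k using pvars_pcoef[of v k e] insert.prems(2) by blast
 have N: "{x \<in> space (PiM I (%_. lborel :: real measure)). ev (%i. x (f i)) (pcoef v j e) = 0}
   \<in> null_sets (PiM I (%_. lborel))"
  unfolding I_def by (rule insert.IH) (use insert.prems vars j in auto)
 have inner: "(\<integral>\<^sup>+ y. indicator S (x(f v := y)) \<partial>lborel) = 0"
  if x: "x \<in> space (PiM I (%_. lborel :: real measure))" "ev (%i. x (f i)) (pcoef v j e) ~= 0" for x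
 proof -
  define T where "T = {y. (\<Sum>k\<le>pdeg e. ev (%i. x (f i)) (pcoef v k e) * y ^ k) = 0}"
  have fin: "finite T" unfolding T_def using polyfun_finite_roots[of "%k. ev (%i. x (f i)) (pcoef v k e)" "pdeg e"] j x by auto
  have "indicator S (x(f v := y)) = (indicator T y :: ennreal)" for y
  proof -
   have "ev (%i. (x(f v := y)) (f i)) e = ev ((%i. x (f i))(v := y)) e"
    by (rule ev_cong) (use insert.prems insert.hyps in \<open>auto simp: inj_on_def\<close>)
   then have "ev (%i. (x(f v := y)) (f i)) e = (\<Sum>k\<le>pdeg e. ev (%i. x (f i)) (pcoef v k e) * y ^ k)"
    using conjunct1[OF ev_pcoef[of "%i. x (f i)" v e y]] by simp
   moreover have "x(f v := y) \<in> space (PiM (insert (f v) I) (%_. lborel :: real measure))"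
    using x(1) by (auto simp: space_PiM PiE_iff extensional_def)
   ultimately show ?thesis by (simp add: S_def T_def indicator_def)
  qed
  then have "(\<integral>\<^sup>+ y. indicator S (x(f v := y)) \<partial>lborel) = emeasure lborel T"
   using borel_closed[OF finite_imp_closed[OF fin]] by simp
  also have "\<dots> = 0" using fin by (simp add: emeasure_lborel_countable countable_finite)
  finally show ?thesis .
 qed
 have ae: "AE x in PiM I (%_. lborel). (\<integral>\<^sup>+ y. indicator S (x(f v := y)) \<partial>lborel) = 0"
  by (rule AE_I'[OF N]) (use inner in auto)
 have "emeasure (PiM (insert (f v) I) (%_. lborel)) S = (\<integral>\<^sup>+ x. indicator S x \<partial>PiM (insert (f v) I) (%_. lborel))"
  using meas by simp
 also have "\<dots> = (\<integral>\<^sup>+ x. (\<integral>\<^sup>+ y. indicator S (x(f v := y)) \<partial>lborel) \<partial>PiM I (%_. lborel))"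
  by (rule product_nn_integral_insert[OF I]) (use meas in simp)
 also have "\<dots> = (\<integral>\<^sup>+ x. 0 \<partial>PiM I (%_. lborel :: real measure))"
  by (rule nn_integral_cong_AE[OF ae])
 also have "\<dots> = 0" by simp
 finally show ?case using meas by (simp add: null_sets_def S_def I_def)
qed

lemma AE_generic:
 assumes "finite VS" "inj_on f VS"
 shows "AE x in PiM (f ` VS) (%_. lborel). generic VS (%i. x (f i))"
proof -
 have "AE x in PiM (f ` VS) (%_. lborel :: real measure). ev (%i. x (f i)) e ~= 0"
  if "pvars e \<subseteq> VS \<and> (\<exists>x :: nat => int. ev x e ~= 0)" for e
  by (rule AE_I'[OF ev_null[OF assms, of e]]) (use that in auto)
 then have "AE x in PiM (f ` VS) (%_. lborel :: real measure). pvars e \<subseteq> VS \<and> (\<exists>x :: nat => int. ev x e ~= 0) --> ev (%i. x (f i)) e ~= 0" for e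
  by (cases "pvars e \<subseteq> VS \<and> (\<exists>x :: nat => int. ev x e ~= 0)") auto
 then have "AE x in PiM (f ` VS) (%_. lborel :: real measure). \<forall>e. pvars e \<subseteq> VS \<and> (\<exists>x :: nat => int. ev x e ~= 0) --> ev (%i. x (f i)) e ~= 0"
  by (simp add: AE_all_countable)
 then show ?thesis by (rule AE_mp) (simp add: generic_def)
qed

section \<open>Answers as rational functions of the entries\<close>

definition vi :: "nat => nat => nat => nat" where "vi q a b = min a b * q + max a b"

definition VS :: "nat => nat set" where "VS q = (%(a, b). a * q + b) ` upper_indices q"

definition mvar :: "nat => real mat => nat => real" where "mvar q M i = M $$ (i div q, i mod q)"

lemma vi_VS: "a < q ==> b < q ==> vi q a b \<in> VS q"
 unfolding vi_def VS_def upper_indices_def by (auto simp: min_def max_def intro!: image_eqI[of _ _ "(min a b, max a b)"])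

lemma VS_less: "i \<in> VS q ==> i < q * q"
proof -
 have "a * q + b < q * q" if "a <= b" "b < q" for a b
 proof -
  have "a * q + b < Suc a * q" using that by simp
  also have "\<dots> <= q * q" using that by (intro mult_le_mono1) auto
  finally show ?thesis .
 qed
 then show "i \<in> VS q ==> i < q * q" unfolding VS_def upper_indices_def by auto
qed

lemma mvar_vi: "M \<in> symmetric_mats q ==> a < q ==> b < q ==> mvar q M (vi q a b) = M $$ (a, b)"
proof -
 assume M: "M \<in> symmetric_mats q" and ab: "a < q" "b < q"
 have "M $$ (b, a) = M $$ (a, b)"
  using M ab index_transpose_mat(1)[of b M a] unfolding symmetric_mats_def by auto
 then show ?thesis using ab by (auto simp: mvar_def vi_def min_def max_def)
qed

text \<open>It only witnesses that the partition function is a polynomial in the entries and is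
  never evaluated by a machine, so its exponential size is harmless. The chosen list fixes an order
  of summation.\<close>

definition zexp :: "nat => multigraph => pexp" where
 "zexp q G = psum (map (%si. foldr PM (map (%(u, v). PV (vi q (si u) (si v))) (snd G)) (PC 1))
   (SOME L. set L = ({..<fst G} \<rightarrow>\<^sub>E {..<q}) \<and> distinct L))"

lemma zexp:
 shows "ev x (zexp q G) = ZZ q (%a b. x (vi q a b)) G" and "multigraph G ==> pvars (zexp q G) \<subseteq> VS q"
proof -
 define L where "L = (SOME L. set L = ({..<fst G} \<rightarrow>\<^sub>E {..<q}) \<and> distinct L)"
 have "finite ({..<fst G} \<rightarrow>\<^sub>E {..<q})" by (simp add: finite_PiE)
 from finite_distinct_list[OF this] have L: "set L = ({..<fst G} \<rightarrow>\<^sub>E {..<q})" "distinct L"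
  unfolding L_def by (rule someI2_ex, simp)+
 have 1: "ev x (foldr PM (map (%(u, v). PV (vi q (si u) (si v))) es) (PC 1)) = (\<Prod>(u, v)\<leftarrow>es. x (vi q (si u) (si v)))"
  for es si by (induction es) auto
 show "ev x (zexp q G) = ZZ q (%a b. x (vi q a b)) G"
  unfolding zexp_def L_def[symmetric] unfolding ev_psum map_map comp_def 1 ZZ_def L(1)[symmetric] case_prod_beta
   sum.distinct_set_conv_list[OF L(2)] ..
 assume G: "multigraph G"
 have 2: "pvars (foldr PM (map (%(u, v). PV (vi q (si u) (si v))) es) (PC 1)) \<subseteq> VS q"
  if "si \<in> {..<fst G} \<rightarrow>\<^sub>E {..<q}" "set es \<subseteq> set (snd G)" for es si
  using that(2)
 proof (induction es)
  case (Cons e es)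
  obtain u v where e: "e = (u, v)" by fastforce
  have "(u, v) \<in> set (snd G)" using Cons.prems e by simp
  then have "u < fst G \<and> v < fst G" using G unfolding multigraph_def case_prod_beta by force
  then have "si u < q" "si v < q" using that(1) by auto
  then show ?case using Cons e vi_VS by simp
 qed simp
 show "pvars (zexp q G) \<subseteq> VS q"
  unfolding zexp_def L_def[symmetric] unfolding pvars_psum using 2 L(1) by auto
qed

lemma Z_mvar:
 assumes "M \<in> symmetric_mats q" "multigraph G"
 shows "Z M G = ev (mvar q M) (zexp q G)"
proof -
 have d: "dim_row M = q" using assms(1) by (auto simp: symmetric_mats_def)
 have "(\<Prod>(u, v)\<leftarrow>es. M $$ (si u, si v)) = (\<Prod>(u, v)\<leftarrow>es. mvar q M (vi q (si u) (si v)))"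
  if "G = (n, es)" "si \<in> {..<n} \<rightarrow>\<^sub>E {..<q}" for n es si
 proof (intro arg_cong[of _ _ prod_list] map_cong refl)
  fix e assume e: "e \<in> set es"
  obtain u v where uv: "e = (u, v)" by fastforce
  have "u < n \<and> v < n" using e assms(2) unfolding multigraph_def that(1) prod.case uv by blast
  then have "si u < q" "si v < q" using that(2) by auto
  then show "(case e of (u, v) => M $$ (si u, si v)) = (case e of (u, v) => mvar q M (vi q (si u) (si v)))"
   using mvar_vi[OF assms(1)] by (simp add: uv)
 qed
 then show ?thesis unfolding zexp(1) Z_def ZZ_def d by (cases G) (auto intro!: sum.cong)
qed

text \<open>Fractions of expressions form a subfield that contains the entries.\<close>

lemma hull_frac:
 assumes "M \<in> symmetric_mats q" "y \<in> is_subfield hull elements_mat M"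
 shows "\<exists>u w. pvars u \<subseteq> VS q \<and> pvars w \<subseteq> VS q \<and> ev (mvar q M) w ~= 0 \<and> y = ev (mvar q M) u / ev (mvar q M) w"
proof -
 define T where "T = {y. \<exists>u w. pvars u \<subseteq> VS q \<and> pvars w \<subseteq> VS q \<and> ev (mvar q M) w ~= 0 \<and> y = ev (mvar q M) u / ev (mvar q M) w}"
 have TI: "z \<in> T" if "pvars u \<subseteq> VS q" "pvars w \<subseteq> VS q" "ev (mvar q M) w ~= 0" "z = ev (mvar q M) u / ev (mvar q M) w" for u w z
  using that unfolding T_def by blast
 have "is_subfield T"
  unfolding is_subfield_def
 proof (intro conjI ballI)
  show "1 \<in> T" by (rule TI[of "PC 1" "PC 1"]) auto
  fix x y assume "x \<in> T" "y \<in> T"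
  then obtain u w u' w' where x: "pvars u \<subseteq> VS q" "pvars w \<subseteq> VS q" "ev (mvar q M) w ~= 0" "x = ev (mvar q M) u / ev (mvar q M) w"
   "pvars u' \<subseteq> VS q" "pvars w' \<subseteq> VS q" "ev (mvar q M) w' ~= 0" "y = ev (mvar q M) u' / ev (mvar q M) w'"
   unfolding T_def by blast
  show "x - y \<in> T"
  proof (rule TI[of "PA (PM u w') (PM (PC (-1)) (PM u' w))" "PM w w'"])
   show "x - y = ev (mvar q M) (PA (PM u w') (PM (PC (-1)) (PM u' w))) / ev (mvar q M) (PM w w')"
    unfolding x(4,8) using x(3,7) by (simp add: diff_frac_eq mult.commute)
  qed (use x in auto)
  show "x * y \<in> T" by (rule TI[of "PM u u'" "PM w w'"]) (use x in auto)
  show "inverse x \<in> T"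
  proof (cases "ev (mvar q M) u = 0")
   case True
   then show ?thesis using x by (intro TI[of "PC 0" "PC 1"]) auto
  next
   case False
   then show ?thesis using x by (intro TI[of w u]) auto
  qed
 qed
 moreover have "elements_mat M \<subseteq> T"
 proof
  fix z assume "z \<in> elements_mat M"
  then obtain a b where ab: "a < q" "b < q" "z = M $$ (a, b)"
   using assms(1) by (auto simp: symmetric_mats_def elements_mat_def)
  show "z \<in> T" by (rule TI[of "PV (vi q a b)" "PC 1"]) (use ab vi_VS mvar_vi[OF assms(1)] in auto)
 qed
 ultimately have "is_subfield hull elements_mat M \<subseteq> T" by (intro hull_minimal)
 then show ?thesis using assms(2) unfolding T_def by blast
qed

section \<open>Unreduced fractions\<close>

instantiation pexp :: "{plus,times}"
begin
definition "plus_pexp = PA"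
definition "times_pexp = PM"
instance ..
end

text \<open>Fractions are neither reduced nor tested for zero. The same evaluation therefore runs
  over reals, integers and expressions, and it commutes with \<open>ev\<close>.\<close>

definition fadd :: "'a::{plus,times} \<times> 'a => 'a \<times> 'a => 'a \<times> 'a" where
 "fadd p r = (fst p * snd r + fst r * snd p, snd p * snd r)"

definition fmul :: "'a::{plus,times} \<times> 'a => 'a \<times> 'a => 'a \<times> 'a" where
 "fmul p r = (fst p * fst r, snd p * snd r)"

definition fdiv :: "'a::{plus,times} \<times> 'a => 'a \<times> 'a => 'a \<times> 'a" where
 "fdiv p r = (fst p * snd r, snd p * fst r)"

definition tval :: "(int => 'a::{plus,times}) => ('a \<times> 'a) list => int \<times> nat list => 'a \<times> 'a" where
 "tval k F t = fold (%(f, n). (%a. fmul a f) ^^ n) (zip F (snd t)) (k (fst t), k 1)"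

definition pval :: "(int => 'a::{plus,times}) => ('a \<times> 'a) list => int_poly => 'a \<times> 'a" where
 "pval k F P = fold (%t acc. fadd acc (tval k F t)) P (k 0, k 1)"

text \<open>The state consists of the partial sum and of the current power of the algebraic
  generator.\<close>

definition estep :: "(int => 'a::{plus,times}) => ('a \<times> 'a) list => 'a \<times> 'a => int_poly \<times> int_poly =>
  ('a \<times> 'a) \<times> ('a \<times> 'a) => ('a \<times> 'a) \<times> ('a \<times> 'a)" where
 "estep k F B PQ s = (fadd (fst s) (fmul (fdiv (pval k F (fst PQ)) (pval k F (snd PQ))) (snd s)), fmul (snd s) B)"

definition evalf :: "(int => 'a::{plus,times}) => ('a \<times> 'a) list => 'a \<times> 'a => field_elem => 'a \<times> 'a" where
 "evalf k F B a = fst (fold (estep k F B) a ((k 0, k 1), (k 1, k 1)))"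

text \<open>It serves twice: evaluation at the real entries compares the expressions with the true
  answer, evaluation at an integer point describes what the register program computes.\<close>

lemma evalf_hom:
 assumes h: "\<And>a b. h (a + b) = h a + h b" "\<And>a b. h (a * b) = h a * h b" "\<And>c. h (k c) = k' c"
 shows "map_prod h h (evalf k F B a) = evalf k' (map (map_prod h h) F) (map_prod h h B) a"
proof -
 have ops: "map_prod h h (fadd p r) = fadd (map_prod h h p) (map_prod h h r)"
  "map_prod h h (fmul p r) = fmul (map_prod h h p) (map_prod h h r)"
  "map_prod h h (fdiv p r) = fdiv (map_prod h h p) (map_prod h h r)" for p r
  by (simp_all add: fadd_def fmul_def fdiv_def h prod_eq_iff)
 have pow: "map_prod h h (((%a. fmul a f) ^^ n) s) = ((%a. fmul a (map_prod h h f)) ^^ n) (map_prod h h s)" for f n s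
  by (induction n) (auto simp: ops)
 have "map_prod h h (fold (%(f, n). (%a. fmul a f) ^^ n) (zip F e) s) =
   fold (%(f, n). (%a. fmul a f) ^^ n) (zip (map (map_prod h h) F) e) (map_prod h h s)" for e s
 proof (induction F arbitrary: e s)
  case (Cons f F)
  then show ?case by (cases e) (auto simp: pow)
 qed simp
 then have t: "map_prod h h (tval k F t) = tval k' (map (map_prod h h) F) t" for t by (simp add: tval_def h)
 have "map_prod h h (fold (%t acc. fadd acc (tval k F t)) P s) =
   fold (%t acc. fadd acc (tval k' (map (map_prod h h) F) t)) P (map_prod h h s)" for P s
  by (induction P arbitrary: s) (auto simp: ops t)
 then have p: "map_prod h h (pval k F P) = pval k' (map (map_prod h h) F) P" for P by (simp add: pval_def h)
 have "map_prod (map_prod h h) (map_prod h h) (fold (estep k F B) a s) =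
   fold (estep k' (map (map_prod h h) F) (map_prod h h B)) a (map_prod (map_prod h h) (map_prod h h) s)" for s
  by (induction a arbitrary: s) (auto simp: ops p estep_def)
 from arg_cong[OF this, of fst] show ?thesis by (simp add: evalf_def h)
qed

definition fv :: "real \<times> real => real" where "fv p = fst p / snd p"

lemma fv_ops:
 assumes "snd p ~= 0" "snd r ~= 0"
 shows "fv (fadd p r) = fv p + fv r" "snd (fadd p r) ~= 0" "fv (fmul p r) = fv p * fv r" "snd (fmul p r) ~= 0"
  "fv r ~= 0 ==> fv (fdiv p r) = fv p / fv r" "fv r ~= 0 ==> snd (fdiv p r) ~= 0"
 using assms by (auto simp: fv_def fadd_def fmul_def fdiv_def field_simps)

lemma tval_real:
 assumes F: "\<And>f. f \<in> set F ==> snd f ~= 0" and "length (snd t) = length F"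
 shows "fv (tval of_int F t) = of_int (fst t) * monomial (map fv F) (snd t) \<and> snd (tval of_int F t) ~= 0"
proof -
 have pow: "fv (((%a. fmul a f) ^^ n) s) = fv s * fv f ^ n \<and> snd (((%a. fmul a f) ^^ n) s) ~= 0"
  if "snd f ~= 0" "snd s ~= 0" for f n s
  using that by (induction n) (auto simp: fv_ops)
 have "fv (fold (%(f, n). (%a. fmul a f) ^^ n) (zip F e) s) = fv s * (\<Prod>i<length F. (map fv F ! i) ^ (e ! i)) \<and>
   snd (fold (%(f, n). (%a. fmul a f) ^^ n) (zip F e) s) ~= 0"
  if "length e = length F" "snd s ~= 0" for e s
  using that F
 proof (induction F arbitrary: e s)
  case (Cons f F)
  then obtain n e' where e: "e = n # e'" by (cases e) auto
  have s': "fv (((%a. fmul a f) ^^ n) s) = fv s * fv f ^ n" "snd (((%a. fmul a f) ^^ n) s) ~= 0"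
   using pow[of f s n] Cons.prems by auto
  have pr: "(\<Prod>i<length (f # F). (map fv (f # F) ! i) ^ (e ! i)) = fv f ^ n * (\<Prod>i<length F. (map fv F ! i) ^ (e' ! i))"
   unfolding e by (simp add: prod.lessThan_Suc_shift del: prod.lessThan_Suc)
  show ?case unfolding pr using Cons.IH[of e' "((%a. fmul a f) ^^ n) s"] Cons.prems s' by (simp add: e)
 qed (simp add: that)
 from this[of "snd t" "(of_int (fst t), of_int 1)"] show ?thesis
  using assms by (simp add: tval_def monomial_def fv_def)
qed

lemma pval_real:
 assumes F: "\<And>f. f \<in> set F ==> snd f ~= 0" and "\<And>c e. (c, e) \<in> set P ==> length e = length F"
 shows "fv (pval of_int F P) = int_poly_val (map fv F) P \<and> snd (pval of_int F P) ~= 0"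
proof -
 have "fv (fold (%t acc. fadd acc (tval of_int F t)) P s) = fv s + int_poly_val (map fv F) P \<and>
   snd (fold (%t acc. fadd acc (tval of_int F t)) P s) ~= 0" if "snd s ~= 0" for s
  using that assms(2)
 proof (induction P arbitrary: s)
  case (Cons t P)
  obtain c e where t: "t = (c, e)" by fastforce
  have tv: "fv (tval of_int F t) = of_int c * monomial (map fv F) e \<and> snd (tval of_int F t) ~= 0"
   using tval_real[OF F, where t = t] Cons.prems(2)[of c e] by (simp add: t)
  have "fv (fadd s (tval of_int F t)) = fv s + of_int c * monomial (map fv F) e" "snd (fadd s (tval of_int F t)) ~= 0"
   using fv_ops(1,2)[of s "tval of_int F t"] tv Cons.prems(1) by auto
  moreover have "\<And>c e. (c, e) \<in> set P ==> length e = length F" using Cons.prems(2) by auto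
  ultimately show ?case using Cons.IH[of "fadd s (tval of_int F t)"] by (simp add: int_poly_val_def t)
 qed (simp add: int_poly_val_def)
 from this[of "(of_int 0, of_int 1)"] show ?thesis by (simp add: pval_def fv_def)
qed

lemma evalf_real:
 assumes F: "\<And>f. f \<in> set F ==> snd f ~= 0" and B: "snd B ~= 0" and a: "wf_field_elem (map fv F) a"
 shows "fv (evalf of_int F B a) = field_elem_val (map fv F) (fv B) a \<and> snd (evalf of_int F B a) ~= 0"
proof -
 have "fv (fst (fold (estep of_int F B) a s)) = fv (fst s) + fv (snd s) * field_elem_val (map fv F) (fv B) a \<and>
   snd (fst (fold (estep of_int F B) a s)) ~= 0" if "snd (fst s) ~= 0" "snd (snd s) ~= 0" for s
  using that a
 proof (induction a arbitrary: s)
  case (Cons PQ a)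
  obtain P Q where PQ: "PQ = (P, Q)" by fastforce
  have wf: "\<And>c e. (c, e) \<in> set P ==> length e = length F" "\<And>c e. (c, e) \<in> set Q ==> length e = length F"
   "int_poly_val (map fv F) Q ~= 0" "wf_field_elem (map fv F) a"
   using Cons.prems(3) unfolding wf_field_elem_def PQ by auto
  note P = pval_real[OF F wf(1)] and Q = pval_real[OF F wf(2)]
  define d where "d = fmul (fdiv (pval of_int F P) (pval of_int F Q)) (snd s)"
  have d: "fv d = int_poly_val (map fv F) P / int_poly_val (map fv F) Q * fv (snd s)" "snd d ~= 0"
   unfolding d_def using P Q wf(3) Cons.prems by (simp_all add: fv_ops)
  have e: "estep of_int F B PQ s = (fadd (fst s) d, fmul (snd s) B)" by (simp add: estep_def d_def PQ)
  have IH: "fv (fst (fold (estep of_int F B) a (estep of_int F B PQ s))) =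
    fv (fadd (fst s) d) + fv (fmul (snd s) B) * field_elem_val (map fv F) (fv B) a \<and>
    snd (fst (fold (estep of_int F B) a (estep of_int F B PQ s))) ~= 0"
   using Cons.IH[of "estep of_int F B PQ s"] wf(4) Cons.prems B d by (simp add: e fv_ops)
  have "field_elem_val (map fv F) (fv B) (PQ # a) =
    int_poly_val (map fv F) P / int_poly_val (map fv F) Q + fv B * field_elem_val (map fv F) (fv B) a"
   unfolding field_elem_val_def
   by (simp add: PQ prod.lessThan_Suc_shift sum.lessThan_Suc_shift sum_distrib_left mult_ac del: sum.lessThan_Suc)
  then show ?case using IH d Cons.prems B by (simp add: fv_ops algebra_simps)
 qed (simp add: field_elem_val_def)
 from this[of "((of_int 0, of_int 1), (of_int 1, of_int 1))"] show ?thesis by (simp add: evalf_def fv_def)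
qed

section \<open>Size of the fraction obtained from an answer\<close>

definition psz :: "pexp => nat => bool" where "psz e n \<longleftrightarrow> pnorm 2 e <= 2 ^ n \<and> pdeg e <= n"

definition fsz :: "pexp \<times> pexp => nat => bool" where "fsz p n \<longleftrightarrow> psz (fst p) n \<and> psz (snd p) n"

lemma psz_mono: "psz e n ==> n <= n' ==> psz e n'"
 unfolding psz_def by (meson le_trans one_le_numeral power_increasing)

lemma fsz_mono: "fsz e n ==> n <= n' ==> fsz e n'"
 unfolding fsz_def by (meson psz_mono)

lemma psz_add: assumes "psz a n" "psz b n" shows "psz (a + b) (Suc n)"
 using assms unfolding psz_def plus_pexp_def by simp

lemma psz_mult: assumes "psz a n" "psz b n'" shows "psz (a * b) (n + n')"
 using assms unfolding psz_def times_pexp_def by (simp add: power_add mult_le_mono add_mono)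

lemma fsz_ops:
 assumes "fsz p n" "fsz r n'"
 shows "fsz (fadd p r) (Suc (n + n'))" "fsz (fmul p r) (n + n')" "fsz (fdiv p r) (n + n')"
 using assms psz_mult[of "fst p" n] psz_mult[of "snd p" n] psz_mult[of "fst r" n' "snd p" n]
 unfolding fsz_def fadd_def fmul_def fdiv_def
 by (auto intro!: psz_add intro: psz_mono[of _ "n + n'"] simp: add.commute[of n' n])

lemma bin_less: "n < 2 ^ length (bin n)"
proof (induction n rule: bin.induct)
 case (1 n)
 then show ?case by (cases "n = 0") (auto simp: bin.simps[of n])
qed

lemma length_enc_list: "length (enc_list f xs) = (\<Sum>x\<leftarrow>xs. Suc (length (f x))) + 1"
 by (induction xs) (auto simp: enc_list_def)

lemma fsz_const: "\<bar>c\<bar> <= 2 ^ n ==> fsz (PC c, PC 1) n"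
proof -
 assume "\<bar>c\<bar> <= 2 ^ n"
 then have "nat \<bar>c\<bar> <= nat (2 ^ n)" by (rule nat_mono)
 then show ?thesis by (simp add: fsz_def psz_def nat_power_eq)
qed

text \<open>Exponents are encoded in unary and coefficients in binary, so the length of the code
  bounds both the degree and the logarithm of the norm.\<close>

lemma tval_size:
 assumes F: "\<And>f. f \<in> set F ==> fsz f ka" and "1 <= ka"
 shows "fsz (tval PC F t) (ka * length ((%(c, e). enc_int c @ enc_list enc_unary e) t))"
proof -
 obtain c e where t: "t = (c, e)" by fastforce
 have pow: "fsz (((%a. fmul a f) ^^ n) s) (m + n * ka)" if "fsz f ka" "fsz s m" for f n s m
 proof (induction n)
  case (Suc n)
  then show ?case using fsz_ops(2)[OF Suc that(1)] by (simp add: algebra_simps)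
 qed (simp add: that)
 have f: "fsz (fold (%(f, n). (%a. fmul a f) ^^ n) (zip F e) s) (m + sum_list e * ka)" if "fsz s m" for s m
  using that F
 proof (induction F arbitrary: e s m)
  case Nil then show ?case by (auto intro: fsz_mono)
 next
  case (Cons f F)
  show ?case
  proof (cases e)
   case Nil then show ?thesis using Cons by simp
  next
   case e: (Cons n e')
   have "fsz (((%a. fmul a f) ^^ n) s) (m + n * ka)" using pow Cons.prems by auto
   from Cons.IH[OF this, of e'] show ?thesis using Cons.prems by (simp add: e algebra_simps)
  qed
 qed
 define l where "l = length (bin (nat \<bar>c\<bar>))"
 have "nat \<bar>c\<bar> <= 2 ^ l" unfolding l_def using bin_less[of "nat \<bar>c\<bar>"] by simp
 then have "\<bar>c\<bar> <= int (2 ^ l)" by linarith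
 then have "fsz (PC c, PC 1) l" by (intro fsz_const) simp
 from f[OF this] have "fsz (tval PC F t) (l + sum_list e * ka)" by (simp add: tval_def t)
 moreover have "l + sum_list e * ka <= ka * length (enc_int c @ enc_list enc_unary e)"
 proof -
  have "sum_list e <= length (enc_list enc_unary e)"
   unfolding length_enc_list by (induction e) (auto simp: enc_unary_def)
  moreover have "l <= length (enc_int c)" unfolding enc_int_def enc_nat_def l_def
   by (simp add: length_enc_list sum_list_triv)
  ultimately have "l * 1 + sum_list e * ka <= length (enc_int c) * ka + length (enc_list enc_unary e) * ka"
   using assms(2) by (intro add_mono mult_le_mono) auto
  then show ?thesis by (simp add: algebra_simps)
 qed
 ultimately show ?thesis by (auto simp: t intro: fsz_mono)
qed

lemma pval_size:
 assumes F: "\<And>f. f \<in> set F ==> fsz f ka" and "1 <= ka"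
 shows "fsz (pval PC F P) (ka * length (enc_int_poly P))"
proof -
 let ?l = "%t. length ((%(c, e). enc_int c @ enc_list enc_unary e) t)"
 have "fsz (fold (%t acc. fadd acc (tval PC F t)) P s) (m + ka * (\<Sum>t\<leftarrow>P. Suc (?l t)))" if "fsz s m" for s m
  using that
 proof (induction P arbitrary: s m)
  case (Cons t P)
  have "fsz (fadd s (tval PC F t)) (Suc (m + ka * ?l t))" by (rule fsz_ops(1)[OF Cons.prems tval_size[OF assms]])
  then have "fsz (fadd s (tval PC F t)) (m + ka * Suc (?l t))" by (rule fsz_mono) (use assms(2) in simp)
  from Cons.IH[OF this] show ?case by (simp add: algebra_simps del: length_append)
 qed simp
 from this[OF fsz_const[of 0 0]] have "fsz (pval PC F P) (0 + ka * (\<Sum>t\<leftarrow>P. Suc (?l t)))" by (simp add: pval_def)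
 then show ?thesis by (rule fsz_mono) (simp add: enc_int_poly_def length_enc_list)
qed

text \<open>Each step enlarges the power of the generator by \<open>ka\<close>, and this power
  enters the next summand. The bound thus becomes quadratic in the length of the answer.\<close>

lemma evalf_size:
 assumes F: "\<And>f. f \<in> set F ==> fsz f ka" "1 <= ka" "fsz B ka"
 shows "fsz (evalf PC F B a) (ka * (length (enc_field_elem a) * (length (enc_field_elem a) + 1)))"
proof -
 let ?l = "%PQ. length ((%(P, Q). enc_int_poly P @ enc_int_poly Q) PQ)"
 have "fsz (fst (fold (estep PC F B) a s)) (m + ka * ((\<Sum>PQ\<leftarrow>a. Suc (?l PQ)) + length a * (d + length a)))"
  if "fsz (fst s) m" "fsz (snd s) (ka * d)" for s m d
  using that
 proof (induction a arbitrary: s m d)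
  case (Cons PQ a)
  obtain P Q where PQ: "PQ = (P, Q)" by fastforce
  let ?m' = "Suc (m + (ka * length (enc_int_poly P) + ka * length (enc_int_poly Q) + ka * d))"
  have 1: "fsz (fst (estep PC F B PQ s)) ?m'"
   unfolding estep_def fst_conv PQ snd_conv
   by (intro fsz_ops Cons.prems pval_size F)
  have "fsz (snd (estep PC F B PQ s)) (ka * d + ka)"
   unfolding estep_def snd_conv by (rule fsz_ops(2)[OF Cons.prems(2) F(3)])
  then have 2: "fsz (snd (estep PC F B PQ s)) (ka * Suc d)" by (simp add: add.commute)
  have "?m' + ka * ((\<Sum>PQ\<leftarrow>a. Suc (?l PQ)) + length a * (Suc d + length a)) <=
    m + ka * ((\<Sum>PQ\<leftarrow>PQ # a. Suc (?l PQ)) + length (PQ # a) * (d + length (PQ # a)))"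
   using F(2) by (simp add: PQ algebra_simps)
  with Cons.IH[OF 1 2] show ?case by (auto intro: fsz_mono)
 qed (auto intro: fsz_mono)
 from this[of "((PC 0, PC 1), (PC 1, PC 1))" 0 0]
 have 1: "fsz (evalf PC F B a) (ka * ((\<Sum>PQ\<leftarrow>a. Suc (?l PQ)) + length a * length a))"
  using fsz_const[of 0 0] fsz_const[of 1 0] by (simp add: evalf_def)
 define S where "S = (\<Sum>PQ\<leftarrow>a. Suc (?l PQ))"
 have "length a <= S" unfolding S_def by (induction a) auto
 then have "length a * length a <= S * S" by (rule mult_le_mono) fact
 then have "S + length a * length a <= (S + 1) * ((S + 1) + 1)" by (simp add: algebra_simps)
 moreover have "length (enc_field_elem a) = S + 1"
  by (simp add: enc_field_elem_def length_enc_list S_def)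
 ultimately have "S + length a * length a <= length (enc_field_elem a) * (length (enc_field_elem a) + 1)"
  by (simp only:)
 then show ?thesis using 1 unfolding S_def[symmetric] by (rule fsz_mono[OF _ mult_le_mono2, rotated])
qed

lemma evalf_closed:
 assumes P: "\<And>c. P (k c)" "\<And>a b. P a ==> P b ==> P (a + b)" "\<And>a b. P a ==> P b ==> P (a * b)"
  and F: "\<And>f. f \<in> set F ==> P (fst f) \<and> P (snd f)" "P (fst B) \<and> P (snd B)"
 shows "P (fst (evalf k F B a)) \<and> P (snd (evalf k F B a))"
proof -
 define Q where "Q p \<longleftrightarrow> P (fst p) \<and> P (snd p)" for p
 have ops: "Q p ==> Q r ==> Q (fadd p r)" "Q p ==> Q r ==> Q (fmul p r)" "Q p ==> Q r ==> Q (fdiv p r)" for p r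
  using P by (auto simp: Q_def fadd_def fmul_def fdiv_def)
 have pow: "Q f ==> Q s ==> Q (((%a. fmul a f) ^^ n) s)" for f n s
  by (induction n) (auto intro: ops)
 have "Q (fold (%(f, n). (%a. fmul a f) ^^ n) (zip F e) s)" if "Q s" for e s
  using that F(1)
 proof (induction F arbitrary: e s)
  case (Cons f F)
  have "Q f" using Cons.prems by (auto simp: Q_def)
  then show ?case using Cons.IH Cons.prems pow by (cases e) auto
 qed simp
 then have t: "Q (tval k F t)" for t by (simp add: tval_def Q_def P)
 have "Q (fold (%t acc. fadd acc (tval k F t)) R s)" if "Q s" for R s
  using that
 proof (induction R arbitrary: s)
  case (Cons u R)
  show ?case using Cons.IH[OF ops(1)[OF Cons.prems t[of u]]] by simp
 qed simp
 then have p: "Q (pval k F R)" for R by (simp add: pval_def Q_def P)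
 have "Q (fst (fold (estep k F B) a s))" if "Q (fst s)" "Q (snd s)" for s
  using that
 proof (induction a arbitrary: s)
  case (Cons PQ a)
  have B: "Q B" using F(2) by (simp add: Q_def)
  have "Q (fst (estep k F B PQ s))" "Q (snd (estep k F B PQ s))"
   unfolding estep_def fst_conv snd_conv by (intro ops p Cons.prems B)+
  then show ?case using Cons.IH by simp
 qed simp
 then show ?thesis by (simp add: evalf_def Q_def P)
qed

text \<open>
 The fractions \<open>F\<close> and \<open>B\<close> express the generators \<open>X\<close> and \<open>bh\<close> by the matrix entries; as the
 entries are independent, an answer of the oracle is correct for all matrices at once.
\<close>

theorem answer_identity:
 assumes M: "M \<in> symmetric_mats q" and gen: "generic (VS q) (mvar q M)" and pres: "presentation M X bh"
 shows "\<exists>F B ka. length F = length X \<and> 1 <= ka \<and>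
  (\<forall>G a. multigraph G --> wf_field_elem X a --> field_elem_val X bh a = Z M G -->
   pvars (snd (evalf PC F B a)) \<subseteq> {..<q * q} \<and>
   psz (snd (evalf PC F B a)) (ka * (length (enc_field_elem a) * (length (enc_field_elem a) + 1))) \<and>
   ev (mvar q M) (snd (evalf PC F B a)) ~= 0 \<and>
   (\<forall>x :: nat => int. ev x (fst (evalf PC F B a)) = ZZ q (%a b. x (vi q a b)) G * ev x (snd (evalf PC F B a))))"
proof -
 define m where "m = mvar q M"
 have hull: "insert bh (set X) \<subseteq> is_subfield hull elements_mat M"
  using pres hull_subset[of "insert bh (set X)" is_subfield] by (simp add: presentation_def)
 have ex: "\<exists>f. pvars (fst f) \<union> pvars (snd f) \<subseteq> VS q \<and> ev m (snd f) ~= 0 \<and> y = fv (map_prod (ev m) (ev m) f)"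
  if "y \<in> insert bh (set X)" for y
  using hull_frac[OF M, of y] hull that unfolding m_def fv_def by fastforce
 define fr where "fr y = (SOME f. pvars (fst f) \<union> pvars (snd f) \<subseteq> VS q \<and> ev m (snd f) ~= 0 \<and> y = fv (map_prod (ev m) (ev m) f))" for y
 have fr: "pvars (fst (fr y)) \<union> pvars (snd (fr y)) \<subseteq> VS q \<and> ev m (snd (fr y)) ~= 0 \<and> y = fv (map_prod (ev m) (ev m) (fr y))"
  if "y \<in> insert bh (set X)" for y
  unfolding fr_def by (rule someI_ex) (rule ex[OF that])
 define F B where "F = map fr X" and "B = fr bh"
 define sz where "sz e = pnorm 2 e + pdeg e" for e
 have psz: "psz e n" if "sz e <= n" for e n
 proof -
  have "n <= 2 ^ n" by (rule less_imp_le) (rule less_exp)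
  then show ?thesis using that unfolding psz_def sz_def by linarith
 qed
 define ka where "ka = 1 + (\<Sum>f\<leftarrow>B # F. sz (fst f) + sz (snd f))"
 have ka: "fsz f ka" if "f \<in> set (B # F)" for f
 proof -
  have "sz (fst f) + sz (snd f) <= (\<Sum>f\<leftarrow>B # F. sz (fst f) + sz (snd f))"
   by (rule member_le_sum_list) (use that in auto)
  then show ?thesis unfolding fsz_def by (intro conjI psz) (auto simp: ka_def)
 qed
 have "pvars (snd (evalf PC F B a)) \<subseteq> {..<q * q} \<and>
   psz (snd (evalf PC F B a)) (ka * (length (enc_field_elem a) * (length (enc_field_elem a) + 1))) \<and>
   ev m (snd (evalf PC F B a)) ~= 0 \<and>
   (\<forall>x :: nat => int. ev x (fst (evalf PC F B a)) = ZZ q (%a b. x (vi q a b)) G * ev x (snd (evalf PC F B a)))"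
  if G: "multigraph G" and a: "wf_field_elem X a" "field_elem_val X bh a = Z M G" for G a
 proof -
  define N D where "N = fst (evalf PC F B a)" and "D = snd (evalf PC F B a)"
  have "pvars (fst (evalf PC F B a)) \<subseteq> VS q \<and> pvars (snd (evalf PC F B a)) \<subseteq> VS q"
  proof (rule evalf_closed)
   fix f assume "f \<in> set F"
   then obtain y where "y \<in> set X" "f = fr y" by (auto simp: F_def)
   then show "pvars (fst f) \<subseteq> VS q \<and> pvars (snd f) \<subseteq> VS q" using fr[of y] by auto
  qed (use fr[of bh] in \<open>auto simp: plus_pexp_def times_pexp_def B_def\<close>)
  then have vars: "pvars N \<union> pvars D \<subseteq> VS q" by (simp add: N_def D_def)
  define h where "h = map_prod (ev m) (ev m)"
  have hom: "h (evalf PC F B a) = evalf of_int (map h F) (h B) a"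
   unfolding h_def by (rule evalf_hom) (auto simp: plus_pexp_def times_pexp_def)
  have X: "map fv (map h F) = X" unfolding F_def map_map by (rule map_idI) (use fr in \<open>auto simp: h_def\<close>)
  have bh: "fv (h B) = bh" using fr[of bh] by (simp add: B_def h_def)
  have "fv (evalf of_int (map h F) (h B) a) = field_elem_val X bh a \<and> snd (evalf of_int (map h F) (h B) a) ~= 0"
  proof (rule evalf_real[of "map h F" "h B" a, unfolded X bh])
   fix f assume "f \<in> set (map h F)"
   then obtain y where "y \<in> set X" "f = h (fr y)" by (auto simp: F_def)
   then show "snd f ~= 0" using fr[of y] by (simp add: h_def)
  next
   show "snd (h B) ~= 0" using fr[of bh] by (simp add: h_def B_def)
  qed (rule a(1))
  then have real: "ev m N / ev m D = Z M G" "ev m D ~= 0"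
   unfolding hom[symmetric] using a(2) by (auto simp: h_def N_def D_def fv_def)
  have "ev x N = ZZ q (%a b. x (vi q a b)) G * ev x D" for x :: "nat => int"
  proof (rule ccontr)
   assume c: "\<not> ?thesis"
   \<comment> \<open>Numerator minus partition function times denominator. It vanishes at the
     entries of \<open>M\<close>, so by genericity it cannot be nonzero at an integer point.\<close>
   define e where "e = PA N (PM (PC (-1)) (PM (zexp q G) D))"
   have "ev x e ~= 0" using c by (simp add: e_def zexp)
   moreover have "pvars e \<subseteq> VS q" using vars zexp(2)[OF G] by (auto simp: e_def)
   ultimately have "ev m e ~= 0" using gen unfolding generic_def m_def by blast
   then show False using real Z_mvar[OF M G] by (simp add: e_def m_def field_simps)
  qed
  moreover have "psz D (ka * (length (enc_field_elem a) * (length (enc_field_elem a) + 1)))"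
   using evalf_size[of F ka B a] ka unfolding D_def fsz_def by (auto simp: ka_def)
  moreover have "pvars D \<subseteq> {..<q * q}" using vars VS_less by auto
  ultimately show ?thesis using real unfolding N_def D_def by blast
 qed
 then show ?thesis unfolding m_def
  by (intro exI[of _ F] exI[of _ B] exI[of _ ka]) (auto simp: F_def ka_def)
qed

section \<open>Exactly-one constraints\<close>

definition cnt :: "nat => bool list => nat list => nat" where
 "cnt b u v = (\<Sum>(c, d)\<leftarrow>zip u v. if c \<and> d = b then 1 else 0)"

lemma cnt_append: "length u = length v ==> cnt b (u @ u') (v @ v') = cnt b u v + cnt b u' v'"
 by (simp add: cnt_def)

lemma cnt_map: "cnt b u (map v [0..<length u]) = card {j. j < length u \<and> u ! j \<and> v j = b}"
proof -
 have "cnt b u (map v [0..<length u]) = (\<Sum>j = 0..<length u. if u ! j \<and> v j = b then 1 else 0)"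
  unfolding cnt_def by (simp add: sum_list_sum_nth)
 also have "\<dots> = (\<Sum>j\<in>{j \<in> {0..<length u}. u ! j \<and> v j = b}. 1)"
  by (rule sum.inter_filter[symmetric]) simp
 finally show ?thesis by (simp add: conj_assoc)
qed

definition cells :: "bool list => nat list" where
 "cells u = map (%j. (if j = 0 then 7 else 5) + (if u ! j then 1 else 0)) [0..<length u]"

definition raster :: "nat list => bool list list => nat list" where
 "raster ps us = (ps @ [0]) @ concat (map (%u. cells u @ [3]) us) @ replicate (length ps) 4 @ [0]"

lemma nth_concat_uniform:
 assumes "\<And>r. r \<in> set rs ==> length r = n" "i < length rs" "j < n"
 shows "concat rs ! (i * n + j) = rs ! i ! j"
 using assms
proof (induction rs arbitrary: i)
 case (Cons r rs)
 show ?case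
 proof (cases i)
  case 0
  then show ?thesis using Cons.prems by (simp add: nth_append)
 next
  case (Suc i')
  have "(r @ concat rs) ! (length r + (i' * n + j)) = concat rs ! (i' * n + j)" by (rule nth_append_length_plus)
  moreover have "length r = n" using Cons.prems by simp
  ultimately show ?thesis using Cons.IH[of i'] Cons.prems Suc by (simp add: add.assoc)
 qed
qed simp

lemma raster_grid:
 assumes "\<And>u. u \<in> set us ==> length u = length ps"
 shows "length (raster ps us) = (length us + 2) * (length ps + 1)"
  "i < length us + 2 ==> j < length ps + 1 ==>
   raster ps us ! (i * (length ps + 1) + j) = ct ((!) ps) (%i j. us ! i ! j) (length us) (length ps) i j"
proof -
 define rs where "rs = (ps @ [0]) # map (%u. cells u @ [3]) us @ [replicate (length ps) 4 @ [0]]"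
 have r: "raster ps us = concat rs" by (simp add: raster_def rs_def)
 have l: "length r = length ps + 1" if "r \<in> set rs" for r
  using that assms by (auto simp: rs_def cells_def)
 have "length (concat rs) = length rs * (length ps + 1)"
  using l by (induction rs) (auto simp: length_concat)
 then show "length (raster ps us) = (length us + 2) * (length ps + 1)" by (simp add: r rs_def)
 assume ij: "i < length us + 2" "j < length ps + 1"
 have "concat rs ! (i * (length ps + 1) + j) = rs ! i ! j"
  by (rule nth_concat_uniform[OF l]) (use ij in \<open>auto simp: rs_def\<close>)
 also have "\<dots> = ct ((!) ps) (%i j. us ! i ! j) (length us) (length ps) i j"
 proof -
  consider "i = 0" | i' where "i = Suc i'" "i' < length us" | "i = length us + 1"
   using ij(1) by (cases i) (auto simp: less_Suc_eq)
  then show ?thesis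
  proof cases
   case 1 then show ?thesis using ij(2) by (auto simp: rs_def ct_def nth_append)
  next
   case 2
   have "length (us ! i') = length ps" using assms 2 by simp
   moreover have "rs ! i = cells (us ! i') @ [3]" using 2 by (simp add: rs_def nth_append)
   ultimately show ?thesis using ij(2) 2 by (auto simp: ct_def nth_append cells_def less_Suc_eq)
  next
   case 3
   then have "rs ! i = replicate (length ps) 4 @ [0]" by (simp add: rs_def nth_append)
   then show ?thesis using ij(2) 3 by (auto simp: ct_def nth_append less_Suc_eq)
  qed
 qed
 finally show "raster ps us ! (i * (length ps + 1) + j) = ct ((!) ps) (%i j. us ! i ! j) (length us) (length ps) i j"
  by (simp add: r)
qed

theorem Z_rows:
 assumes q: "3 <= q" and ps: "ps ~= []" "\<And>p. p \<in> set ps ==> p <= 2"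
  and us: "\<And>u. u \<in> set us ==> length u = length ps"
 shows "planar (gg (raster ps us) (length ps + 1))"
  "ZZ q m0 (gg (raster ps us) (length ps + 1)) = (\<Prod>t\<leftarrow>raster ps us. kc q t) *
   (\<Sum>v\<in>{v. length v = length ps \<and> set v \<subseteq> {0, 1} \<and>
     (\<forall>j<length ps. (ps ! j = 1 --> v ! j = 0) \<and> (ps ! j = 2 --> v ! j = 1))}.
    \<Prod>u\<leftarrow>us. 3 ^ cnt 0 u v - 3 ^ cnt 1 u v)"
proof -
 have p: "ps ! j <= 2" if "j < length ps" for j using ps that by simp
 show "planar (gg (raster ps us) (length ps + 1))"
  by (rule planar_gg[OF raster_grid(1)[OF us] raster_grid(2)[OF us] p]) simp_all
 define nc where "nc = length ps"
 define V where "V = {v \<in> {..<nc} \<rightarrow>\<^sub>E {..<2::nat}. \<forall>j<nc. (ps ! j = 1 --> v j = 0) \<and> (ps ! j = 2 --> v j = 1)}"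
 define V' where "V' = {v. length v = nc \<and> set v \<subseteq> {0, 1} \<and> (\<forall>j<nc. (ps ! j = 1 --> v ! j = 0) \<and> (ps ! j = 2 --> v ! j = (1::nat)))}"
 define G where "G v = (\<Prod>u\<leftarrow>us. 3 ^ cnt 0 u v - 3 ^ cnt 1 u v :: int)" for v
 have "ZZ q m0 (gg (raster ps us) (nc + 1)) = (\<Prod>t\<leftarrow>raster ps us. kc q t) *
   (\<Sum>v\<in>V. \<Prod>i<length us. 3 ^ card {j. j < nc \<and> us ! i ! j \<and> v j = 0} - 3 ^ card {j. j < nc \<and> us ! i ! j \<and> v j = 1})"
  unfolding V_def nc_def
  by (rule Z_grid[OF q _ raster_grid(1)[OF us] raster_grid(2)[OF us] p]) (use ps in simp_all)
 also have "(\<Sum>v\<in>V. \<Prod>i<length us. 3 ^ card {j. j < nc \<and> us ! i ! j \<and> v j = 0} - 3 ^ card {j. j < nc \<and> us ! i ! j \<and> v j = 1}) =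
   (\<Sum>v\<in>V. G (map v [0..<nc]))"
 proof (rule sum.cong[OF refl])
  fix v
  have "G (map v [0..<nc]) = (\<Prod>i = 0..<length us. 3 ^ cnt 0 (us ! i) (map v [0..<nc]) - 3 ^ cnt 1 (us ! i) (map v [0..<nc]))"
   unfolding G_def using prod.list_conv_set_nth[of "map (%u. 3 ^ cnt 0 u (map v [0..<nc]) - 3 ^ cnt 1 u (map v [0..<nc]) :: int) us"]
   by simp
  also have "\<dots> = (\<Prod>i = 0..<length us. 3 ^ card {j. j < nc \<and> us ! i ! j \<and> v j = 0} - 3 ^ card {j. j < nc \<and> us ! i ! j \<and> v j = 1})"
  proof (rule prod.cong[OF refl])
   fix i assume "i \<in> {0..<length us}"
   then have "length (us ! i) = nc" using us by (simp add: nc_def)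
   then show "(3::int) ^ cnt 0 (us ! i) (map v [0..<nc]) - 3 ^ cnt 1 (us ! i) (map v [0..<nc]) =
     3 ^ card {j. j < nc \<and> us ! i ! j \<and> v j = 0} - 3 ^ card {j. j < nc \<and> us ! i ! j \<and> v j = 1}"
    using cnt_map[of _ "us ! i" v] by simp
  qed
  finally show "(\<Prod>i<length us. 3 ^ card {j. j < nc \<and> us ! i ! j \<and> v j = 0} - 3 ^ card {j. j < nc \<and> us ! i ! j \<and> v j = 1}) =
    G (map v [0..<nc])" by (simp add: atLeast0LessThan)
 qed
 also have "\<dots> = (\<Sum>v\<in>V'. G v)"
 proof (rule sum.reindex_bij_witness[where i = "%l. \<lambda>j\<in>{..<nc}. l ! j" and j = "%v. map v [0..<nc]"])
  fix v assume v: "v \<in> V"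
  then have v2: "v j < 2" if "j < nc" for j using that by (auto simp: V_def)
  show "(\<lambda>j\<in>{..<nc}. map v [0..<nc] ! j) = v"
   using v by (auto simp: V_def fun_eq_iff PiE_iff extensional_def)
  have "set (map v [0..<nc]) \<subseteq> {0, 1}" using v2 by (fastforce simp: less_2_cases_iff)
  then show "map v [0..<nc] \<in> V'" using v by (simp add: V_def V'_def)
 next
  fix l assume l: "l \<in> V'"
  then show "map (\<lambda>j\<in>{..<nc}. l ! j) [0..<nc] = l" by (intro nth_equalityI) (auto simp: V'_def)
  have "l ! j < 2" if "j < nc" for j
  proof -
   have "l ! j \<in> set l" using that l by (simp add: V'_def)
   then have "l ! j \<in> {0, 1}" using l by (auto simp: V'_def)
   then show ?thesis by auto
  qed
  then show "(\<lambda>j\<in>{..<nc}. l ! j) \<in> V" using l by (auto simp: V_def V'_def)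
 qed simp
 finally show "ZZ q m0 (gg (raster ps us) (length ps + 1)) = (\<Prod>t\<leftarrow>raster ps us. kc q t) *
   (\<Sum>v\<in>{v. length v = length ps \<and> set v \<subseteq> {0, 1} \<and>
     (\<forall>j<length ps. (ps ! j = 1 --> v ! j = 0) \<and> (ps ! j = 2 --> v ! j = 1))}.
    \<Prod>u\<leftarrow>us. 3 ^ cnt 0 u v - 3 ^ cnt 1 u v)"
  by (simp only: nc_def V'_def G_def)
qed

text \<open>
 Every cell \<open>ka\<close> has \<open>tg\<close> Boolean variables and a label.  For each \<open>rh\<close> exactly one of the
 variables selected by the label among those of the cells \<open>ka\<close>, \<open>ka + 1\<close> and \<open>ka + W\<close> has to be
 true.  A row of the grid forbids that the numbers of selected columns with values 0 and 1 agree;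
 pinned columns shift the balance, so that \<open>K\<close> rows leave exactly one true variable.
\<close>

definition msk :: "nat => nat => nat => nat" where
 "msk W ka ka' = (if ka' = ka then 1 else if ka' = ka + 1 then 2 else if ka' = ka + W then 3 else 0)"

definition asz :: "nat => (nat => nat => nat => nat => bool) => nat => nat => nat" where
 "asz tg con l rh = (\<Sum>m\<in>{1,2,3}. card {ta. ta < tg \<and> con l rh ta m})"

text \<open>Row \<open>r\<close> excludes the case of exactly \<open>kst r\<close> true variables.
  The case of one true variable has to remain, so its row excludes 0 once more.\<close>

definition kst :: "nat => nat" where "kst r = (if r = 1 then 0 else r)"

definition selrow :: "nat => (nat => nat => nat => nat => bool) => nat => nat => nat list => bool list" where
 "selrow tg con l rh ms = concat (map (%m. map (%ta. con l rh ta m) [0..<tg]) ms)"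

text \<open>If \<open>k\<close> of the \<open>a\<close> selected variables are true, the pinned
  columns add \<open>2 * K - a\<close> zeros and \<open>2 * K - 2 * kst r\<close> ones. The totals
  are \<open>2 * K - k\<close> zeros and \<open>2 * K - 2 * kst r + k\<close> ones, which agree only
  for \<open>k = kst r\<close>.\<close>

definition urow :: "nat => nat => (nat => nat => nat => nat => bool) => nat => nat => nat => nat list => bool list" where
 "urow K tg con l rh r ms = (map (%j. j < K - asz tg con l rh) [0..<K] @ replicate K True @
   map (%j. j < 2 * K - 2 * kst r) [0..<2 * K]) @ selrow tg con l rh ms"

definition pcols :: "nat => nat => nat list" where
 "pcols K n = replicate (2 * K) 1 @ replicate (2 * K) 2 @ replicate n 0"

definition urows :: "nat => nat => nat => (nat => nat => nat => nat => bool) => nat => nat list => bool list list" where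
 "urows K R tg con W ls = concat (map (%ka. concat (map (%rh. map (%r.
   urow K tg con (ls ! ka) rh r (map (msk W ka) [0..<length ls])) [0..<Suc K]) [0..<R])) [0..<length ls])"

definition ckst :: "nat => int" where
 "ckst K = (\<Prod>r<Suc K. 3 ^ (2 * K - 1) - 3 ^ (2 * K + 1 - 2 * kst r))"

text \<open>The two exponents would agree only for \<open>kst r = 1\<close>, a value that
  \<open>kst\<close> does not take.\<close>

lemma ckst_nz: assumes "1 <= K" shows "ckst K ~= 0"
proof -
 have "(3::int) ^ (2 * K - 1) ~= 3 ^ (2 * K + 1 - 2 * kst r)" if "r < Suc K" for r
 proof -
  have "2 * K - 1 ~= 2 * K + 1 - 2 * kst r" using that assms by (auto simp: kst_def)
  then show ?thesis by (simp add: power_inject_exp)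
 qed
 then show ?thesis unfolding ckst_def by (subst prod_zero_iff) auto
qed

lemma cnt_const: "cnt b u (replicate (length u) c) = (if c = b then length (filter id u) else 0)"
 unfolding cnt_def by (induction u) (auto simp: id_def)

lemma cnt_le_sum: "length u = length x ==> set x \<subseteq> {0, 1} ==> cnt 0 u x + cnt 1 u x = length (filter id u)"
 unfolding cnt_def by (induction u x rule: list_induct2) auto

lemma length_filter_upt_less: "a <= n ==> length (filter id (map (%j. j < a) [0..<n])) = a"
proof -
 assume "a <= n"
 then have "{j. j < n \<and> j < a} = {..<a}" by auto
 moreover have "{i. i < n \<and> [0..<n] ! i < a} = {j. j < n \<and> j < a}" by auto
 ultimately show ?thesis by (simp add: filter_map comp_def length_filter_conv_card)
qed

definition xsel :: "nat => nat list set" where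
 "xsel n = {x. length x = n \<and> set x \<subseteq> {0, 1}}"

lemma pinned_lists:
 "{v. length v = length (pcols K n) \<and> set v \<subseteq> {0, 1} \<and>
   (\<forall>j<length (pcols K n). (pcols K n ! j = 1 --> v ! j = 0) \<and> (pcols K n ! j = 2 --> v ! j = 1))} =
  (%x. replicate (2 * K) 0 @ replicate (2 * K) 1 @ x) ` xsel n" (is "?A = ?B")
proof (intro equalityI subsetI)
 fix v assume v: "v \<in> ?A"
 then have l: "length v = 4 * K + n" "set v \<subseteq> {0, 1}" by (auto simp: pcols_def)
 have e: "v ! j = (if j < 2 * K then 0 else 1)" if "j < 4 * K" for j
  using v that by (auto simp: pcols_def nth_append)
 have "take (4 * K) v = replicate (2 * K) 0 @ replicate (2 * K) 1"
  by (rule nth_equalityI) (use l e in \<open>auto simp: nth_append\<close>)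
 then have "v = replicate (2 * K) 0 @ replicate (2 * K) 1 @ drop (4 * K) v"
  by (metis append.assoc append_take_drop_id)
 moreover have "drop (4 * K) v \<in> xsel n" using l set_drop_subset[of "4 * K" v] by (auto simp: xsel_def)
 ultimately show "v \<in> ?B" by blast
next
 fix v assume "v \<in> ?B"
 then show "v \<in> ?A" by (auto simp: xsel_def pcols_def nth_append)
qed

text \<open>If a constraint has \<open>k \<noteq> 1\<close> true variables, then
  \<open>k \<le> K\<close> and its row \<open>k\<close> has weight 0. If it has one, its rows
  multiply to \<open>ckst K\<close>, which does not depend on the constraint.\<close>

theorem exact_one:
 assumes q: "3 <= q" and K: "1 <= K" and ls: "ls ~= []" and tg: "1 <= tg"
  and aK: "\<And>ka rh. ka < length ls ==> rh < R ==> asz tg con (ls ! ka) rh <= K"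
  and asel: "\<And>ka rh. ka < length ls ==> rh < R ==>
   length (filter id (selrow tg con (ls ! ka) rh (map (msk W ka) [0..<length ls]))) = asz tg con (ls ! ka) rh"
 defines "G \<equiv> gg (raster (pcols K (length ls * tg)) (urows K R tg con W ls)) (4 * K + length ls * tg + 1)"
 shows "planar G"
  "ZZ q m0 G = (\<Prod>t\<leftarrow>raster (pcols K (length ls * tg)) (urows K R tg con W ls). kc q t) *
   (ckst K ^ (length ls * R) * int (card {x \<in> xsel (length ls * tg). \<forall>ka<length ls. \<forall>rh<R.
     cnt 1 (selrow tg con (ls ! ka) rh (map (msk W ka) [0..<length ls])) x = 1}))"
proof -
 define n where "n = length ls * tg"
 define sel where "sel ka rh = selrow tg con (ls ! ka) rh (map (msk W ka) [0..<length ls])" for ka rh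
 have lsel: "length (selrow tg con l rh ms) = length ms * tg" for l rh ms
  by (induction ms) (auto simp: selrow_def)
 have lp: "length (pcols K n) = 4 * K + n" by (simp add: pcols_def)
 have us: "length u = length (pcols K n)" if "u \<in> set (urows K R tg con W ls)" for u
  using that by (auto simp: urows_def urow_def lsel pcols_def n_def)
 have ps: "pcols K n ~= []" "\<And>p. p \<in> set (pcols K n) ==> p <= 2" using K by (auto simp: pcols_def)
 have "planar (gg (raster (pcols K n) (urows K R tg con W ls)) (length (pcols K n) + 1))"
  by (rule Z_rows(1)[OF q ps us])
 then show "planar G" unfolding G_def by (simp add: lp n_def[symmetric] add.assoc)
 have G: "G = gg (raster (pcols K n) (urows K R tg con W ls)) (length (pcols K n) + 1)"
  by (simp add: G_def lp n_def[symmetric])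
 let ?v = "%x. replicate (2 * K) 0 @ replicate (2 * K) 1 @ x"
 have row: "(3::int) ^ cnt 0 (urow K tg con (ls ! ka) rh r ms) (?v x) - 3 ^ cnt 1 (urow K tg con (ls ! ka) rh r ms) (?v x) =
   3 ^ (2 * K - k) - 3 ^ (2 * K - 2 * kst r + k)" if "ka < length ls" "rh < R" "r < Suc K" "x \<in> xsel n"
   "ms = map (msk W ka) [0..<length ls]" "k = cnt 1 (sel ka rh) x" for ka rh r ms x k
 proof -
  define a where "a = asz tg con (ls ! ka) rh"
  have a: "a <= K" using aK that by (simp add: a_def)
  have s: "cnt 0 (sel ka rh) x + k = a"
   using cnt_le_sum[of "sel ka rh" x] asel[OF that(1,2)] that unfolding sel_def a_def by (simp add: lsel xsel_def n_def)
  have "kst r <= K" using that K by (simp add: kst_def)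
  define u1 u2 where "u1 = map (%j. j < K - a) [0..<K] @ replicate K True" and "u2 = map (%j. j < 2 * K - 2 * kst r) [0..<2 * K]"
  have u: "urow K tg con (ls ! ka) rh r ms = u1 @ u2 @ sel ka rh"
   by (simp add: urow_def u1_def u2_def sel_def a_def that)
  have l: "length u1 = 2 * K" "length u2 = 2 * K" by (auto simp: u1_def u2_def)
  have f: "length (filter id u1) = 2 * K - a" "length (filter id u2) = 2 * K - 2 * kst r"
   using length_filter_upt_less[of "K - a" K] length_filter_upt_less[of "2 * K - 2 * kst r" "2 * K"] a
   by (auto simp: u1_def u2_def)
  have "cnt b (urow K tg con (ls ! ka) rh r ms) (?v x) =
    (if b = 0 then 2 * K - a else 0) + (if b = 1 then 2 * K - 2 * kst r else 0) + cnt b (sel ka rh) x" for b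
   unfolding u using cnt_const[of b u1 0] cnt_const[of b u2 1] l f by (auto simp: cnt_append)
  then have "cnt 0 (urow K tg con (ls ! ka) rh r ms) (?v x) = 2 * K - k"
   "cnt 1 (urow K tg con (ls ! ka) rh r ms) (?v x) = 2 * K - 2 * kst r + k"
   using s a that(6) by auto
  then show ?thesis by simp
 qed
 define good where "good x \<longleftrightarrow> (\<forall>ka<length ls. \<forall>rh<R. cnt 1 (sel ka rh) x = 1)" for x
 have prod: "(\<Prod>u\<leftarrow>urows K R tg con W ls. 3 ^ cnt 0 u (?v x) - 3 ^ cnt 1 u (?v x)) =
   (if good x then ckst K ^ (length ls * R) else 0)" if x: "x \<in> xsel n" for x
 proof -
  define P where "P ka rh = (\<Prod>r<Suc K. (3::int) ^ (2 * K - cnt 1 (sel ka rh) x) - 3 ^ (2 * K - 2 * kst r + cnt 1 (sel ka rh) x))" for ka rh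
  have upt: "(\<Prod>i\<leftarrow>[0..<m]. f i) = (\<Prod>i<m. f i)" for m and f :: "nat => int"
   using prod.distinct_set_conv_list[of "[0..<m]" f] by (simp add: atLeast0LessThan)
  have "(\<Prod>u\<leftarrow>urows K R tg con W ls. (3::int) ^ cnt 0 u (?v x) - 3 ^ cnt 1 u (?v x)) = (\<Prod>ka<length ls. \<Prod>rh<R. P ka rh)"
   unfolding urows_def prod_list_concat_map map_map comp_def upt P_def
   by (intro prod.cong refl) (use x row in auto)
  also have "\<dots> = (if good x then ckst K ^ (length ls * R) else 0)"
  proof (cases "good x")
   case True
   have "P ka rh = ckst K" if "ka < length ls" "rh < R" for ka rh
   proof -
    have c: "cnt 1 (sel ka rh) x = 1" using True that by (simp add: good_def)
    have "2 * K - 2 * kst r + 1 = 2 * K + 1 - 2 * kst r" if "r < Suc K" for r using that by (auto simp: kst_def)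
    then show ?thesis unfolding P_def ckst_def c by (intro prod.cong refl) auto
   qed
   then have "(\<Prod>ka<length ls. \<Prod>rh<R. P ka rh) = (\<Prod>ka<length ls. \<Prod>rh<R. ckst K)"
    by (intro prod.cong refl) auto
   then show ?thesis using True by (simp add: power_mult mult.commute)
  next
   case False
   then obtain ka rh where kr: "ka < length ls" "rh < R" "cnt 1 (sel ka rh) x ~= 1" by (auto simp: good_def)
   define k where "k = cnt 1 (sel ka rh) x"
   have "k <= K" using cnt_le_sum[of "sel ka rh" x] asel[OF kr(1,2)] aK[OF kr(1,2)] x
    unfolding sel_def k_def by (simp add: lsel xsel_def n_def)
   then have "3 ^ (2 * K - k) - 3 ^ (2 * K - 2 * kst k + k) = (0::int)" using kr(3) by (simp add: kst_def k_def)
   then have "P ka rh = 0" unfolding P_def using \<open>k <= K\<close> by (subst prod_zero_iff) (auto simp: k_def)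
   then have "(\<Prod>rh<R. P ka rh) = 0" using kr by (intro prod_zero) auto
   then have "(\<Prod>ka<length ls. \<Prod>rh<R. P ka rh) = 0" using kr by (intro prod_zero) auto
   then show ?thesis using False by simp
  qed
  finally show ?thesis .
 qed
 have fin: "finite (xsel n)" unfolding xsel_def using finite_lists_length_eq[of "{0,1::nat}" n]
  by (simp add: conj_commute)
 have "(\<Sum>v\<in>?v ` xsel n. \<Prod>u\<leftarrow>urows K R tg con W ls. 3 ^ cnt 0 u v - 3 ^ cnt 1 u v) =
   (\<Sum>x\<in>xsel n. \<Prod>u\<leftarrow>urows K R tg con W ls. (3::int) ^ cnt 0 u (?v x) - 3 ^ cnt 1 u (?v x))"
  by (subst sum.reindex) (auto simp: inj_on_def)
 also have "\<dots> = (\<Sum>x\<in>xsel n. if good x then ckst K ^ (length ls * R) else 0)"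
  by (rule sum.cong[OF refl prod])
 also have "\<dots> = (\<Sum>x\<in>{x \<in> xsel n. good x}. ckst K ^ (length ls * R))"
  by (rule sum.inter_filter[OF fin, symmetric])
 also have "\<dots> = ckst K ^ (length ls * R) * int (card {x \<in> xsel n. good x})" by simp
 finally have sum: "(\<Sum>v\<in>?v ` xsel n. \<Prod>u\<leftarrow>urows K R tg con W ls. 3 ^ cnt 0 u v - 3 ^ cnt 1 u v) =
   ckst K ^ (length ls * R) * int (card {x \<in> xsel n. good x})" .
 have "ZZ q m0 (gg (raster (pcols K n) (urows K R tg con W ls)) (length (pcols K n) + 1)) =
   (\<Prod>t\<leftarrow>raster (pcols K n) (urows K R tg con W ls). kc q t) *
   (\<Sum>v\<in>{v. length v = length (pcols K n) \<and> set v \<subseteq> {0, 1} \<and>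
     (\<forall>j<length (pcols K n). (pcols K n ! j = 1 --> v ! j = 0) \<and> (pcols K n ! j = 2 --> v ! j = 1))}.
    \<Prod>u\<leftarrow>urows K R tg con W ls. 3 ^ cnt 0 u v - 3 ^ cnt 1 u v)"
  by (rule Z_rows(2)[OF q ps us])
 then show "ZZ q m0 G = (\<Prod>t\<leftarrow>raster (pcols K (length ls * tg)) (urows K R tg con W ls). kc q t) *
   (ckst K ^ (length ls * R) * int (card {x \<in> xsel (length ls * tg). \<forall>ka<length ls. \<forall>rh<R.
     cnt 1 (selrow tg con (ls ! ka) rh (map (msk W ka) [0..<length ls])) x = 1}))"
  unfolding G[symmetric] pinned_lists sum unfolding good_def sel_def n_def .
qed

section \<open>Tilings\<close>

lemma cnt_map_nth: "length v = n ==> cnt b (map P [0..<n]) v = card {j. j < n \<and> P j \<and> v ! j = b}"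
proof -
 assume l: "length v = n"
 then have v: "v = map ((!) v) [0..<length (map P [0..<n])]" using map_nth[of v] by simp
 have "cnt b (map P [0..<n]) v = card {j. j < length (map P [0..<n]) \<and> map P [0..<n] ! j \<and> v ! j = b}"
  by (subst (1) v, rule cnt_map)
 also have "{j. j < length (map P [0..<n]) \<and> map P [0..<n] ! j \<and> v ! j = b} = {j. j < n \<and> P j \<and> v ! j = b}" by auto
 finally show ?thesis .
qed

lemma length_selrow: "length (selrow tg con l rh ms) = length ms * tg"
 by (induction ms) (auto simp: selrow_def)

lemma cnt_selrow:
 "length x = length ms * tg ==> cnt b (selrow tg con l rh ms) x =
   (\<Sum>i<length ms. card {ta. ta < tg \<and> con l rh ta (ms ! i) \<and> x ! (i * tg + ta) = b})"
proof (induction ms arbitrary: x)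
 case Nil
 then show ?case by (simp add: selrow_def cnt_def)
next
 case (Cons m ms)
 have "cnt b (selrow tg con l rh (m # ms)) x =
   cnt b (map (%ta. con l rh ta m) [0..<tg] @ selrow tg con l rh ms) (take tg x @ drop tg x)"
  by (simp add: selrow_def)
 also have "\<dots> = cnt b (map (%ta. con l rh ta m) [0..<tg]) (take tg x) + cnt b (selrow tg con l rh ms) (drop tg x)"
  by (rule cnt_append) (use Cons.prems in simp)
 also have "cnt b (map (%ta. con l rh ta m) [0..<tg]) (take tg x) =
   card {ta. ta < tg \<and> con l rh ta m \<and> take tg x ! ta = b}"
  by (rule cnt_map_nth) (use Cons.prems in simp)
 also have "{ta. ta < tg \<and> con l rh ta m \<and> take tg x ! ta = b} = {ta. ta < tg \<and> con l rh ta m \<and> x ! ta = b}" by auto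
 also have "cnt b (selrow tg con l rh ms) (drop tg x) =
   (\<Sum>i<length ms. card {ta. ta < tg \<and> con l rh ta (ms ! i) \<and> drop tg x ! (i * tg + ta) = b})"
  by (rule Cons.IH) (use Cons.prems in simp)
 also have "(\<Sum>i<length ms. card {ta. ta < tg \<and> con l rh ta (ms ! i) \<and> drop tg x ! (i * tg + ta) = b}) =
   (\<Sum>i<length ms. card {ta. ta < tg \<and> con l rh ta ((m # ms) ! Suc i) \<and> x ! (Suc i * tg + ta) = b})"
 proof (intro sum.cong refl arg_cong[where f = card] Collect_cong conj_cong)
  fix i ta assume "i \<in> {..<length ms}" "ta < tg"
  then show "(drop tg x ! (i * tg + ta) = b) = (x ! (Suc i * tg + ta) = b)"
   using Cons.prems by (simp add: add.assoc)
 qed simp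
 finally show ?case unfolding length_Cons sum.lessThan_Suc_shift by simp
qed

text \<open>Since \<open>W\<close> is at least 2, the cells \<open>ka + 1\<close> and
  \<open>ka + W\<close> are different.\<close>

lemma sum_msk:
 assumes "2 <= W" "ka < N" "\<And>i. c 0 i = (0::nat)"
 shows "(\<Sum>i<N. c (msk W ka i) i) = c 1 ka + (if ka + 1 < N then c 2 (ka + 1) else 0) + (if ka + W < N then c 3 (ka + W) else 0)"
proof -
 have "(\<Sum>i<N. c (msk W ka i) i) =
   (\<Sum>i<N. (if i = ka then c 1 i else 0) + (if i = ka + 1 then c 2 i else 0) + (if i = ka + W then c 3 i else 0))"
  by (intro sum.cong refl) (use assms in \<open>auto simp: msk_def\<close>)
 also have "\<dots> = c 1 ka + (if ka + 1 < N then c 2 (ka + 1) else 0) + (if ka + W < N then c 3 (ka + W) else 0)"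
  unfolding sum.distrib using assms(2) by (simp add: sum.delta)
 finally show ?thesis .
qed

locale tile_set =
 fixes tg CE CN :: nat and east west north south :: "nat => nat"
  and allow :: "nat => nat => bool" and rgt upw :: "nat => bool"
 assumes tg: "1 <= tg" and east: "\<And>ta. ta < tg ==> east ta < CE" and north: "\<And>ta. ta < tg ==> north ta < CN"
begin

text \<open>Matching is expressed by exactly-one conditions: for each colour \<open>e\<close>,
  either the tile here has east colour \<open>e\<close> or the tile on the right has a west colour
  other than \<open>e\<close>, but not both. For all \<open>e\<close> together this says that the
  colours are equal. Where no match is required, the rule repeats that the cell has one
  tile.\<close>

definition con :: "nat => nat => nat => nat => bool" where
 "con l rh ta m \<longleftrightarrow>
   (if rh = 0 then m = 1
   else if rh = 1 then m = 1 \<and> allow l ta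
   else if rh < 2 + CE then
    (if rgt l then m = 1 \<and> east ta = rh - 2 \<or> m = 2 \<and> west ta ~= rh - 2 else m = 1)
   else (if upw l then m = 1 \<and> north ta = rh - (2 + CE) \<or> m = 3 \<and> south ta ~= rh - (2 + CE) else m = 1))"

abbreviation "nrul \<equiv> 2 + CE + CN"

definition tilings :: "nat => nat list => (nat => nat) set" where
 "tilings W ls = {f \<in> {..<length ls} \<rightarrow>\<^sub>E {..<tg}. \<forall>ka<length ls. allow (ls ! ka) (f ka) \<and>
   (rgt (ls ! ka) --> east (f ka) = west (f (ka + 1))) \<and> (upw (ls ! ka) --> north (f ka) = south (f (ka + W)))}"

lemma con0: "\<not> con l rh ta 0" by (simp add: con_def)

lemma con2: "con l rh ta 2 ==> rgt l" by (simp add: con_def split: if_splits)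

lemma con3: "con l rh ta 3 ==> upw l" by (simp add: con_def split: if_splits)

lemma asz_con_le: "asz tg con l rh <= 3 * tg"
proof -
 have "card {ta. ta < tg \<and> con l rh ta m} <= tg" for m
  using card_mono[of "{..<tg}" "{ta. ta < tg \<and> con l rh ta m}"] by (auto simp: subset_iff)
 from add_mono[OF this[of 1] add_mono[OF this[of 2] this[of 3]]] show ?thesis by (simp add: asz_def)
qed

context
 fixes W :: nat and ls :: "nat list"
 assumes W: "2 <= W"
  and rgt: "\<And>ka. ka < length ls ==> rgt (ls ! ka) ==> ka + 1 < length ls"
  and upw: "\<And>ka. ka < length ls ==> upw (ls ! ka) ==> ka + W < length ls"
begin

lemma cnt_masked:
 assumes "ka < length ls" "length x = length ls * tg"
 shows "cnt b (selrow tg con (ls ! ka) rh (map (msk W ka) [0..<length ls])) x =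
  card {ta. ta < tg \<and> con (ls ! ka) rh ta 1 \<and> x ! (ka * tg + ta) = b} +
  card {ta. ta < tg \<and> con (ls ! ka) rh ta 2 \<and> x ! ((ka + 1) * tg + ta) = b} +
  card {ta. ta < tg \<and> con (ls ! ka) rh ta 3 \<and> x ! ((ka + W) * tg + ta) = b}"
proof -
 define c where "c m i = card {ta. ta < tg \<and> con (ls ! ka) rh ta m \<and> x ! (i * tg + ta) = b}" for m i
 have "cnt b (selrow tg con (ls ! ka) rh (map (msk W ka) [0..<length ls])) x = (\<Sum>i<length ls. c (msk W ka i) i)"
  using cnt_selrow[of x "map (msk W ka) [0..<length ls]" tg b con "ls ! ka" rh] assms by (simp add: c_def)
 also have "\<dots> = c 1 ka + (if ka + 1 < length ls then c 2 (ka + 1) else 0) + (if ka + W < length ls then c 3 (ka + W) else 0)"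
  by (rule sum_msk[OF W assms(1)]) (simp add: c_def con0)
 also have "(if ka + 1 < length ls then c 2 (ka + 1) else 0) = c 2 (ka + 1)"
  using rgt[OF assms(1)] con2[of "ls ! ka"] by (auto simp: c_def)
 also have "(if ka + W < length ls then c 3 (ka + W) else 0) = c 3 (ka + W)"
  using upw[OF assms(1)] con3[of "ls ! ka"] by (auto simp: c_def)
 finally show ?thesis by (simp only: c_def)
qed

lemma filter_selrow:
 assumes "ka < length ls"
 shows "length (filter id (selrow tg con (ls ! ka) rh (map (msk W ka) [0..<length ls]))) = asz tg con (ls ! ka) rh"
proof -
 have a: "(i + n) * tg + ta < length ls * tg" if "i + n < length ls" "ta < tg" for i n ta
 proof -
  have "(i + n) * tg + ta < Suc (i + n) * tg" using that by simp
  also have "\<dots> <= length ls * tg" by (rule mult_right_mono) (use that in simp_all)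
  finally show ?thesis .
 qed
 have "length (filter id (selrow tg con (ls ! ka) rh (map (msk W ka) [0..<length ls]))) =
   cnt 1 (selrow tg con (ls ! ka) rh (map (msk W ka) [0..<length ls])) (replicate (length ls * tg) 1)"
  using cnt_const[of 1 "selrow tg con (ls ! ka) rh (map (msk W ka) [0..<length ls])" 1] by (simp add: length_selrow)
 also have "\<dots> = card {ta. ta < tg \<and> con (ls ! ka) rh ta 1} + card {ta. ta < tg \<and> con (ls ! ka) rh ta 2} +
   card {ta. ta < tg \<and> con (ls ! ka) rh ta 3}"
 proof -
  have e: "{ta. ta < tg \<and> con (ls ! ka) rh ta m \<and> replicate (length ls * tg) 1 ! ((ka + n) * tg + ta) = (1::nat)} =
    {ta. ta < tg \<and> con (ls ! ka) rh ta m}" if en: "(\<exists>ta. con (ls ! ka) rh ta m) --> ka + n < length ls" for m n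
  proof -
   have "replicate (length ls * tg) 1 ! ((ka + n) * tg + ta) = (1::nat)" if t: "ta < tg" "con (ls ! ka) rh ta m" for ta
    by (rule nth_replicate, rule a) (use t en in blast)+
   then show ?thesis by blast
  qed
  have e1: "(\<exists>ta. con (ls ! ka) rh ta 1) --> ka + 0 < length ls" using assms by simp
  have e2: "(\<exists>ta. con (ls ! ka) rh ta 2) --> ka + 1 < length ls" using con2 rgt[OF assms] by metis
  have e3: "(\<exists>ta. con (ls ! ka) rh ta 3) --> ka + W < length ls" using con3 upw[OF assms] by metis
  show ?thesis
   unfolding cnt_masked[OF assms length_replicate] e[OF e2] e[OF e3]
   using e[OF e1] by simp
 qed
 finally show ?thesis by (simp add: asz_def)
qed

definition onehot :: "(nat => nat) => nat list" where
 "onehot f = map (%i. if f (i div tg) = i mod tg then 1 else 0) [0..<length ls * tg]"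

lemma onehot_nth:
 assumes "ka < length ls" "ta < tg" shows "onehot f ! (ka * tg + ta) = (if f ka = ta then 1 else 0)"
proof -
 have "ka * tg + ta < Suc ka * tg" using assms by simp
 also have "\<dots> <= length ls * tg" by (rule mult_right_mono) (use assms in simp_all)
 finally show ?thesis using assms by (simp add: onehot_def)
qed

text \<open>Rule 0 makes an assignment one-hot in every cell, so that it is a map from cells to
  tiles. The other rules then say that the map is a tiling.\<close>

theorem card_tilings:
 "card {x \<in> xsel (length ls * tg). \<forall>ka<length ls. \<forall>rh<nrul.
   cnt 1 (selrow tg con (ls ! ka) rh (map (msk W ka) [0..<length ls])) x = 1} = card (tilings W ls)"
proof -
 let ?N = "length ls"
 let ?ok = "%x. \<forall>ka<?N. \<forall>rh<nrul. cnt 1 (selrow tg con (ls ! ka) rh (map (msk W ka) [0..<?N])) x = 1"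
 have x: "onehot f \<in> xsel (?N * tg)" for f by (auto simp: onehot_def xsel_def)
 have ok: "?ok (onehot f) \<longleftrightarrow> f \<in> tilings W ls" if f: "f \<in> {..<?N} \<rightarrow>\<^sub>E {..<tg}" for f
 proof -
  have f': "f ka < tg" if "ka < ?N" for ka using f that by auto
  have c: "card {ta. ta < tg \<and> con l rh ta m \<and> onehot f ! (ka * tg + ta) = 1} = of_bool (con l rh (f ka) m)"
   if "ka < ?N" for ka l rh m
  proof -
   have "{ta. ta < tg \<and> con l rh ta m \<and> onehot f ! (ka * tg + ta) = 1} = (if con l rh (f ka) m then {f ka} else {})"
    using onehot_nth[OF that] f'[OF that] by (auto split: if_splits)
   then show ?thesis by simp
  qed
  have s: "cnt 1 (selrow tg con (ls ! ka) rh (map (msk W ka) [0..<?N])) (onehot f) =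
    of_bool (con (ls ! ka) rh (f ka) 1) + of_bool (con (ls ! ka) rh (f (ka + 1)) 2) +
    of_bool (con (ls ! ka) rh (f (ka + W)) 3)" if k: "ka < ?N" for ka rh
  proof -
   have "card {ta. ta < tg \<and> con (ls ! ka) rh ta 2 \<and> onehot f ! ((ka + 1) * tg + ta) = 1} = of_bool (con (ls ! ka) rh (f (ka + 1)) 2)"
   proof (cases "ka + 1 < ?N")
    case False
    then have "\<not> con (ls ! ka) rh ta 2" for ta using con2 rgt[OF k] by metis
    then show ?thesis by simp
   qed (rule c)
   moreover have "card {ta. ta < tg \<and> con (ls ! ka) rh ta 3 \<and> onehot f ! ((ka + W) * tg + ta) = 1} = of_bool (con (ls ! ka) rh (f (ka + W)) 3)"
   proof (cases "ka + W < ?N")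
    case False
    then have "\<not> con (ls ! ka) rh ta 3" for ta using con3 upw[OF k] by metis
    then show ?thesis by simp
   qed (rule c)
   ultimately show ?thesis using c[OF k] x[of f] by (subst cnt_masked[OF k]) (simp_all add: xsel_def del: mult_Suc)
  qed
  \<comment> \<open>From left to right, rule 1 gives admissibility and the rules of the colours
    \<open>east a\<close> and \<open>north a\<close> give the two matches.\<close>
  have eq: "(\<forall>rh<nrul. of_bool (con l rh a 1) + of_bool (con l rh b 2) + of_bool (con l rh d 3) = (1::nat)) \<longleftrightarrow>
    allow l a \<and> (rgt l --> east a = west b) \<and> (upw l --> north a = south d)" (is "?l \<longleftrightarrow> ?r")
   if "a < tg" for l a b d
  proof
   assume l: ?l
   have "allow l a" using l[rule_format, of 1] by (simp add: con_def of_bool_def split: if_splits)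
   moreover have "east a = west b" if "rgt l"
    using l[rule_format, of "2 + east a"] east[OF \<open>a < tg\<close>] that by (simp add: con_def split: if_splits)
   moreover have "north a = south d" if "upw l"
    using l[rule_format, of "2 + CE + north a"] north[OF \<open>a < tg\<close>] that by (simp add: con_def split: if_splits)
   ultimately show ?r by simp
  next
   assume ?r
   then show ?l by (auto simp: con_def)
  qed
  have "(\<forall>rh<nrul. cnt 1 (selrow tg con (ls ! ka) rh (map (msk W ka) [0..<?N])) (onehot f) = 1) \<longleftrightarrow>
    allow (ls ! ka) (f ka) \<and> (rgt (ls ! ka) --> east (f ka) = west (f (ka + 1))) \<and>
    (upw (ls ! ka) --> north (f ka) = south (f (ka + W)))" if "ka < ?N" for ka
   unfolding s[OF that] by (rule eq[OF f'[OF that]])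
  then show ?thesis using f unfolding tilings_def by simp
 qed
 have "{x \<in> xsel (?N * tg). ?ok x} = onehot ` tilings W ls"
 proof (intro equalityI subsetI)
  fix v assume v: "v \<in> {x \<in> xsel (?N * tg). ?ok x}"
  then have l: "length v = ?N * tg" "set v \<subseteq> {0, 1}" by (auto simp: xsel_def)
  have "card {ta. ta < tg \<and> v ! (ka * tg + ta) = 1} = 1" if k: "ka < ?N" for ka
  proof -
   have "cnt 1 (selrow tg con (ls ! ka) 0 (map (msk W ka) [0..<?N])) v = 1" using v k by auto
   then show ?thesis using cnt_masked[OF k l(1), of 1 0] by (simp add: con_def)
  qed
  then have "\<exists>t. {ta. ta < tg \<and> v ! (ka * tg + ta) = 1} = {t}" if "ka < ?N" for ka
   using that by (simp add: card_1_singleton_iff)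
  then obtain g where g: "\<And>ka. ka < ?N ==> {ta. ta < tg \<and> v ! (ka * tg + ta) = 1} = {g ka}" by metis
  define f where "f = restrict g {..<?N}"
  have f: "f \<in> {..<?N} \<rightarrow>\<^sub>E {..<tg}"
  proof -
   have "g ka < tg" if "ka < ?N" for ka using g[OF that] by auto
   then show ?thesis by (auto simp: f_def)
  qed
  have "onehot f = v"
  proof (rule nth_equalityI)
   show "length (onehot f) = length v" by (simp add: onehot_def l)
   fix i assume "i < length (onehot f)"
   then have i: "i < ?N * tg" by (simp add: onehot_def)
   define ka ta where "ka = i div tg" and "ta = i mod tg"
   have kt: "ka < ?N" "ta < tg" "i = ka * tg + ta"
    using i tg by (auto simp: ka_def ta_def less_mult_imp_div_less)
   have "v ! i \<in> set v" using l i by simp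
   then have "v ! i = 0 \<or> v ! i = 1" using l(2) by blast
   moreover have "v ! i = 1 \<longleftrightarrow> ta = g ka" using g[OF kt(1)] kt by auto
   ultimately show "onehot f ! i = v ! i" using onehot_nth[OF kt(1,2), of f] kt by (auto simp: f_def)
  qed
  then show "v \<in> onehot ` tilings W ls" using ok[OF f] v by blast
 next
  fix v assume "v \<in> onehot ` tilings W ls"
  then obtain f where f: "f \<in> tilings W ls" "v = onehot f" by blast
  then have "f \<in> {..<?N} \<rightarrow>\<^sub>E {..<tg}" by (simp add: tilings_def)
  then show "v \<in> {x \<in> xsel (?N * tg). ?ok x}" using f ok x by simp
 qed
 moreover have "inj_on onehot (tilings W ls)"
 proof (rule inj_onI)
  fix f g assume fg: "f \<in> tilings W ls" "g \<in> tilings W ls" "onehot f = onehot g"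
  have "f ka = g ka" if "ka < ?N" for ka
  proof -
   have "f ka < tg" using fg(1) that by (auto simp: tilings_def)
   then have "(if g ka = f ka then 1 else 0) = (1::nat)"
    using onehot_nth[OF that, of "f ka" f] onehot_nth[OF that, of "f ka" g] by (simp only: fg(3) if_True refl)
   then show ?thesis by (metis zero_neq_one)
  qed
  moreover have "f \<in> {..<?N} \<rightarrow>\<^sub>E {..<tg}" "g \<in> {..<?N} \<rightarrow>\<^sub>E {..<tg}" using fg(1,2) by (simp_all add: tilings_def)
  ultimately show "f = g" by (metis PiE_ext lessThan_iff)
 qed
 ultimately show ?thesis by (simp add: card_image)
qed

end

end

section \<open>Computations as tilings\<close>

text \<open>A cell of the space-time diagram: state, symbols read by the heads, for each tape its
  symbol and whether the head is here, one cell to the left or one to the right, and whether this is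
  the origin. State and read symbols are repeated along the row, so that each tile can apply
  \<open>delta\<close> on its own.\<close>

type_synonym tile = "nat \<times> nat list \<times> (nat \<times> bool \<times> bool \<times> bool) list \<times> bool"

abbreviation (input) "sy c \<equiv> fst c"
abbreviation (input) "hh c \<equiv> fst (snd c)"
abbreviation (input) "hL c \<equiv> fst (snd (snd c))"
abbreviation (input) "hR c \<equiv> snd (snd (snd c))"
abbreviation (input) "st T \<equiv> fst T"
abbreviation (input) "rd T \<equiv> fst (snd T)"
abbreviation (input) "ce T \<equiv> fst (snd (snd T))"
abbreviation (input) "og T \<equiv> snd (snd (snd T))"

definition eastS :: "tile => nat \<times> nat list \<times> (bool \<times> bool) list" where
 "eastS T = (st T, rd T, map (%c. (hh c, hR c)) (ce T))"

definition westS :: "tile => nat \<times> nat list \<times> (bool \<times> bool) list" where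
 "westS T = (st T, rd T, map (%c. (hL c, hh c)) (ce T))"

definition southS :: "tile => nat \<times> (nat \<times> bool) list \<times> bool" where
 "southS T = (st T, map (%c. (sy c, hh c)) (ce T), og T)"

text \<open>The upper colour is the next configuration at this place. A query leaves the oracle tape
  blank with its head at the origin, and for this reason tiles know where the origin is.\<close>

definition northS :: "machine => tile => nat \<times> (nat \<times> bool) list \<times> bool" where
 "northS V T =
   (if st T = 1 then southS T
   else if st T = 2 then (3, (map (%c. (sy c, hh c)) (ce T))[2 := (0, og T)], og T)
   else (fst (delta V (st T) (rd T)),
    map2 (%c a. (if hh c then fst a else sy c, if snd a = 0 then hh c else if snd a = 1 then hL c else hR c))
     (ce T) (snd (delta V (st T) (rd T))), og T))"

text \<open>The repeated read symbols are checked in the places where the heads are.\<close>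

definition tset :: "machine => tile set" where
 "tset V = {T. st T < nstates V \<and> length (rd T) = ntapes V \<and> set (rd T) \<subseteq> {..<nsyms V} \<and> length (ce T) = ntapes V \<and>
   (\<forall>j<ntapes V. sy (ce T ! j) < nsyms V \<and> (hh (ce T ! j) --> sy (ce T ! j) = rd T ! j))}"

lemma finite_tset: "finite (tset V)"
proof -
 have "tset V \<subseteq> {..<nstates V} \<times> {l. set l \<subseteq> {..<nsyms V} \<and> length l = ntapes V} \<times>
   {l. set l \<subseteq> {..<nsyms V} \<times> UNIV \<and> length l = ntapes V} \<times> UNIV"
 proof
  fix T assume T: "T \<in> tset V"
  have "set (ce T) \<subseteq> {..<nsyms V} \<times> UNIV"
  proof
   fix c assume "c \<in> set (ce T)"
   then obtain i where "i < ntapes V" "c = ce T ! i" using T by (auto simp: tset_def in_set_conv_nth)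
   then show "c \<in> {..<nsyms V} \<times> UNIV" using T by (auto simp: tset_def mem_Times_iff)
  qed
  then show "T \<in> {..<nstates V} \<times> {l. set l \<subseteq> {..<nsyms V} \<and> length l = ntapes V} \<times>
   {l. set l \<subseteq> {..<nsyms V} \<times> UNIV \<and> length l = ntapes V} \<times> UNIV"
   using T by (cases T) (auto simp: tset_def)
 qed
 then show ?thesis by (rule finite_subset) (intro finite_cartesian_product finite_lists_length_eq finite_lessThan finite; simp)
qed

definition rtile :: "nat => config => nat => tile" where
 "rtile B c p = (let x = int p - int B in
   (fst c, reads (snd c), map (%(f, h). (f x, h = x, h = x - 1, h = x + 1)) (snd c), x = 0))"

definition wfc :: "machine => nat => config => bool" where
 "wfc V t c \<longleftrightarrow> fst c < nstates V \<and> length (snd c) = ntapes V \<and>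
   (\<forall>j<ntapes V. (\<forall>i. fst (snd c ! j) i < nsyms V) \<and> \<bar>snd (snd c ! j)\<bar> <= int t)"

lemma reads_wfc: assumes "wfc V t c" shows "length (reads (snd c)) = ntapes V" "set (reads (snd c)) \<subseteq> {..<nsyms V}"
proof -
 show "length (reads (snd c)) = ntapes V" using assms by (simp add: reads_def wfc_def)
 then show "set (reads (snd c)) \<subseteq> {..<nsyms V}"
  using assms by (auto simp: in_set_conv_nth reads_nth wfc_def)
qed

lemma delta_wfc:
 assumes "wf_machine V" "s < nstates V" "length rs = ntapes V" "set rs \<subseteq> {..<nsyms V}"
 shows "fst (delta V s rs) < nstates V" "length (snd (delta V s rs)) = ntapes V"
  "j < ntapes V ==> fst (snd (delta V s rs) ! j) < nsyms V"
  "j < ntapes V ==> snd (snd (delta V s rs) ! j) \<in> {-1, 0, 1}"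
proof -
 have *: "fst (delta V s rs) < nstates V" "length (snd (delta V s rs)) = ntapes V"
   "set (snd (delta V s rs)) \<subseteq> {..<nsyms V} \<times> {-1, 0, 1}"
  using assms unfolding wf_machine_def by (auto simp: case_prod_unfold)
 then show "fst (delta V s rs) < nstates V" "length (snd (delta V s rs)) = ntapes V" by auto
 assume "j < ntapes V"
 then have "snd (delta V s rs) ! j \<in> {..<nsyms V} \<times> {-1, 0, 1}" using * by (metis nth_mem subsetD)
 then show "fst (snd (delta V s rs) ! j) < nsyms V" "snd (snd (delta V s rs) ! j) \<in> {-1, 0, 1}" by auto
qed

lemma step_nth:
 assumes "fst c ~= 1" "fst c ~= 2" "wf_machine V" "wfc V t c"
 shows "fst (step f V c) = fst (delta V (fst c) (reads (snd c)))" "length (snd (step f V c)) = ntapes V"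
  "j < ntapes V ==> snd (step f V c) ! j =
   ((fst (snd c ! j))(snd (snd c ! j) := fst (snd (delta V (fst c) (reads (snd c))) ! j)),
    snd (snd c ! j) + snd (snd (delta V (fst c) (reads (snd c))) ! j))"
proof -
 obtain s ts where c: "c = (s, ts)" by (cases c)
 obtain s' as where d: "delta V s (reads ts) = (s', as)" by (cases "delta V s (reads ts)")
 have l: "length as = ntapes V" "length ts = ntapes V"
  using delta_wfc(2)[OF assms(3) _ reads_wfc[OF assms(4)], of s] assms(4) d c by (auto simp: wfc_def)
 have st: "step f V c = (s', perform ts as)" using assms(1,2) c d by (simp add: step_delta)
 show "fst (step f V c) = fst (delta V (fst c) (reads (snd c)))" "length (snd (step f V c)) = ntapes V"
  using st d c l by (simp_all add: perform_def)
 show "j < ntapes V ==> snd (step f V c) ! j =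
   ((fst (snd c ! j))(snd (snd c ! j) := fst (snd (delta V (fst c) (reads (snd c))) ! j)),
    snd (snd c ! j) + snd (snd (delta V (fst c) (reads (snd c))) ! j))"
  using st d c l by (simp add: perform_def split: prod.splits)
qed

abbreviation "blank \<equiv> %_. [] :: bool list"

lemma wfc_step: assumes V: "wf_machine V" and c: "wfc V t c" shows "wfc V (Suc t) (step blank V c)"
proof -
 obtain s ts where cs: "c = (s, ts)" by (cases c)
 consider "s = 1" | "s = 2" | "s ~= 1" "s ~= 2" by blast
 then show ?thesis
 proof cases
  case 1 then show ?thesis using c cs by (force simp: step_def wfc_def)
 next
  case 2
  have "3 < nstates V" "0 < nsyms V" using V by (auto simp: wf_machine_def)
  moreover have "step blank V c = (3, ts[2 := word_tape []])" using cs 2 by (simp add: step_def)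
  moreover have "(\<forall>i. fst (ts[2 := word_tape []] ! j) i < nsyms V) \<and> \<bar>snd (ts[2 := word_tape []] ! j)\<bar> <= int (Suc t)"
   if j: "j < ntapes V" for j
  proof -
   have "\<forall>i. fst (ts ! j) i < nsyms V" "\<bar>snd (ts ! j)\<bar> <= int t" using c cs j by (auto simp: wfc_def)
   then show ?thesis using \<open>0 < nsyms V\<close> c cs j by (cases "j = 2") (auto simp: wfc_def word_tape_def)
  qed
  ultimately show ?thesis using c cs by (simp add: wfc_def)
 next
  case 3
  note n = step_nth[OF _ _ V c, where f = blank] and d = delta_wfc[OF V _ reads_wfc[OF c], of s]
  have s: "s < nstates V" using c cs by (simp add: wfc_def)
  have "(\<forall>i. fst (snd (step blank V c) ! j) i < nsyms V) \<and> \<bar>snd (snd (step blank V c) ! j)\<bar> <= int (Suc t)"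
   if j: "j < ntapes V" for j
  proof -
   have "\<forall>i. fst (ts ! j) i < nsyms V" "\<bar>snd (ts ! j)\<bar> <= int t" using c cs j by (auto simp: wfc_def)
   then show ?thesis using n(3)[OF _ _ j] d(3,4)[OF s j] 3 cs by auto
  qed
  then show ?thesis using n(1,2) d(1)[OF s] 3 cs by (simp add: wfc_def)
 qed
qed

lemma south_rtile:
 "southS (rtile B c p) = (fst c, map (%(f, h). (f (int p - int B), h = int p - int B)) (snd c), p = B)"
 by (auto simp: southS_def rtile_def Let_def)

lemma north_rtile:
 assumes V: "wf_machine V" and c: "wfc V t c"
 shows "northS V (rtile B c p) = southS (rtile B (step blank V c) p)"
proof -
 obtain s ts where cs: "c = (s, ts)" by (cases c)
 consider "s = 1" | "s = 2" | "s ~= 1" "s ~= 2" by blast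
 then show ?thesis
 proof cases
  case 1 then show ?thesis using cs by (simp add: northS_def step_def rtile_def Let_def)
 next
  case 2
  have "(map (%(f, h). (f x, h = x)) ts)[2 := (0, p = B)] = map (%(f, h). (f x, h = x)) (ts[2 := word_tape []])"
   if "x = int p - int B" for x
   using that by (auto simp: map_update word_tape_def)
  then show ?thesis using cs 2 by (auto simp: northS_def step_def rtile_def Let_def southS_def comp_def case_prod_unfold)
 next
  case 3
  note n = step_nth[OF _ _ V c, where f = blank] and d = delta_wfc[OF V _ reads_wfc[OF c], of s]
  have s: "s < nstates V" and l: "length ts = ntapes V" using c cs by (auto simp: wfc_def)
  define as where "as = snd (delta V s (reads ts))"
  define x where "x = int p - int B"
  have "map2 (%c a. (if hh c then fst a else sy c, if snd a = 0 then hh c else if snd a = 1 then hL c else hR c))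
    (map (%(f, h). (f x, h = x, h = x - 1, h = x + 1)) ts) as =
   map (%(f, h). (f x, h = x)) (snd (step blank V c))" (is "?l = ?r")
  proof (rule nth_equalityI)
   show le: "length ?l = length ?r" using n(2) d(2)[OF s] 3 cs l by (simp add: as_def)
   fix j assume "j < length ?l"
   then have j: "j < ntapes V" using l by simp
   obtain f h where fh: "ts ! j = (f, h)" by (cases "ts ! j")
   have la: "length as = ntapes V" using d(2)[OF s] cs by (simp add: as_def)
   have "snd (as ! j) \<in> {-1, 0, 1}" using d(4)[OF s j] cs by (simp add: as_def)
   then show "?l ! j = ?r ! j" using n(2) n(3)[OF _ _ j] 3 cs l j la fh by (auto simp: as_def)
  qed
  then show ?thesis using n(1) 3 cs
   by (simp add: northS_def south_rtile) (simp add: rtile_def Let_def as_def x_def)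
 qed
qed

lemma east_rtile: "eastS (rtile B c p) = westS (rtile B c (Suc p))"
 by (auto simp: eastS_def westS_def rtile_def Let_def case_prod_unfold)

lemma rtile_tset: assumes "wfc V t c" shows "rtile B c p \<in> tset V"
 using assms reads_wfc[OF assms] by (auto simp: tset_def rtile_def Let_def wfc_def reads_nth case_prod_unfold)

text \<open>The lower colours leave only the read symbols and the neighbour flags open. The read
  symbols are constant along the row and checked at the heads, which lie inside the window. The
  flags are determined by the adjacent tiles, and at the two ends they are false.\<close>

lemma row_unique:
 assumes c: "wfc V B c" and B: "p <= 2 * B"
  and ts: "\<And>p. p <= 2 * B ==> F p \<in> tset V"
  and so: "\<And>p. p <= 2 * B ==> southS (F p) = southS (rtile B c p)"
  and ew: "\<And>p. p < 2 * B ==> eastS (F p) = westS (F (Suc p))"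
  and lb: "\<And>j. j < ntapes V ==> \<not> hL (ce (F 0) ! j)"
  and rb: "\<And>j. j < ntapes V ==> \<not> hR (ce (F (2 * B)) ! j)"
 shows "F p = rtile B c p"
proof -
 define k where "k = ntapes V"
 have l: "length (snd c) = k" using c by (simp add: wfc_def k_def)
 have le: "length (ce (F p)) = k" "length (rd (F p)) = k" if "p <= 2 * B" for p
  using ts[OF that] by (auto simp: tset_def k_def)
 have sh: "sy (ce (F p) ! j) = fst (snd c ! j) (int p - int B)" "hh (ce (F p) ! j) \<longleftrightarrow> snd (snd c ! j) = int p - int B"
  if "p <= 2 * B" "j < k" for p j
 proof -
  have "map (%c. (sy c, hh c)) (ce (F p)) = map (%(f, h). (f (int p - int B), h = int p - int B)) (snd c)"
   using so[OF that(1)] unfolding south_rtile by (simp add: southS_def)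
  from arg_cong[OF this, of "%l. l ! j"] show "sy (ce (F p) ! j) = fst (snd c ! j) (int p - int B)"
   "hh (ce (F p) ! j) \<longleftrightarrow> snd (snd c ! j) = int p - int B" using le(1)[OF that(1)] l that by (auto simp: case_prod_unfold)
 qed
 have adj: "rd (F p) = rd (F (Suc p))" "j < k ==> hh (ce (F p) ! j) = hL (ce (F (Suc p)) ! j)"
   "j < k ==> hR (ce (F p) ! j) = hh (ce (F (Suc p)) ! j)" if "p < 2 * B" for p j
 proof -
  have *: "rd (F p) = rd (F (Suc p))" "map (%c. (hh c, hR c)) (ce (F p)) = map (%c. (hL c, hh c)) (ce (F (Suc p)))"
   using ew[OF that] by (auto simp: eastS_def westS_def)
  show "rd (F p) = rd (F (Suc p))" by (rule *)
  show "j < k ==> hh (ce (F p) ! j) = hL (ce (F (Suc p)) ! j)" "j < k ==> hR (ce (F p) ! j) = hh (ce (F (Suc p)) ! j)"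
   using arg_cong[OF *(2), of "%l. l ! j"] le(1)[of p] le(1)[of "Suc p"] that by auto
 qed
 have w: "\<bar>snd (snd c ! j)\<bar> <= int B" if "j < k" for j using c that by (simp add: wfc_def k_def)
 have rd0: "rd (F p) = rd (F 0)" if "p <= 2 * B" for p
  using that by (induction p) (use adj(1) in \<open>auto simp: Suc_le_eq\<close>)
 have rd: "rd (F p) = reads (snd c)" if "p <= 2 * B" for p
 proof (rule nth_equalityI)
  show "length (rd (F p)) = length (reads (snd c))" using le[OF that] l by (simp add: reads_def)
  fix j assume "j < length (rd (F p))"
  then have j: "j < k" using le[OF that] by simp
  \<comment> \<open>The column of head \<open>j\<close> in the window.\<close>
  define x where "x = nat (snd (snd c ! j) + int B)"
  have x: "x <= 2 * B" "int x - int B = snd (snd c ! j)" using w[OF j] by (auto simp: x_def)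
  have "rd (F x) ! j = sy (ce (F x) ! j)" using ts[OF x(1)] sh(2)[OF x(1) j] x j by (auto simp: tset_def k_def)
  then show "rd (F p) ! j = reads (snd c) ! j" using rd0[OF that] rd0[OF x(1)] sh(1)[OF x(1) j] x l j by (simp add: reads_nth)
 qed
 have "ce (F p) = ce (rtile B c p)"
 proof (rule nth_equalityI)
  show "length (ce (F p)) = length (ce (rtile B c p))" using le[OF B] l by (simp add: rtile_def Let_def)
  fix j assume "j < length (ce (F p))"
  then have j: "j < k" using le[OF B] by simp
  have L: "hL (ce (F p) ! j) \<longleftrightarrow> snd (snd c ! j) = int p - int B - 1"
  proof (cases p)
   case 0 then show ?thesis using lb[of j] j w[OF j] by (auto simp: k_def)
  next
   case (Suc p')
   then show ?thesis using adj(2)[of p' j] sh(2)[of p' j] B j by (auto simp: algebra_simps)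
  qed
  have R: "hR (ce (F p) ! j) \<longleftrightarrow> snd (snd c ! j) = int p - int B + 1"
  proof (cases "p = 2 * B")
   case True then show ?thesis using rb[of j] j w[OF j] by (auto simp: k_def)
  next
   case False
   then show ?thesis using adj(3)[of p j] sh(2)[of "Suc p" j] B j by (auto simp: algebra_simps)
  qed
  have "ce (rtile B c p) ! j = (fst (snd c ! j) (int p - int B), snd (snd c ! j) = int p - int B,
    snd (snd c ! j) = int p - int B - 1, snd (snd c ! j) = int p - int B + 1)"
   using l j by (simp add: rtile_def Let_def case_prod_unfold)
  then show "ce (F p) ! j = ce (rtile B c p) ! j"
   using sh[OF B j] L R by (cases "ce (F p) ! j") simp
 qed
 moreover have "st (F p) = fst c" "og (F p) \<longleftrightarrow> p = B" using so[OF B] unfolding south_rtile by (auto simp: southS_def)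
 ultimately show ?thesis using rd[OF B] by (cases "F p") (auto simp: rtile_def Let_def)
qed

text \<open>Row classes: 0 first, 1 inner, 2 last. Column classes: 0 left end, 1 inner, 2 origin, 3
  right end. Input classes: 0 blank, 1 and 2 fixed letters, 3 a free letter. This makes 48 labels,
  the alphabet size used later.\<close>

definition lab :: "nat => nat => nat => nat" where "lab r c k = (r * 4 + c) * 4 + k"

lemma lab_simps [simp]:
 assumes "c < 4" "k < 4"
 shows "lab r c k div 16 = r" "lab r c k div 4 mod 4 = c" "lab r c k mod 4 = k"
 using assms unfolding lab_def by presburger+

definition tls :: "machine => tile list" where
 "tls V = (SOME l. set l = tset V \<and> distinct l)"

lemma tls: "set (tls V) = tset V" "distinct (tls V)"
 using someI_ex[OF finite_distinct_list[OF finite_tset[of V]]] by (simp_all add: tls_def)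

definition tix :: "machine => tile => nat" where
 "tix V T = (SOME i. i < length (tls V) \<and> tls V ! i = T)"

lemma tix: "T \<in> tset V ==> tix V T < length (tls V) \<and> tls V ! tix V T = T"
 unfolding tix_def by (rule someI_ex) (metis in_set_conv_nth tls(1))

lemma tls_tset: "i < length (tls V) ==> tls V ! i \<in> tset V"
 by (metis nth_mem tls(1))

text \<open>No head is outside the window, the first row is a start configuration whose input fits
  the template, and in the last row the output tape has the letter 2, that is \<open>True\<close>,
  at the origin.\<close>

definition allowT :: "machine => nat => nat => nat => tile => bool" where
 "allowT V r c k T \<longleftrightarrow>
   (c = 0 --> (\<forall>j<ntapes V. \<not> hL (ce T ! j))) \<and> (c = 3 --> (\<forall>j<ntapes V. \<not> hR (ce T ! j))) \<and>
   (r = 0 --> st T = 0 \<and> (og T \<longleftrightarrow> c = 2) \<and> (\<forall>j<ntapes V. (hh (ce T ! j) \<longleftrightarrow> c = 2) \<and>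
    (if j = 0 then (if k = 3 then sy (ce T ! j) \<in> {1, 2} else sy (ce T ! j) = k) else sy (ce T ! j) = 0))) \<and>
   (r = 2 \<and> c = 2 --> sy (ce T ! 1) = 2)"

definition allow :: "machine => nat => nat => bool" where
 "allow V l ta = allowT V (l div 16) (l div 4 mod 4) (l mod 4) (tls V ! ta)"

text \<open>The sides of a tile are tuples; they are numbered because \<open>tile_set\<close> has
  one rule for each colour number.\<close>

definition colour :: "(tile => 'a :: countable) => machine => nat => nat" where
 "colour s V ta = to_nat (s (tls V ! ta))"

definition ncol :: "(tile => 'a :: countable) => machine => nat" where
 "ncol s V = Suc (Max (colour s V ` {..<length (tls V)}))"

lemma colour_less: "ta < length (tls V) ==> colour s V ta < ncol s V"
 by (simp add: ncol_def less_Suc_eq_le)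

lemma tls_nonempty: assumes "wf_machine V" shows "1 <= length (tls V)"
proof -
 have "rtile 0 (0, replicate (ntapes V) (%_. 0, 0)) 0 \<in> tset V"
  by (rule rtile_tset[where t = 0]) (use assms in \<open>auto simp: wfc_def wf_machine_def\<close>)
 then have "tls V ~= []" using tls(1)[of V] by auto
 then show ?thesis by (cases "tls V") auto
qed

locale verifier =
 fixes V :: machine
 assumes V: "wf_machine V"
begin

sublocale tile_set "length (tls V)" "ncol eastS V" "ncol (northS V) V" "colour eastS V" "colour westS V"
 "colour (northS V) V" "colour southS V" "allow V" "%l. l div 4 mod 4 ~= 3" "%l. l div 16 ~= 2"
 by unfold_locales (auto simp: colour_less intro: tls_nonempty[OF V, simplified])

definition conf :: "bool list => nat => config" where
 "conf z t = (step blank V ^^ t) (init_config V z)"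

lemma conf_0: "conf z 0 = init_config V z" by (simp add: conf_def)
lemma conf_Suc: "conf z (Suc t) = step blank V (conf z t)" by (simp add: conf_def)

lemma wfc_conf: "wfc V t (conf z t)"
proof (induction t)
 case 0
 have "2 < nsyms V" "0 < nsyms V" "1 < nsyms V" "0 < nstates V" "0 < ntapes V" using V by (auto simp: wf_machine_def)
 then show ?case
  by (auto simp: conf_0 init_config_def wfc_def word_tape_def nth_Cons split: nat.splits)
qed (simp add: conf_Suc wfc_step[OF V])

lemma wfc_mono: "wfc V t c ==> t <= B ==> wfc V B c" by (force simp: wfc_def)

definition rowl :: "nat => nat => nat list => nat list" where
 "rowl B r tm = lab r 0 0 # replicate (B - 1) (lab r 1 0) @ lab r 2 (hd tm) # map (lab r 1) (tl tm) @
   replicate (B - length tm) (lab r 1 0) @ [lab r 3 0]"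

definition labels :: "nat => nat list => nat list" where
 "labels B tm = rowl B 0 tm @ concat (replicate (B - 1) (rowl B 1 [0])) @ rowl B 2 [0]"

definition ccls :: "nat => nat => nat" where
 "ccls B p = (if p = 0 then 0 else if p = 2 * B then 3 else if p = B then 2 else 1)"

definition rcls :: "nat => nat => nat" where
 "rcls B t = (if t = 0 then 0 else if t = B then 2 else 1)"

definition kcls :: "nat => nat list => nat => nat => nat" where
 "kcls B tm t p = (if t = 0 \<and> B <= p \<and> p < B + length tm then tm ! (p - B) else 0)"

lemma length_rowl: "1 <= length tm ==> length tm <= B ==> length (rowl B r tm) = 2 * B + 1"
 by (simp add: rowl_def)

lemma rowl_nth:
 assumes "1 <= length tm" "length tm <= B" "p <= 2 * B"
 shows "rowl B r tm ! p = lab r (ccls B p) (if B <= p \<and> p < B + length tm then tm ! (p - B) else 0)"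
proof -
 obtain a tm' where tm: "tm = a # tm'" using assms(1) by (cases tm) auto
 have tm': "length tm' < B" using assms tm by simp
 consider "p = 0" | "1 <= p" "p < B" | "p = B" "B ~= 0" | "B < p" "p < B + length tm" | "B + length tm <= p" "p < 2 * B" | "p = 2 * B" "B ~= 0"
  using assms by linarith
 then show ?thesis
 proof cases
  case 1 then show ?thesis using assms by (auto simp: rowl_def ccls_def)
 next
  case 2 then show ?thesis using assms by (auto simp: rowl_def ccls_def nth_Cons nth_append split: nat.splits)
 next
  case 3 then show ?thesis using assms tm by (auto simp: rowl_def ccls_def nth_Cons nth_append split: nat.splits)
 next
  case 4
  define i where "i = p - B - 1"
  have i: "p = Suc (B + i)" "i < length tm'" using 4 tm by (auto simp: i_def)
  then show ?thesis using tm tm' by (auto simp: rowl_def ccls_def nth_Cons nth_append split: nat.splits)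
 next
  case 5
  define i where "i = p - B - 1"
  have i: "p = Suc (B + i)" "length tm' <= i" "i < B - 1" using 5 tm by (auto simp: i_def)
  then show ?thesis using tm tm' by (auto simp: rowl_def ccls_def nth_Cons nth_append split: nat.splits)
 next
  case 6 then show ?thesis using tm tm' by (auto simp: rowl_def ccls_def nth_Cons nth_append split: nat.splits)
 qed
qed

context
 fixes B :: nat and tm :: "nat list"
 assumes B: "1 <= length tm" "length tm <= B" and tm: "set tm \<subseteq> {1, 2, 3}"
begin

definition W :: nat where "W = 2 * B + 1"

lemma length_labels: "length (labels B tm) = (B + 1) * W"
proof -
 have l: "length (rowl B 0 tm) = W" "length (rowl B r [0]) = W" for r
  using B length_rowl[OF B] length_rowl[of "[0]" B] by (simp_all add: W_def)
 have "length (labels B tm) = W + ((B - 1) * W + W)"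
  by (simp add: labels_def length_concat sum_list_replicate l del: One_nat_def)
 also have "\<dots> = (B - 1 + 2) * W" by (simp only: add_mult_distrib mult_2)
 also have "B - 1 + 2 = B + 1" using B by linarith
 finally show ?thesis .
qed

lemma labels_nth:
 assumes "t <= B" "p <= 2 * B"
 shows "labels B tm ! (t * W + p) = lab (rcls B t) (ccls B p) (kcls B tm t p)"
proof -
 have B1: "1 <= B" using B by simp
 define rs where "rs = rowl B 0 tm # replicate (B - 1) (rowl B 1 [0]) @ [rowl B 2 [0]]"
 have "length r = W" if "r \<in> set rs" for r
  using that length_rowl[OF B] length_rowl[of "[0]" B] B1 by (auto simp: rs_def W_def)
 then have "concat rs ! (t * W + p) = rs ! t ! p"
  by (rule nth_concat_uniform) (use assms B1 in \<open>auto simp: rs_def W_def\<close>)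
 moreover have "labels B tm = concat rs" by (simp add: labels_def rs_def)
 moreover have "rs ! t ! p = lab (rcls B t) (ccls B p) (kcls B tm t p)"
 proof -
  consider "t = 0" | "0 < t" "t < B" | "t = B" "t ~= 0" using assms by linarith
  then show ?thesis
  proof cases
   case 1 then show ?thesis using rowl_nth[OF B assms(2), of 0] by (simp add: rs_def rcls_def kcls_def)
  next
   case 2
   then have "rs ! t = rowl B 1 [0]" by (cases t) (auto simp: rs_def nth_append)
   then show ?thesis using rowl_nth[of "[0]" B p 1] B1 assms 2 by (auto simp: rcls_def kcls_def)
  next
   case 3
   then have "rs ! t = rowl B 2 [0]" using B1 by (cases t) (auto simp: rs_def nth_append)
   then show ?thesis using rowl_nth[of "[0]" B p 2] B1 assms 3 by (auto simp: rcls_def kcls_def)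
  qed
 qed
 ultimately show ?thesis by simp
qed

lemma kcls_less: "kcls B tm t p < 4"
proof -
 have "tm ! i \<in> {1, 2, 3}" if "i < length tm" for i using tm that by (meson nth_mem subsetD)
 then show ?thesis unfolding kcls_def by (auto simp: less_diff_conv2 dest!: meta_spec[of _ "p - B"])
qed

lemma label_parts:
 assumes "t <= B" "p <= 2 * B"
 shows "labels B tm ! (t * W + p) div 16 = rcls B t" "labels B tm ! (t * W + p) div 4 mod 4 = ccls B p"
  "labels B tm ! (t * W + p) mod 4 = kcls B tm t p"
 using kcls_less[of t p] unfolding labels_nth[OF assms] by (auto simp: ccls_def)

lemma cell_cases:
 assumes "ka < length (labels B tm)"
 obtains t p where "t <= B" "p <= 2 * B" "ka = t * W + p"
proof
 show "ka div W <= B" using assms unfolding length_labels by (metis Suc_eq_plus1 less_Suc_eq_le less_mult_imp_div_less)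
 show "ka mod W <= 2 * B" by (simp add: W_def mod_Suc_le_divisor)
qed simp

lemma cell_less: "t <= B ==> p <= 2 * B ==> t * W + p < length (labels B tm)"
proof -
 assume tp: "t <= B" "p <= 2 * B"
 then have "t * W + p < Suc t * W" by (simp add: W_def)
 also have "\<dots> <= (B + 1) * W" by (rule mult_right_mono) (use tp in simp_all)
 finally show ?thesis by (simp add: length_labels)
qed

lemma labels_rgt: "ka < length (labels B tm) ==> labels B tm ! ka div 4 mod 4 ~= 3 ==> ka + 1 < length (labels B tm)"
proof -
 assume "ka < length (labels B tm)" and r: "labels B tm ! ka div 4 mod 4 ~= 3"
 then obtain t p where tp: "t <= B" "p <= 2 * B" "ka = t * W + p" using cell_cases by blast
 then have "p < 2 * B" using r B label_parts(2)[of t p] by (auto simp: ccls_def split: if_splits)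
 then show ?thesis using cell_less[of t "Suc p"] tp by simp
qed

lemma labels_upw: "ka < length (labels B tm) ==> labels B tm ! ka div 16 ~= 2 ==> ka + W < length (labels B tm)"
proof -
 assume "ka < length (labels B tm)" and r: "labels B tm ! ka div 16 ~= 2"
 then obtain t p where tp: "t <= B" "p <= 2 * B" "ka = t * W + p" using cell_cases by blast
 then have "t < B" using r B label_parts(1)[of t p] by (auto simp: rcls_def split: if_splits)
 then show ?thesis using cell_less[of "Suc t" p] tp by (simp add: algebra_simps)
qed

definition matches :: "bool list => bool" where
 "matches z \<longleftrightarrow> length z = length tm \<and> (\<forall>i<length tm. tm ! i = 3 \<or> tm ! i = (if z ! i then 2 else 1))"

definition tiles :: "(nat => nat) => nat => nat => tile" where
 "tiles f t p = tls V ! f (t * W + p)"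

definition run :: "bool list => nat => nat" where
 "run z = (\<lambda>ka\<in>{..<length (labels B tm)}. tix V (rtile B (conf z (ka div W)) (ka mod W)))"

lemma tilings_iff:
 assumes f: "f \<in> {..<length (labels B tm)} \<rightarrow>\<^sub>E {..<length (tls V)}"
 shows "f \<in> tilings W (labels B tm) \<longleftrightarrow> (\<forall>t\<le>B. \<forall>p\<le>2 * B.
  allowT V (rcls B t) (ccls B p) (kcls B tm t p) (tiles f t p) \<and>
  (p < 2 * B --> eastS (tiles f t p) = westS (tiles f t (Suc p))) \<and>
  (t < B --> northS V (tiles f t p) = southS (tiles f (Suc t) p)))" (is "_ \<longleftrightarrow> (\<forall>t\<le>B. \<forall>p\<le>2 * B. ?P t p)")
proof -
 define Q where "Q ka \<longleftrightarrow> allow V (labels B tm ! ka) (f ka) \<and>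
   (labels B tm ! ka div 4 mod 4 ~= 3 --> colour eastS V (f ka) = colour westS V (f (ka + 1))) \<and>
   (labels B tm ! ka div 16 ~= 2 --> colour (northS V) V (f ka) = colour southS V (f (ka + W)))" for ka
 have Q: "Q (t * W + p) \<longleftrightarrow> ?P t p" if tp: "t <= B" "p <= 2 * B" for t p
 proof -
  have "ccls B p ~= 3 \<longleftrightarrow> p < 2 * B" "rcls B t ~= 2 \<longleftrightarrow> t < B" using tp B by (auto simp: ccls_def rcls_def)
  moreover have "t * W + p + W = Suc t * W + p" "t * W + p + 1 = t * W + Suc p" by simp_all
  ultimately show ?thesis unfolding Q_def allow_def label_parts[OF tp] colour_def tiles_def by (simp only: to_nat_split inj_eq[OF inj_to_nat])
 qed
 have "f \<in> tilings W (labels B tm) \<longleftrightarrow> (\<forall>ka<length (labels B tm). Q ka)"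
  using f by (simp add: tilings_def Q_def)
 also have "\<dots> \<longleftrightarrow> (\<forall>t\<le>B. \<forall>p\<le>2 * B. Q (t * W + p))"
  using cell_less cell_cases by metis
 finally show ?thesis using Q by simp
qed

lemma run_PiE: "run z \<in> {..<length (labels B tm)} \<rightarrow>\<^sub>E {..<length (tls V)}"
 using tix[OF rtile_tset[OF wfc_conf]] by (auto simp: run_def)

lemma tiles_run: assumes "t <= B" "p <= 2 * B" shows "tiles (run z) t p = rtile B (conf z t) p"
proof -
 have "p < W" using assms by (simp add: W_def)
 then have "(t * W + p) div W = t" "(t * W + p) mod W = p" by simp_all
 then show ?thesis using cell_less[OF assms] tix[OF rtile_tset[OF wfc_conf]] by (simp add: tiles_def run_def)
qed

lemma run_allowed:
 assumes z: "matches z" and tp: "t <= B" "p <= 2 * B" and acc: "fst (snd (conf z B) ! 1) 0 = 2"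
 shows "allowT V (rcls B t) (ccls B p) (kcls B tm t p) (rtile B (conf z t) p)"
proof -
 have l: "length (snd (conf z t)) = ntapes V" and h: "\<And>j. j < ntapes V ==> \<bar>snd (snd (conf z t) ! j)\<bar> <= int B"
  using wfc_mono[OF wfc_conf tp(1)] by (auto simp: wfc_def)
 have c: "ce (rtile B (conf z t) p) ! j = (fst (snd (conf z t) ! j) (int p - int B), snd (snd (conf z t) ! j) = int p - int B,
    snd (snd (conf z t) ! j) = int p - int B - 1, snd (snd (conf z t) ! j) = int p - int B + 1)" if "j < ntapes V" for j
  using l that by (simp add: rtile_def Let_def case_prod_unfold)
 have L: "\<not> hL (ce (rtile B (conf z t) p) ! j)" if "j < ntapes V" "ccls B p = 0" for j
  using that B h[OF that(1)] unfolding c[OF that(1)] by (auto simp: ccls_def split: if_splits)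
 have R: "\<not> hR (ce (rtile B (conf z t) p) ! j)" if "j < ntapes V" "ccls B p = 3" for j
  using that B h[OF that(1)] unfolding c[OF that(1)] by (auto simp: ccls_def split: if_splits)
 have c2: "ccls B p = 2 \<longleftrightarrow> p = B" using B by (auto simp: ccls_def)
 have S: "st (rtile B (conf z 0) p) = 0" "og (rtile B (conf z 0) p) \<longleftrightarrow> p = B"
  by (auto simp: rtile_def Let_def conf_0 init_config_def)
 have H: "(hh (ce (rtile B (conf z t) p) ! j) \<longleftrightarrow> p = B) \<and>
   (if j = 0 then (if kcls B tm t p = 3 then sy (ce (rtile B (conf z t) p) ! j) \<in> {1, 2} else sy (ce (rtile B (conf z t) p) ! j) = kcls B tm t p)
    else sy (ce (rtile B (conf z t) p) ! j) = 0)" if j: "j < ntapes V" and t0: "t = 0" for j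
 proof -
  have n: "snd (conf z 0) ! j = (if j = 0 then word_tape z else word_tape [])"
   using j by (auto simp: conf_0 init_config_def nth_Cons split: nat.splits)
  have h0: "snd (word_tape w) = 0" for w by (simp add: word_tape_def)
  have "fst (word_tape z) (int p - int B) = (if kcls B tm 0 p = 3 then (if z ! (p - B) then 2 else 1) else kcls B tm 0 p)"
  proof (cases "B <= p \<and> p < B + length tm")
   case True
   then have e: "int p - int B = int (p - B)" "p - B < length z" using z by (auto simp: matches_def)
   have "p - B < length tm" using True by linarith
   then have "tm ! (p - B) = 3 \<or> tm ! (p - B) = (if z ! (p - B) then 2 else 1)" using z unfolding matches_def by blast
   moreover have "fst (word_tape z) (int p - int B) = (if z ! (p - B) then 2 else 1)"
    unfolding e(1) using e(2) by (simp add: word_tape_def)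
   moreover have "kcls B tm 0 p = tm ! (p - B)" using True by (simp add: kcls_def)
   ultimately show ?thesis by auto
  next
   case False
   then show ?thesis using z by (auto simp: word_tape_def kcls_def matches_def)
  qed
  then have f: "fst (word_tape z) (int p - int B) = (if kcls B tm t p = 3 then (if z ! (p - B) then 2 else 1) else kcls B tm t p)"
   unfolding t0 .
  have p: "(0 = int p - int B) \<longleftrightarrow> p = B" by linarith
  have b: "fst (word_tape []) i = 0" for i by (simp add: word_tape_def)
  show ?thesis
  proof (cases "j = 0")
   case True
   then show ?thesis unfolding c[OF j] using f n t0 by (simp add: h0 p)
  next
   case False
   then show ?thesis unfolding c[OF j] using n t0 by (simp add: h0 p b)
  qed
 qed
 have A: "sy (ce (rtile B (conf z t) p) ! 1) = 2" if "rcls B t = 2" "ccls B p = 2"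
 proof -
  have "1 < ntapes V" using V by (simp add: wf_machine_def)
  moreover have "t = B" using that B tp by (auto simp: rcls_def split: if_splits)
  ultimately show ?thesis using c[of 1] acc c2 that by simp
 qed
 have r0: "t = 0" if "rcls B t = 0" using that B by (auto simp: rcls_def split: if_splits)
 show ?thesis unfolding allowT_def c2
 proof (intro conjI impI allI)
  fix j assume j: "j < ntapes V"
  show "\<not> hL (ce (rtile B (conf z t) p) ! j)" if "ccls B p = 0" by (rule L[OF j that])
  show "\<not> hR (ce (rtile B (conf z t) p) ! j)" if "ccls B p = 3" by (rule R[OF j that])
  assume r: "rcls B t = 0"
  show "hh (ce (rtile B (conf z t) p) ! j) \<longleftrightarrow> p = B" by (rule conjunct1[OF H[OF j r0[OF r]]])
  show "if j = 0 then (if kcls B tm t p = 3 then sy (ce (rtile B (conf z t) p) ! j) \<in> {1, 2} else sy (ce (rtile B (conf z t) p) ! j) = kcls B tm t p)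
    else sy (ce (rtile B (conf z t) p) ! j) = 0" by (rule conjunct2[OF H[OF j r0[OF r]]])
 next
  assume r: "rcls B t = 0"
  show "st (rtile B (conf z t) p) = 0" "og (rtile B (conf z t) p) \<longleftrightarrow> p = B" unfolding r0[OF r] by (rule S)+
 next
  assume "rcls B t = 2 \<and> p = B"
  then show "sy (ce (rtile B (conf z t) p) ! 1) = 2" using A c2 by blast
 qed
qed

text \<open>The rows of a tiling are successive configurations: labels and free letters fix the
  first row, and \<open>row_unique\<close> fixes each later one from the row below. The input can be
  read off the first row, so tilings and accepted inputs correspond one to one.\<close>

theorem card_tilings_verifier:
 "card (tilings W (labels B tm)) = card {z. matches z \<and> fst (snd (conf z B) ! 1) 0 = 2}"
proof -
 let ?S = "{z. matches z \<and> fst (snd (conf z B) ! 1) 0 = 2}"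
 have B1: "1 <= B" using B by simp
 have k1: "1 < ntapes V" "0 < ntapes V" using V by (simp_all add: wf_machine_def)
 have im: "run ` ?S = tilings W (labels B tm)"
 proof (intro equalityI subsetI)
  fix f assume "f \<in> run ` ?S"
  then obtain z where z: "matches z" "fst (snd (conf z B) ! 1) 0 = 2" "f = run z" by blast
  have "allowT V (rcls B t) (ccls B p) (kcls B tm t p) (tiles f t p) \<and>
    (p < 2 * B --> eastS (tiles f t p) = westS (tiles f t (Suc p))) \<and>
    (t < B --> northS V (tiles f t p) = southS (tiles f (Suc t) p))" if tp: "t <= B" "p <= 2 * B" for t p
   using run_allowed[OF z(1) tp z(2)] tiles_run[of t p z] tiles_run[of t "Suc p" z] tiles_run[of "Suc t" p z]
    north_rtile[OF V wfc_conf, of B z t p] east_rtile tp by (simp add: z(3) conf_Suc)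
  then show "f \<in> tilings W (labels B tm)" using tilings_iff[OF run_PiE] z(3) by blast
 next
  fix f assume f: "f \<in> tilings W (labels B tm)"
  then have fP: "f \<in> {..<length (labels B tm)} \<rightarrow>\<^sub>E {..<length (tls V)}" by (simp add: tilings_def)
  define F where "F = tiles f"
  have al: "allowT V (rcls B t) (ccls B p) (kcls B tm t p) (F t p)" if "t <= B" "p <= 2 * B" for t p
   using tilings_iff[OF fP] f that unfolding F_def by blast
  have ew: "eastS (F t p) = westS (F t (Suc p))" if "t <= B" "p < 2 * B" for t p
   using tilings_iff[OF fP] f that unfolding F_def by (metis less_imp_le)
  have ns: "northS V (F t p) = southS (F (Suc t) p)" if "t < B" "p <= 2 * B" for t p
   using tilings_iff[OF fP] f that unfolding F_def by (metis less_imp_le)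
  have ts: "F t p \<in> tset V" if "t <= B" "p <= 2 * B" for t p
   unfolding F_def tiles_def by (rule tls_tset) (use fP cell_less[OF that] in auto)
  define z where "z = map (%i. sy (ce (F 0 (B + i)) ! 0) = 2) [0..<length tm]"
  have a0: "st (F 0 p) = 0 \<and> (og (F 0 p) \<longleftrightarrow> p = B) \<and> (\<forall>j<ntapes V. (hh (ce (F 0 p) ! j) \<longleftrightarrow> p = B) \<and>
    (if j = 0 then (if kcls B tm 0 p = 3 then sy (ce (F 0 p) ! j) \<in> {1, 2} else sy (ce (F 0 p) ! j) = kcls B tm 0 p)
     else sy (ce (F 0 p) ! j) = 0))" if "p <= 2 * B" for p
  proof -
   have "ccls B p = 2 \<longleftrightarrow> p = B" using B1 by (auto simp: ccls_def)
   moreover have "rcls B 0 = 0" by (simp add: rcls_def)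
   ultimately show ?thesis using al[OF le0 that] unfolding allowT_def by (simp only: simp_thms) blast
  qed
  have tmi: "tm ! i = 1 \<or> tm ! i = 2 \<or> tm ! i = 3" if "i < length tm" for i
   using tm nth_mem[OF that] by blast
  have a1: "if kcls B tm 0 p = 3 then sy (ce (F 0 p) ! 0) \<in> {1, 2} else sy (ce (F 0 p) ! 0) = kcls B tm 0 p"
   if "p <= 2 * B" for p
   using conjunct2[OF spec[OF conjunct2[OF conjunct2[OF a0[OF that]]], THEN mp, OF k1(2)]]
   unfolding if_P[OF refl] .
  have s0: "sy (ce (F 0 (B + i)) ! 0) = (if z ! i then 2 else 1) \<and> (tm ! i = 3 \<or> tm ! i = sy (ce (F 0 (B + i)) ! 0))"
   if i: "i < length tm" for i
  proof -
   have "B + i <= 2 * B" "kcls B tm 0 (B + i) = tm ! i" using i B by (auto simp: kcls_def)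
   then show ?thesis using a1[of "B + i"] tmi[OF i] i by (auto simp: z_def)
  qed
  have m: "matches z" unfolding matches_def using s0 by (auto simp: z_def)
  have lb: "\<not> hL (ce (F t 0) ! j)" if "t <= B" "j < ntapes V" for t j
   using al[OF that(1), of 0] that by (simp add: allowT_def ccls_def)
  have rb: "\<not> hR (ce (F t (2 * B)) ! j)" if "t <= B" "j < ntapes V" for t j
   using al[OF that(1), of "2 * B"] that B1 by (simp add: allowT_def ccls_def)
  have row: "F t p = rtile B (conf z t) p" if "t <= B" "p <= 2 * B" for t p
   using that
  proof (induction t arbitrary: p)
   case 0
   show ?case
   proof (rule row_unique[where F = "F 0", OF wfc_mono[OF wfc_conf le0] 0(2)])
    fix p assume p: "p <= 2 * B"
    have lc: "length (ce (F 0 p)) = ntapes V" using ts[OF le0 p] by (simp add: tset_def)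
    have "map (%c. (sy c, hh c)) (ce (F 0 p)) = map (%(f, h). (f (int p - int B), h = int p - int B)) (snd (conf z 0))"
    proof (rule nth_equalityI)
     show "length (map (%c. (sy c, hh c)) (ce (F 0 p))) = length (map (%(f, h). (f (int p - int B), h = int p - int B)) (snd (conf z 0)))"
      using lc wfc_conf[of 0 z] by (simp add: wfc_def)
     fix j assume "j < length (map (%c. (sy c, hh c)) (ce (F 0 p)))"
     then have j: "j < ntapes V" using lc by simp
     have n: "snd (conf z 0) ! j = (if j = 0 then word_tape z else word_tape [])" "length (snd (conf z 0)) = ntapes V"
      using j wfc_conf[of 0 z] by (auto simp: wfc_def) (auto simp: conf_0 init_config_def nth_Cons split: nat.splits)
     have "sy (ce (F 0 p) ! 0) = fst (word_tape z) (int p - int B)"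
     proof (cases "B <= p \<and> p < B + length tm")
      case True
      then have e: "int p - int B = int (p - B)" "p - B < length z" "B + (p - B) = p" by (auto simp: z_def)
      have "fst (word_tape z) (int p - int B) = (if z ! (p - B) then 2 else 1)"
       unfolding e(1) using e(2) by (simp add: word_tape_def)
      moreover have "p - B < length tm" using True by linarith
      ultimately show ?thesis using s0[of "p - B"] e(3) by simp
     next
      case False
      then have "kcls B tm 0 p = 0" by (auto simp: kcls_def)
      then have "sy (ce (F 0 p) ! 0) = 0" using a1[OF p] by simp
      then show ?thesis using False by (auto simp: word_tape_def z_def)
     qed
     then show "map (%c. (sy c, hh c)) (ce (F 0 p)) ! j = map (%(f, h). (f (int p - int B), h = int p - int B)) (snd (conf z 0)) ! j"
      using a0[OF p] j lc n by (auto simp: word_tape_def case_prod_unfold)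
    qed
    then show "southS (F 0 p) = southS (rtile B (conf z 0) p)"
     using a0[OF p] unfolding south_rtile by (simp add: southS_def) (simp add: conf_0 init_config_def)
   qed (use ts ew lb rb in auto)
  next
   case (Suc t)
   show ?case
   proof (rule row_unique[where F = "F (Suc t)", OF wfc_mono[OF wfc_conf Suc.prems(1)] Suc.prems(2)])
    fix p assume p: "p <= 2 * B"
    have "southS (F (Suc t) p) = northS V (F t p)" using ns[of t p] Suc.prems p by simp
    also have "F t p = rtile B (conf z t) p" using Suc p by simp
    also have "northS V \<dots> = southS (rtile B (conf z (Suc t)) p)" using north_rtile[OF V wfc_conf] by (simp add: conf_Suc)
    finally show "southS (F (Suc t) p) = southS (rtile B (conf z (Suc t)) p)" .
   qed (use ts ew lb rb Suc.prems in auto)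
  qed
  have "fst (snd (conf z B) ! 1) 0 = 2"
  proof -
   have "rcls B B = 2" "ccls B B = 2" using B1 by (auto simp: rcls_def ccls_def)
   then have "sy (ce (F B B) ! 1) = 2" using al[of B B] by (simp add: allowT_def)
   then show ?thesis using row[of B B] k1 wfc_conf[of B z] by (simp add: rtile_def Let_def wfc_def case_prod_unfold)
  qed
  moreover have "f = run z"
  proof (rule PiE_ext[OF fP run_PiE])
   fix ka assume k: "ka \<in> {..<length (labels B tm)}"
   then obtain t p where tp: "t <= B" "p <= 2 * B" "ka = t * W + p" using cell_cases by blast
   have "tls V ! f ka = tls V ! run z ka" using row[OF tp(1,2)] tiles_run[OF tp(1,2), of z] by (simp add: F_def tiles_def tp(3))
   moreover have "f ka < length (tls V)" "run z ka < length (tls V)" using fP run_PiE[of z] k by auto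
   ultimately show "f ka = run z ka" using tls(2) by (simp add: nth_eq_iff_index_eq)
  qed
  ultimately show "f \<in> run ` ?S" using m by blast
 qed
 have "inj_on run ?S"
 proof (rule inj_onI)
  fix y z assume yz: "y \<in> ?S" "z \<in> ?S" "run y = run z"
  show "y = z"
  proof (rule nth_equalityI)
   show "length y = length z" using yz by (simp add: matches_def)
   fix i assume i: "i < length y"
   then have p: "B + i <= 2 * B" "i < length z" using yz B by (auto simp: matches_def)
   have "rtile B (conf y 0) (B + i) = rtile B (conf z 0) (B + i)"
    using tiles_run[OF le0 p(1)] yz(3) by metis
   moreover have "sy (ce (rtile B (conf w 0) (B + i)) ! 0) = (if w ! i then 2 else 1)" if "i < length w" for w
    using that by (simp add: rtile_def Let_def conf_0 init_config_def word_tape_def)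
   ultimately have "(if y ! i then 2 else 1) = (if z ! i then 2 else (1::nat))" using i p(2) by metis
   then show "y ! i = z ! i" by (simp split: if_splits)
  qed
 qed
 then show ?thesis using card_image[of run ?S] unfolding im by simp
qed

end

end

text \<open>The pair code writes \<open>True\<close> before each letter of \<open>x\<close>,
  \<open>False\<close> after the last one and then \<open>y\<close>. On the tape \<open>True\<close>
  is 2 and \<open>False\<close> is 1; the entry 3 stands for a free letter of
  \<open>y\<close>.\<close>

definition tmpl :: "bool list => nat => nat list" where
 "tmpl x n = concat (map (%b. [2, if b then 2 else 1]) x) @ 1 # replicate n 3"

lemma set_tmpl: "set (tmpl x n) \<subseteq> {1, 2, 3}" "1 <= length (tmpl x n)"
 by (auto simp: tmpl_def split: if_splits)

definition fits :: "nat list => bool list => bool" where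
 "fits = list_all2 (%c b. c = 3 \<or> c = (if b then 2 else 1))"

lemma fits_tmpl: "{z. fits (tmpl x n) z} = enc_pair x ` {y. length y = n}"
proof -
 have a: "fits (concat (map (%b. [2, if b then 2 else 1]) x) @ t) z \<longleftrightarrow>
   (\<exists>z'. z = concat (map (%b. [True, b]) x) @ z' \<and> fits t z')" for t z
 proof (induction x arbitrary: z)
  case Nil then show ?case by simp
 next
  case (Cons b x)
  have "fits (concat (map (%b. [2, if b then 2 else 1]) (b # x)) @ t) z \<longleftrightarrow>
    (\<exists>z2. z = True # b # z2 \<and> fits (concat (map (%b. [2, if b then 2 else 1]) x) @ t) z2)"
   by (auto simp: fits_def list_all2_Cons1 split: if_splits)
  then show ?case unfolding Cons.IH by auto
 qed
 have b: "fits (replicate n 3) z \<longleftrightarrow> length z = n" for z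
  by (auto simp: fits_def list_all2_conv_all_nth)
 have "fits (1 # replicate n 3) z \<longleftrightarrow> (\<exists>y. z = False # y \<and> length y = n)" for z
  using b by (auto simp: fits_def list_all2_Cons1 split: if_splits)
 then show ?thesis unfolding tmpl_def a by (auto simp: enc_pair_def enc_list_def)
qed

lemma tape_word_single:
 assumes "tape_word t = [b]" shows "fst t 0 = 2 \<longleftrightarrow> b"
proof -
 have "(LEAST i. fst t (int i) \<notin> {1, 2}) = 1" using arg_cong[OF assms, of length] by (simp add: tape_word_def)
 then have "tape_word t = [fst t 0 = 2]" unfolding tape_word_def by simp
 then show ?thesis using assms by simp
qed

context verifier
begin

lemma matches_fits:
 assumes "1 <= length tm" "set tm \<subseteq> {1, 2, 3}"
 shows "matches tm z \<longleftrightarrow> fits tm z"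
 unfolding matches_def[OF assms(1) order_refl assms(2)] fits_def list_all2_conv_all_nth by (auto simp: eq_commute)

text \<open>Halting configurations are fixed, so the verdict reached at time \<open>t\<close> is
  still present at time \<open>B\<close>.\<close>

lemma conf_accepts:
 assumes "computes_within blank V z [b] t" "t <= B"
 shows "fst (snd (conf z B) ! 1) 0 = 2 \<longleftrightarrow> b"
proof -
 have t: "fst (conf z t) = 1" "tape_word (snd (conf z t) ! 1) = [b]"
  using assms(1) unfolding computes_within_def conf_def by (auto split: prod.splits)
 have "conf z (t + d) = conf z t" for d
  by (induction d) (use t in \<open>auto simp: conf_Suc step_def split: prod.splits\<close>)
 from this[of "B - t"] show ?thesis using tape_word_single[OF t(2)] assms(2) by simp
qed

text \<open>A constraint selects at most all tiles of three cells.\<close>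

abbreviation "K0 \<equiv> 3 * length (tls V)"

definition grows :: "nat => nat list => nat list" where
 "grows B tm = raster (pcols K0 (length (labels B tm) * length (tls V)))
   (urows K0 nrul (length (tls V)) con (W B) (labels B tm))"

definition gwidth :: "nat => nat list => nat" where
 "gwidth B tm = 4 * K0 + length (labels B tm) * length (tls V) + 1"

text \<open>\<open>B\<close> bounds the input length and the running time, so the window contains
  the whole computation and its last row shows the verdict.\<close>

theorem count_graph:
 assumes q: "3 <= q"
  and acc: "\<And>z. computes_within blank V z [Vp z] (poly pT (length z))"
  and g: "\<And>x. g x = card {y. length y = poly pn (length x) \<and> Vp (enc_pair x y)}"
  and tm: "tm = tmpl x (poly pn (length x))" and B: "length tm <= B" "poly pT (length tm) <= B"
 shows "planar (gg (grows B tm) (gwidth B tm))"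
  "ZZ q m0 (gg (grows B tm) (gwidth B tm)) = (\<Prod>t\<leftarrow>grows B tm. kc q t) *
    (ckst K0 ^ (length (labels B tm) * nrul) * int (g x))"
proof -
 have tm1: "1 <= length tm" "set tm \<subseteq> {1, 2, 3}" using set_tmpl[of x "poly pn (length x)"] by (simp_all add: tm)
 have W: "2 <= W B" using B tm1 by (simp add: W_def)
 have ls: "labels B tm ~= []" by (simp add: labels_def rowl_def)
 have th: "1 <= length (tls V)" by (rule tls_nonempty[OF V])
 have K: "1 <= K0" using th by simp
 have asel: "length (filter id (selrow (length (tls V)) con (labels B tm ! ka) rh (map (msk (W B) ka) [0..<length (labels B tm)]))) =
   asz (length (tls V)) con (labels B tm ! ka) rh" if "ka < length (labels B tm)" for ka rh
  by (rule filter_selrow[OF W labels_rgt[OF tm1(1) B(1) tm1(2)] labels_upw[OF tm1(1) B(1) tm1(2)] that])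
 note e = exact_one[OF q K ls th asz_con_le asel, of nrul]
 show "planar (gg (grows B tm) (gwidth B tm))" unfolding grows_def gwidth_def by (rule e(1))
 have "card {x \<in> xsel (length (labels B tm) * length (tls V)). \<forall>ka<length (labels B tm). \<forall>rh<nrul.
     cnt 1 (selrow (length (tls V)) con (labels B tm ! ka) rh (map (msk (W B) ka) [0..<length (labels B tm)])) x = 1} =
   card (tilings (W B) (labels B tm))"
  by (rule card_tilings[OF W labels_rgt[OF tm1(1) B(1) tm1(2)] labels_upw[OF tm1(1) B(1) tm1(2)]])
 also have "\<dots> = card {z. matches tm z \<and> fst (snd (conf z B) ! 1) 0 = 2}"
  by (rule card_tilings_verifier[OF tm1(1) B(1) tm1(2)])
 also have "{z. matches tm z \<and> fst (snd (conf z B) ! 1) 0 = 2} = enc_pair x ` {y. length y = poly pn (length x) \<and> Vp (enc_pair x y)}"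
 proof -
  have "(fst (snd (conf z B) ! 1) 0 = 2) = Vp z" if "fits tm z" for z
  proof -
   have "length z = length tm" using that by (simp add: fits_def list_all2_lengthD)
   then show ?thesis using conf_accepts[OF acc[of z]] B(2) by simp
  qed
  then have "{z. matches tm z \<and> fst (snd (conf z B) ! 1) 0 = 2} = {z. fits tm z} \<inter> {z. Vp z}"
   by (auto simp: matches_fits[OF tm1])
  then show ?thesis unfolding tm fits_tmpl by auto
 qed
 also have "card \<dots> = g x" unfolding g by (rule card_image) (simp add: inj_on_def enc_pair_def)
 finally have c: "card {x \<in> xsel (length (labels B tm) * length (tls V)). \<forall>ka<length (labels B tm). \<forall>rh<nrul.
     cnt 1 (selrow (length (tls V)) con (labels B tm ! ka) rh (map (msk (W B) ka) [0..<length (labels B tm)])) x = 1} = g x" .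
 show "ZZ q m0 (gg (grows B tm) (gwidth B tm)) = (\<Prod>t\<leftarrow>grows B tm. kc q t) *
    (ckst K0 ^ (length (labels B tm) * nrul) * int (g x))"
  unfolding grows_def gwidth_def c[symmetric] by (rule e(2))
qed

end

section \<open>Polynomial-time functions\<close>

definition bnd :: "nat => (env => nat) => bool" where
 "bnd A b \<longleftrightarrow> (\<exists>K k. \<forall>e. vld A K e --> b e <= (sz K e + 2) ^ k)"

lemma bndI: "(\<And>e. vld A K e ==> b e <= (sz K e + 2) ^ k) ==> bnd A b"
 unfolding bnd_def by blast

lemma bnd_const: "bnd A (%e. c)"
proof (rule bndI[where K = 0 and k = c])
 have "c <= 2 ^ c" by (rule less_imp_le) (rule less_exp)
 also have "\<dots> <= (sz 0 e + 2) ^ c" for e by (rule power_mono) auto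
 finally show "c <= (sz 0 e + 2) ^ c" for e .
qed

lemma bnd_pair:
 assumes "bnd A b" "bnd A b'"
 obtains K k where "\<And>e. vld A K e ==> b e <= (sz K e + 2) ^ k" "\<And>e. vld A K e ==> b' e <= (sz K e + 2) ^ k"
proof -
 obtain K k where 1: "\<And>e. vld A K e ==> b e <= (sz K e + 2) ^ k" using assms(1) unfolding bnd_def by blast
 obtain K' k' where 2: "\<And>e. vld A K' e ==> b' e <= (sz K' e + 2) ^ k'" using assms(2) unfolding bnd_def by blast
 have m: "(sz K1 e + 2) ^ k1 <= (sz (K + K') e + 2) ^ (k + k')" if "K1 <= K + K'" "k1 <= k + k'" for K1 k1 e
 proof -
  have "(sz K1 e + 2) ^ k1 <= (sz (K + K') e + 2) ^ k1" by (rule power_mono) (use sz_mono[OF that(1)] in auto)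
  also have "\<dots> <= (sz (K + K') e + 2) ^ (k + k')" by (rule power_increasing) (use that in auto)
  finally show ?thesis .
 qed
 show thesis
 proof (rule that[where K = "K + K'" and k = "k + k'"])
  fix e assume "vld A (K + K') e"
  then have "vld A K e" "vld A K' e" by (auto intro: vld_mono)
  then show "b e <= (sz (K + K') e + 2) ^ (k + k')" "b' e <= (sz (K + K') e + 2) ^ (k + k')"
   using order_trans[OF 1 m] order_trans[OF 2 m] by auto
 qed
qed

lemma bnd_mult: assumes "bnd A b" "bnd A b'" shows "bnd A (%e. b e * b' e)"
proof -
 obtain K k where "\<And>e. vld A K e ==> b e <= (sz K e + 2) ^ k" "\<And>e. vld A K e ==> b' e <= (sz K e + 2) ^ k"
  by (rule bnd_pair[OF assms]) blast
 then show ?thesis by (intro bndI[where K = K and k = "k + k"]) (auto simp: power_add intro!: mult_mono)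
qed

lemma bnd_add: assumes "bnd A b" "bnd A b'" shows "bnd A (%e. b e + b' e)"
proof -
 obtain K k where "\<And>e. vld A K e ==> b e <= (sz K e + 2) ^ k" "\<And>e. vld A K e ==> b' e <= (sz K e + 2) ^ k"
  by (rule bnd_pair[OF assms]) blast
 then have "b e + b' e <= (sz K e + 2) ^ Suc k" if "vld A K e" for e
  using add_mono[of "b e" "(sz K e + 2) ^ k" "b' e" "(sz K e + 2) ^ k"] that by (simp add: trans_le_add2)
 then show ?thesis by (rule bndI)
qed

text \<open>A program cannot write more symbols than it makes steps.\<close>

lemma bnd_FP: assumes "FP A f" shows "bnd A (%e. length (f e))"
proof -
 obtain K B k where f: "FPt A f K B (%n. (n + 2) ^ k)" using assms unfolding FP_def FPw_def by auto
 obtain c where c: "\<And>e. vld A K (%i. e (Suc i)) ==> e 0 = [] ==> (\<forall>j\<ge>Suc K. e j = []) ==>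
   exle c e ((sz K (%i. e (Suc i)) + 2) ^ k) (e(0 := f (%i. e (Suc i))))"
  by (rule FPt_run[OF f, of Suc "Suc K" 0]) auto
 show ?thesis
 proof (rule bndI[where K = K and k = k])
  fix e :: env assume e: "vld A K e"
  define e' where "e' i = (if 0 < i \<and> i < Suc K then e (i - 1) else [])" for i
  have v: "vld A K (%i. e' (Suc i))" using e by (simp add: vld_def e'_def)
  have "f (%i. e' (Suc i)) = f e" by (rule FPt_dep[OF f v]) (simp add: e'_def)
  moreover have "sz K (%i. e' (Suc i)) = sz K e" by (rule sz_cong) (simp add: e'_def)
  ultimately show "length (f e) <= (sz K e + 2) ^ k"
   using exle_len[OF c[OF v], of 0] by (simp add: e'_def)
 qed
qed

lemma FP_symbols: assumes "FP A f" obtains K where "\<And>e. vld A K e ==> set (f e) \<subseteq> {..<A}"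
 using assms FPt_val unfolding FP_def FPw_def by meson

lemma FP_fold1:
 assumes g: "FP A g" and b: "FP A b" and h: "\<And>x. x < A ==> FP A (%e. h x (e 0) (%i. e (Suc i)))"
  and bd: "bnd A bh" "\<And>e m. vld A K e ==> m <= length (g e) ==> length (fold (%x a. h x a e) (take m (g e)) (b e)) <= bh e"
 shows "FP A (%e. fold (%x a. h x a e) (g e) (b e))"
proof -
 have f: "facc 1 (%x i E. h x (E 0) (%i. E (Suc i))) e w a 0 = fold (%x a. h x a e) w (a 0)" for e w a
  by (induction w arbitrary: a) (simp_all add: facc_def mrg_def)
 obtain K' k where k: "\<And>e. vld A K' e ==> bh e <= (sz K' e + 2) ^ k" using bd(1) unfolding bnd_def by blast
 have "FP A (%e. facc 1 (%x i E. h x (E 0) (%i. E (Suc i))) e (g e) (%i. b e) 0)"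
 proof (rule FP_fold[where ?K0.0 = "K + K'" and ?k0.0 = k, OF g b h])
  fix e m i assume e: "vld A (K + K') e" "m <= length (g e)" "i < (1::nat)"
  have "length (fold (%x a. h x a e) (take m (g e)) (b e)) <= bh e"
   by (rule bd(2)[OF vld_mono[OF e(1)] e(2)]) simp
  also have "\<dots> <= (sz K' e + 2) ^ k" by (rule k[OF vld_mono[OF e(1)]]) simp
  also have "\<dots> <= (sz (K + K') e + 2) ^ k" by (rule power_mono) (auto intro: sz_mono)
  finally show "length (facc 1 (%x i E. h x (E 0) (%i. E (Suc i))) e (take m (g e)) (%i. b e) i) <= (sz (K + K') e + 2) ^ k"
   using e(3) f by simp
 qed simp_all
 then show ?thesis unfolding f .
qed

text \<open>One of two ways to meet the length bound of \<open>FP_fold\<close>: every letter adds at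
  most \<open>bh e\<close>. In \<open>FP_fold_max\<close> an update never pushes a length beyond
  \<open>bh e\<close>.\<close>

lemma FP_fold_add:
 assumes g: "FP A g" and b: "FP A b" and h: "\<And>x. x < A ==> FP A (%e. h x (e 0) (%i. e (Suc i)))"
  and bd: "bnd A bh" "\<And>x a e. x < A ==> length (h x a e) <= length a + bh e"
 shows "FP A (%e. fold (%x a. h x a e) (g e) (b e))"
proof -
 obtain K where K: "\<And>e. vld A K e ==> set (g e) \<subseteq> {..<A}" by (rule FP_symbols[OF g]) blast
 have l: "length (fold (%x a. h x a e) w a) <= length a + length w * bh e" if "set w \<subseteq> {..<A}" for w a e
  using that
 proof (induction w arbitrary: a)
  case (Cons x w)
  have "length (fold (%x a. h x a e) w (h x a e)) <= length (h x a e) + length w * bh e" using Cons by simp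
  then show ?case using bd(2)[of x a e] Cons.prems by simp
 qed simp
 show ?thesis
 proof (rule FP_fold1[OF g b h bnd_add[OF bnd_FP[OF b] bnd_mult[OF bnd_FP[OF g] bd(1)]]])
  fix e m assume e: "vld A K e" "m <= length (g e)"
  have "set (take m (g e)) \<subseteq> {..<A}" using K[OF e(1)] set_take_subset[of m "g e"] by blast
  from l[OF this, of e "b e"] show "length (fold (%x a. h x a e) (take m (g e)) (b e)) <= length (b e) + length (g e) * bh e"
   using e(2) by (elim order_trans) (simp add: mult_le_mono1)
 qed
qed

lemma FP_fold_max:
 assumes g: "FP A g" and b: "FP A b" and h: "\<And>x. x < A ==> FP A (%e. h x (e 0) (%i. e (Suc i)))"
  and bd: "bnd A bh" "\<And>x a e. length (h x a e) <= max (length a) (bh e)"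
 shows "FP A (%e. fold (%x a. h x a e) (g e) (b e))"
proof (rule FP_fold1[OF g b h bnd_add[OF bnd_FP[OF b] bd(1)]])
 fix e m
 have l: "length (fold (%x a. h x a e) w a) <= max (length a) (bh e)" for w a
 proof (induction w arbitrary: a)
  case (Cons x w)
  have "length (fold (%x a. h x a e) w (h x a e)) <= max (length (h x a e)) (bh e)" by (rule Cons)
  then show ?case using bd(2)[of x a e] by simp
 qed simp
 show "length (fold (%x a. h x a e) (take m (g e)) (b e)) <= length (b e) + bh e" if "vld A 0 e"
  using l[of "take m (g e)" "b e"] by linarith
qed

lemma FP_app2: assumes "FP A (%e. F (e 0) (e 1))" "FP A f" "FP A g" shows "FP A (%e. F (f e) (g e))"
 using FP_let[OF assms(3) FP_let[OF FP_rename[OF assms(2), of Suc] assms(1)]] by simp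

lemma FP_lit: "set w \<subseteq> {..<A} ==> FP A (%e. w)"
 by (induction w) (auto intro: FP_nil FP_Cons)

lemma FP_rev: assumes "FP A f" shows "FP A (%e. rev (f e))"
proof -
 have "FP A (%e. fold (%x a. x # a) (f e) [])"
  by (rule FP_fold_add[where h = "%x a e. x # a", OF assms FP_nil _ bnd_const[of A 1]]) (auto intro: FP_Cons FP_var)
 then show ?thesis by (simp add: rev_conv_fold)
qed

lemma FP_app: assumes "FP A f" "FP A g" shows "FP A (%e. f e @ g e)"
proof -
 have "FP A (%e. fold (%x a. x # a) (rev (f e)) (g e))"
  by (rule FP_fold_add[where h = "%x a e. x # a", OF FP_rev[OF assms(1)] assms(2) _ bnd_const[of A 1]]) (auto intro: FP_Cons FP_var)
 moreover have "fold (%x a. x # a) (rev u) v = u @ v" for u v :: "nat list" by (induction u) auto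
 ultimately show ?thesis by simp
qed

lemma FP_drop: assumes "FP A f" "FP A g" shows "FP A (%e. drop (length (f e)) (g e))"
proof -
 have "FP A (%e. fold (%x a. tl a) (f e) (g e))"
  by (rule FP_fold_add[where h = "%x a e. tl a", OF assms _ bnd_const[of A 0]]) (auto intro: FP_tl FP_var)
 moreover have "fold (%x a. tl a) u v = drop (length u) v" for u v :: "nat list"
  by (induction u arbitrary: v) (auto simp: drop_Suc)
 ultimately show ?thesis by simp
qed

lemma FP_take: assumes "FP A f" "FP A g" shows "FP A (%e. take (length (f e)) (g e))"
proof -
 have "take n w = rev (drop (length (drop n w)) (rev w))" for n and w :: "nat list"
  by (cases "n <= length w") (simp_all add: rev_drop)
 then show ?thesis using FP_rev[OF FP_drop[OF FP_drop[OF assms] FP_rev[OF assms(2)]]] by simp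
qed

text \<open>The prefix before a letter supplies the position of the letter in unary.\<close>

definition scan :: "(nat => nat list => nat list) => nat list => nat list" where
 "scan F w = concat (map (%ka. F (w ! ka) (take ka w)) [0..<length w])"

lemma FP_scan:
 assumes g: "FP A g" and F: "\<And>x. x < A ==> FP A (%e. F x (e 0) (%i. e (Suc i)))"
 shows "FP A (%e. scan (%x p. F x p e) (g e))"
proof -
 \<comment> \<open>Accumulator 0 is the result, accumulator 1 the prefix read so far.\<close>
 define h where "h x i E = (if i = 0 then E 0 @ F x (E 1) (%i. E (Suc (Suc i))) else E 1 @ [x])" for x i :: nat and E :: env
 have h01: "h x 0 E = E 0 @ F x (E 1) (%i. E (Suc (Suc i)))" "h x 1 E = E 1 @ [x]" for x E by (simp_all add: h_def)
 have f: "facc 2 h e (take m w) (%_. []) 0 = concat (map (%ka. F (w ! ka) (take ka w) e) [0..<m]) \<and>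
   facc 2 h e (take m w) (%_. []) 1 = take m w" if "m <= length w" for e m w
  using that
 proof (induction m)
  case 0 then show ?case by (simp add: facc_def)
 next
  case (Suc m)
  then have "m < length w" by simp
  from facc_take_Suc[OF this, of 2 h e "%_. []"]
  show ?case using Suc by (simp only: h01) (simp add: mrg_def take_Suc_conv_app_nth)
 qed
 have "\<exists>K k. \<forall>x<A. \<forall>e. vld A K e --> length (F x (e 0) (%i. e (Suc i))) <= (sz K e + 2) ^ k"
 proof -
  have "bnd A (%e. \<Sum>x<n. length (F x (e 0) (%i. e (Suc i))))" if "n <= A" for n
   using that by (induction n) (auto intro!: bnd_add bnd_FP F bnd_const)
  from this[of A] obtain K k where "\<And>e. vld A K e ==> (\<Sum>x<A. length (F x (e 0) (%i. e (Suc i)))) <= (sz K e + 2) ^ k"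
   unfolding bnd_def by auto
  moreover have "length (F x (e 0) (%i. e (Suc i))) <= (\<Sum>x<A. length (F x (e 0) (%i. e (Suc i))))" if "x < A" for x and e :: env
   using that by (intro member_le_sum[where f = "%x. length (F x (e 0) (%i. e (Suc i)))"]) auto
  ultimately show ?thesis using order_trans by blast
 qed
 then obtain K k where k: "\<And>x e. x < A ==> vld A K e ==> length (F x (e 0) (%i. e (Suc i))) <= (sz K e + 2) ^ k" by blast
 obtain K1 where K1: "\<And>e. vld A K1 e ==> set (g e) \<subseteq> {..<A}" by (rule FP_symbols[OF g]) blast
 obtain K2 k2 where k2: "\<And>e. vld A K2 e ==> length (g e) <= (sz K2 e + 2) ^ k2" using bnd_FP[OF g] unfolding bnd_def by blast
 define bh where "bh e = length (g e) * (length (g e) + sz K e + 2) ^ k + length (g e)" for e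
 have "bnd A (%e. sz K e)" by (rule bndI[where K = K and k = 1]) simp
 then have b1: "bnd A (%e. length (g e) + sz K e + 2)" by (intro bnd_add bnd_FP[OF g] bnd_const)
 have "bnd A (%e. (length (g e) + sz K e + 2) ^ k)" for k
 proof (induction k)
  case (Suc k) then show ?case unfolding power_Suc by (rule bnd_mult[OF b1])
 qed (simp add: bnd_const)
 then have "bnd A bh" unfolding bh_def by (intro bnd_add bnd_mult bnd_FP[OF g])
 then obtain K3 k3 where k3: "\<And>e. vld A K3 e ==> bh e <= (sz K3 e + 2) ^ k3" unfolding bnd_def by blast
 have "FP A (%e. facc 2 h e (g e) (%i. []) 0)"
 proof (rule FP_fold[where n = 2 and b = "%i e. []" and ?K0.0 = "K + K1 + K3" and ?k0.0 = k3, OF g FP_nil])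
  fix x i assume "x < A" "i < (2::nat)"
  have "FP A (%E. F x (E 1) (%i. E (Suc (Suc i))))"
   using FP_rename[OF F[OF \<open>x < A\<close>], of Suc] by simp
  then show "FP A (h x i)"
   unfolding h_def[abs_def] using \<open>x < A\<close> by (cases "i = 0") (auto intro!: FP_app FP_var FP_lit)
 next
  fix e m i assume e: "vld A (K + K1 + K3) e" "m <= length (g e)" "i < (2::nat)"
  have le: "length (F (g e ! ka) (take ka (g e)) e) <= (length (g e) + sz K e + 2) ^ k" if "ka < length (g e)" for ka
  proof -
   have s: "set (g e) \<subseteq> {..<A}" by (rule K1[OF vld_mono[OF e(1)]]) simp
   then have "g e ! ka < A" using that nth_mem by blast
   have "vld A K e" by (rule vld_mono[OF e(1)]) simp
   then have "vld A K (case_nat (take ka (g e)) e)"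
    using s set_take_subset[of ka "g e"] unfolding vld_def by (auto split: nat.splits)
   from k[OF \<open>g e ! ka < A\<close> this]
   have "length (F (g e ! ka) (take ka (g e)) e) <= (sz K (case_nat (take ka (g e)) e) + 2) ^ k" by simp
   also have "sz K (case_nat (take ka (g e)) e) <= length (g e) + sz K e"
   proof (cases K)
    case (Suc K')
    have "sz K (case_nat (take ka (g e)) e) = length (take ka (g e)) + sz K' e"
     unfolding sz_def Suc sum.lessThan_Suc_shift by simp
    then show ?thesis using sz_mono[of K' K e] Suc that by simp
   qed (simp add: sz_def)
   finally show ?thesis by (simp add: power_mono)
  qed
  have "length (concat (map (%ka. F (g e ! ka) (take ka (g e)) e) [0..<m])) <= m * (length (g e) + sz K e + 2) ^ k"
   using e(2)
  proof (induction m)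
   case (Suc m)
   then show ?case using le[of m] by (simp del: add_2_eq_Suc' add_Suc_right)
  qed simp
  also have "\<dots> <= length (g e) * (length (g e) + sz K e + 2) ^ k" using e(2) by (rule mult_le_mono1)
  finally have "length (facc 2 h e (take m (g e)) (%i. []) i) <= bh e"
   using f[OF e(2), of e] e(2,3) by (auto simp: less_2_cases_iff bh_def)
  also have "\<dots> <= (sz K3 e + 2) ^ k3" by (rule k3[OF vld_mono[OF e(1)]]) simp
  also have "\<dots> <= (sz (K + K1 + K3) e + 2) ^ k3" by (rule power_mono) (auto intro: sz_mono)
  finally show "length (facc 2 h e (take m (g e)) (%i. []) i) <= (sz (K + K1 + K3) e + 2) ^ k3" .
 qed simp
 then show ?thesis using f[OF order_refl] by (simp add: scan_def)
qed

lemma FP_cmap: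
 assumes "FP A g" "\<And>x. x < A ==> FP A (F x)" shows "FP A (%e. concat (map (%x. F x e) (g e)))"
proof -
 have "scan (%x p. F x e) w = concat (map (%x. F x e) w)" for e w
  unfolding scan_def by (rule arg_cong[where f = concat]) (rule nth_equalityI; simp)
 then show ?thesis using FP_scan[OF assms(1), of "%x p. F x"] FP_rename[OF assms(2), of _ Suc] by simp
qed

lemma FP_map: assumes "FP A g" "\<And>x. x < A ==> c x < A" shows "FP A (%e. map c (g e))"
proof -
 have "FP A (%e. concat (map (%x. [c x]) (g e)))"
  by (rule FP_cmap[where F = "%x e. [c x]", OF assms(1)]) (rule FP_lit, simp add: assms(2))
 then show ?thesis by simp
qed

lemma FP_rep: "FP A g ==> c < A ==> FP A (%e. replicate (length (g e)) c)"
 using FP_map[of A g "%_. c"] by (simp add: map_replicate_const)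

text \<open>One round for each letter is enough, and after the first letter other than
  \<open>c\<close> the rounds change nothing.\<close>

lemma FP_dropWhile: assumes "FP A g" shows "FP A (%e. dropWhile (%x. x = c) (g e))"
proof -
 have "FP A (%e. fold (%x a. if hdis c a then tl a else a) (g e) (g e))"
  by (rule FP_fold_add[where h = "%x a e. if hdis c a then tl a else a", OF assms assms _ bnd_const[of A 0]])
   (rule FP_if[OF FP_var FP_tl[OF FP_var] FP_var], simp)
 moreover have "fold (%x a. if hdis c a then tl a else a) u w = dropWhile (%x. x = c) w" if "length w <= length u" for u w :: "nat list"
  using that
 proof (induction u arbitrary: w)
  case (Cons x u)
  then show ?case
  proof (cases w)
   case (Cons y w')
   have "fold (%x a. if hdis c a then tl a else a) u w = w" if "\<not> hdis c w" for u w :: "nat list"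
    using that by (induction u) auto
   then show ?thesis using Cons Cons.prems Cons.IH[of w'] by (simp add: hdis_def)
  qed (use Cons.IH[of "[]"] in \<open>simp add: hdis_def\<close>)
 qed simp
 ultimately show ?thesis by simp
qed

lemma FP_concat: "(\<And>y. y \<in> set ys ==> FP A (f y)) ==> FP A (%e. concat (map (%y. f y e) ys))"
 by (induction ys) (auto intro: FP_nil FP_app)

text \<open>Horner's scheme in unary.\<close>

lemma FP_poly:
 assumes "1 < A" "FP A f" shows "FP A (%e. replicate (poly p (length (f e))) 1)"
proof (induction p)
 case 0 then show ?case by (simp add: FP_nil)
next
 case (pCons c p)
 have "FP A (%e. replicate c 1 @ concat (map (%x. replicate (poly p (length (f e))) 1) (f e)))"
  by (rule FP_app[OF FP_lit FP_cmap[where F = "%x e. replicate (poly p (length (f e))) 1", OF assms(2) pCons.IH]]) (use assms(1) in auto)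
 moreover have "concat (map (%x. replicate n 1) w) = replicate (length w * n) (1::nat)" for n and w :: "nat list"
  by (induction w) (auto simp: replicate_add)
 ultimately show ?case by (simp add: replicate_add)
qed

section \<open>Arithmetic modulo powers of two\<close>

text \<open>Residues modulo \<open>2 ^ L\<close> with the lowest bit first, so that
  \<open>take\<close> reduces the modulus and \<open>drop\<close> divides by powers of 2. Negative
  numbers appear in two's complement.\<close>

primrec wd :: "nat => int => nat list" where
 "wd 0 z = []"
| "wd (Suc L) z = nat (z mod 2) # wd L (z div 2)"

lemma length_wd [simp]: "length (wd L z) = L" by (induction L arbitrary: z) auto

lemma set_wd: "set (wd L z) \<subseteq> {0, 1}"
proof (induction L arbitrary: z)
 case (Suc L)
 have "z mod 2 = 0 \<or> z mod 2 = 1" by presburger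
 then show ?case using Suc[of "z div 2"] by auto
qed simp

lemma wd_append: "wd (M + N) z = wd M z @ wd N (z div 2 ^ M)"
 by (induction M arbitrary: z) (auto simp: zdiv_zmult2_eq)

lemma take_wd: "take e (wd L z) = wd (min e L) z"
proof (cases "e <= L")
 case True
 then show ?thesis using wd_append[of e "L - e" z] by (simp add: min_def)
qed (simp add: min_def)

lemma drop_wd: "v <= L ==> drop v (wd L z) = wd (L - v) (z div 2 ^ v)"
 using wd_append[of v "L - v" z] by simp

lemma wd_0: "wd L 0 = replicate L 0" by (induction L) auto

lemma wd_m1: "wd L (-1) = replicate L 1" by (induction L) auto

lemma wd_cong: "z mod 2 ^ L = z' mod 2 ^ L ==> wd L z = wd L z'"
proof (induction L arbitrary: z z')
 case (Suc L)
 have "z mod 2 ^ Suc L mod 2 = z mod 2" "z' mod 2 ^ Suc L mod 2 = z' mod 2" by (auto simp: mod_mod_cancel)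
 moreover have "z mod 2 ^ Suc L div 2 = z div 2 mod 2 ^ L" "z' mod 2 ^ Suc L div 2 = z' div 2 mod 2 ^ L"
  by (auto simp: zmod_zmult2_eq)
 ultimately show ?case using Suc by (metis wd.simps(2))
qed simp

text \<open>Beyond \<open>M\<close> bits such a number only has sign bits.\<close>

lemma wd_const:
 assumes "- (2 ^ M) <= c" "c < 2 ^ M"
 shows "wd L c = take L (wd M c @ replicate L (if c < 0 then 1 else 0))"
proof -
 have "c div 2 ^ M = (if c < 0 then -1 else 0)"
 proof (cases "c < 0")
  case True
  have "(c + 2 ^ M) div 2 ^ M = 0" using assms True by (intro div_pos_pos_trivial) auto
  then show ?thesis using True by simp
 qed (use assms in \<open>simp add: div_pos_pos_trivial\<close>)
 then have "wd L (c div 2 ^ M) = replicate L (if c < 0 then 1 else 0)" by (simp add: wd_0 wd_m1)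
 then have "wd (M + L) c = wd M c @ replicate L (if c < 0 then 1 else 0)" by (simp add: wd_append)
 then show ?thesis using take_wd[of L "M + L" c] by simp
qed

lemma wd_power: "wd L (2 ^ E) = take L (replicate E 0 @ 1 # replicate L 0)"
proof -
 have "wd E (2 ^ E) = wd E 0" by (rule wd_cong) simp
 moreover have "wd (Suc L) 1 = 1 # replicate L 0" by (simp add: wd_0)
 ultimately have "wd (E + Suc L) (2 ^ E) = replicate E 0 @ 1 # replicate L 0" by (simp only: wd_append wd_0) simp
 then show ?thesis using take_wd[of L "E + Suc L" "2 ^ E"] by (simp del: wd.simps)
qed

section \<open>Addition and multiplication of residues\<close>

definition zadd :: "nat list => nat list => nat list" where
 "zadd u v = scan (%x p. if x <= 1 then if hdis 1 (drop (length p) v) then [x + 1] else [x] else [x]) u"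

text \<open>Digitwise addition leaves digits 0, 1, 2. This step passes the carry on, which lies on
  top of the result built in reverse.\<close>

definition nstep :: "nat => nat list => nat list" where
 "nstep x a = (if hdis 1 a then (x + 1) div 2 # (x + 1) mod 2 # tl a else x div 2 # x mod 2 # tl a)"

definition addw :: "nat list => nat list => nat list" where
 "addw u v = rev (tl (fold nstep (zadd u v) [0]))"

text \<open>Horner's scheme from the highest bit of \<open>v\<close>: a shift doubles, and
  \<open>take\<close> drops the overflow.\<close>

definition mulw :: "nat list => nat list => nat list" where
 "mulw u v = fold (%x a. addw (if x = 1 then u else replicate (length u) 0) (take (length u) (0 # a))) (rev v)
   (replicate (length u) 0)"

lemma length_scan1: "(\<And>x p. length (F x p) = 1) ==> length (scan F w) = length w"
 by (simp add: scan_def length_concat comp_def sum_list_triv)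

lemma length_addw [simp]: "length (addw u v) = length u"
proof -
 have "length (fold nstep w a) = length w + length a" if "a ~= []" for w a
  using that by (induction w arbitrary: a) (auto simp: nstep_def)
 moreover have "length (zadd u v) = length u" unfolding zadd_def by (rule length_scan1) auto
 ultimately show ?thesis by (simp add: addw_def)
qed

lemma length_mulw [simp]: "length (mulw u v) = length u"
proof -
 have "length (fold (%x a. addw (if x = 1 then u else replicate (length u) 0) (take (length u) (0 # a))) w a) = length u"
  if "length a = length u" for a and w :: "nat list"
  using that by (induction w arbitrary: a) auto
 then show ?thesis by (simp add: mulw_def del: One_nat_def)
qed

lemma addw_wd: "addw (wd L y) (wd L z) = wd L (y + z)"
proof -
 have "zadd (wd L y) (wd L z) = map2 (+) (wd L y) (wd L z)"
 proof -
  have s: "zadd u v = map (%i. u ! i + v ! i) [0..<length u]"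
   if "length u = length v" "set u \<subseteq> {0, 1}" "set v \<subseteq> {0, 1}" for u v
  proof -
   have "(if u ! i <= 1 then if hdis 1 (drop (length (take i u)) v) then [u ! i + 1] else [u ! i] else [u ! i]) = [u ! i + v ! i]"
    if "i < length u" for i
   proof -
    have "u ! i \<in> {0, 1}" "v ! i \<in> {0, 1}" using that \<open>length u = length v\<close> \<open>set u \<subseteq> _\<close> \<open>set v \<subseteq> _\<close> by (metis nth_mem subsetD)+
    moreover have "hdis 1 (drop i v) \<longleftrightarrow> v ! i = 1" using that \<open>length u = length v\<close> by (simp add: hdis_def hd_drop_conv_nth)
    ultimately show ?thesis using that by auto
   qed
   then have "map (%i. if u ! i <= 1 then if hdis 1 (drop (length (take i u)) v) then [u ! i + 1] else [u ! i] else [u ! i]) [0..<length u] =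
     map (%i. [u ! i + v ! i]) [0..<length u]"
    by (intro map_cong refl) (auto simp del: length_take)
   then show ?thesis unfolding zadd_def scan_def by (simp only:) (simp add: comp_def)
  qed
  have "zadd (wd L y) (wd L z) = map (%i. wd L y ! i + wd L z ! i) [0..<length (wd L y)]"
   by (rule s[OF _ set_wd set_wd]) simp
  then show ?thesis by (intro nth_equalityI) auto
 qed
 \<comment> \<open>\<open>c\<close> is the incoming carry and \<open>r\<close> the reversed result
   so far.\<close>
 moreover have "\<exists>c'. fold nstep (map2 (+) (wd L y) (wd L z)) (c # r) = c' # rev (wd L (y + z + int c)) @ r" if "c <= 1" for c r
  using that
 proof (induction L arbitrary: y z c r)
  case (Suc L)
  define d where "d = nat (y mod 2) + nat (z mod 2)"
  have d: "int d = y mod 2 + z mod 2" by (simp add: d_def)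
  have n: "nstep d (c # r) = (d + c) div 2 # (d + c) mod 2 # r"
  proof -
   have "c = 0 \<or> c = 1" using Suc.prems by linarith
   then show ?thesis by (elim disjE) (simp_all add: nstep_def hdis_def)
  qed
  have "y mod 2 <= 1" "z mod 2 <= 1" by presburger+
  then have c1: "(d + c) div 2 <= 1" using d Suc.prems by linarith
  have e: "y + z + int c = int (d + c) + (y div 2 + z div 2) * 2" using d by simp
  have "(y + z + int c) mod 2 = int ((d + c) mod 2)" unfolding e mod_mult_self1 of_nat_mod by simp
  then have c2: "(d + c) mod 2 = nat ((y + z + int c) mod 2)" by simp
  have c3: "y div 2 + z div 2 + int ((d + c) div 2) = (y + z + int c) div 2" using div_mult_self1[of "2::int" "int (d + c)" "y div 2 + z div 2"] unfolding e of_nat_div of_nat_numeral by linarith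
  obtain c' where IH: "fold nstep (map2 (+) (wd L (y div 2)) (wd L (z div 2))) ((d + c) div 2 # (d + c) mod 2 # r) =
    c' # rev (wd L ((y + z + int c) div 2)) @ (d + c) mod 2 # r"
   using Suc.IH[OF c1, of "y div 2" "z div 2" "(d + c) mod 2 # r"] unfolding c3 by blast
  have "fold nstep (map2 (+) (wd (Suc L) y) (wd (Suc L) z)) (c # r) =
    fold nstep (map2 (+) (wd L (y div 2)) (wd L (z div 2))) (nstep d (c # r))" by (simp add: d_def)
  also have "\<dots> = c' # rev (wd L ((y + z + int c) div 2)) @ (d + c) mod 2 # r" unfolding n by (rule IH)
  finally show ?case unfolding c2 by simp
 qed simp
 from this[of 0 "[]"] obtain c' where "fold nstep (map2 (+) (wd L y) (wd L z)) [0] = c' # rev (wd L (y + z)) @ []" by auto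
 ultimately show ?thesis by (simp add: addw_def)
qed

lemma mulw_wd: "mulw (wd L y) (wd L z) = wd L (y * z)"
proof -
 let ?f = "%x a. addw (if x = 1 then wd L y else replicate (length (wd L y)) 0) (take (length (wd L y)) (0 # a))"
 have s: "?f x (wd L a) = wd L (int x * y + 2 * a)" if "x <= 1" for x a
 proof -
  have "take L (0 # wd L a) = take L (wd (Suc L) (2 * a))" by simp
  also have "\<dots> = wd L (2 * a)" by (simp only: take_wd) simp
  finally have "take L (0 # wd L a) = wd L (2 * a)" .
  moreover have "(if x = 1 then wd L y else replicate (length (wd L y)) 0) = wd L (int x * y)"
  proof -
   have "x = 0 \<or> x = 1" using that by linarith
   then show ?thesis by (elim disjE) (simp_all add: wd_0)
  qed
  ultimately show ?thesis by (simp add: addw_wd)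
 qed
 have "fold ?f (rev (wd M z)) (wd L 0) = wd L (y * (z mod 2 ^ M))" for M
 proof (induction M arbitrary: z)
  case (Suc M)
  have "z mod 2 ^ Suc M = 2 * (z div 2 mod 2 ^ M) + z mod 2" by (simp add: zmod_zmult2_eq)
  then have e: "int (nat (z mod 2)) * y + 2 * (y * (z div 2 mod 2 ^ M)) = y * (z mod 2 ^ Suc M)"
   by (simp add: algebra_simps)
  have "z mod 2 = 0 \<or> z mod 2 = 1" by presburger
  then have "nat (z mod 2) <= 1" by auto
  from s[OF this] show ?case using Suc[of "z div 2"] e by simp
 qed simp
 from this[of L] have "mulw (wd L y) (wd L z) = wd L (y * (z mod 2 ^ L))" by (simp add: mulw_def wd_0)
 also have "\<dots> = wd L (y * z)" by (rule wd_cong) (simp add: mod_mult_right_eq)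
 finally show ?thesis .
qed

context
 fixes A :: nat
 assumes A: "3 <= A"
begin

lemma FP_zadd: assumes "FP A f" "FP A g" shows "FP A (%e. zadd (f e) (g e))"
proof -
 have "FP A (%e. zadd (e 0) (e 1))"
  unfolding zadd_def
 proof (rule FP_scan[where F = "%x p e. if x <= 1 then if hdis 1 (drop (length p) (e 1)) then [x + 1] else [x] else [x]", OF FP_var])
  fix x assume x: "x < A"
  have "FP A (%e. if hdis 1 (drop (length (e 0)) (e (Suc 1))) then [x + 1] else [x])" if "x <= 1"
   by (intro FP_if FP_drop FP_var FP_lit) (use x that A in auto)
  then show "FP A (%e. if x <= 1 then if hdis 1 (drop (length (e 0)) (e (Suc 1))) then [x + 1] else [x] else [x])"
   by (cases "x <= 1") (use x in \<open>auto intro: FP_lit\<close>)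
 qed
 from FP_app2[OF this assms] show ?thesis .
qed

lemma FP_addw: assumes "FP A f" "FP A g" shows "FP A (%e. addw (f e) (g e))"
proof -
 have "FP A (%e. fold (%x a. nstep x a) (zadd (f e) (g e)) [0])"
 proof (rule FP_fold_add[where h = "%x a e. nstep x a", OF FP_zadd[OF assms] FP_lit _ bnd_const[of A 2]])
  fix x assume x: "x < A"
  have "(x + 1) div 2 < A" "(x + 1) mod 2 < A" "x div 2 < A" "x mod 2 < A" using A x by linarith+
  then show "FP A (%e. nstep x (e 0))" unfolding nstep_def by (intro FP_if FP_Cons FP_tl FP_var)
 qed (use A in \<open>auto simp: nstep_def\<close>)
 then show ?thesis unfolding addw_def by (intro FP_rev FP_tl)
qed

lemma FP_mulw: assumes "FP A f" "FP A g" shows "FP A (%e. mulw (f e) (g e))"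
proof -
 have "FP A (%e. mulw (e 0) (e 1))"
  unfolding mulw_def
 proof (rule FP_fold_max[where h = "%x a e. addw (if x = 1 then e 0 else replicate (length (e 0)) 0) (take (length (e 0)) (0 # a))"
    and bh = "%e. length (e 0)", OF FP_rev[OF FP_var] FP_rep[OF FP_var] _ bnd_FP[OF FP_var]])
  fix x
  show "FP A (%e. addw (if x = 1 then e (Suc 0) else replicate (length (e (Suc 0))) 0) (take (length (e (Suc 0))) (0 # e 0)))"
   by (cases "x = 1") (use A in \<open>auto intro!: FP_addw FP_var FP_take FP_Cons FP_rep\<close>)
 qed (use A in auto)
 from FP_app2[OF this assms] show ?thesis .
qed

lemma FP_wd: assumes "FP A l" shows "FP A (%e. wd (length (l e)) c)"
proof -
 have "int (nat \<bar>c\<bar>) < int (2 ^ nat \<bar>c\<bar>)" by (simp only: of_nat_less_iff less_exp)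
 then have "\<bar>c\<bar> < 2 ^ nat \<bar>c\<bar>" by simp
 then have "- (2 ^ nat \<bar>c\<bar>) <= c" "c < 2 ^ nat \<bar>c\<bar>" by linarith+
 note c = wd_const[OF this]
 have "{0, 1} \<subseteq> {..<A}" using A by auto
 then have "set (wd (nat \<bar>c\<bar>) c) \<subseteq> {..<A}" using set_wd by (rule order_trans[rotated])
 then have "FP A (%e. take (length (l e)) (wd (nat \<bar>c\<bar>) c @ replicate (length (l e)) (if c < 0 then 1 else 0)))"
  by (rule FP_take[OF assms FP_app[OF FP_lit FP_rep[OF assms]]]) (use A in auto)
 also have "(%e. take (length (l e)) (wd (nat \<bar>c\<bar>) c @ replicate (length (l e)) (if c < 0 then 1 else 0))) = (%e. wd (length (l e)) c)"
  by (rule ext, rule c[symmetric])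
 finally show ?thesis .
qed

lemma FP_wd_power: assumes "FP A l" "FP A f" shows "FP A (%e. wd (length (l e)) (2 ^ length (f e)))"
 unfolding wd_power by (intro FP_take FP_app FP_rep FP_Cons assms) (use A in auto)

end

text \<open>Newton's iteration for the inverse of \<open>d\<close>, which squares the error
  \<open>1 - y * d\<close>.\<close>

definition newton :: "nat list => nat list => nat list" where
 "newton d y = mulw y (addw (wd (length y) 2) (mulw (mulw y d) (wd (length y) (-1))))"

text \<open>The length of \<open>u\<close> is the number of bits wanted. The factors 2 of
  \<open>d\<close> are cancelled from \<open>n\<close> as well, and the odd part of \<open>d\<close>
  is inverted modulo \<open>2 ^ length u\<close>.\<close>

definition quot :: "nat list => nat list => nat list => nat list" where
 "quot u d n = (let d' = dropWhile (%x. x = 0) d; v = drop (length d') d;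
   d'' = take (length u) d'; n'' = take (length u) (drop (length v) n);
   y = fold (%_ y. newton d'' y) u (wd (length u) 1)
  in rev (dropWhile (%x. x = 0) (rev (mulw n'' y))))"

lemma trim_wd: "g < 2 ^ e ==> rev (dropWhile (%x. x = 0) (rev (wd e (int g)))) = enc (bin g)"
proof (induction e arbitrary: g)
 case 0 then show ?case by (simp add: bin.simps enc_def)
next
 case (Suc e)
 have "int g div 2 = int (g div 2)" "int g mod 2 = int (g mod 2)" by (simp_all add: zdiv_int zmod_int)
 then have w: "wd (Suc e) (int g) = g mod 2 # wd e (int (g div 2))" by simp
 have IH: "rev (dropWhile (%x. x = 0) (rev (wd e (int (g div 2))))) = enc (bin (g div 2))"
  by (rule Suc.IH) (use Suc.prems in auto)
 have t: "rev (dropWhile (%x. x = 0) (rev (x # w))) =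
   (let t = rev (dropWhile (%x. x = 0) (rev w)) in if t = [] then if x = 0 then [] else [x] else x # t)" for x :: nat and w
  by (auto simp: dropWhile_append Let_def dropWhile_eq_Nil_conv)
 have "enc (bin n) = [] \<longleftrightarrow> n = 0" for n by (simp add: bin.simps[of n] enc_def)
 then show ?case unfolding w t IH Let_def using bin.simps[of g] bin.simps[of 0]
  by (auto simp: enc_def odd_iff_mod_2_eq_one)
qed

text \<open>Cancelling \<open>2 ^ v\<close> costs \<open>v\<close> bits of precision. The start
  value 1 has even error because \<open>d'\<close> is odd. After \<open>e\<close> iterations the
  error is divisible by \<open>2 ^ (2 ^ e)\<close> and so by \<open>2 ^ e\<close>.\<close>

lemma quot_wd:
 assumes d: "d = 2 ^ v * d'" "odd d'" and le: "v + length u <= L" "u ~= []"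
  and n: "2 ^ (v + length u) dvd n - d * int g" and g: "g < 2 ^ length u"
 shows "quot u (wd L d) (wd L n) = enc (bin g)"
proof -
 define e where "e = length u"
 have Lv: "wd L d = replicate v 0 @ wd (L - v) d'"
 proof -
  have "wd v d = wd v 0" by (rule wd_cong) (simp add: d)
  then show ?thesis using wd_append[of v "L - v" d] le by (simp add: d wd_0)
 qed
 have "L - v ~= 0" using le by (cases u) auto
 then obtain L' where L': "L - v = Suc L'" by (cases "L - v") auto
 have "dropWhile (%x. x = 0) (wd (L - v) d') = wd (L - v) d'" unfolding L' using d(2) by (simp add: odd_iff_mod_2_eq_one)
 then have D: "dropWhile (%x. x = 0) (wd L d) = wd (L - v) d'" unfolding Lv by (simp add: dropWhile_append)
 have "length (drop (length (wd (L - v) d')) (wd L d)) = v" using le by simp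
 moreover have m: "min e (L - v) = e" using le by (simp add: e_def)
 moreover have "take e (wd (L - v) d') = wd e d'" by (simp only: take_wd m)
 moreover have "take e (drop v (wd L n)) = wd e (n div 2 ^ v)" using le by (subst drop_wd) (simp_all add: take_wd m)
 moreover have "fold (%_ y. newton (wd e d') y) w (wd e y) = wd e (((%y. y * (2 - y * d')) ^^ length w) y)" for w :: "nat list" and y
 proof -
  have n: "newton (wd e d') (wd e y) = wd e (y * (2 - y * d'))" for y by (simp add: newton_def addw_wd mulw_wd)
  show ?thesis by (induction w arbitrary: y) (simp_all only: fold_simps n list.size comp_apply funpow_Suc_right funpow_0 add_0_right add_Suc_right)
 qed
 ultimately have q: "quot u (wd L d) (wd L n) =
   rev (dropWhile (%x. x = 0) (rev (wd e ((n div 2 ^ v) * (((%y. y * (2 - y * d')) ^^ e) 1)))))"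
  unfolding quot_def D by (simp add: Let_def e_def[symmetric] mulw_wd)
 define y where "y = ((%y. y * (2 - y * d')) ^^ e) 1"
 have "1 - d' * (((%y. y * (2 - y * d')) ^^ k) 1) = (1 - d') ^ (2 ^ k)" for k
 proof (induction k)
  case (Suc k)
  define z where "z = ((%y. y * (2 - y * d')) ^^ k) 1"
  have "1 - d' * (z * (2 - z * d')) = (1 - d' * z)\<^sup>2" by (simp add: power2_eq_square algebra_simps)
  then show ?case using Suc by (simp add: z_def power_mult[symmetric] mult.commute)
 qed simp
 from this[of e] have y: "1 - d' * y = (1 - d') ^ (2 ^ e)" by (simp add: y_def)
 have "(2::int) dvd 1 - d'" using d(2) by simp
 then have "(2::int) ^ (2 ^ e) dvd (1 - d') ^ (2 ^ e)" by (rule dvd_power_same)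
 moreover have "(2::int) ^ e dvd 2 ^ (2 ^ e)" by (rule le_imp_power_dvd) (rule less_imp_le, rule less_exp)
 ultimately have y1: "2 ^ e dvd 1 - d' * y" unfolding y by (rule dvd_trans[rotated])
 obtain k where "n - d * int g = 2 ^ (v + length u) * k" using n by (auto elim: dvdE)
 then have n': "n = 2 ^ v * (d' * int g + 2 ^ e * k)" by (simp add: d e_def power_add algebra_simps)
 have "n div 2 ^ v * y - int g = 2 ^ e * (k * y) - (1 - d' * y) * int g"
  unfolding n' by (simp add: algebra_simps)
 also have "2 ^ e dvd \<dots>" using y1 by (intro dvd_diff) auto
 finally have "wd e (n div 2 ^ v * y) = wd e (int g)" by (intro wd_cong) (simp add: mod_eq_dvd_iff)
 then show ?thesis unfolding q y_def[symmetric] using trim_wd[of g e] g by (simp add: e_def)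
qed

lemma FP_quot:
 assumes A: "3 <= A" and "FP A u" "FP A d" "FP A n" shows "FP A (%e. quot (u e) (d e) (n e))"
proof -
 have 1: "FP A (%e. dropWhile (%x. x = 0) (d e))" by (rule FP_dropWhile) fact
 have d: "FP A (%e. take (length (u e)) (dropWhile (%x. x = 0) (d e)))" by (intro FP_take 1 assms)
 have "FP A (%e. fold (%x y. newton (take (length (u e)) (dropWhile (%x. x = 0) (d e))) y) (u e) (wd (length (u e)) 1))"
 proof (rule FP_fold_add[where h = "%x y e. newton (take (length (u e)) (dropWhile (%x. x = 0) (d e))) y",
    OF assms(2) FP_wd[OF A assms(2)] _ bnd_const[of A 0]])
  fix x
  show "FP A (%e. newton (take (length (u (%i. e (Suc i)))) (dropWhile (%x. x = 0) (d (%i. e (Suc i))))) (e 0))"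
   unfolding newton_def using FP_rename[OF d, of Suc] by (intro FP_mulw FP_addw FP_wd FP_var A)
 qed (simp add: newton_def)
 then show ?thesis unfolding quot_def Let_def by (intro FP_rev FP_dropWhile FP_mulw FP_take FP_drop 1 assms)
qed

section \<open>Evaluating an answer\<close>

definition rp :: "nat => nat list => nat list" where "rp i l = concat (replicate i l)"

lemma length_rp [simp]: "length (rp i l) = i * length l" by (induction i) (auto simp: rp_def)

lemma FP_rp: "FP A f ==> FP A (%e. rp i (f e))"
 by (induction i) (auto simp: rp_def intro: FP_nil FP_app)

text \<open>\<open>c\<close> registers with values modulo \<open>2 ^ length l\<close> precede the unread part of the input.\<close>

definition blk :: "nat => nat list => (nat => int) => nat list" where
 "blk c l rh = concat (map (%i. wd (length l) (rh i)) [0..<c])"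

lemma length_blk [simp]: "length (blk c l rh) = c * length l"
 by (induction c) (auto simp: blk_def)

lemma blk_split: "i < c ==> blk c l rh = blk i l rh @ wd (length l) (rh i) @ concat (map (%i. wd (length l) (rh i)) [Suc i..<c])"
 using upt_add_eq_append[of 0 i "c - i"] by (simp add: blk_def upt_conv_Cons)

text \<open>The expression is fixed, so its evaluation unfolds into finitely many operations on
  words; a variable is a block cut out of the registers.\<close>

fun wev :: "nat list => nat list => pexp => nat list" where
 "wev l a (PC k) = wd (length l) k"
| "wev l a (PV i) = take (length l) (drop (length (rp i l)) a)"
| "wev l a (PA p r) = addw (wev l a p) (wev l a r)"
| "wev l a (PM p r) = mulw (wev l a p) (wev l a r)"

lemma length_wev: "length (wev l a p) <= length l"
 by (induction p) auto

lemma wev_blk: "pvars p \<subseteq> {..<c} ==> wev l (blk c l rh @ r) p = wd (length l) (ev rh p)"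
proof (induction p)
 case (PV i)
 then show ?case using blk_split[of i c l rh] by simp
qed (auto simp: addw_wd mulw_wd)

lemma FP_wev: "3 <= A ==> FP A l ==> FP A a ==> FP A (%e. wev (l e) (a e) p)"
 by (induction p) (auto intro: FP_wd FP_addw FP_mulw intro!: FP_take FP_drop FP_rp simp del: length_rp)

definition setr :: "nat => nat list => nat list => nat list => nat list" where
 "setr i l w a = take (length (rp i l)) a @ w @ drop (length (rp (Suc i) l)) a"

lemma setr_blk: assumes "i < c" shows "setr i l (wd (length l) z) (blk c l rh @ r) = blk c l (rh(i := z)) @ r"
proof -
 have 1: "blk i l (rh(i := z)) = blk i l rh" unfolding blk_def by (rule arg_cong[where f = concat]) simp
 have 2: "map (%j. wd (length l) ((rh(i := z)) j)) [Suc i..<c] = map (%j. wd (length l) (rh j)) [Suc i..<c]" by simp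
 have "blk c l (rh(i := z)) = blk i l rh @ wd (length l) z @ concat (map (%i. wd (length l) (rh i)) [Suc i..<c])"
  unfolding blk_split[OF assms, of l "rh(i := z)"] 1 2 by simp
 then show ?thesis by (simp add: setr_def blk_split[OF assms, of l rh])
qed

section \<open>Register programs that consume their input\<close>

type_synonym prog = "nat list => nat list => nat list"

text \<open>The length condition rules out accumulated growth, so that loops become instances of
  \<open>FP_fold_max\<close>.\<close>

definition prog :: "nat => nat => prog => bool" where
 "prog A c P \<longleftrightarrow> FP A (%e. P (e 0) (e 1)) \<and> (\<forall>a l. length (P a l) <= max (length a) (c * length l))"

text \<open>The program removes \<open>w\<close> from the front of the input and applies
  \<open>f\<close> to the registers. As the rest \<open>r\<close> is arbitrary, specifications of
  consecutive parsers compose.\<close>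

definition does :: "nat => prog => nat list => ((nat => int) => nat => int) => bool" where
 "does c P w f \<longleftrightarrow> (\<forall>l rh r. P (blk c l rh @ w @ r) l = blk c l (f rh) @ r)"

definition assign :: "(nat \<times> pexp) list => (nat => int) => nat => int" where
 "assign ps = fold (%(i, p) rh. rh(i := ev rh p)) ps"

definition op :: "(nat \<times> pexp) list => prog" where
 "op ps = (%a l. fold (%(i, p) a. setr i l (wev l a p) a) ps a)"

definition sq :: "prog => prog => prog" where "sq P Q a l = Q (P a l) l"

definition del :: "nat => prog" where
 "del c a l = take (length (rp c l)) a @ tl (drop (length (rp c l)) a)"

definition branch :: "nat => prog => prog => prog" where
 "branch c P Q a l = (if hdis 1 (drop (length (rp c l)) a) then P (del c a l) l else Q (del c a l) l)"

text \<open>This follows the format of \<open>enc_list\<close>, where a 1 announces an element and a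
  0 the end. Folding over the whole state provides enough rounds; at the final 0 the remaining ones
  do nothing.\<close>

definition loop :: "nat => prog => prog" where
 "loop c P a l = del c (fold (%_ a. if hdis 1 (drop (length (rp c l)) a) then P (del c a l) l else a) a a) l"

lemma does_op: "(\<And>i p. (i, p) \<in> set ps ==> i < c \<and> pvars p \<subseteq> {..<c}) ==> does c (op ps) [] (assign ps)"
proof (induction ps)
 case (Cons ip ps)
 obtain i p where ip: "ip = (i, p)" by fastforce
 have "i < c" "pvars p \<subseteq> {..<c}" using Cons.prems[of i p] ip by auto
 moreover have "does c (op ps) [] (assign ps)" by (rule Cons.IH) (rule Cons.prems, simp)
 ultimately show ?case using setr_blk[of i c] wev_blk[of p c] by (simp add: does_def op_def assign_def ip)
qed (simp add: does_def op_def assign_def)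

lemma does_sq: "does c P w f ==> does c Q w' g ==> does c (sq P Q) (w @ w') (%rh. g (f rh))"
 by (simp add: does_def sq_def)

lemma does_del: "does c (del c) [b] (%rh. rh)" by (simp add: does_def del_def)

lemma does_branch1: "does c P w f ==> does c (branch c P Q) (1 # w) f"
 by (simp add: does_def branch_def del_def hdis_def)

lemma does_branch0: "does c Q w f ==> does c (branch c P Q) (0 # w) f"
 by (simp add: does_def branch_def del_def hdis_def)

lemma does_loop:
 assumes "\<And>v. v \<in> set vs ==> does c P (W v) (u v)"
 shows "does c (loop c P) (concat (map (%v. 1 # W v) vs) @ [0]) (fold u vs)"
 unfolding does_def
proof (intro allI)
 fix l rh r
 define h where "h = (%(x :: nat) a. if hdis 1 (drop (length (rp c l)) a) then P (del c a l) l else a)"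
 have stop: "fold h z (blk c l rh @ 0 # r) = blk c l rh @ 0 # r" for z rh
  by (induction z) (auto simp: h_def hdis_def)
 have f: "fold h z (blk c l rh @ concat (map (%v. 1 # W v) vs) @ 0 # r) = blk c l (fold u vs rh) @ 0 # r" if "length vs <= length z" for z rh
  using assms that
 proof (induction vs arbitrary: z rh)
  case (Cons v vs)
  obtain y z' where z: "z = y # z'" using Cons.prems(2) by (cases z) auto
  have "does c P (W v) (u v)" by (rule Cons.prems) simp
  then have "h y (blk c l rh @ concat (map (%v. 1 # W v) (v # vs)) @ 0 # r) =
    blk c l (u v rh) @ concat (map (%v. 1 # W v) vs) @ 0 # r"
   by (simp add: does_def h_def hdis_def del_def)
  then show ?case using Cons.IH[of z' "u v rh"] Cons.prems z by simp
 qed (simp add: stop)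
 define s where "s = blk c l rh @ concat (map (%v. 1 # W v) vs) @ 0 # r"
 have "length vs <= (\<Sum>v\<leftarrow>vs. Suc (length (W v)))" by (induction vs) auto
 then have "length vs <= length s" by (simp add: s_def length_concat comp_def)
 from f[OF this, of rh, folded s_def] have "loop c P s l = blk c l (fold u vs rh) @ r"
  unfolding loop_def h_def[symmetric] by (simp add: del_def)
 then show "loop c P (blk c l rh @ (concat (map (%v. 1 # W v) vs) @ [0]) @ r) l = blk c l (fold u vs rh) @ r"
  by (simp add: s_def)
qed

context
 fixes A c :: nat
 assumes A: "3 <= A"
begin

lemma prog_sq: assumes "prog A c P" "prog A c Q" shows "prog A c (sq P Q)"
proof -
 have "FP A (%e. Q (P (e 0) (e 1)) (e 1))"
  using assms FP_app2[of A Q "%e. P (e 0) (e 1)" "%e. e 1"] FP_var unfolding prog_def by blast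
 moreover have "length (Q (P a l) l) <= max (length a) (c * length l)" for a l
 proof -
  have "length (Q (P a l) l) <= max (length (P a l)) (c * length l)" "length (P a l) <= max (length a) (c * length l)"
   using assms unfolding prog_def by auto
  then show ?thesis by linarith
 qed
 ultimately show ?thesis unfolding prog_def sq_def by blast
qed

lemma FP_del: "FP A f ==> FP A g ==> FP A (%e. del c (f e) (g e))"
 unfolding del_def by (intro FP_app FP_take FP_tl FP_drop FP_rp)

lemma length_del: "length (del c a l) <= length a" by (simp add: del_def)

lemma prog_del: "prog A c (del c)"
 unfolding prog_def using length_del by (auto intro: FP_del FP_var simp: le_max_iff_disj)

lemma prog_op: "(\<And>i p. (i, p) \<in> set ps ==> i < c) ==> prog A c (op ps)"
proof (induction ps)
 case Nil then show ?case by (auto simp: prog_def op_def intro: FP_var)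
next
 case (Cons ip ps)
 obtain i p where ip: "ip = (i, p)" by fastforce
 have "prog A c (%a l. setr i l (wev l a p) a)"
  unfolding prog_def
 proof (intro conjI allI)
  show "FP A (%e. setr i (e 1) (wev (e 1) (e 0) p) (e 0))"
   unfolding setr_def by (intro FP_app FP_take FP_drop FP_rp FP_wev A FP_var)
  have "i < c" by (rule Cons.prems[of i p]) (simp add: ip)
  then have "Suc i * length l <= c * length l" for l :: "nat list" by (intro mult_right_mono) auto
  then have 1: "length l + i * length l <= c * length l" for l :: "nat list" by simp
  have 2: "length (setr i l (wev l a p) a) = min (length a) (i * length l) + length (wev l a p) + (length a - (length l + i * length l))" for a l
   by (simp add: setr_def min.commute)
  show "length (setr i l (wev l a p) a) <= max (length a) (c * length l)" for a l
   using 1[of l] 2[of l a] length_wev[of l a p] by linarith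
 qed
 moreover have "prog A c (op ps)" using Cons by auto
 ultimately have "prog A c (sq (%a l. setr i l (wev l a p) a) (op ps))" by (rule prog_sq)
 moreover have "sq (%a l. setr i l (wev l a p) a) (op ps) = op (ip # ps)" by (auto simp: sq_def op_def ip fun_eq_iff)
 ultimately show ?case by simp
qed

lemma prog_branch: assumes "prog A c P" "prog A c Q" shows "prog A c (branch c P Q)"
proof -
 have "FP A (%e. R (del c (e 0) (e 1)) (e 1))" if "prog A c R" for R
  using that FP_app2[of A R "%e. del c (e 0) (e 1)" "%e. e 1"] FP_var FP_del unfolding prog_def by blast
 then have "FP A (%e. branch c P Q (e 0) (e 1))"
  unfolding branch_def using assms by (intro FP_if FP_drop FP_rp FP_var)
 moreover have "length (branch c P Q a l) <= max (length a) (c * length l)" for a l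
 proof -
  have "length (R (del c a l) l) <= max (length a) (c * length l)" if "prog A c R" for R
  proof -
   have "length (R (del c a l) l) <= max (length (del c a l)) (c * length l)" using that by (simp add: prog_def)
   then show ?thesis using length_del[of a l] by linarith
  qed
  then show ?thesis unfolding branch_def using assms by (simp only: split: if_split) blast
 qed
 ultimately show ?thesis unfolding prog_def by blast
qed

lemma prog_loop: assumes "prog A c P" shows "prog A c (loop c P)"
proof -
 define h where "h = (%a (e :: env). if hdis 1 (drop (length (rp c (e 1))) a) then P (del c a (e 1)) (e 1) else a)"
 have P: "length (P a l) <= max (length a) (c * length l)" "FP A (%e. P (e 0) (e 1))" for a l using assms by (auto simp: prog_def)
 have h: "length (h a e) <= max (length a) (c * length (e 1))" for a e
  using P(1)[of "del c a (e 1)" "e 1"] length_del[of a "e 1"] unfolding h_def by auto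
 have "FP A (%e. fold (%x a. h a e) (e 0) (e 0))"
 proof (rule FP_fold_max[where h = "%x. h" and bh = "%e. c * length (e 1)", OF FP_var FP_var _ _ h])
  show "bnd A (%e. c * length (e 1))" by (intro bnd_mult bnd_const bnd_FP FP_var)
  have "FP A (%e. P (del c (e 0) (e 2)) (e 2))"
   using FP_app2[OF P(2) FP_del[OF FP_var FP_var] FP_var] .
  then show "FP A (%e. h (e 0) (%i. e (Suc i)))"
   unfolding h_def by (intro FP_if FP_drop FP_rp FP_var) (simp_all add: numeral_2_eq_2)
 qed
 then have "FP A (%e. loop c P (e 0) (e 1))" unfolding loop_def h_def by (intro FP_del FP_var)
 moreover have "length (fold (%_ a. if hdis 1 (drop (length (rp c l)) a) then P (del c a l) l else a) w a) <= max (length a) (c * length l)" for w a l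
 proof (induction w arbitrary: a)
  case (Cons x w)
  have "length (if hdis 1 (drop (length (rp c l)) a) then P (del c a l) l else a) <= max (length a) (c * length l)"
   using h[of a "%_. l"] by (simp add: h_def)
  then show ?case using Cons[of "if hdis 1 (drop (length (rp c l)) a) then P (del c a l) l else a"] by (simp del: length_rp)
 qed simp
 ultimately show ?thesis unfolding prog_def by (auto simp: loop_def intro: order_trans[OF length_del] simp del: length_rp)
qed

end

lemma enc_append: "enc (u @ v) = enc u @ enc v" by (simp add: enc_def)

lemma enc_enc_list: "enc (enc_list f xs) = concat (map (%x. 1 # enc (f x)) xs) @ [0]"
 by (induction xs) (simp_all add: enc_list_def enc_def)

lemma assign_simps: "assign [] rh = rh" "assign ((i, p) # ps) rh = assign ps (rh(i := ev rh p))"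
 by (simp_all add: assign_def)

text \<open>
 Registers 0, 1, 2 read an integer, (3, 4) hold the value of a term, (5, 6) of a polynomial, (7, 8)
 of a numerator, (9, 10) of the sum and (11, 12) the power of \<open>bh\<close>; all are fractions.  The value
 of \<open>bh\<close> is in (13, 14) and those of the indeterminates follow.
\<close>

definition "bit1 = [(0, PA (PV 0) (PV 1)), (1, PA (PV 1) (PV 1))]"
definition "bit0 = [(1, PA (PV 1) (PV 1))]"
definition "nat0 = [(0, PC 0), (1, PC 1)]"
definition "int1 = [(3, PM (PV 0) (PV 2)), (4, PC 1)]"
definition "mul1 i = [(3, PM (PV 3) (PV (15 + 2 * i))), (4, PM (PV 4) (PV (16 + 2 * i)))]"
definition "pol0 = [(5, PC 0), (6, PC 1)]"
definition "pol1 = [(5, PA (PM (PV 5) (PV 4)) (PM (PV 3) (PV 6))), (6, PM (PV 6) (PV 4))]"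
definition "elt0 = [(7, PV 5), (8, PV 6)]"
definition "elt1 = [(3, PM (PM (PV 7) (PV 6)) (PV 11)), (4, PM (PM (PV 8) (PV 5)) (PV 12)),
 (9, PA (PM (PV 9) (PV 4)) (PM (PV 3) (PV 10))), (10, PM (PV 10) (PV 4)),
 (11, PM (PV 11) (PV 13)), (12, PM (PV 12) (PV 14))]"
definition "all0 = [(9, PC 0), (10, PC 1), (11, PC 1), (12, PC 1)]"

lemmas op_defs = bit1_def bit0_def nat0_def int1_def mul1_def pol0_def pol1_def elt0_def elt1_def all0_def

locale parser =
 fixes n c :: nat
 assumes c: "c = 15 + 2 * n"
begin

definition "natP = sq (op nat0) (loop c (branch c (op bit1) (op bit0)))"
definition "intP = sq (branch c (op [(2, PC (-1))]) (op [(2, PC 1)])) (sq natP (op int1))"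
text \<open>The number of exponents is known, so the marks of the list code are skipped without a
  test.\<close>

definition "expP is = foldr (%i P. sq (del c) (sq (loop c (op (mul1 i))) P)) is (del c)"
definition "termP = sq intP (expP [0..<n])"
definition "polyP = sq (op pol0) (loop c (sq termP (op pol1)))"
definition "elemP = sq polyP (sq (op elt0) (sq polyP (op elt1)))"
definition "allP = sq (op all0) (loop c elemP)"

lemma prog_allP: assumes A: "3 <= A" shows "prog A c allP"
proof -
 have op: "prog A c (op ps)" if "\<forall>(i, p)\<in>set ps. i < 15" for ps
  by (rule prog_op[OF A]) (use that c in fastforce)
 have "prog A c intP" unfolding intP_def natP_def
  by (intro prog_sq prog_branch prog_loop op A) (auto simp: op_defs)
 moreover have "prog A c (expP is)" for "is"
  unfolding expP_def by (induction "is") (auto simp: op_defs intro!: prog_sq prog_del prog_loop op A)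
 ultimately have "prog A c polyP" unfolding polyP_def termP_def
  by (intro prog_sq prog_loop op A) (auto simp: op_defs)
 then show ?thesis unfolding allP_def elemP_def
  by (intro prog_sq prog_loop op A) (auto simp: op_defs)
qed

text \<open>These functions give the effect of the parsers on the registers; \<open>allF\<close>
  identifies the last one with \<open>evalf\<close> on fractions of integers.\<close>

definition "natF m rh = fold (%b. assign (if b then bit1 else bit0)) (bin m) (assign nat0 rh)"
definition "intF z rh = assign int1 (natF (nat \<bar>z\<bar>) (assign [(2, PC (if z < 0 then -1 else 1))] rh))"
definition "expF is ks = fold (%(i, k). assign (mul1 i) ^^ k) (zip is ks)"
definition "termF t rh = expF [0..<n] (snd t) (intF (fst t) rh)"
definition "polyF P rh = fold (%t rh. assign pol1 (termF t rh)) P (assign pol0 rh)"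
definition "elemF PQ rh = assign elt1 (polyF (snd PQ) (assign elt0 (polyF (fst PQ) rh)))"
definition "allF a rh = fold elemF a (assign all0 rh)"

lemma does_small: "\<forall>(i, p)\<in>set ps. i < 15 \<and> pvars p \<subseteq> {..<15} ==> does c (op ps) [] (assign ps)"
 by (rule does_op) (use c in fastforce)

lemma does_mul1: assumes "i < n" shows "does c (op (mul1 i)) [] (assign (mul1 i))"
 by (rule does_op) (use assms in \<open>auto simp: mul1_def c\<close>)

lemma does_natP: "does c natP (enc (enc_nat m)) (natF m)"
proof -
 have b: "does c (branch c (op bit1) (op bit0)) (enc [b]) (assign (if b then bit1 else bit0))" for b
 proof (cases b)
  case True
  have "does c (op bit1) [] (assign bit1)" by (rule does_small) (auto simp: op_defs)
  from does_branch1[OF this] show ?thesis using True by (simp add: enc_def)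
 next
  case False
  have "does c (op bit0) [] (assign bit0)" by (rule does_small) (auto simp: op_defs)
  from does_branch0[OF this] show ?thesis using False by (simp add: enc_def)
 qed
 have "does c (op nat0) [] (assign nat0)" by (rule does_small) (auto simp: op_defs)
 from does_sq[OF this does_loop[where W = "%b. enc [b]", OF b, of "bin m"]]
 show ?thesis by (simp add: natP_def enc_nat_def enc_enc_list natF_def[abs_def])
qed

lemma does_intP: "does c intP (enc (enc_int z)) (intF z)"
proof -
 have "does c (op [(2, PC s)]) [] (assign [(2, PC s)])" for s by (rule does_small) auto
 then have "does c (branch c (op [(2, PC (-1))]) (op [(2, PC 1)])) (enc [z < 0]) (assign [(2, PC (if z < 0 then -1 else 1))])"
  using does_branch1 does_branch0 by (simp add: enc_def)
 moreover have "does c (op int1) [] (assign int1)" by (rule does_small) (auto simp: op_defs)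
 ultimately have "does c intP (enc [z < 0] @ enc (enc_nat (nat \<bar>z\<bar>)) @ []) (%rh. assign int1 (natF (nat \<bar>z\<bar>)
   (assign [(2, PC (if z < 0 then -1 else 1))] rh)))"
  unfolding intP_def by (intro does_sq does_natP)
 then show ?thesis by (simp add: enc_int_def intF_def[abs_def] enc_def)
qed

lemma does_expP:
 "length is = length ks ==> set is \<subseteq> {..<n} ==> does c (expP is) (enc (enc_list enc_unary ks)) (expF is ks)"
proof (induction "is" ks rule: list_induct2)
 case Nil then show ?case using does_del[of c 0] by (simp add: expP_def expF_def enc_list_def enc_def id_def)
next
 case (Cons i "is" k ks)
 have "does c (loop c (op (mul1 i))) (concat (map (%v. 1 # []) (replicate k ())) @ [0]) (fold (%_. assign (mul1 i)) (replicate k ()))"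
  by (rule does_loop) (use Cons.prems in \<open>auto intro: does_mul1\<close>)
 moreover have "concat (map (%v. [1]) (replicate k ())) @ [0] = enc (enc_unary k)"
  by (induction k) (auto simp: enc_unary_def enc_def)
 moreover have "fold (%_. assign (mul1 i)) (replicate k ()) = assign (mul1 i) ^^ k"
  by (induction k) (auto simp: funpow_swap1 fun_eq_iff)
 ultimately have "does c (loop c (op (mul1 i))) (enc (enc_unary k)) (assign (mul1 i) ^^ k)" by simp
 from does_sq[OF does_del[of c 1] does_sq[OF this Cons.IH]] Cons.prems
 show ?case by (simp add: expP_def expF_def enc_enc_list comp_def)
qed

lemma does_polyP:
 assumes "\<And>t. t \<in> set P ==> length (snd t) = n" shows "does c polyP (enc (enc_int_poly P)) (polyF P)"
proof -
 have t: "does c (sq termP (op pol1)) (enc ((%(c, e). enc_int c @ enc_list enc_unary e) t)) (%rh. assign pol1 (termF t rh))"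
  if "t \<in> set P" for t
 proof -
  have "does c (op pol1) [] (assign pol1)" by (rule does_small) (auto simp: op_defs)
  moreover have "does c (expP [0..<n]) (enc (enc_list enc_unary (snd t))) (expF [0..<n] (snd t))"
   by (rule does_expP) (use assms[OF that] in auto)
  ultimately show ?thesis
   using does_sq[OF does_sq[OF does_intP[of "fst t"]], of "expP [0..<n]" _ _ "op pol1" "[]" "assign pol1"]
   by (simp add: termP_def termF_def[abs_def] enc_append case_prod_unfold)
 qed
 have "does c (op pol0) [] (assign pol0)" by (rule does_small) (auto simp: op_defs)
 from does_sq[OF this does_loop[where vs = P, OF t]]
 show ?thesis by (simp add: polyP_def polyF_def[abs_def] enc_int_poly_def enc_enc_list)
qed

lemma does_allP:
 assumes "\<And>P Q t. (P, Q) \<in> set a ==> t \<in> set P \<union> set Q ==> length (snd t) = n"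
 shows "does c allP (enc (enc_field_elem a)) (allF a)"
proof -
 have t: "does c elemP (enc ((%(P, Q). enc_int_poly P @ enc_int_poly Q) PQ)) (elemF PQ)" if "PQ \<in> set a" for PQ
 proof -
  have "does c polyP (enc (enc_int_poly (fst PQ))) (polyF (fst PQ))" "does c polyP (enc (enc_int_poly (snd PQ))) (polyF (snd PQ))"
   by (rule does_polyP, use assms[of "fst PQ" "snd PQ"] that in \<open>simp add: case_prod_unfold\<close>)+
  moreover have "does c (op elt0) [] (assign elt0)" "does c (op elt1) [] (assign elt1)"
   by (rule does_small; auto simp: op_defs)+
  ultimately have "does c elemP (enc (enc_int_poly (fst PQ)) @ [] @ enc (enc_int_poly (snd PQ)) @ [])
    (%rh. assign elt1 (polyF (snd PQ) (assign elt0 (polyF (fst PQ) rh))))"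
   unfolding elemP_def by (intro does_sq)
  then show ?thesis by (simp add: elemF_def[abs_def] enc_append case_prod_unfold)
 qed
 have "does c (op all0) [] (assign all0)" by (rule does_small) (auto simp: op_defs)
 from does_sq[OF this does_loop[where vs = a, OF t]]
 show ?thesis by (simp add: allP_def allF_def[abs_def] enc_field_elem_def enc_enc_list)
qed

abbreviation "Fr rh is \<equiv> map (%i. (rh (15 + 2 * i), rh (16 + 2 * i))) is"

text \<open>The bits come lowest first, and register 1 holds the weight of the next bit.\<close>

lemma natF: "natF m rh 0 = int m" "2 <= i ==> natF m rh i = rh i"
proof -
 have "fold (%b. assign (if b then bit1 else bit0)) (bin m) rh 0 = rh 0 + rh 1 * int m \<and>
   (\<forall>i\<ge>2. fold (%b. assign (if b then bit1 else bit0)) (bin m) rh i = rh i)" for rh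
 proof (induction m arbitrary: rh rule: bin.induct)
  case (1 m)
  show ?case
  proof (cases "m = 0")
   case True then show ?thesis by (simp add: bin.simps)
  next
   case False
   have "int m = (if odd m then 1 else 0) + 2 * int (m div 2)" by presburger
   moreover have "assign (if odd m then bit1 else bit0) rh 0 = rh 0 + rh 1 * (if odd m then 1 else 0)"
    "assign (if odd m then bit1 else bit0) rh 1 = 2 * rh 1"
    "2 <= i ==> assign (if odd m then bit1 else bit0) rh i = rh i" for i
    by (auto simp: op_defs assign_simps)
   ultimately show ?thesis using 1[OF False, of "assign (if odd m then bit1 else bit0) rh"] False
    by (simp add: bin.simps[of m] algebra_simps)
  qed
 qed
 note this[of "assign nat0 rh"]
 then show "natF m rh 0 = int m" "2 <= i ==> natF m rh i = rh i" by (auto simp: natF_def op_defs assign_simps)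
qed

lemma intF: "intF z rh 3 = z" "intF z rh 4 = 1" "5 <= i ==> intF z rh i = rh i"
 by (auto simp: intF_def op_defs assign_simps natF)

lemma expF:
 "(expF is ks rh 3, expF is ks rh 4) = fold (%(f, n). (%a. fmul a f) ^^ n) (zip (Fr rh is) ks) (rh 3, rh 4) \<and>
  (\<forall>i\<ge>5. expF is ks rh i = rh i)"
proof (induction "is" arbitrary: ks rh)
 case (Cons i "is")
 show ?case
 proof (cases ks)
  case c2: (Cons k ks')
  define si where "si = (assign (mul1 i) ^^ k) rh"
  have "((assign (mul1 i) ^^ k) rh 3, (assign (mul1 i) ^^ k) rh 4) = ((%a. fmul a (rh (15 + 2 * i), rh (16 + 2 * i))) ^^ k) (rh 3, rh 4) \<and>
    (\<forall>j\<ge>5. (assign (mul1 i) ^^ k) rh j = rh j)"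
  proof (induction k)
   case (Suc k)
   define ta where "ta = (assign (mul1 i) ^^ k) rh"
   have "assign (mul1 i) ta 3 = ta 3 * ta (15 + 2 * i)" "assign (mul1 i) ta 4 = ta 4 * ta (16 + 2 * i)"
    "\<And>j. 5 <= j ==> assign (mul1 i) ta j = ta j" by (auto simp: mul1_def assign_simps)
   moreover have "(ta 3, ta 4) = ((%a. fmul a (rh (15 + 2 * i), rh (16 + 2 * i))) ^^ k) (rh 3, rh 4)" "\<And>j. 5 <= j ==> ta j = rh j"
    using Suc by (auto simp: ta_def)
   ultimately show ?case unfolding funpow.simps comp_apply ta_def[symmetric] by (simp add: fmul_def prod_eq_iff)
  qed simp
  then have s: "(si 3, si 4) = ((%a. fmul a (rh (15 + 2 * i), rh (16 + 2 * i))) ^^ k) (rh 3, rh 4)" "\<And>j. 5 <= j ==> si j = rh j"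
   unfolding si_def by auto
  have "Fr si is = Fr rh is" using s(2) by simp
  then show ?thesis using Cons.IH[of ks' si] c2 s by (simp add: expF_def si_def)
 qed (simp add: expF_def)
qed (simp add: expF_def)

lemma termF: "(termF t rh 3, termF t rh 4) = tval (%c. c) (Fr rh [0..<n]) t" "5 <= i ==> termF t rh i = rh i"
 using expF[of "[0..<n]" "snd t" "intF (fst t) rh"] by (auto simp: termF_def tval_def intF comp_def)

lemma polyF: "(polyF P rh 5, polyF P rh 6) = pval (%c. c) (Fr rh [0..<n]) P \<and> (\<forall>i\<ge>7. polyF P rh i = rh i)"
proof -
 have "(fold (%t rh. assign pol1 (termF t rh)) P rh 5, fold (%t rh. assign pol1 (termF t rh)) P rh 6) =
   fold (%t acc. fadd acc (tval (%c. c) (Fr rh [0..<n]) t)) P (rh 5, rh 6) \<and>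
   (\<forall>i\<ge>7. fold (%t rh. assign pol1 (termF t rh)) P rh i = rh i)" for rh
 proof (induction P arbitrary: rh)
  case (Cons t P)
  define si where "si = assign pol1 (termF t rh)"
  define x where "x = tval (%c. c) (Fr rh [0..<n]) t"
  have "termF t rh 3 = fst x" "termF t rh 4 = snd x" using termF(1)[of t rh] by (auto simp: x_def prod_eq_iff)
  then have s: "(si 5, si 6) = fadd (rh 5, rh 6) x" "\<And>i. 7 <= i ==> si i = rh i"
   by (auto simp: si_def pol1_def assign_simps termF(2) fadd_def)
  have "Fr si [0..<n] = Fr rh [0..<n]" using s(2) by simp
  then show ?case using Cons[of si] s by (simp add: si_def x_def)
 qed simp
 note this[of "assign pol0 rh"]
 moreover have "assign pol0 rh 5 = 0" "assign pol0 rh 6 = 1" "\<And>i. 7 <= i ==> assign pol0 rh i = rh i"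
  by (auto simp: pol0_def assign_simps)
 ultimately show ?thesis by (simp add: polyF_def pval_def comp_def)
qed

lemma elemF:
 "((elemF PQ rh 9, elemF PQ rh 10), (elemF PQ rh 11, elemF PQ rh 12)) =
   estep (%c. c) (Fr rh [0..<n]) (rh 13, rh 14) PQ ((rh 9, rh 10), (rh 11, rh 12)) \<and> (\<forall>i\<ge>13. elemF PQ rh i = rh i)"
proof -
 define x y where "x = pval (%c. c) (Fr rh [0..<n]) (fst PQ)" and "y = pval (%c. c) (Fr rh [0..<n]) (snd PQ)"
 define si where "si = assign elt0 (polyF (fst PQ) rh)"
 define ta where "ta = polyF (snd PQ) si"
 have "polyF (fst PQ) rh 5 = fst x" "polyF (fst PQ) rh 6 = snd x" "\<And>i. 7 <= i ==> polyF (fst PQ) rh i = rh i"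
  using polyF[of "fst PQ" rh] by (auto simp: x_def prod_eq_iff)
 then have s: "si 7 = fst x" "si 8 = snd x" "\<And>i. 9 <= i ==> si i = rh i" by (auto simp: si_def elt0_def assign_simps)
 then have "Fr si [0..<n] = Fr rh [0..<n]" by simp
 then have t: "ta 5 = fst y" "ta 6 = snd y" "ta 7 = fst x" "ta 8 = snd x" "\<And>i. 9 <= i ==> ta i = rh i"
  using polyF[of "snd PQ" si] s by (auto simp: y_def ta_def prod_eq_iff)
 have "elemF PQ rh = assign elt1 ta" by (simp add: elemF_def ta_def si_def)
 then show ?thesis using t
  by (auto simp: elt1_def assign_simps estep_def x_def[symmetric] y_def[symmetric] fadd_def fmul_def fdiv_def)
qed

theorem allF: "(allF a rh 9, allF a rh 10) = evalf (%c. c) (Fr rh [0..<n]) (rh 13, rh 14) a"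
proof -
 have "((fold elemF a rh 9, fold elemF a rh 10), (fold elemF a rh 11, fold elemF a rh 12)) =
   fold (estep (%c. c) (Fr rh [0..<n]) (rh 13, rh 14)) a ((rh 9, rh 10), (rh 11, rh 12))" for rh
 proof (induction a arbitrary: rh)
  case (Cons PQ a)
  have "Fr (elemF PQ rh) [0..<n] = Fr rh [0..<n]" "elemF PQ rh 13 = rh 13" "elemF PQ rh 14 = rh 14"
   using elemF[of PQ rh] by simp_all
  then show ?case using Cons[of "elemF PQ rh"] elemF[of PQ rh] by (simp only: fold_simps)
 qed simp
 note this[of "assign all0 rh"]
 moreover have "assign all0 rh 9 = 0" "assign all0 rh 10 = 1" "assign all0 rh 11 = 1" "assign all0 rh 12 = 1"
  "\<And>i. 13 <= i ==> assign all0 rh i = rh i" by (auto simp: all0_def assign_simps)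
 ultimately show ?thesis unfolding allF_def evalf_def by (simp add: prod_eq_iff)
qed

end

section \<open>Computing the instance\<close>

lemma concat_map_concat: "concat (map f (concat xss)) = concat (map (%xs. concat (map f xs)) xss)"
 by (induction xss) auto

text \<open>Vertex numbers arise as lengths of words and have to be written in binary. Counting
  modulo \<open>2 ^ length u\<close> is exact, as the count is \<open>length u\<close>.\<close>

definition bnU :: "nat list => nat list" where
 "bnU u = concat (map (%b. [1, b]) (rev (dropWhile (%x. x = 0)
   (rev (fold (%_ a. addw a (wd (length u) 1)) u (wd (length u) 0)))))) @ [0]"

lemma bnU: "bnU u = enc (enc_nat (length u))"
proof -
 have "fold (%_ a. addw a (wd L 1)) w (wd L z) = wd L (z + int (length w))" for L z and w :: "nat list"
  by (induction w arbitrary: z) (simp_all add: addw_wd add.assoc)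
 from this[of "length u" u 0] have "fold (%_ a. addw a (wd (length u) 1)) u (wd (length u) 0) = wd (length u) (int (length u))" by simp
 then show ?thesis unfolding bnU_def enc_nat_def enc_enc_list using trim_wd[OF less_exp, of "length u"] by (simp add: enc_def comp_def)
qed

text \<open>The width enters as the length of \<open>v\<close>. The prefix \<open>p\<close> has the
  number of the cell as its length, and appending nothing, one letter or \<open>v\<close> yields the
  cell itself, its right or its upper neighbour.\<close>

definition encg :: "nat list => nat list => nat list" where
 "encg w v = rp 7 (map (%_. 1) w) @ 0 # scan (%t p. concat (map (%(k1, d, k2).
   1 # bnU (rp 7 p @ replicate k1 0) @ bnU (rp 7 (p @ (if d = 0 then [] else if d = 1 then [0] else v)) @ replicate k2 0)) (cedges t))) w @ [0]"

lemma encg: "encg w v = enc (enc_graph (gg w (length v)))"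
proof -
 have "enc (enc_unary (7 * length w)) = rp 7 (map (%_. 1) w) @ [0]"
 proof -
  have "rp k (map (%_. 1) w) = replicate (k * length w) 1" for k
   by (induction k) (simp_all add: rp_def replicate_add map_replicate_const)
  then show ?thesis by (simp add: enc_unary_def enc_def)
 qed
 then show ?thesis unfolding encg_def enc_graph_def gg_def
  by (simp add: enc_append enc_enc_list scan_def comp_def case_prod_unfold bnU cshift_def concat_map_concat if_distrib[of length] algebra_simps cong: if_cong)
   (intro arg_cong[where f = concat] map_cong refl, simp add: min_def algebra_simps)
qed

text \<open>\<open>B\<close> is given as the length of \<open>bb\<close>. Symbols from 4 on get
  label 0, because the result of a function in \<open>FP\<close> must stay within the alphabet for
  arbitrary words.\<close>

definition rowN :: "nat => nat list => nat list => nat list" where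
 "rowN r bb tm = lab r 0 0 # replicate (length (tl bb)) (lab r 1 0) @
   (if hdis 1 tm then [lab r 2 1] else if hdis 2 tm then [lab r 2 2] else [lab r 2 0]) @
   map (%x. if x < 4 then lab r 1 x else 0) (tl tm) @ replicate (length (drop (length tm) bb)) (lab r 1 0) @ [lab r 3 0]"

definition labN :: "nat list => nat list => nat list" where
 "labN bb tm = rowN 0 bb tm @ concat (map (%_. rowN 1 bb [0]) (tl bb)) @ rowN 2 bb [0]"

definition mskN :: "nat list => nat list => nat list => nat list" where
 "mskN bb ls p = take (length ls) (replicate (length p) 0 @ 1 # 2 # replicate (length (tl (bb @ bb))) 0 @ 3 # replicate (length ls) 0)"

lemma mskN: assumes "1 <= length bb" "length p <= length ls"
 shows "mskN bb ls p = map (msk (2 * length bb + 1) (length p)) [0..<length ls]"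
 by (rule nth_equalityI) (use assms in \<open>auto simp: mskN_def msk_def nth_append nth_Cons split: nat.splits\<close>)

definition tmpN :: "nat poly => nat list => nat list" where
 "tmpN pn w = concat (map (%b. if b = 1 then [2, 2] else [2, 1]) w) @ 1 # replicate (length (replicate (poly pn (length w)) (1 :: nat))) 3"

lemma tmpN: "tmpN pn (enc x) = tmpl x (poly pn (length x))"
 by (simp add: tmpN_def tmpl_def enc_def comp_def) (rule arg_cong[where f = concat], simp)

definition bbN :: "nat poly => nat list => nat list" where
 "bbN pT tm = tm @ replicate (poly pT (length tm)) 1"

context
 fixes A :: nat
 assumes A: "48 <= A"
begin

lemma FP_bnU: assumes "FP A f" shows "FP A (%e. bnU (f e))"
proof -
 have A3: "3 <= A" using A by simp
 have "FP A (%e. fold (%x a. addw a (wd (length (f e)) 1)) (f e) (wd (length (f e)) 0))"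
  by (rule FP_fold_add[where h = "%x a e. addw a (wd (length (f e)) 1)", OF assms FP_wd[OF A3 assms] _ bnd_const[of A 0]])
   (auto intro!: FP_addw FP_var FP_wd FP_rename[OF assms, of Suc] A3)
 then show ?thesis unfolding bnU_def
  by (intro FP_app FP_cmap FP_lit FP_rev FP_dropWhile) (use A in auto)
qed

lemma FP_encg: assumes "FP A w" "FP A v" shows "FP A (%e. encg (w e) (v e))"
proof -
 have "FP A (%e. scan (%t p. concat (map (%kdk. 1 # bnU (rp 7 p @ replicate (fst kdk) 0) @
   bnU (rp 7 (p @ (if fst (snd kdk) = 0 then [] else if fst (snd kdk) = 1 then [0] else v e)) @ replicate (snd (snd kdk)) 0)) (cedges t))) (w e))"
 proof (rule FP_scan[OF assms(1)], rule FP_concat)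
  fix kdk :: "nat \<times> nat \<times> nat"
  have "FP A (%e. if fst (snd kdk) = 0 then [] else if fst (snd kdk) = 1 then [0] else v (%i. e (Suc i)))"
   using A FP_rename[OF assms(2), of Suc]
   by (cases "fst (snd kdk) = 0"; cases "fst (snd kdk) = 1") (simp_all add: FP_nil FP_lit)
  then show "FP A (%e. 1 # bnU (rp 7 (e 0) @ replicate (fst kdk) 0) @
   bnU (rp 7 (e 0 @ (if fst (snd kdk) = 0 then [] else if fst (snd kdk) = 1 then [0] else v (%i. e (Suc i)))) @ replicate (snd (snd kdk)) 0))"
   by (intro FP_Cons FP_app FP_bnU FP_rp FP_var FP_lit) (use A in auto)
 qed
 then show ?thesis unfolding encg_def case_prod_unfold
  by (intro FP_app FP_Cons FP_rp FP_map FP_lit assms FP_nil) (use A in auto)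
qed

lemma FP_rowN: assumes "FP A f" "FP A g" "r < 3" shows "FP A (%e. rowN r (f e) (g e))"
proof -
 have l: "lab r c k < A" if "c < 4" "k < 4" for c k using A assms(3) that by (simp add: lab_def)
 have "FP A (%e. map (%x. if x < 4 then lab r 1 x else 0) (tl (g e)))"
  by (rule FP_map[OF FP_tl[OF assms(2)]]) (use l A in auto)
 moreover have "FP A (%e. if hdis 1 (g e) then [lab r 2 1] else if hdis 2 (g e) then [lab r 2 2] else [lab r 2 0])"
  by (intro FP_if FP_lit assms) (use l in auto)
 ultimately show ?thesis unfolding rowN_def
  by (intro FP_Cons FP_app FP_rep FP_drop FP_tl FP_lit assms) (use l in auto)
qed

lemma FP_labN: assumes "FP A f" "FP A g" shows "FP A (%e. labN (f e) (g e))"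
 unfolding labN_def by (intro FP_app FP_rowN FP_cmap FP_tl assms FP_lit) (use A in auto)

lemma FP_mskN: assumes "FP A f" "FP A g" "FP A h" shows "FP A (%e. mskN (f e) (g e) (h e))"
 unfolding mskN_def by (intro FP_take FP_app FP_Cons FP_rep FP_tl assms) (use A in auto)

lemma FP_tmpN: assumes "FP A f" shows "FP A (%e. tmpN pn (f e))"
proof -
 have "FP A (%e. if x = 1 then [2, 2] else [2, 1 :: nat])" for x :: nat
  by (cases "x = 1") (simp_all only: if_True if_False refl, (rule FP_lit, use A in simp)+)
 then show ?thesis unfolding tmpN_def
  by (intro FP_app FP_Cons FP_cmap FP_rep FP_poly assms) (use A in auto)
qed

lemma FP_bbN: "FP A f ==> FP A (%e. bbN pT (f e))"
 unfolding bbN_def by (intro FP_app FP_poly) (use A in auto)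

lemma FP_powers:
 assumes "FP A l" "FP A w" shows "FP A (%e. fold (%x a. mulw a (wd (length (l e)) (k x))) (w e) (wd (length (l e)) 1))"
proof -
 have A3: "3 <= A" using A by simp
 show ?thesis
  by (rule FP_fold_add[where h = "%x a e. mulw a (wd (length (l e)) (k x))", OF assms(2) FP_wd[OF A3 assms(1)] _ bnd_const[of A 0]])
   (auto intro!: FP_mulw FP_var FP_wd FP_rename[OF assms(1), of Suc] A3)
qed

end

lemma powers: "fold (%x a. mulw a (wd L (k x))) w (wd L 1) = wd L (\<Prod>x\<leftarrow>w. k x)"
proof -
 have "fold (%x a. mulw a (wd L (k x))) w (wd L z) = wd L (z * (\<Prod>x\<leftarrow>w. k x))" for z
  by (induction w arbitrary: z) (simp_all add: mulw_wd mult.assoc)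
 then show ?thesis by simp
qed

lemma cells_append: assumes "u ~= []" shows "cells (u @ v) = cells u @ map (%b. 5 + (if b then 1 else 0)) v"
proof (rule nth_equalityI)
 fix i assume "i < length (cells (u @ v))"
 then show "cells (u @ v) ! i = (cells u @ map (%b. 5 + (if b then 1 else 0)) v) ! i"
 proof -
  have "0 < length u" using assms by simp
  then show ?thesis using \<open>i < length (cells (u @ v))\<close> by (cases i; cases "i < length u") (auto simp: cells_def nth_append)
 qed
qed (simp add: cells_def)

definition pre :: "nat => nat => (nat => nat => nat => nat => bool) => nat => nat => nat => bool list" where
 "pre K tg con l rh r = map (%j. j < K - asz tg con l rh) [0..<K] @ replicate K True @
   map (%j. j < 2 * K - 2 * kst r) [0..<2 * K]"

definition rowsN :: "nat => nat => nat => (nat => nat => nat => nat => bool) => nat => nat list => nat list" where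
 "rowsN K R tg con l ms = concat (map (%rh. concat (map (%r. cells (pre K tg con l rh r) @
   concat (map (%m. map (%ta. 5 + (if con l rh ta m then 1 else 0)) [0..<tg]) ms) @ [3]) [0..<Suc K])) [0..<R])"

lemma cells_urow: assumes "1 <= K"
 shows "cells (urow K tg con l rh r ms) = cells (pre K tg con l rh r) @
  concat (map (%m. map (%ta. 5 + (if con l rh ta m then 1 else 0)) [0..<tg]) ms)"
proof -
 have "urow K tg con l rh r ms = pre K tg con l rh r @ selrow tg con l rh ms" by (simp add: urow_def pre_def)
 moreover have "pre K tg con l rh r ~= []" using assms by (simp add: pre_def)
 ultimately show ?thesis by (simp add: cells_append selrow_def map_concat comp_def)
qed

definition psN :: "nat => nat => nat list => nat list" where
 "psN K tg ls = replicate (2 * K) 1 @ replicate (2 * K) 2 @ concat (map (%_. replicate tg 0) ls)"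

lemma psN: "psN K tg ls = pcols K (length ls * tg)"
 by (induction ls) (auto simp: psN_def pcols_def replicate_add)

text \<open>The prefix before a label has the number of its cell as length, from which the mask of
  the cell is built.\<close>

definition growsN :: "nat => nat => nat => (nat => nat => nat => nat => bool) => nat list => nat list => nat list" where
 "growsN K R tg con bb ls = (psN K tg ls @ [0]) @ scan (%l p. rowsN K R tg con l (mskN bb ls p)) ls @
   replicate (length (psN K tg ls)) 4 @ [0]"

lemma growsN:
 assumes "1 <= K" "1 <= length bb"
 shows "growsN K R tg con bb ls = raster (pcols K (length ls * tg)) (urows K R tg con (2 * length bb + 1) ls)"
proof -
 have "concat (map (%u. cells u @ [3]) (urows K R tg con (2 * length bb + 1) ls)) =
   concat (map (%ka. rowsN K R tg con (ls ! ka) (map (msk (2 * length bb + 1) ka) [0..<length ls])) [0..<length ls])"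
  unfolding urows_def rowsN_def concat_map_concat map_map comp_def cells_urow[OF assms(1)] append_assoc ..
 also have "\<dots> = scan (%l p. rowsN K R tg con l (mskN bb ls p)) ls"
  unfolding scan_def
 proof (intro arg_cong[where f = concat] map_cong refl)
  fix ka assume "ka \<in> set [0..<length ls]"
  then have "length (take ka ls) = ka" by simp
  then show "rowsN K R tg con (ls ! ka) (map (msk (2 * length bb + 1) ka) [0..<length ls]) =
    rowsN K R tg con (ls ! ka) (mskN bb ls (take ka ls))"
   using mskN[OF assms(2), of "take ka ls" ls] by simp
 qed
 finally show ?thesis by (simp add: growsN_def raster_def psN)
qed

lemma FP_growsN: assumes A: "48 <= A" and "FP A f" "FP A g" shows "FP A (%e. growsN K R tg con (f e) (g e))"
proof -
 have "FP A (%e. psN K tg (g e))" unfolding psN_def by (intro FP_app FP_lit FP_cmap assms) (use A in auto)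
 moreover have "FP A (%e. scan (%l p. rowsN K R tg con l (mskN (f e) (g e) p)) (g e))"
 proof (rule FP_scan[OF assms(3)])
  fix x
  have "FP A (%e. mskN (f (%i. e (Suc i))) (g (%i. e (Suc i))) (e 0))"
   by (intro FP_mskN A FP_var FP_rename[OF assms(2), of Suc] FP_rename[OF assms(3), of Suc])
  moreover have "cells u ~= [] ==> True" "set (cells u) \<subseteq> {..<A}" for u using A by (auto simp: cells_def)
  ultimately show "FP A (%e. rowsN K R tg con x (mskN (f (%i. e (Suc i))) (g (%i. e (Suc i))) (e 0)))"
   unfolding rowsN_def by (intro FP_concat FP_app FP_lit FP_cmap) (use A in auto)
 qed
 ultimately show ?thesis unfolding growsN_def by (intro FP_app FP_lit FP_rep) (use A in auto)
qed

context verifier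
begin

lemma W_eq: "1 <= B ==> W B = 2 * B + 1" using W_def[of "[1]" B] by simp

lemma rowN: "length bb = B ==> 1 <= length tm ==> set tm \<subseteq> {0, 1, 2, 3} ==> hd tm ~= 3 ==> rowN r bb tm = rowl B r tm"
 by (cases tm) (auto simp: rowN_def rowl_def hdis_def)

lemma labN:
 assumes "length bb = B" "1 <= length tm" "set tm \<subseteq> {1, 2, 3}" "hd tm ~= 3"
 shows "labN bb tm = labels B tm"
proof -
 have "rowN 0 bb tm = rowl B 0 tm" by (rule rowN) (use assms in auto)
 moreover have "rowN r bb [0] = rowl B r [0]" for r by (rule rowN) (use assms in auto)
 ultimately show ?thesis using assms(1) by (simp add: labN_def labels_def map_replicate_const)
qed

definition "lsX pn pT w = labN (bbN pT (tmpN pn w)) (tmpN pn w)"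
definition "omX pn pT w = growsN K0 nrul (length (tls V)) con (bbN pT (tmpN pn w)) (lsX pn pT w)"
text \<open>Used for its length, the width of the grid: all columns and the one that ends the
  rows.\<close>

definition "wdX pn pT w = psN K0 (length (tls V)) (lsX pn pT w) @ [0]"

lemma FP_X: assumes "48 <= A" "FP A f"
 shows "FP A (%e. lsX pn pT (f e))" "FP A (%e. omX pn pT (f e))" "FP A (%e. wdX pn pT (f e))"
proof -
 show 1: "FP A (%e. lsX pn pT (f e))" unfolding lsX_def by (intro FP_labN FP_bbN FP_tmpN assms)
 then show "FP A (%e. omX pn pT (f e))" unfolding omX_def by (intro FP_growsN FP_bbN FP_tmpN assms)
 show "FP A (%e. wdX pn pT (f e))" unfolding wdX_def psN_def by (intro FP_app FP_lit FP_cmap 1) (use assms in auto)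
qed

lemma X_eq:
 fixes x pn pT defines "tm \<equiv> tmpl x (poly pn (length x))" defines "B \<equiv> length tm + poly pT (length tm)"
 shows "lsX pn pT (enc x) = labels B tm" "omX pn pT (enc x) = grows B tm" "length (wdX pn pT (enc x)) = gwidth B tm"
proof -
 have B: "length (bbN pT tm) = B" by (simp add: bbN_def B_def)
 have tm: "1 <= length tm" "set tm \<subseteq> {1, 2, 3}" using set_tmpl[of x "poly pn (length x)"] by (simp_all add: tm_def)
 have "hd tm ~= 3" by (cases x) (auto simp: tm_def tmpl_def)
 then show 1: "lsX pn pT (enc x) = labels B tm"
  unfolding lsX_def tmpN tm_def[symmetric] by (intro labN B tm)
 have "1 <= B" using tm by (simp add: B_def)
 then show "omX pn pT (enc x) = grows B tm"
  using growsN[of K0 "bbN pT tm" nrul "length (tls V)" con "labels B tm"] tls_nonempty[OF V]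
  unfolding omX_def 1 grows_def tmpN tm_def[symmetric] B W_eq[OF \<open>1 <= B\<close>] by simp
 show "length (wdX pn pT (enc x)) = gwidth B tm" by (simp add: wdX_def 1 psN gwidth_def pcols_def)
qed

end

section \<open>Elements of the generated field\<close>

lemma subfield_hull: "is_subfield (is_subfield hull S)"
 by (rule hull_in) (auto simp: is_subfield_def)

lemma subfieldD:
 assumes "is_subfield K"
 shows "1 \<in> K" "0 \<in> K" "x \<in> K ==> y \<in> K ==> x - y \<in> K" "x \<in> K ==> y \<in> K ==> x * y \<in> K"
  "x \<in> K ==> inverse x \<in> K" "x \<in> K ==> - x \<in> K" "x \<in> K ==> y \<in> K ==> x + y \<in> K"
proof -
 show 1: "1 \<in> K" and d: "x \<in> K ==> y \<in> K ==> x - y \<in> K" and "x \<in> K ==> y \<in> K ==> x * y \<in> K" "x \<in> K ==> inverse x \<in> K" for x y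
  using assms by (auto simp: is_subfield_def)
 show 0: "0 \<in> K" using d[OF 1 1] by simp
 show m: "x \<in> K ==> - x \<in> K" for x using d[OF 0, of x] by simp
 show "x \<in> K ==> y \<in> K ==> x + y \<in> K" using d[OF _ m, of x y] by simp
qed

lemma subfield_sum: "is_subfield K ==> (\<And>i. i \<in> A ==> f i \<in> K) ==> sum f A \<in> K"
 by (induction A rule: infinite_finite_induct) (auto simp: subfieldD)

lemma Z_in_hull: assumes "M \<in> carrier_mat q q" "multigraph G" shows "Z M G \<in> is_subfield hull elements_mat M"
proof -
 obtain n es where G: "G = (n, es)" by (cases G)
 note s = subfieldD[OF subfield_hull[of "elements_mat M"]]
 have "(\<Prod>(u, v)\<leftarrow>es'. M $$ (si u, si v)) \<in> is_subfield hull elements_mat M"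
  if "si \<in> {..<n} \<rightarrow>\<^sub>E {..<dim_row M}" "set es' \<subseteq> set es" for si es'
  using that(2)
 proof (induction es')
  case (Cons uv es')
  obtain u v where uv: "uv = (u, v)" by fastforce
  then have "u < n" "v < n" using assms(2) Cons.prems by (auto simp: multigraph_def G)
  then have "si u < q" "si v < q" using that(1) assms(1) by auto
  then have "M $$ (si u, si v) \<in> elements_mat M" using assms(1) by auto
  then show ?case using Cons uv s(4) hull_inc[of _ "elements_mat M" is_subfield] by simp
 qed (simp add: s(1))
 then show ?thesis unfolding Z_def G by (auto intro!: subfield_sum[OF subfield_hull])
qed

text \<open>The ring generated by \<open>X\<close> over the integers; quotients of its elements are
  the coefficients that an answer may contain.\<close>

definition ipv :: "real list => real set" where
 "ipv X = {int_poly_val X P | P. \<forall>(c, e)\<in>set P. length e = length X}"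

lemma ipv_closed:
 shows "1 \<in> ipv X" "x \<in> set X ==> x \<in> ipv X" "x \<in> ipv X ==> y \<in> ipv X ==> x - y \<in> ipv X"
  "x \<in> ipv X ==> y \<in> ipv X ==> x * y \<in> ipv X"
proof -
 let ?ok = "%P. \<forall>(c, e)\<in>set P. length e = length X"
 show "1 \<in> ipv X"
  unfolding ipv_def by (rule CollectI, rule exI[of _ "[(1, replicate (length X) 0)]"]) (simp add: int_poly_val_def monomial_def)
 show "x \<in> ipv X" if x: "x \<in> set X"
 proof -
  obtain i where i: "i < length X" "x = X ! i" using x by (metis in_set_conv_nth)
  have "monomial X ((replicate (length X) 0)[i := 1]) = (\<Prod>j<length X. if j = i then x else 1)"
   unfolding monomial_def by (rule prod.cong) (auto simp: nth_list_update i)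
  then show ?thesis unfolding ipv_def
   by (intro CollectI exI[of _ "[(1, (replicate (length X) 0)[i := 1])]"]) (simp add: int_poly_val_def i(1))
 qed
 assume "x \<in> ipv X" "y \<in> ipv X"
 then obtain P Q where P: "x = int_poly_val X P" "?ok P" and Q: "y = int_poly_val X Q" "?ok Q" unfolding ipv_def by auto
 have n: "int_poly_val X (map (%(c, e). (- c, e)) Q) = - int_poly_val X Q" for Q
  by (induction Q) (auto simp: int_poly_val_def)
 show "x - y \<in> ipv X" unfolding ipv_def
  using P Q by (intro CollectI exI[of _ "P @ map (%(c, e). (- c, e)) Q"]) (use n[of Q] in \<open>auto simp: int_poly_val_def\<close>)
 have m: "monomial X (map2 (+) e e') = monomial X e * monomial X e'" if "length e = length X" "length e' = length X" for e e'
  using that by (simp add: monomial_def power_add prod.distrib[symmetric])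
 have s: "int_poly_val X (map (%(c', e'). (c * c', map2 (+) e e')) Q) = of_int c * monomial X e * int_poly_val X Q"
  if "length e = length X" "?ok Q" for c e Q
  using that(2) by (induction Q) (auto simp: int_poly_val_def m[OF that(1)] algebra_simps)
 have "int_poly_val X (concat (map (%(c, e). map (%(c', e'). (c * c', map2 (+) e e')) Q) P)) = int_poly_val X P * int_poly_val X Q"
  using P(2)
 proof (induction P)
  case (Cons t P)
  obtain c e where t: "t = (c, e)" by fastforce
  have "int_poly_val X (U @ U') = int_poly_val X U + int_poly_val X U'" for U U' by (simp add: int_poly_val_def)
  then show ?case using Cons t s[of e Q c] Q(2) by (simp add: algebra_simps) (simp add: int_poly_val_def algebra_simps)
 qed (simp add: int_poly_val_def)
 then show "x * y \<in> ipv X" unfolding ipv_def P(1) Q(1)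
  by (intro CollectI exI[of _ "concat (map (%(c, e). map (%(c', e'). (c * c', map2 (+) e e')) Q) P)"])
   (use P(2) Q(2) in \<open>fastforce simp: min_def\<close>)
qed

lemma hull_quotient: assumes "x \<in> is_subfield hull set X" shows "\<exists>a\<in>ipv X. \<exists>b\<in>ipv X. b ~= 0 \<and> x = a / b"
proof -
 let ?R = "{x. \<exists>a\<in>ipv X. \<exists>b\<in>ipv X. b ~= 0 \<and> x = a / b}"
 note c = ipv_closed[where X = X]
 have "is_subfield ?R"
  unfolding is_subfield_def
 proof (intro conjI ballI)
  show "1 \<in> ?R" using c(1) by (intro CollectI bexI[of _ 1]) auto
 next
  fix x y assume "x \<in> ?R" "y \<in> ?R"
  then obtain a b a' b' where *: "a \<in> ipv X" "b \<in> ipv X" "b ~= 0" "x = a / b" "a' \<in> ipv X" "b' \<in> ipv X" "b' ~= 0" "y = a' / b'" by auto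
  show "x - y \<in> ?R" using * by (intro CollectI bexI[of _ "a * b' - a' * b"] bexI[of _ "b * b'"]) (auto simp: field_simps intro: c)
  show "x * y \<in> ?R" using * by (intro CollectI bexI[of _ "a * a'"] bexI[of _ "b * b'"]) (auto intro: c)
  have "0 \<in> ipv X" using c(3)[OF c(1) c(1)] by simp
  show "inverse x \<in> ?R"
  proof (cases "a = 0")
   case True
   then show ?thesis using * \<open>0 \<in> ipv X\<close> c(1) by (intro CollectI bexI[of _ 0] bexI[of _ 1]) auto
  qed (use * in \<open>intro CollectI bexI[of _ b] bexI[of _ a]; auto\<close>)
 qed
 moreover have "set X \<subseteq> ?R" proof
  fix x assume "x \<in> set X"
  then show "x \<in> ?R" using c(1,2) by (intro CollectI bexI[of _ x] bexI[of _ 1]) auto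
 qed
 ultimately have "is_subfield hull set X \<subseteq> ?R" by (intro hull_minimal)
 then show ?thesis using assms by auto
qed

section \<open>Inverses in a simple algebraic extension\<close>

definition kp :: "real set => real poly => bool" where "kp K f \<longleftrightarrow> (\<forall>i. coeff f i \<in> K)"

context
 fixes K assumes K: "is_subfield K"
begin

lemmas Kc = subfieldD[OF K]

lemma kp_ops: "kp K f ==> kp K g ==> kp K (f - g)" "kp K f ==> kp K g ==> kp K (f + g)" "kp K f ==> kp K g ==> kp K (f * g)"
 "kp K f ==> kp K (- f)" "c \<in> K ==> kp K (monom c n)"
 by (auto simp: kp_def coeff_mult Kc intro!: subfield_sum[OF K])

text \<open>Long division uses only field operations on coefficients, so quotient and remainder stay
  over \<open>K\<close>.\<close>

lemma kp_div: assumes "kp K f" "f ~= 0"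
 shows "kp K m ==> \<exists>s r. kp K s \<and> kp K r \<and> m = f * s + r \<and> (r = 0 \<or> degree r < degree f)"
proof (induction "degree m" arbitrary: m rule: less_induct)
 case less
 show ?case
 proof (cases "m = 0 \<or> degree m < degree f")
  case True then show ?thesis using less.prems by (intro exI[of _ 0] exI[of _ m]) (auto simp: kp_def Kc)
 next
  case False
  define t where "t = monom (lead_coeff m * inverse (lead_coeff f)) (degree m - degree f)"
  have t: "kp K t" unfolding t_def using less.prems assms by (intro kp_ops Kc) (auto simp: kp_def)
  have d: "degree (f * t) <= degree m" "coeff (f * t) (degree m) = lead_coeff m"
  proof -
   have "degree (f * t) <= degree f + (degree m - degree f)"
    using degree_mult_le[of f t] degree_monom_le[of "lead_coeff m * inverse (lead_coeff f)" "degree m - degree f"] by (simp add: t_def)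
   then show "degree (f * t) <= degree m" using False by simp
   show "coeff (f * t) (degree m) = lead_coeff m"
    using False assms(2) coeff_mult_degree_sum[of f t] by (simp add: t_def degree_monom_eq)
  qed
  show ?thesis
  proof (cases "m = f * t")
   case True then show ?thesis using t by (intro exI[of _ t] exI[of _ 0]) (auto simp: kp_def Kc)
  next
   case F2: False
   have "degree (m - f * t) <= degree m" using degree_diff_le[OF order_refl d(1)] by simp
   moreover have "degree (m - f * t) ~= degree m"
    using d(2) F2 leading_coeff_0_iff[of "m - f * t"] by auto
   ultimately have "degree (m - f * t) < degree m" by simp
   from less.hyps[OF this] kp_ops(1)[OF less.prems kp_ops(3)[OF assms(1) t]]
   obtain s r where "kp K s" "kp K r" "m - f * t = f * s + r" "r = 0 \<or> degree r < degree f" by auto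
   then show ?thesis using t by (intro exI[of _ "s + t"] exI[of _ r]) (auto simp: kp_ops algebra_simps)
  qed
 qed
qed

text \<open>Euclidean descent: dividing an annihilating polynomial \<open>m\<close> of minimal
  degree by \<open>f\<close> shows that at \<open>bh\<close> the product of \<open>f\<close> and
  \<open>s\<close> is minus the remainder \<open>r\<close>, of smaller degree. By minimality
  \<open>r\<close> can vanish at \<open>bh\<close> only if \<open>f\<close> is constant.\<close>

lemma kp_inverse:
 assumes "algebraic_over K bh" "kp K f" "poly f bh ~= 0" shows "\<exists>h. kp K h \<and> poly f bh * poly h bh = 1"
proof -
 define P where "P m \<longleftrightarrow> m ~= 0 \<and> kp K m \<and> poly m bh = 0" for m
 have "\<exists>m. P m" using assms(1) by (auto simp: P_def algebraic_over_def kp_def)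
 then obtain m where m: "P m" "\<And>m'. P m' ==> degree m <= degree m'" using ex_has_least_nat[of P _ degree] by metis
 have "\<exists>h. kp K h \<and> poly f bh * poly h bh = 1" if "kp K f" "poly f bh ~= 0" "degree f < degree m" for f
  using that
 proof (induction "degree f" arbitrary: f rule: less_induct)
  case less
  have f0: "f ~= 0" using less.prems by auto
  from kp_div[OF less.prems(1) f0, of m] m(1)
  obtain s r where sr: "kp K s" "kp K r" "m = f * s + r" "r = 0 \<or> degree r < degree f" by (auto simp: P_def)
  have v: "poly f bh * poly s bh = - poly r bh" using m(1) sr(3) by (simp add: P_def eq_neg_iff_add_eq_0)
  show ?case
  proof (cases "poly r bh = 0")
   case True
   have "r = 0" using m(2)[of r] sr True less.prems(3) by (force simp: P_def)
   then have m': "m = f * s" "poly s bh = 0" "s ~= 0" using sr v less.prems m(1) by (auto simp: P_def)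
   then have "degree m <= degree s" using m(2)[of s] sr by (simp add: P_def)
   then have "degree f = 0" using m' f0 by (simp add: degree_mult_eq)
   then obtain c where c: "f = [:c:]" by (metis degree_eq_zeroE)
   have "c \<in> K" using less.prems(1) c by (auto simp: kp_def dest: spec[of _ 0])
   then show ?thesis using c less.prems by (intro exI[of _ "monom (inverse c) 0"]) (auto simp: kp_ops(5)[OF Kc(5)] poly_monom)
  next
   case False
   then have "degree r < degree f" using sr by auto
   from less.hyps[OF this sr(2) False] less.prems(3) this
   obtain h where "kp K h" "poly r bh * poly h bh = 1" by auto
   then show ?thesis using sr v by (intro exI[of _ "- (s * h)"]) (simp add: kp_ops mult.assoc[symmetric])
  qed
 qed
 note small = this
 have "m ~= 0" using m(1) by (simp add: P_def)
 from kp_div[OF _ this assms(2)] m(1) obtain s r where sr: "kp K r" "f = m * s + r" "r = 0 \<or> degree r < degree m"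
  by (auto simp: P_def)
 then have "poly f bh = poly r bh" using m(1) by (simp add: P_def)
 then show ?thesis using small[of r] sr assms(3) by auto
qed

lemma kp_field:
 assumes "algebraic_over K bh" "y \<in> is_subfield hull insert bh K" shows "\<exists>f. kp K f \<and> poly f bh = y"
proof -
 let ?T = "{poly f bh | f. kp K f}"
 have k: "kp K [:c:]" if "c \<in> K" for c using kp_ops(5)[OF that, of 0] by (simp add: monom_0)
 have "is_subfield ?T"
  unfolding is_subfield_def
 proof (intro conjI ballI)
  show "1 \<in> ?T" using k[OF Kc(1)] by (intro CollectI exI[of _ "[:1:]"]) simp
 next
  fix x y assume "x \<in> ?T" "y \<in> ?T"
  then obtain f g where *: "x = poly f bh" "y = poly g bh" "kp K f" "kp K g" by auto
  show "x - y \<in> ?T" using * by (intro CollectI exI[of _ "f - g"]) (simp add: kp_ops)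
  show "x * y \<in> ?T" using * by (intro CollectI exI[of _ "f * g"]) (simp add: kp_ops)
  show "inverse x \<in> ?T"
  proof (cases "x = 0")
   case True then show ?thesis using k[OF Kc(2)] by (intro CollectI exI[of _ "[:0:]"]) simp
  next
   case False
   then obtain h where "kp K h" "x * poly h bh = 1" using kp_inverse[OF assms(1) *(3)] * by auto
   then show ?thesis by (intro CollectI exI[of _ h]) (auto simp: inverse_unique)
  qed
 qed
 moreover have "insert bh K \<subseteq> ?T"
 proof
  fix x assume "x \<in> insert bh K"
  then show "x \<in> ?T"
  proof
   assume "x = bh" then show ?thesis using kp_ops(5)[OF Kc(1), of 1] by (intro CollectI exI[of _ "monom 1 1"]) (simp add: poly_monom)
  qed (use k in \<open>intro CollectI exI[of _ "[:x:]"]; simp\<close>)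
 qed
 ultimately show ?thesis using assms(2) hull_minimal[of "insert bh K" ?T is_subfield] by auto
qed

end

text \<open>This guarantees that the query is an instance of the problem; elsewhere the oracle is
  unconstrained.\<close>

theorem field_elem_exists:
 assumes "algebraic_over (is_subfield hull set X) bh" "y \<in> is_subfield hull insert bh (set X)"
 shows "\<exists>a. wf_field_elem X a \<and> field_elem_val X bh a = y"
proof -
 let ?K = "is_subfield hull set X"
 have "y \<in> is_subfield hull insert bh ?K"
  using assms(2) hull_mono[of "insert bh (set X)" "insert bh ?K" is_subfield] hull_subset[of "set X" is_subfield] by auto
 then obtain f where f: "kp ?K f" "poly f bh = y" using kp_field[OF subfield_hull assms(1)] by auto
 have "\<exists>PQ. (\<forall>(c, e)\<in>set (fst PQ) \<union> set (snd PQ). length e = length X) \<and> int_poly_val X (snd PQ) ~= 0 \<and>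
   coeff f i = int_poly_val X (fst PQ) / int_poly_val X (snd PQ)" for i
 proof -
  have "coeff f i \<in> ?K" using f by (simp add: kp_def)
  from hull_quotient[OF this] obtain P Q where "\<forall>(c, e)\<in>set P. length e = length X" "\<forall>(c, e)\<in>set Q. length e = length X"
   "int_poly_val X Q ~= 0" "coeff f i = int_poly_val X P / int_poly_val X Q" unfolding ipv_def by auto
  then show ?thesis by (intro exI[of _ "(P, Q)"]) auto
 qed
 then obtain F where F: "\<And>i. (\<forall>(c, e)\<in>set (fst (F i)) \<union> set (snd (F i)). length e = length X) \<and> int_poly_val X (snd (F i)) ~= 0 \<and>
   coeff f i = int_poly_val X (fst (F i)) / int_poly_val X (snd (F i))" by metis
 have "wf_field_elem X (map F [0..<Suc (degree f)])" unfolding wf_field_elem_def using F by (auto simp: case_prod_unfold simp del: upt_Suc)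
 moreover have "field_elem_val X bh (map F [0..<Suc (degree f)]) = (\<Sum>i<Suc (degree f). coeff f i * bh ^ i)"
  unfolding field_elem_val_def using F by (intro sum.cong) (simp_all del: upt_Suc)
 ultimately show ?thesis using f(2) by (auto simp: poly_altdef lessThan_Suc_atMost)
qed

section \<open>The reduction\<close>

definition pf :: "('a => bool list) => bool" where
 "pf f \<longleftrightarrow> (\<forall>x y r s. f x @ r = f y @ s --> x = y \<and> r = s)"

lemma pf_list: assumes "pf f" shows "pf (enc_list f)"
proof -
 have "enc_list f xs @ r = enc_list f ys @ s ==> xs = ys \<and> r = s" for xs ys r s
 proof (induction xs arbitrary: ys)
  case Nil then show ?case by (cases ys) (auto simp: enc_list_def)
 next
  case (Cons x xs)
  obtain y ys' where ys: "ys = y # ys'" using Cons.prems by (cases ys) (auto simp: enc_list_def)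
  then have "f x @ (enc_list f xs @ r) = f y @ (enc_list f ys' @ s)" using Cons.prems by (simp add: enc_list_def)
  then have "x = y" "enc_list f xs @ r = enc_list f ys' @ s" using assms unfolding pf_def by blast+
  then show ?case using Cons.IH ys by blast
 qed
 then show ?thesis unfolding pf_def by blast
qed

lemma bin_inj: "bin m = bin n ==> m = n"
proof (induction m arbitrary: n rule: bin.induct)
 case (1 m)
 show ?case
 proof (cases "m = 0 \<or> n = 0")
  case True then show ?thesis using 1(2) by (auto simp: bin.simps[of m] bin.simps[of n] split: if_splits)
 next
  case False
  then have "odd m = odd n" "bin (m div 2) = bin (n div 2)" using 1(2) bin.simps[of m] bin.simps[of n] by auto
  have "m mod 2 = n mod 2" using \<open>odd m = odd n\<close> by presburger
  moreover have "m ~= 0" using False by simp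
  then have "m div 2 = n div 2" by (rule 1(1)) (rule \<open>bin (m div 2) = bin (n div 2)\<close>)
  ultimately show ?thesis by (metis div_mult_mod_eq)
 qed
qed

text \<open>A correct answer to a word is correct for some graph with this code, so the code has to
  determine the graph.\<close>

lemma enc_graph_inj: "enc_graph G = enc_graph G' ==> G = G'"
proof -
 assume a: "enc_graph G = enc_graph G'"
 obtain n es n' es' where G: "G = (n, es)" "G' = (n', es')" by fastforce
 have nat: "pf enc_nat"
 proof -
  have "pf (%b. [b])" by (simp add: pf_def)
  from pf_list[OF this] show ?thesis unfolding pf_def enc_nat_def using bin_inj by blast
 qed
 have "pf (%(u, v). enc_nat u @ enc_nat v)" unfolding pf_def
 proof (intro allI impI)
  fix x y r s assume "(case x of (u, v) => enc_nat u @ enc_nat v) @ r = (case y of (u, v) => enc_nat u @ enc_nat v) @ s"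
  then have "enc_nat (fst x) @ (enc_nat (snd x) @ r) = enc_nat (fst y) @ (enc_nat (snd y) @ s)" by (simp add: case_prod_unfold)
  then have "fst x = fst y" "enc_nat (snd x) @ r = enc_nat (snd y) @ s" using nat unfolding pf_def by blast+
  moreover from this(2) have "snd x = snd y" "r = s" using nat unfolding pf_def by blast+
  ultimately show "x = y \<and> r = s" by (simp add: prod_eq_iff)
 qed
 from pf_list[OF this] have l: "pf (enc_list (%(u, v). enc_nat u @ enc_nat v))" .
 have u: "n = n' \<and> r = s" if "enc_unary n @ r = enc_unary n' @ s" for n n' r s
  using that
 proof (induction n arbitrary: n')
  case 0 then show ?case by (cases n') (auto simp: enc_unary_def)
 next
  case (Suc n) then show ?case by (cases n') (auto simp: enc_unary_def)
 qed
 have *: "n = n'" "enc_list (%(u, v). enc_nat u @ enc_nat v) es @ [] = enc_list (%(u, v). enc_nat u @ enc_nat v) es' @ []"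
  using u[of n _ n'] a unfolding G enc_graph_def by simp_all
 show ?thesis using l[unfolded pf_def, rule_format, OF *(2)] *(1) unfolding G by simp
qed

text \<open>The partition function is a polynomial in the entries with integer coefficients.\<close>

lemma ZZ_dvd:
 fixes m m' :: "nat => nat => int"
 assumes "multigraph G" "\<And>a b. a < q ==> b < q ==> k dvd m a b - m' a b"
 shows "k dvd ZZ q m G - ZZ q m' G"
proof -
 obtain n es where G: "G = (n, es)" by (cases G)
 have "k dvd (\<Prod>(u, v)\<leftarrow>es'. m (si u) (si v)) - (\<Prod>(u, v)\<leftarrow>es'. m' (si u) (si v))"
  if "si \<in> {..<n} \<rightarrow>\<^sub>E {..<q}" "set es' \<subseteq> set es" for si es'
  using that(2)
 proof (induction es')
  case (Cons uv es')
  obtain u v where uv: "uv = (u, v)" by fastforce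
  then have "u < n" "v < n" using assms(1) Cons.prems by (auto simp: multigraph_def G)
  then have 1: "k dvd m (si u) (si v) - m' (si u) (si v)" using that(1) by (intro assms(2)) auto
  define x x' where "x = (\<Prod>(u, v)\<leftarrow>es'. m (si u) (si v))" and "x' = (\<Prod>(u, v)\<leftarrow>es'. m' (si u) (si v))"
  have "k dvd x - x'" using Cons by (simp add: x_def x'_def)
  then have "k dvd (m (si u) (si v) - m' (si u) (si v)) * x + m' (si u) (si v) * (x - x')" using 1 by simp
  also have "\<dots> = m (si u) (si v) * x - m' (si u) (si v) * x'" by (simp add: algebra_simps)
  finally show ?case by (simp add: uv x_def x'_def)
 qed simp
 then show ?thesis unfolding ZZ_def G by (auto simp: sum_subtractf[symmetric] intro!: dvd_sum)
qed

text \<open>The largest power of 2 dividing a nonzero integer is at most its absolute value.\<close>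

lemma odd_part: assumes "(d :: int) ~= 0" "\<bar>d\<bar> <= 2 ^ N" shows "\<exists>v d'. d = 2 ^ v * d' \<and> odd d' \<and> v <= N"
proof -
 obtain d' where d: "d = 2 ^ multiplicity 2 d * d'" "odd d'" using multiplicity_decompose'[of d 2] assms(1) by (auto simp: mult.commute)
 have "1 <= \<bar>d'\<bar>" using d(2) by (cases "d' = 0") auto
 then have "(2::int) ^ multiplicity 2 d <= 2 ^ multiplicity 2 d * \<bar>d'\<bar>" by simp
 also have "\<dots> = \<bar>d\<bar>" using arg_cong[OF d(1), of abs] by (simp only: abs_mult power_abs abs_numeral)
 finally have "(2::int) ^ multiplicity 2 d <= 2 ^ N" using assms(2) by linarith
 then have "multiplicity 2 d <= N" by (subst (asm) power_increasing_iff) auto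
 then show ?thesis using d by blast
qed

lemma poly_nat_mono: fixes p :: "nat poly" shows "a <= b ==> poly p a <= poly p b"
 by (induction p) (auto intro!: add_mono mult_mono)

lemma finite_pvars: "finite (pvars p)" by (induction p) auto

lemma abs_prod_list_le: "(\<And>x. x \<in> set w ==> \<bar>k x\<bar> <= 2 ^ c) ==> \<bar>\<Prod>x\<leftarrow>w. k x :: int\<bar> <= 2 ^ (c * length w)"
proof (induction w)
 case (Cons x w)
 then have "\<bar>k x\<bar> * \<bar>\<Prod>x\<leftarrow>w. k x\<bar> <= 2 ^ c * 2 ^ (c * length w)" by (intro mult_mono) auto
 then show ?case by (simp add: abs_mult power_add)
qed simp

lemma abs_le_power: "\<bar>z :: int\<bar> <= 2 ^ nat \<bar>z\<bar>"
proof -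
 have "int (nat \<bar>z\<bar>) <= int (2 ^ nat \<bar>z\<bar>)" by (simp only: of_nat_le_iff less_imp_le[OF less_exp])
 then show ?thesis by simp
qed

text \<open>A crude bound: all constants are at most \<open>8 * q ^ 7\<close>, and
  \<open>n < 2 ^ n\<close> moves this into the exponent.\<close>

lemma kc_bounds: assumes "3 <= q" shows "0 < kc q t" "\<bar>kc q t\<bar> <= 2 ^ (8 * q ^ 7)"
proof -
 show p: "0 < kc q t" using assms by (auto simp: kc_def)
 have "q ^ k <= q ^ 7" if "k <= 7" for k using assms that by (intro power_increasing) auto
 then have "int q ^ 6 <= int q ^ 7" "int q ^ 1 <= int q ^ 7" "int q ^ 0 <= int q ^ 7"
  by (simp_all only: of_nat_power[symmetric] of_nat_le_iff)
 then have "kc q t <= int (8 * q ^ 7)" by (auto simp: kc_def)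
 also have "\<dots> <= int (2 ^ (8 * q ^ 7))" by (simp only: of_nat_le_iff less_imp_le[OF less_exp])
 finally show "\<bar>kc q t\<bar> <= 2 ^ (8 * q ^ 7)" using p by simp
qed

lemma m0_vi: "m0 (vi q a b div q) (vi q a b mod q) = m0 a b" if "a < q" "b < q"
proof -
 have "vi q a b div q = min a b" "vi q a b mod q = max a b" using that by (auto simp: vi_def)
 then show ?thesis by (auto simp: m0_def min_def max_def)
qed

context verifier
begin

text \<open>The query is the graph \<open>Gx x\<close>. The fractions \<open>F\<close> and
  \<open>B\<close> depend only on the matrix and its presentation and are built into the machine,
  which evaluates the answer at the perturbed point and divides by the known factor.\<close>

theorem turing_reduction:
 assumes q: "3 <= q" and M: "M \<in> symmetric_mats q" and gen: "generic (VS q) (mvar q M)" and pres: "presentation M X bh"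
  and acc: "\<And>z. computes_within blank V z [Vp z] (poly pT (length z))"
  and g: "\<And>x. g x = card {y. length y = poly pn (length x) \<and> Vp (enc_pair x y)}"
 shows "poly_time_Turing_reducible (bin \<circ> g) (Pl_EVAL M X bh)"
 unfolding poly_time_Turing_reducible_def
proof
 fix p
 obtain F B ka where FB: "length F = length X"
  and id: "\<And>G a. multigraph G ==> wf_field_elem X a ==> field_elem_val X bh a = Z M G ==>
   pvars (snd (evalf PC F B a)) \<subseteq> {..<q * q} \<and>
   psz (snd (evalf PC F B a)) (ka * (length (enc_field_elem a) * (length (enc_field_elem a) + 1))) \<and>
   ev (mvar q M) (snd (evalf PC F B a)) ~= 0 \<and>
   (\<forall>x :: nat => int. ev x (fst (evalf PC F B a)) = ZZ q (%a b. x (vi q a b)) G * ev x (snd (evalf PC F B a)))"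
  using answer_identity[OF M gen pres] by blast
 define n c where "n = length X" and "c = 15 + 2 * n"
 interpret P: parser n c by unfold_locales (rule c_def)
 define reg where "reg j = (if j = 13 then fst B else if j = 14 then snd B else if j < 13 then PC 0
  else if odd j then fst (F ! ((j - 15) div 2)) else snd (F ! ((j - 15) div 2)))" for j
 have "finite (\<Union>j<c. pvars (reg j))" using finite_pvars by auto
 then obtain NV where NV: "\<And>j. j < c ==> pvars (reg j) \<subseteq> {..<NV}" unfolding finite_nat_iff_bounded by blast
 define tm Bx Gx where "tm x = tmpl x (poly pn (length x))" and "Bx x = length (tm x) + poly pT (length (tm x))"
  and "Gx x = gg (grows (Bx x) (tm x)) (gwidth (Bx x) (tm x))" for x
 have om: "lsX pn pT (enc x) = labels (Bx x) (tm x)" "omX pn pT (enc x) = grows (Bx x) (tm x)"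
  "length (wdX pn pT (enc x)) = gwidth (Bx x) (tm x)" for x
  unfolding tm_def Bx_def by (rule X_eq)+
 have planar: "planar (Gx x)" and count: "ZZ q m0 (Gx x) = (\<Prod>t\<leftarrow>grows (Bx x) (tm x). kc q t) *
   (ckst K0 ^ (length (labels (Bx x) (tm x)) * nrul) * int (g x))" for x
  unfolding Gx_def by (rule count_graph[OF q acc g tm_def]; simp add: Bx_def)+
 then have mg: "multigraph (Gx x)" for x by (simp add: planar_def)
 define f1 where "f1 e = encg (omX pn pT (e 0)) (wdX pn pT (e 0))" for e :: env
 have A: "48 <= (48 :: nat)" "3 <= (48 :: nat)" by simp_all
 note FPX = FP_X[OF A(1) FP_var[of 48 0]]
 have f1: "FP 48 f1" unfolding f1_def[abs_def] by (intro FP_encg FPX A)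
 have f1x: "f1 (%i. if i = 0 then enc x else []) = enc (enc_graph (Gx x))" for x
  by (simp add: f1_def encg om Gx_def)
 define cR where "cR = ckst K0 ^ nrul"
 \<comment> \<open>Unary lengths. \<open>vU\<close> bounds the bits of the constant factor.
   \<open>eU\<close> has one letter more than a witness, since all words may be witnesses.
   \<open>nU\<close> also covers norm and degree of the denominator and determines the perturbation.
   \<open>lU\<close> is the precision: room for the powers of 2 in the constant and in the
   denominator, and for the bits of the count.\<close>
 define vU eU nU lU where "vU e = rp (8 * q ^ 7) (omX pn pT (e 0)) @ rp (nat \<bar>cR\<bar>) (lsX pn pT (e 0))"
  and "eU e = 0 # replicate (poly pn (length (e 0))) 1"
  and "nU e = vU e @ eU e @ replicate (poly [:0, ka, ka:] (length (e 1))) 1"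
  and "lU e = vU e @ eU e @ replicate (poly ([:2, 1:] ^ (q * q + 2)) (length (nU e))) 1" for e :: env
 define cc where "cc i = m0 (i div q) (i mod q)" for i
 \<comment> \<open>The perturbed entries modulo \<open>2 ^ length (lU e)\<close>. The exponents are
   produced in unary; this is polynomial because the number of variables is fixed.\<close>
 define xs where "xs e = concat (map (%i. addw (wd (length (lU e)) (cc i))
  (wd (length (lU e)) (2 ^ length (replicate (poly ([:2, 1:] ^ Suc i) (length (nU e))) (1 :: nat))))) [0..<NV])" for e
 define init where "init e = concat (map (%j. wev (lU e) (xs e) (reg j)) [0..<c])" for e
 define st where "st e = P.allP (init e @ e 1) (lU e)" for e
 define cwd where "cwd e = mulw (fold (%x a. mulw a (wd (length (lU e)) (kc q x))) (omX pn pT (e 0)) (wd (length (lU e)) 1))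
  (fold (%x a. mulw a (wd (length (lU e)) cR)) (lsX pn pT (e 0)) (wd (length (lU e)) 1))" for e
 \<comment> \<open>At the perturbed point the numerator is the denominator times a number congruent
   to constant times count. Dividing by constant times denominator thus leaves the count.\<close>
 define f2 where "f2 e = quot (eU e) (mulw (cwd e) (wev (lU e) (st e) (PV 10))) (wev (lU e) (st e) (PV 9))" for e
 have fe: "FP 48 eU" unfolding eU_def[abs_def] by (intro FP_Cons FP_poly FP_var) simp_all
 have fv: "FP 48 vU" unfolding vU_def[abs_def] by (intro FP_app FP_rp FPX)
 have fn: "FP 48 nU" unfolding nU_def[abs_def] by (intro FP_app FP_poly FP_var fe fv) simp
 have fl: "FP 48 lU" unfolding lU_def[abs_def] by (intro FP_app FP_poly fn fe fv) simp
 have "FP 48 xs" unfolding xs_def[abs_def]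
  by (intro FP_concat FP_addw FP_wd FP_wd_power FP_poly A fl fn) simp
 then have fi: "FP 48 init" unfolding init_def[abs_def] by (intro FP_concat FP_wev A fl)
 have "FP 48 (%e. P.allP (e 0) (e 1))" using P.prog_allP[OF A(2)] unfolding prog_def by blast
 then have fs: "FP 48 st" unfolding st_def[abs_def] by (rule FP_app2[OF _ FP_app[OF fi FP_var] fl])
 have fc: "FP 48 cwd" unfolding cwd_def[abs_def] by (intro FP_mulw FP_powers A fl FPX)
 have f2: "FP 48 f2" unfolding f2_def[abs_def] by (intro FP_quot FP_mulw FP_wev A fe fl fs fc)
 define Ans where "Ans x = {enc_field_elem b | b. wf_field_elem X b \<and> field_elem_val X bh b = Z M (Gx x)} \<inter>
  {a. length a <= poly p (length (enc_graph (Gx x)))}" for x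
 have f2x: "f2 (%i. if i = 0 then enc x else if i = 1 then enc a else []) = enc (bin (g x))" if aA: "a \<in> Ans x" for x a
 proof -
  define E :: env where "E = (%i. if i = 0 then enc x else if i = 1 then enc a else [])"
  have E: "E 0 = enc x" "E 1 = enc a" by (simp_all add: E_def)
  obtain b where b: "a = enc_field_elem b" "wf_field_elem X b" "field_elem_val X bh b = Z M (Gx x)" using aA by (auto simp: Ans_def)
  note id = id[OF mg b(2,3)]
  define nu d where "nu = evalf PC F B b" and "d = length (nU E)"
  define L v where "L = length (lU E)" and "v = length (vU E)"
  define x0 where "x0 i = cc i + 2 ^ ((d + 2) ^ Suc i)" for i
  have cc1: "\<bar>cc i\<bar> <= 1" for i by (simp add: cc_def m0_def)
  have pw: "poly ([:2, 1:] ^ k) m = (m + 2) ^ k" for k m :: nat by (simp add: poly_power add.commute)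
  have xs: "xs E = blk NV (lU E) x0"
   unfolding xs_def blk_def x0_def length_replicate pw addw_wd d_def ..
  define rh where "rh j = ev x0 (reg j)" for j
  have "map (%j. wev (lU E) (blk NV (lU E) x0) (reg j)) [0..<c] = map (%j. wd (length (lU E)) (rh j)) [0..<c]"
   using wev_blk[OF NV, of _ "lU E" x0 "[]"] by (intro map_cong) (simp_all add: rh_def)
  then have "init E = blk c (lU E) rh" unfolding init_def xs by (simp only: blk_def[of c])
  moreover have "does c P.allP (enc a) (P.allF b)" unfolding b(1)
   by (rule P.does_allP) (use b(2) in \<open>fastforce simp: wf_field_elem_def n_def\<close>)
  ultimately have st: "st E = blk c (lU E) (P.allF b rh) @ []"
   unfolding st_def E does_def by (metis append_Nil2)
  have "map (%i. (rh (15 + 2 * i), rh (16 + 2 * i))) [0..<n] = map (map_prod (ev x0) (ev x0)) F"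
   by (rule nth_equalityI) (auto simp: n_def FB rh_def reg_def prod_eq_iff)
  moreover have "(rh 13, rh 14) = map_prod (ev x0) (ev x0) B" by (simp add: rh_def reg_def prod_eq_iff)
  ultimately have "(P.allF b rh 9, P.allF b rh 10) = evalf (%c. c) (map (map_prod (ev x0) (ev x0)) F) (map_prod (ev x0) (ev x0) B) b"
   using P.allF[of b rh] by simp
  also have "\<dots> = map_prod (ev x0) (ev x0) nu" unfolding nu_def
   by (rule evalf_hom[symmetric]) (simp_all add: plus_pexp_def times_pexp_def)
  finally have N: "P.allF b rh 9 = ev x0 (fst nu)" "P.allF b rh 10 = ev x0 (snd nu)" by (auto simp: prod_eq_iff)
  have w: "wev (lU E) (st E) (PV i) = wd L (P.allF b rh i)" if "i < c" for i
   unfolding st using wev_blk[of "PV i" c "lU E" "P.allF b rh" "[]"] that by (simp add: L_def)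
  have W: "wev (lU E) (st E) (PV 9) = wd L (ev x0 (fst nu))" "wev (lU E) (st E) (PV 10) = wd L (ev x0 (snd nu))"
   using w[of 9] w[of 10] N by (simp_all add: c_def)
  define C where "C = (\<Prod>t\<leftarrow>grows (Bx x) (tm x). kc q t) * (\<Prod>t\<leftarrow>labels (Bx x) (tm x). cR)"
  have cw: "cwd E = wd L C" unfolding cwd_def powers E om L_def[symmetric] mulw_wd C_def ..
  have pr: "(\<Prod>t\<leftarrow>ls. cR) = cR ^ length ls" for ls :: "nat list" by (induction ls) auto
  have Zm0: "ZZ q m0 (Gx x) = C * int (g x)"
   unfolding count C_def pr unfolding cR_def power_mult[symmetric] by (simp only: mult.commute[of nrul] mult.assoc)
  have C0: "C ~= 0"
  proof -
   have "(\<Prod>t\<leftarrow>ls. kc q t) ~= 0" for ls using kc_bounds(1)[OF q] by (induction ls) (auto simp: less_le)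
   moreover have "cR ~= 0" unfolding cR_def using ckst_nz[of K0] tls_nonempty[OF V] by simp
   ultimately show ?thesis by (simp add: C_def pr)
  qed
  have "\<bar>C\<bar> <= 2 ^ v"
  proof -
   have "\<bar>C\<bar> <= 2 ^ (8 * q ^ 7 * length (grows (Bx x) (tm x))) * 2 ^ (nat \<bar>cR\<bar> * length (labels (Bx x) (tm x)))"
    unfolding C_def abs_mult by (intro mult_mono abs_prod_list_le kc_bounds q abs_le_power) auto
   then show ?thesis by (simp add: v_def vU_def E om power_add)
  qed
  from odd_part[OF C0 this] obtain v1 C' where C': "C = 2 ^ v1 * C'" "odd C'" "v1 <= v" by blast
  have el: "length (eU E) = poly pn (length x) + 1" by (simp add: eU_def E)
  have dd: "d = v + length (eU E) + ka * (length a * (length a + 1))" by (simp add: d_def nU_def v_def E E(2)[simplified] algebra_simps)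
  have LL: "L = v + length (eU E) + (d + 2) ^ (q * q + 2)" by (simp only: L_def lU_def length_append length_replicate pw d_def v_def add.assoc)
  have psz: "pnorm 2 (snd nu) <= 2 ^ d" "pdeg (snd nu) <= d"
  proof -
   have "psz (snd nu) (ka * (length a * (length a + 1)))" using id by (simp add: nu_def b(1))
   moreover have "(2::nat) ^ (ka * (length a * (length a + 1))) <= 2 ^ d" by (rule power_increasing) (simp_all add: dd)
   ultimately show "pnorm 2 (snd nu) <= 2 ^ d" "pdeg (snd nu) <= d" using dd unfolding psz_def by linarith+
  qed
  have pv: "pvars (snd nu) \<subseteq> {..<q * q}" using id by (simp add: nu_def)
  have nz: "ev x0 (snd nu) ~= 0" unfolding x0_def
   by (rule kronecker[OF pv psz cc1, where m = "mvar q M"]) (use id in \<open>simp add: nu_def\<close>)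
  have "\<bar>ev x0 (snd nu)\<bar> < 2 ^ ((d + 2) ^ (q * q + 2))" unfolding x0_def by (rule kronecker_bound[OF pv psz cc1])
  from odd_part[OF nz less_imp_le[OF this]] obtain v2 N' where N': "ev x0 (snd nu) = 2 ^ v2 * N'" "odd N'" "v2 <= (d + 2) ^ (q * q + 2)" by blast
  define T where "T = ZZ q (%a b. x0 (vi q a b)) (Gx x)"
  have fs: "ev x0 (fst nu) = T * ev x0 (snd nu)" using id by (simp add: nu_def T_def)
  \<comment> \<open>Every perturbation is a power of 2 with exponent at least \<open>d + 2\<close>,
    which exceeds \<open>v + length (eU E)\<close>.\<close>
  have "2 ^ (v + length (eU E)) dvd T - ZZ q m0 (Gx x)"
   unfolding T_def
  proof (rule ZZ_dvd[OF mg])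
   fix a b assume ab: "a < q" "b < q"
   have "v + length (eU E) <= (d + 2) ^ 1" using dd by simp
   also have "(d + 2) ^ 1 <= (d + 2) ^ Suc (vi q a b)" by (rule power_increasing) auto
   finally have "(2::int) ^ (v + length (eU E)) dvd 2 ^ ((d + 2) ^ Suc (vi q a b))" by (rule le_imp_power_dvd)
   then show "2 ^ (v + length (eU E)) dvd x0 (vi q a b) - m0 a b" using m0_vi[OF ab] by (simp add: x0_def cc_def)
  qed
  then have dv: "2 ^ (v + length (eU E)) dvd T - C * int (g x)" by (simp add: Zm0)
  \<comment> \<open>Multiplying the congruence by the denominator raises the modulus by
    \<open>2 ^ v2\<close>. So \<open>length (eU E)\<close> bits remain after cancelling the powers
    of 2 in the constant and in the denominator.\<close>
  have "2 ^ (v1 + v2 + length (eU E)) dvd (2::int) ^ (v2 + (v + length (eU E)))"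
   by (rule le_imp_power_dvd) (use C'(3) in simp)
  also have "\<dots> dvd ev x0 (snd nu) * (T - C * int (g x))"
   unfolding power_add[of 2 v2] by (rule mult_dvd_mono) (use N' dv in auto)
  also have "\<dots> = ev x0 (fst nu) - C * ev x0 (snd nu) * int (g x)" by (simp add: fs algebra_simps)
  finally have n: "2 ^ (v1 + v2 + length (eU E)) dvd ev x0 (fst nu) - C * ev x0 (snd nu) * int (g x)" .
  have gl: "g x < 2 ^ length (eU E)"
  proof -
   have "g x <= card {y :: bool list. set y \<subseteq> UNIV \<and> length y = poly pn (length x)}"
    unfolding g by (rule card_mono) (auto intro: finite_lists_length_eq[of UNIV, simplified])
   also have "\<dots> = 2 ^ poly pn (length x)" by (subst card_lists_length_eq) auto
   also have "\<dots> < 2 ^ length (eU E)" by (simp add: el)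
   finally show ?thesis .
  qed
  have "quot (eU E) (wd L (C * ev x0 (snd nu))) (wd L (ev x0 (fst nu))) = enc (bin (g x))"
   by (rule quot_wd[where v = "v1 + v2" and d' = "C' * N'", OF _ _ _ _ n gl])
    (use C' N' LL el in \<open>auto simp: power_add\<close>)
  then show ?thesis unfolding E_def[symmetric] f2_def W cw mulw_wd .
 qed
 obtain k K where k: "\<And>e. vld 48 K e ==> length (f1 e) <= (sz K e + 2) ^ k" using bnd_FP[OF f1] unfolding bnd_def by blast
 \<comment> \<open>The query is polynomially long because a program in \<open>FP\<close> computes
   it; by \<open>p\<close> this also bounds the answer.\<close>
 have ql: "length (enc_graph (Gx x)) <= (length x + 2) ^ k" for x
 proof -
  define e :: env where "e = (%i. if i = 0 then enc x else [])"
  have "sz K e <= length x"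
  proof -
   have "sz K e <= sz (Suc K) e" by (rule sz_mono) simp
   also have "\<dots> = length x" unfolding sz_def sum.lessThan_Suc_shift by (simp add: e_def)
   finally show ?thesis .
  qed
  then have "(sz K e + 2) ^ k <= (length x + 2) ^ k" by (intro power_mono) auto
  moreover have "vld 48 K e" by (auto simp: vld_def e_def enc_def)
  moreover have "length (f1 e) = length (enc_graph (Gx x))" unfolding e_def f1x by simp
  ultimately show ?thesis using k[of e] by linarith
 qed
 have "\<exists>N (r :: nat poly). wf_machine N \<and> (\<forall>f. (\<forall>x. f (enc_graph (Gx x)) \<in> Ans x) -->
   (\<forall>x. computes_within f N x (bin (g x)) (poly r (length x))))"
 proof (rule reduction_machine[OF f1 f2 _ f1x f2x])
  show "pb (%n. poly p ((n + 2) ^ k))" by (rule pb_comp[OF pb_poly]) (intro pb_intros)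
  show "length a <= poly p ((length x + 2) ^ k)" if "a \<in> Ans x" for x a
   using that poly_nat_mono[OF ql, of p x] by (auto simp: Ans_def)
 qed simp_all
 then obtain N r where N: "wf_machine N" "\<And>f x. (\<forall>x. f (enc_graph (Gx x)) \<in> Ans x) ==> computes_within f N x (bin (g x)) (poly r (length x))"
  by blast
 have "f (enc_graph (Gx x)) \<in> Ans x" if s: "solves f (Pl_EVAL M X bh) p" for f x
 proof -
  have "Z M (Gx x) \<in> is_subfield hull insert bh (set X)"
   using Z_in_hull[OF _ mg] M pres by (auto simp: symmetric_mats_def presentation_def)
  then obtain a where "wf_field_elem X a" "field_elem_val X bh a = Z M (Gx x)"
   using field_elem_exists pres unfolding presentation_def by blast
  then have "enc_graph (Gx x) \<in> Domain (Pl_EVAL M X bh)" using planar unfolding Pl_EVAL_def by blast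
  then have "(enc_graph (Gx x), f (enc_graph (Gx x))) \<in> Pl_EVAL M X bh"
   "length (f (enc_graph (Gx x))) <= poly p (length (enc_graph (Gx x)))" using s unfolding solves_def by auto
  then show ?thesis unfolding Ans_def Pl_EVAL_def using enc_graph_inj by blast
 qed
 then show "\<exists>N (r :: nat poly). wf_machine N \<and> (\<forall>f. solves f (Pl_EVAL M X bh) p -->
   (\<forall>x. computes_within f N x ((bin \<circ> g) x) (poly r (length x))))"
  using N by (intro exI[of _ N] exI[of _ r]) auto
qed

end

theorem generic_hard:
 assumes "3 <= q" "M \<in> symmetric_mats q" "generic (VS q) (mvar q M)" shows "Pl_EVAL_hard M"
 unfolding Pl_EVAL_hard_def sharpP_hard_def
proof (intro allI impI ballI)
 fix X bh g assume pres: "presentation M X bh" and "g \<in> sharpP"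
 then obtain Vp pn where "poly_time (%w. [Vp w])" and g: "\<And>x. g x = card {y. length y = poly pn (length x) \<and> Vp (enc_pair x y)}"
  unfolding sharpP_def by auto
 then obtain V pT where Vm: "wf_machine V" "\<And>z. computes_within blank V z [Vp z] (poly pT (length z))" unfolding poly_time_def by auto
 interpret verifier V by unfold_locales (rule Vm(1))
 show "poly_time_Turing_reducible (bin \<circ> g) (Pl_EVAL M X bh)" by (rule turing_reduction[OF assms pres Vm(2) g])
qed

theorem mainTheorem4:
  fixes q :: nat
  assumes "3 \<le> q"
  shows "upper_entries q ` {M \<in> symmetric_mats q. \<not> Pl_EVAL_hard M}
           \<in> null_sets (symmetric_lebesgue q)"
proof -
 \<comment> \<open>Variable \<open>a * q + b\<close> stands for the entry at
   \<open>(a, b)\<close>.\<close>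
 define f where "f i = (i div q, i mod q)" for i
 have U: "f ` VS q = upper_indices q" and inj: "inj_on f (VS q)" and fin: "finite (VS q)"
 proof -
  have fv: "f (a * q + b) = (a, b)" if "(a, b) \<in> upper_indices q" for a b using that by (simp add: f_def upper_indices_def)
  then show "f ` VS q = upper_indices q" "inj_on f (VS q)" by (force simp: VS_def image_iff inj_on_def)+
  have "upper_indices q \<subseteq> {..<q} \<times> {..<q}" by (auto simp: upper_indices_def)
  then show "finite (VS q)" unfolding VS_def by (intro finite_imageI) (rule finite_subset, auto)
 qed
 have "AE x in PiM (upper_indices q) (%_. lborel :: real measure). generic (VS q) (%i. x (f i))"
  using AE_generic[OF fin inj] unfolding U .
 then obtain S where S: "S \<in> null_sets (PiM (upper_indices q) (%_. lborel :: real measure))"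
  "{x \<in> space (PiM (upper_indices q) (%_. lborel)). \<not> generic (VS q) (%i. x (f i))} \<subseteq> S"
  by (auto elim: AE_E3 simp: eventually_ae_filter)
 have "upper_entries q ` {M \<in> symmetric_mats q. \<not> Pl_EVAL_hard M} \<subseteq> S"
 proof
  fix x assume "x \<in> upper_entries q ` {M \<in> symmetric_mats q. \<not> Pl_EVAL_hard M}"
  then obtain M where M: "M \<in> symmetric_mats q" "\<not> Pl_EVAL_hard M" "x = upper_entries q M" by blast
  have "\<not> generic (VS q) (mvar q M)" using generic_hard[OF assms M(1)] M(2) by blast
  \<comment> \<open>The variables in \<open>VS q\<close> are entries on and above the diagonal,
    where \<open>x\<close> and \<open>M\<close> agree.\<close>
  moreover have "ev (%i. x (f i)) e = ev (mvar q M) e" if "pvars e \<subseteq> VS q" for e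
  proof -
   have "x (f i) = mvar q M i" if "i \<in> pvars e" for i
   proof -
    have "f i \<in> upper_indices q" using that \<open>pvars e \<subseteq> VS q\<close> U by blast
    then show ?thesis by (simp add: M(3) upper_entries_def mvar_def f_def)
   qed
   then show ?thesis by (induction e) auto
  qed
  ultimately have "\<not> generic (VS q) (%i. x (f i))" unfolding generic_def by metis
  moreover have "x \<in> space (PiM (upper_indices q) (%_. lborel))" by (auto simp: M(3) upper_entries_def space_PiM)
  ultimately show "x \<in> S" using S(2) by blast
 qed
 \<comment> \<open>Measurability of the set itself is not established beforehand; in the completed
   measure a subset of a null set is a null set.\<close>
 then show ?thesis unfolding symmetric_lebesgue_def
  by (rule null_sets_completion_subset[OF _ null_sets_completionI[OF S(1)]])
qed

end
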